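(* Let $D\subseteq M$ be a normal crossing elliptic divisor with elliptic ideal $\mathcal{I}_{|D|}$, let $\mathcal{G}\rightrightarrows M$ be the elliptic groupoid of $(M,D)$ with source $s$ and target $t$, and let $\mathcal{D}:=s^{-1}[D]=t^{-1}[D]\subseteq\mathcal{G}$. Then $s^*\mathcal{I}_{|D|}=t^*\mathcal{I}_{|D|}$, and the ideal sheaf $\mathcal{I}_{|\mathcal{D}|}:=s^*\mathcal{I}_{|D|}=t^*\mathcal{I}_{|D|}$ is an elliptic ideal sheaf (of a normal crossing elliptic divisor) with divisor $\mathcal{D}$, such that $s,t:(\mathcal{G},\mathcal{D})\to(M,D)$ are maps of elliptic pairs, i.e. strong maps of pairs that pull back $\mathcal{I}_{|D|}$ to $\mathcal{I}_{|\mathcal{D}|}$.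
   Context: Conventions. For a smooth map $f$, the pullback $f^*\mathcal{I}$ of an ideal sheaf is the ideal sheaf generated by the functions $\phi\circ f$, $\phi\in\mathcal{I}$. A strong map of pairs $f:(X,Z)\to(Y,W)$ is a smooth map with $f^{-1}(W)=Z$. Manifolds of arrows may be non-Hausdorff. Normal crossing elliptic divisors. A normal crossing elliptic divisor on an $n$-manifold $M$ is a subset $D$ with an ideal sheaf $\mathcal{I}_{|D|}\subseteq C^\infty(-;\mathbb{R})$ such that every $x\in M$ has a chart $V$ centred at $x$ (normal crossing chart) with coordinates $(x_1,\dots,x_{n-2k},z_1,\dots,z_k)$, $z_j\in\mathbb{C}$, with $D\cap V=\{\prod_jz_j=0\}$, $\mathcal{I}_{|D|}(V)=\langle\prod_jz_j\bar z_j\rangle$. Here $k=\mathrm{mult}(x)$ and $D[k]=\{x:\mathrm{mult}(x)=k\}$, so $D[0]=M\setminus D$. A normal crossing tubular neighbourhood of $N\in\pi_0(D[i])$ is a tubular neighbourhood $U_N\to N$ covered by trivialising charts that are normal crossing charts around $N$. Local models. Let $N\in\pi_0(D[i])$, $i\geq1$, $\Gamma_i=(\mathbb{Z}/2)^i\rtimes\Sigma_i$, and let $P_N\to N$ be the principal $\Gamma_i$-bundle whose fibre at $p$ consists of all coorientations and orderings of the $i$ local hyperplanes $\{z_j=0\}$ through $p$; pull it back to $P_N\to U_N$. In each connected component $E$ of $P_N$ the preimage of $D$ is a union $H_1\cup\dots\cup H_i$ of globally ordered, cooriented smooth elliptic divisors. Let $\beta:\widetilde{E\times E}\to E\times E$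 be the iterated complex blow-up along $H_1\times H_1,\dots,H_i\times H_i$ (with respect to the ideals locally generated by $z_j\circ\mathrm{pr}_1,z_j\circ\mathrm{pr}_2$, $z_j$ a local complex defining function of $H_j$), and $\mathcal{G}_E$ the complement of the closures $\overline{\beta^{-1}[N_0\times N_1]}$ over all pairs $N_0\neq N_1$ of connected components of multiplicity strata in $E$ (including multiplicity zero). With $s=\mathrm{pr}_2\circ\beta$, $t=\mathrm{pr}_1\circ\beta$, the pair groupoid over $E\setminus\bigcup H_j$ extends uniquely to a Lie groupoid $\mathcal{G}_E\rightrightarrows E$, with charts $(x,y,a,b)$, $a\in\mathbb{C}^k,b\in(\mathbb{C}^* )^k$, $t=(x,a)$, $s=(y,a_1b_1,\dots,a_kb_k)$. The $\Gamma_i$-action lifts to $\bigsqcup_E\mathcal{G}_E$ and $\mathcal{G}_N:=(\bigsqcup_E\mathcal{G}_E)/\Gamma_i\rightrightarrows U_N$, with product $[g][h]=[g\cdot(h\cdot\delta)]$, $\delta\in\Gamma_i$ being the unique element with $s(g)=t(h\cdot\delta)$. For $N\in\pi_0(D[0])$ put $U_N=N$ and $\mathcal{G}_N=N\times N$ (pair groupoid). Gluing: the elliptic groupoid. Let $S$ be a connected component of $N'\cap U_N$ with $N'\in\pi_0(D[j])$, $j\le i$. In normal crossing charts around $x,y\in S$, the arrows of $\mathcal{G}_N$ from $y$ to $x$ are identified with $(\mathbb{C}^* )^j\times\{\Phi_N(\gamma)\}$, where $(\mathbb{C}^* )^j$ records the coordinates $b$ for the $j$ hyperplanes through $S$, $\gamma$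 ranges over homotopy classes of paths in $S$ from $y$ to $x$, and $\Phi_N(\gamma)$ is parallel transport in $P_N$ along $\gamma$. Define $\kappa_{N',N}:\mathcal{G}_N|_S\to\mathcal{G}_{N'}|_{N'}$ by $(z,\Phi_N(\gamma))\mapsto(z,\Phi_{N'}(\gamma))$. The elliptic groupoid $\mathcal{G}\rightrightarrows M$ is, as a groupoid, $\bigsqcup_N\mathcal{G}_N|_N$ over all $N\in\pi_0(D[i])$, $i\ge0$; its topology and (possibly non-Hausdorff) smooth structure are those obtained by gluing the $\mathcal{G}_N$ along the maps $\kappa_{N',N}$ (iterated pushout over $i$), so that the maps $\mathcal{G}_N\to\mathcal{G}$ equal to $\kappa_{N',N}$ over each $S\subseteq N'\cap U_N$ are local diffeomorphisms and the blow-up charts $(x,y,a,b)$ are charts of $\mathcal{G}$. *)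

theory Defs
  imports "HOL-Analysis.Analysis"
begin

section \<open>Smooth manifolds, not necessarily Hausdorff\<close>

primrec Ck_on :: "nat \<Rightarrow> ('e::real_normed_vector \<Rightarrow> 'f::real_normed_vector) \<Rightarrow> 'e set \<Rightarrow> bool" where
  "Ck_on 0 f S \<longleftrightarrow> continuous_on S f"
| "Ck_on (Suc k) f S \<longleftrightarrow>
     (\<forall>x\<in>S. f differentiable (at x)) \<and> (\<forall>v. Ck_on k (\<lambda>x. frechet_derivative f (at x) v) S)"

text \<open>Only used for open sets \<open>S\<close>.\<close>

definition Cinf_on :: "'e set \<Rightarrow> ('e::real_normed_vector \<Rightarrow> 'f::real_normed_vector) \<Rightarrow> bool" where
  "Cinf_on S f \<longleftrightarrow> (\<forall>k. Ck_on k f S)"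

record ('p, 'e) mfd =
  mtop :: "'p topology"
  atlas :: "('p set \<times> ('p \<Rightarrow> 'e)) set"

definition top_chart :: "('p, 'e::euclidean_space) mfd \<Rightarrow> 'p set \<Rightarrow> ('p \<Rightarrow> 'e) \<Rightarrow> bool" where
  "top_chart X V \<phi> \<longleftrightarrow> openin (mtop X) V \<and> open (\<phi> ` V) \<and>
     homeomorphic_map (subtopology (mtop X) V) (top_of_set (\<phi> ` V)) \<phi>"

definition compatible :: "'p set \<Rightarrow> ('p \<Rightarrow> 'e::euclidean_space) \<Rightarrow> 'p set \<Rightarrow> ('p \<Rightarrow> 'e) \<Rightarrow> bool" where
  "compatible V \<phi> W \<psi> \<longleftrightarrow>
     Cinf_on (\<phi> ` (V \<inter> W)) (\<psi> \<circ> inv_into V \<phi>) \<and> Cinf_on (\<psi> ` (V \<inter> W)) (\<phi> \<circ> inv_into W \<psi>)"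

definition smooth_mfd :: "('p, 'e::euclidean_space) mfd \<Rightarrow> bool" where
  "smooth_mfd X \<longleftrightarrow> (\<forall>(V, \<phi>)\<in>atlas X. top_chart X V \<phi>) \<and> \<Union> (fst ` atlas X) = topspace (mtop X) \<and>
     (\<forall>(V, \<phi>)\<in>atlas X. \<forall>(W, \<psi>)\<in>atlas X. compatible V \<phi> W \<psi>)"

text \<open>The charts of the maximal atlas:\<close>

definition chart :: "('p, 'e::euclidean_space) mfd \<Rightarrow> 'p set \<Rightarrow> ('p \<Rightarrow> 'e) \<Rightarrow> bool" where
  "chart X V \<phi> \<longleftrightarrow> top_chart X V \<phi> \<and> (\<forall>(W, \<psi>)\<in>atlas X. compatible V \<phi> W \<psi>)"

text \<open>Sections over \<open>U\<close> are represented by total functions whose values outside \<open>U\<close> are irrelevant.\<close>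

definition smooth_funs :: "('p, 'e::euclidean_space) mfd \<Rightarrow> 'p set \<Rightarrow> ('p \<Rightarrow> 'k::real_normed_vector) set" where
  "smooth_funs X U = {f. \<forall>(V, \<phi>)\<in>atlas X. Cinf_on (\<phi> ` (U \<inter> V)) (f \<circ> inv_into V \<phi>)}"

definition smooth_map :: "('p, 'e::euclidean_space) mfd \<Rightarrow> ('q, 'f::euclidean_space) mfd \<Rightarrow> ('p \<Rightarrow> 'q) \<Rightarrow> bool" where
  "smooth_map X Y F \<longleftrightarrow> continuous_map (mtop X) (mtop Y) F \<and>
     (\<forall>(W, \<psi>)\<in>atlas Y. \<psi> \<circ> F \<in> smooth_funs X {x \<in> topspace (mtop X). F x \<in> W})"

definition diffeo :: "('p, 'e::euclidean_space) mfd \<Rightarrow> ('q, 'f::euclidean_space) mfd \<Rightarrow> ('p \<Rightarrow> 'q) \<Rightarrow> bool" where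
  "diffeo X Y F \<longleftrightarrow> (\<exists>G. smooth_map X Y F \<and> smooth_map Y X G \<and>
     (\<forall>x\<in>topspace (mtop X). G (F x) = x) \<and> (\<forall>y\<in>topspace (mtop Y). F (G y) = y))"

definition open_sub :: "('p, 'e) mfd \<Rightarrow> 'p set \<Rightarrow> ('p, 'e) mfd" where
  "open_sub X A = \<lparr>mtop = subtopology (mtop X) A, atlas = {(V \<inter> A, \<phi>) | V \<phi>. (V, \<phi>) \<in> atlas X}\<rparr>"

definition local_diffeo :: "('p, 'e::euclidean_space) mfd \<Rightarrow> ('q, 'f::euclidean_space) mfd \<Rightarrow> ('p \<Rightarrow> 'q) \<Rightarrow> bool" where
  "local_diffeo X Y F \<longleftrightarrow> (\<forall>x\<in>topspace (mtop X). \<exists>W. openin (mtop X) W \<and> x \<in> W \<and>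
     openin (mtop Y) (F ` W) \<and> diffeo (open_sub X W) (open_sub Y (F ` W)) F)"

definition prod_mfd :: "('p, 'e) mfd \<Rightarrow> ('q, 'f) mfd \<Rightarrow> ('p \<times> 'q, 'e \<times> 'f) mfd" where
  "prod_mfd X Y = \<lparr>mtop = prod_topology (mtop X) (mtop Y),
     atlas = {(V \<times> W, map_prod \<phi> \<psi>) | V \<phi> W \<psi>. (V, \<phi>) \<in> atlas X \<and> (W, \<psi>) \<in> atlas Y}\<rparr>"

definition sum_mfd :: "('i \<Rightarrow> ('p, 'e) mfd) \<Rightarrow> 'i set \<Rightarrow> ('i \<times> 'p, 'e) mfd" where
  "sum_mfd X A = \<lparr>mtop = sum_topology (\<lambda>a. mtop (X a)) A,
     atlas = {({a} \<times> V, \<phi> \<circ> snd) | a V \<phi>. a \<in> A \<and> (V, \<phi>) \<in> atlas (X a)}\<rparr>"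

text \<open>The smooth structure on the total space of a local homeomorphism \<open>p\<close> to a manifold.\<close>

definition etale_mfd :: "'q topology \<Rightarrow> ('q \<Rightarrow> 'p) \<Rightarrow> ('p, 'e) mfd \<Rightarrow> ('q, 'e) mfd" where
  "etale_mfd \<T> p X = \<lparr>mtop = \<T>,
     atlas = {(B, \<phi> \<circ> p) | B V \<phi>. openin \<T> B \<and> inj_on p B \<and> (V, \<phi>) \<in> atlas X \<and> p ` B \<subseteq> V}\<rparr>"

text \<open>The quotient topology and smooth structure for a quotient map \<open>q\<close> that is a local homeomorphism.\<close>

definition quot_mfd :: "('p, 'e) mfd \<Rightarrow> ('p \<Rightarrow> 'q) \<Rightarrow> ('q, 'e) mfd" where
  "quot_mfd X q =
    \<lparr>mtop = topology (\<lambda>W. W \<subseteq> q ` topspace (mtop X) \<and> openin (mtop X) {x \<in> topspace (mtop X). q x \<in> W}),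
     atlas = {(q ` B, \<phi> \<circ> inv_into B q) | B V \<phi>.
       openin (mtop X) B \<and> inj_on q B \<and> (V, \<phi>) \<in> atlas X \<and> B \<subseteq> V}\<rparr>"


section \<open>Ideal sheaves\<close>

type_synonym ('p, 'k) sheaf = "'p set \<Rightarrow> ('p \<Rightarrow> 'k) set"

definition ideal_sheaf :: "('p, 'e::euclidean_space) mfd \<Rightarrow> ('p, 'k::real_normed_field) sheaf \<Rightarrow> bool" where
  "ideal_sheaf X J \<longleftrightarrow> (\<forall>U. openin (mtop X) U \<longrightarrow>
     J U \<subseteq> smooth_funs X U \<and>
     (\<lambda>_. 0) \<in> J U \<and>
     (\<forall>f\<in>J U. \<forall>g\<in>J U. (\<lambda>x. f x + g x) \<in> J U) \<and>
     (\<forall>h\<in>smooth_funs X U. \<forall>f\<in>J U. (\<lambda>x. h x * f x) \<in> J U) \<and>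
     (\<forall>f\<in>J U. \<forall>g. (\<forall>x\<in>U. g x = f x) \<longrightarrow> g \<in> J U) \<and>
     (\<forall>W. openin (mtop X) W \<and> W \<subseteq> U \<longrightarrow> J U \<subseteq> J W) \<and>
     (\<forall>f. (\<forall>x\<in>U. \<exists>W. openin (mtop X) W \<and> x \<in> W \<and> W \<subseteq> U \<and> f \<in> J W) \<longrightarrow> f \<in> J U))"

definition sheaf_eq :: "('p, 'e::euclidean_space) mfd \<Rightarrow> ('p, 'k) sheaf \<Rightarrow> ('p, 'k) sheaf \<Rightarrow> bool" where
  "sheaf_eq X J K \<longleftrightarrow> (\<forall>U. openin (mtop X) U \<longrightarrow> J U = K U)"

text \<open>The ideal sheaf generated by a collection \<open>\<S>\<close> of pairs of an open set and a function on it.\<close>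

definition gen_sheaf :: "('p, 'e::euclidean_space) mfd \<Rightarrow> ('p set \<times> ('p \<Rightarrow> 'k::real_normed_field)) set \<Rightarrow> ('p, 'k) sheaf" where
  "gen_sheaf X \<S> U = {g \<in> smooth_funs X U. \<forall>x\<in>U. \<exists>W (c::nat) h f.
     openin (mtop X) W \<and> x \<in> W \<and> W \<subseteq> U \<and>
     (\<forall>l<c. h l \<in> smooth_funs X W \<and> (\<exists>V. W \<subseteq> V \<and> (V, f l) \<in> \<S>)) \<and>
     (\<forall>y\<in>W. g y = (\<Sum>l<c. h l y * f l y))}"

definition pullback :: "('p, 'e::euclidean_space) mfd \<Rightarrow> ('q, 'f::euclidean_space) mfd \<Rightarrow> ('p \<Rightarrow> 'q) \<Rightarrow>
    ('q, 'k::real_normed_field) sheaf \<Rightarrow> ('p, 'k) sheaf" where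
  "pullback X Y F J =
     gen_sheaf X {({x \<in> topspace (mtop X). F x \<in> V}, \<phi> \<circ> F) | V \<phi>. openin (mtop Y) V \<and> \<phi> \<in> J V}"

text \<open>The restriction of \<open>J\<close> to \<open>V\<close> is generated by the functions \<open>f 0, \<dots>, f (c - 1)\<close>.\<close>

definition generated_on :: "('p, 'e::euclidean_space) mfd \<Rightarrow> 'p set \<Rightarrow> ('p, 'k::real_normed_field) sheaf \<Rightarrow>
    nat \<Rightarrow> (nat \<Rightarrow> 'p \<Rightarrow> 'k) \<Rightarrow> bool" where
  "generated_on X V J c f \<longleftrightarrow> (\<forall>W. openin (mtop X) W \<and> W \<subseteq> V \<longrightarrow>
     J W = {g. \<exists>h. (\<forall>l<c. h l \<in> smooth_funs X W) \<and> (\<forall>x\<in>W. g x = (\<Sum>l<c. h l x * f l x))})"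


section \<open>Normal crossing elliptic divisors\<close>

text \<open>An enumeration \<open>e\<close> of the standard basis of the model space turns a chart with values in it into
  coordinates \<open>(z\<^sub>0, \<dots>, z\<^sub>k\<^sub>-\<^sub>1, x)\<close>; the real coordinates are those with index at least \<open>2 * k\<close>.\<close>

definition frame_enum :: "(nat \<Rightarrow> 'e::euclidean_space) \<Rightarrow> bool" where
  "frame_enum e \<longleftrightarrow> bij_betw e {..<DIM('e)} Basis"

definition zc :: "(nat \<Rightarrow> 'e::euclidean_space) \<Rightarrow> nat \<Rightarrow> 'e \<Rightarrow> complex" where
  "zc e j v = Complex (v \<bullet> e (2 * j)) (v \<bullet> e (2 * j + 1))"

text \<open>The generator \<open>\<Prod>j. z\<^sub>j * cnj z\<^sub>j\<close> is written with \<open>z * cnj z = (cmod z)\<^sup>2\<close>.\<close>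

definition nc_coords :: "('p, 'e::euclidean_space) mfd \<Rightarrow> 'p set \<Rightarrow> ('p, real) sheaf \<Rightarrow>
    nat \<Rightarrow> 'p set \<Rightarrow> ('p \<Rightarrow> 'e) \<Rightarrow> (nat \<Rightarrow> 'e) \<Rightarrow> bool" where
  "nc_coords X D I k V \<phi> e \<longleftrightarrow> chart X V \<phi> \<and> frame_enum e \<and> 2 * k \<le> DIM('e) \<and>
     D \<inter> V = {q \<in> V. (\<Prod>j<k. zc e j (\<phi> q)) = 0} \<and>
     generated_on X V I 1 (\<lambda>_ q. \<Prod>j<k. (cmod (zc e j (\<phi> q)))\<^sup>2)"

definition nc_chart :: "('p, 'e::euclidean_space) mfd \<Rightarrow> 'p set \<Rightarrow> ('p, real) sheaf \<Rightarrow>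
    nat \<Rightarrow> 'p \<Rightarrow> 'p set \<Rightarrow> ('p \<Rightarrow> 'e) \<Rightarrow> (nat \<Rightarrow> 'e) \<Rightarrow> bool" where
  "nc_chart X D I k p V \<phi> e \<longleftrightarrow> nc_coords X D I k V \<phi> e \<and> p \<in> V \<and> \<phi> p = 0"

definition nc_elliptic_divisor :: "('p, 'e::euclidean_space) mfd \<Rightarrow> 'p set \<Rightarrow> ('p, real) sheaf \<Rightarrow> bool" where
  "nc_elliptic_divisor X D I \<longleftrightarrow> smooth_mfd X \<and> D \<subseteq> topspace (mtop X) \<and> ideal_sheaf X I \<and>
     (\<forall>p\<in>topspace (mtop X). \<exists>k V \<phi> e. nc_chart X D I k p V \<phi> e)"

definition strong_map :: "('p, 'e::euclidean_space) mfd \<Rightarrow> 'p set \<Rightarrow> ('q, 'f::euclidean_space) mfd \<Rightarrow> 'q set \<Rightarrow>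
    ('p \<Rightarrow> 'q) \<Rightarrow> bool" where
  "strong_map X Z Y W F \<longleftrightarrow> smooth_map X Y F \<and> {x \<in> topspace (mtop X). F x \<in> W} = Z"

definition elliptic_map :: "('p, 'e::euclidean_space) mfd \<Rightarrow> 'p set \<Rightarrow> ('p, real) sheaf \<Rightarrow>
    ('q, 'f::euclidean_space) mfd \<Rightarrow> 'q set \<Rightarrow> ('q, real) sheaf \<Rightarrow> ('p \<Rightarrow> 'q) \<Rightarrow> bool" where
  "elliptic_map X Z J Y W I F \<longleftrightarrow> strong_map X Z Y W F \<and> sheaf_eq X (pullback X Y F I) J"


section \<open>Cooriented local hyperplanes\<close>

text \<open>\<open>f\<close> and \<open>g\<close> define the same germ at \<open>p\<close> of a codimension two submanifold, with the same
  coorientation: their differentials at \<open>p\<close> are surjective onto \<open>\<complex>\<close> and differ by the real-linear map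
  \<open>w \<mapsto> a w + b cnj w\<close>, whose determinant is \<open>\<bar>a\<bar>\<^sup>2 - \<bar>b\<bar>\<^sup>2\<close>.\<close>

definition same_cohyp :: "('p, 'e::euclidean_space) mfd \<Rightarrow> 'p \<Rightarrow> ('p \<Rightarrow> complex) \<Rightarrow> ('p \<Rightarrow> complex) \<Rightarrow> bool" where
  "same_cohyp X p f g \<longleftrightarrow> (\<exists>V \<phi> f' g' a b. chart X V \<phi> \<and> p \<in> V \<and>
     f \<in> smooth_funs X V \<and> g \<in> smooth_funs X V \<and>
     f p = 0 \<and> g p = 0 \<and> (\<forall>q\<in>V. f q = 0 \<longleftrightarrow> g q = 0) \<and>
     ((f \<circ> inv_into V \<phi>) has_derivative f') (at (\<phi> p)) \<and>
     ((g \<circ> inv_into V \<phi>) has_derivative g') (at (\<phi> p)) \<and>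
     surj f' \<and> surj g' \<and> cmod b < cmod a \<and> (\<forall>v. f' v = a * g' v + b * cnj (g' v)))"

definition cohyp :: "('p, 'e::euclidean_space) mfd \<Rightarrow> 'p \<Rightarrow> ('p \<Rightarrow> complex) \<Rightarrow> ('p \<Rightarrow> complex) set" where
  "cohyp X p z = {f. same_cohyp X p f z}"

definition reverse_coor :: "('p \<Rightarrow> complex) set \<Rightarrow> ('p \<Rightarrow> complex) set" where
  "reverse_coor C = (\<lambda>f. cnj \<circ> f) ` C"

definition framing :: "('p, 'e::euclidean_space) mfd \<Rightarrow> nat \<Rightarrow> ('p \<Rightarrow> 'e) \<Rightarrow> (nat \<Rightarrow> 'e) \<Rightarrow> 'p \<Rightarrow>
    ('p \<Rightarrow> complex) set list" where
  "framing X i \<phi> e p = map (\<lambda>j. cohyp X p (\<lambda>q. zc e j (\<phi> q))) [0..<i]"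

text \<open>\<open>(\<int>/2)\<^sup>i \<rtimes> \<Sigma>\<^sub>i\<close> and its right action by reordering and reversing coorientations.\<close>

definition Gam :: "nat \<Rightarrow> ((nat \<Rightarrow> bool) \<times> (nat \<Rightarrow> nat)) set" where
  "Gam i = {(\<epsilon>, \<sigma>). \<sigma> permutes {..<i}}"

definition Gam_act :: "nat \<Rightarrow> (nat \<Rightarrow> bool) \<times> (nat \<Rightarrow> nat) \<Rightarrow>
    ('p \<Rightarrow> complex) set list \<Rightarrow> ('p \<Rightarrow> complex) set list" where
  "Gam_act i \<delta> c = map (\<lambda>j. (if fst \<delta> j then reverse_coor else id) (c ! snd \<delta> j)) [0..<i]"


section \<open>Complex blow-ups\<close>

text \<open>The affine charts of the blow-up of \<open>{z\<^sub>0 = \<dots> = z\<^sub>c\<^sub>-\<^sub>1 = 0}\<close>: over the part of projective space where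
  the \<open>m\<close>-th homogeneous coordinate is nonzero, \<open>v\<close> records the equation \<open>z\<^sub>m\<close>, the ratios
  \<open>z\<^sub>l / z\<^sub>m\<close> for \<open>l \<noteq> m\<close>, and the remaining coordinates of the point \<open>w\<close> below.\<close>

definition blow_rel :: "(nat \<Rightarrow> 'e::euclidean_space) \<Rightarrow> nat \<Rightarrow> nat \<Rightarrow> 'e \<Rightarrow> 'e \<Rightarrow> bool" where
  "blow_rel e c m v w \<longleftrightarrow>
     (\<forall>l<c. zc e l w = (if l = m then zc e m v else zc e l v * zc e m v)) \<and>
     (\<forall>r. 2 * c \<le> r \<and> r < DIM('e) \<longrightarrow> w \<bullet> e r = v \<bullet> e r)"

definition blowup_over :: "('p, 'e::euclidean_space) mfd \<Rightarrow> ('q, 'e) mfd \<Rightarrow> ('q \<Rightarrow> 'p) \<Rightarrow>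
    nat \<Rightarrow> 'p set \<Rightarrow> ('p \<Rightarrow> 'e) \<Rightarrow> (nat \<Rightarrow> 'e) \<Rightarrow> bool" where
  "blowup_over X Y \<beta> c V \<phi> e \<longleftrightarrow> (\<exists>W \<psi>.
     {y \<in> topspace (mtop Y). \<beta> y \<in> V} = (\<Union>m<c. W m) \<and>
     (\<forall>m<c. chart Y (W m) (\<psi> m) \<and>
        (\<forall>y\<in>W m. blow_rel e c m (\<psi> m y) (\<phi> (\<beta> y))) \<and>
        \<psi> m ` W m = {v. \<exists>w\<in>\<phi> ` V. blow_rel e c m v w}) \<and>
     (\<forall>m<c. \<forall>l<c. l \<noteq> m \<longrightarrow> W m \<inter> W l = {y \<in> W m. zc e l (\<psi> m y) \<noteq> 0}))"

text \<open>\<open>\<beta> : Y \<rightarrow> X\<close> is the complex blow-up of \<open>X\<close> with respect to a complex ideal \<open>J\<close> which is locally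
  either trivial or generated by \<open>c\<close> complex coordinate functions.\<close>

definition complex_blowup :: "nat \<Rightarrow> ('p, 'e::euclidean_space) mfd \<Rightarrow> ('p, complex) sheaf \<Rightarrow>
    ('q, 'e) mfd \<Rightarrow> ('q \<Rightarrow> 'p) \<Rightarrow> bool" where
  "complex_blowup c X J Y \<beta> \<longleftrightarrow> smooth_mfd Y \<and> smooth_map Y X \<beta> \<and>
     (\<forall>x\<in>topspace (mtop X).
       (\<exists>V. openin (mtop X) V \<and> x \<in> V \<and> (\<lambda>_. 1) \<in> J V \<and>
          diffeo (open_sub Y {y \<in> topspace (mtop Y). \<beta> y \<in> V}) (open_sub X V) \<beta>) \<or>
       (\<exists>V \<phi> e. chart X V \<phi> \<and> x \<in> V \<and> frame_enum e \<and> 2 * c \<le> DIM('e) \<and>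
          generated_on X V J c (\<lambda>l q. zc e l (\<phi> q)) \<and> blowup_over X Y \<beta> c V \<phi> e))"

text \<open>Iterated blow-up of codimension two centres, each with respect to the pulled back ideal.\<close>

primrec iter_blowup :: "nat \<Rightarrow> ('p, 'e::euclidean_space) mfd \<Rightarrow> (nat \<Rightarrow> ('p, complex) sheaf) \<Rightarrow>
    ('q, 'e) mfd \<Rightarrow> ('q \<Rightarrow> 'p) \<Rightarrow> bool" where
  "iter_blowup 0 X J Y \<beta> \<longleftrightarrow> smooth_mfd Y \<and> diffeo Y X \<beta>"
| "iter_blowup (Suc m) X J Y \<beta> \<longleftrightarrow> (\<exists>(Z :: ('q, 'e) mfd) \<gamma> \<delta>. iter_blowup m X J Z \<gamma> \<and>
     complex_blowup 2 Z (pullback Z X \<gamma> (J m)) Y \<delta> \<and> (\<forall>y\<in>topspace (mtop Y). \<beta> y = \<gamma> (\<delta> y)))"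


section \<open>The local models\<close>

locale elliptic_pair =
  fixes M :: "('a, 'e::euclidean_space) mfd" and D :: "'a set" and I :: "('a, real) sheaf"
  assumes hausdorff: "Hausdorff_space (mtop M)"
    and second_countable: "second_countable (mtop M)"
    and divisor: "nc_elliptic_divisor M D I"
begin

definition stratum :: "nat \<Rightarrow> 'a set" where
  "stratum k = {p. \<exists>V \<phi> e. nc_chart M D I k p V \<phi> e}"

definition pieces :: "nat \<Rightarrow> 'a set set" where
  "pieces k = connected_components_of (subtopology (mtop M) (stratum k))"

text \<open>A tubular neighbourhood \<open>\<pi> : U \<rightarrow> N\<close> as a vector bundle with zero section \<open>N\<close>; \<open>T\<close> is a set of
  normal crossing charts that are vector bundle trivialisations, with fibre coordinates
  \<open>z\<^sub>0, \<dots>, z\<^sub>i\<^sub>-\<^sub>1\<close>. For \<open>i = 0\<close> this forces \<open>U = N\<close>.\<close>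

definition nc_tube :: "nat \<Rightarrow> 'a set \<Rightarrow> 'a set \<Rightarrow> ('a \<Rightarrow> 'a) \<Rightarrow> ('a set \<times> ('a \<Rightarrow> 'e) \<times> (nat \<Rightarrow> 'e)) set \<Rightarrow> bool" where
  "nc_tube i N U \<pi> T \<longleftrightarrow> openin (mtop M) U \<and> N \<subseteq> U \<and> \<pi> ` U \<subseteq> N \<and> (\<forall>p\<in>N. \<pi> p = p) \<and>
     U = (\<Union>(V, \<phi>, e)\<in>T. V) \<and>
     (\<forall>(V, \<phi>, e)\<in>T. nc_coords M D I i V \<phi> e \<and> V = {u \<in> U. \<pi> u \<in> V} \<and>
        (\<forall>v\<in>\<phi> ` V. \<forall>w. (\<forall>r. 2 * i \<le> r \<and> r < DIM('e) \<longrightarrow> w \<bullet> e r = v \<bullet> e r) \<longrightarrow> w \<in> \<phi> ` V) \<and>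
        (\<forall>u\<in>V. (\<forall>j<i. zc e j (\<phi> (\<pi> u)) = 0) \<and>
           (\<forall>r. 2 * i \<le> r \<and> r < DIM('e) \<longrightarrow> \<phi> (\<pi> u) \<bullet> e r = \<phi> u \<bullet> e r))) \<and>
     (\<forall>(V, \<phi>, e)\<in>T. \<forall>(W, \<psi>, e')\<in>T. \<forall>p\<in>V \<inter> W \<inter> N. \<exists>A. linear A \<and>
        (\<forall>u\<in>V \<inter> W. \<pi> u = p \<longrightarrow> \<psi> u - \<psi> p = A (\<phi> u - \<phi> p)))"

text \<open>All orderings and coorientations of the \<open>i\<close> local hyperplanes through a point of \<open>stratum i\<close>.\<close>

definition framings :: "nat \<Rightarrow> 'a \<Rightarrow> ('a \<Rightarrow> complex) set list set" where
  "framings i p = {framing M i \<phi> e p | V \<phi> e. nc_chart M D I i p V \<phi> e}"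

end

type_synonym 'a cov = "'a \<times> ('a \<Rightarrow> complex) set list"

locale elliptic_tubes = elliptic_pair M D I
  for M :: "('a, 'e::euclidean_space) mfd" and D :: "'a set" and I :: "('a, real) sheaf" +
  fixes U :: "nat \<Rightarrow> 'a set \<Rightarrow> 'a set"
    and pr :: "nat \<Rightarrow> 'a set \<Rightarrow> 'a \<Rightarrow> 'a"
    and T :: "nat \<Rightarrow> 'a set \<Rightarrow> ('a set \<times> ('a \<Rightarrow> 'e) \<times> (nat \<Rightarrow> 'e)) set"
  assumes tube: "N \<in> pieces i \<Longrightarrow> nc_tube i N (U i N) (pr i N) (T i N)"
begin

text \<open>The bundle \<open>P\<^sub>N \<rightarrow> U\<^sub>N\<close>. The topology makes the framings by the coordinates of a normal crossing
  chart around \<open>N\<close>, pulled back along \<open>U\<^sub>N \<rightarrow> N\<close>, into open sections.\<close>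

definition PN_top :: "nat \<Rightarrow> 'a set \<Rightarrow> 'a cov topology" where
  "PN_top i N = topology_generated_by
     {{(u, framing M i \<phi> e (pr i N u)) | u. u \<in> B} | B V \<phi> e.
        nc_coords M D I i V \<phi> e \<and> openin (mtop M) B \<and> B \<subseteq> U i N \<and> pr i N ` B \<subseteq> V}"

definition PN :: "nat \<Rightarrow> 'a set \<Rightarrow> ('a cov, 'e) mfd" where
  "PN i N = etale_mfd (PN_top i N) fst M"

definition act :: "nat \<Rightarrow> (nat \<Rightarrow> bool) \<times> (nat \<Rightarrow> nat) \<Rightarrow> 'a cov \<Rightarrow> 'a cov" where
  "act i \<delta> = (\<lambda>(u, c). (u, Gam_act i \<delta> c))"

definition sheets :: "nat \<Rightarrow> 'a set \<Rightarrow> 'a cov set set" where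
  "sheets i N = connected_components_of (mtop (PN i N))"

text \<open>The connected components of the multiplicity strata of a sheet.\<close>

definition sheet_pieces :: "nat \<Rightarrow> 'a set \<Rightarrow> 'a cov set \<Rightarrow> 'a cov set set" where
  "sheet_pieces i N E =
     (\<Union>k. connected_components_of (subtopology (mtop (PN i N)) {x \<in> E. fst x \<in> stratum k}))"

text \<open>Local complex defining functions of the \<open>j\<close>-th divisor \<open>H\<^sub>j\<close> in a sheet: those fibre coordinates, or their
  conjugates, that define the \<open>j\<close>-th hyperplane with its coorientation.\<close>

definition defining_funs :: "nat \<Rightarrow> 'a set \<Rightarrow> 'a cov set \<Rightarrow> nat \<Rightarrow> ('a cov set \<times> ('a cov \<Rightarrow> complex)) set" where
  "defining_funs i N E j = {(B, \<zeta> \<circ> fst) | B \<zeta>. openin (mtop (PN i N)) B \<and> B \<subseteq> E \<and>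
     (\<exists>(V, \<phi>, e)\<in>T i N. fst ` B \<subseteq> V \<and>
        (\<exists>m<i. \<zeta> = (\<lambda>q. zc e m (\<phi> q)) \<or> \<zeta> = (\<lambda>q. cnj (zc e m (\<phi> q)))) \<and>
        (\<forall>(u, c)\<in>B. c ! j = cohyp M (pr i N u) \<zeta>))}"

definition square :: "nat \<Rightarrow> 'a set \<Rightarrow> 'a cov set \<Rightarrow> ('a cov \<times> 'a cov, 'e \<times> 'e) mfd" where
  "square i N E = prod_mfd (open_sub (PN i N) E) (open_sub (PN i N) E)"

definition centre_ideal :: "nat \<Rightarrow> 'a set \<Rightarrow> 'a cov set \<Rightarrow> nat \<Rightarrow> ('a cov \<times> 'a cov, complex) sheaf" where
  "centre_ideal i N E j = gen_sheaf (square i N E)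
     ({(B \<times> E, \<zeta> \<circ> fst) | B \<zeta>. (B, \<zeta>) \<in> defining_funs i N E j} \<union>
      {(E \<times> B, \<zeta> \<circ> snd) | B \<zeta>. (B, \<zeta>) \<in> defining_funs i N E j})"

text \<open>Parallel transport in \<open>P\<^sub>N\<close> along the path \<open>\<gamma>\<close> takes \<open>x\<close> to \<open>x'\<close>.\<close>

definition transports :: "nat \<Rightarrow> 'a set \<Rightarrow> (real \<Rightarrow> 'a) \<Rightarrow> 'a cov \<Rightarrow> 'a cov \<Rightarrow> bool" where
  "transports i N \<gamma> x x' \<longleftrightarrow> (\<exists>\<eta>. pathin (mtop (PN i N)) \<eta> \<and> \<eta> 0 = x \<and> \<eta> 1 = x' \<and>
     (\<forall>r\<in>{0..1}. fst (\<eta> r) = \<gamma> r))"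

end

locale elliptic_blowups = elliptic_tubes M D I U pr T
  for M :: "('a, 'e::euclidean_space) mfd" and D :: "'a set" and I :: "('a, real) sheaf"
    and U :: "nat \<Rightarrow> 'a set \<Rightarrow> 'a set"
    and pr :: "nat \<Rightarrow> 'a set \<Rightarrow> 'a \<Rightarrow> 'a"
    and T :: "nat \<Rightarrow> 'a set \<Rightarrow> ('a set \<times> ('a \<Rightarrow> 'e) \<times> (nat \<Rightarrow> 'e)) set" +
  fixes Y :: "nat \<Rightarrow> 'a set \<Rightarrow> 'a cov set \<Rightarrow> ('y, 'e \<times> 'e) mfd"
    and \<beta> :: "nat \<Rightarrow> 'a set \<Rightarrow> 'a cov set \<Rightarrow> 'y \<Rightarrow> 'a cov \<times> 'a cov"
  assumes blowup: "\<lbrakk>N \<in> pieces i; E \<in> sheets i N\<rbrakk> \<Longrightarrow>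
    iter_blowup i (square i N E) (centre_ideal i N E) (Y i N E) (\<beta> i N E)"
begin

text \<open>The groupoid over a sheet. For \<open>i = 0\<close> there is no blow-up, the only sheet is \<open>N\<close> and
  the result is the pair groupoid of \<open>N\<close>.\<close>

definition GE_arrows :: "nat \<Rightarrow> 'a set \<Rightarrow> 'a cov set \<Rightarrow> 'y set" where
  "GE_arrows i N E = topspace (mtop (Y i N E)) -
     \<Union> {mtop (Y i N E) closure_of {y \<in> topspace (mtop (Y i N E)). \<beta> i N E y \<in> N0 \<times> N1} | N0 N1.
          N0 \<in> sheet_pieces i N E \<and> N1 \<in> sheet_pieces i N E \<and> N0 \<noteq> N1}"

definition GE :: "nat \<Rightarrow> 'a set \<Rightarrow> 'a cov set \<Rightarrow> ('y, 'e \<times> 'e) mfd" where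
  "GE i N E = open_sub (Y i N E) (GE_arrows i N E)"

definition GE_tgt :: "nat \<Rightarrow> 'a set \<Rightarrow> 'a cov set \<Rightarrow> 'y \<Rightarrow> 'a cov" where
  "GE_tgt i N E y = fst (\<beta> i N E y)"

definition GE_src :: "nat \<Rightarrow> 'a set \<Rightarrow> 'a cov set \<Rightarrow> 'y \<Rightarrow> 'a cov" where
  "GE_src i N E y = snd (\<beta> i N E y)"

text \<open>The product is the extension by continuity of the product of the pair groupoid over the
  complement of the divisor.\<close>

definition GE_mult :: "nat \<Rightarrow> 'a set \<Rightarrow> 'a cov set \<Rightarrow> 'y \<Rightarrow> 'y \<Rightarrow> 'y" where
  "GE_mult i N E g h = (THE k. (g, h, k) \<in>
     prod_topology (mtop (GE i N E)) (prod_topology (mtop (GE i N E)) (mtop (GE i N E))) closure_of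
       {(g', h', k'). g' \<in> GE_arrows i N E \<and> h' \<in> GE_arrows i N E \<and> k' \<in> GE_arrows i N E \<and>
          fst (GE_tgt i N E g') \<notin> D \<and> fst (GE_src i N E g') \<notin> D \<and> fst (GE_src i N E h') \<notin> D \<and>
          GE_src i N E g' = GE_tgt i N E h' \<and>
          GE_tgt i N E k' = GE_tgt i N E g' \<and> GE_src i N E k' = GE_src i N E h'})"

definition Gsum :: "nat \<Rightarrow> 'a set \<Rightarrow> ('a cov set \<times> 'y, 'e \<times> 'e) mfd" where
  "Gsum i N = sum_mfd (GE i N) (sheets i N)"

text \<open>The lifts of the \<open>\<Gamma>\<^sub>i\<close>-action to the disjoint union of the \<open>\<G>\<^sub>E\<close>.\<close>

definition Gam_lifts :: "nat \<Rightarrow> 'a set \<Rightarrow> ('a cov set \<times> 'y \<Rightarrow> 'a cov set \<times> 'y) set" where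
  "Gam_lifts i N = {F. diffeo (Gsum i N) (Gsum i N) F \<and> (\<exists>\<delta>\<in>Gam i. \<forall>x\<in>topspace (mtop (Gsum i N)).
     case_prod (GE_tgt i N) (F x) = act i \<delta> (case_prod (GE_tgt i N) x) \<and>
     case_prod (GE_src i N) (F x) = act i \<delta> (case_prod (GE_src i N) x))}"

definition orbit :: "nat \<Rightarrow> 'a set \<Rightarrow> 'a cov set \<times> 'y \<Rightarrow> ('a cov set \<times> 'y) set" where
  "orbit i N x = {F x | F. F \<in> Gam_lifts i N}"

definition GN :: "nat \<Rightarrow> 'a set \<Rightarrow> (('a cov set \<times> 'y) set, 'e \<times> 'e) mfd" where
  "GN i N = quot_mfd (Gsum i N) (orbit i N)"

definition GN_tgt :: "nat \<Rightarrow> 'a set \<Rightarrow> ('a cov set \<times> 'y) set \<Rightarrow> 'a" where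
  "GN_tgt i N a = the_elem ((\<lambda>(E, g). fst (GE_tgt i N E g)) ` a)"

definition GN_src :: "nat \<Rightarrow> 'a set \<Rightarrow> ('a cov set \<times> 'y) set \<Rightarrow> 'a" where
  "GN_src i N a = the_elem ((\<lambda>(E, g). fst (GE_src i N E g)) ` a)"

definition GN_mult :: "nat \<Rightarrow> 'a set \<Rightarrow> ('a cov set \<times> 'y) set \<Rightarrow> ('a cov set \<times> 'y) set \<Rightarrow> ('a cov set \<times> 'y) set" where
  "GN_mult i N a b = (THE c. \<exists>E g h. (E, g) \<in> a \<and> (E, h) \<in> b \<and> GE_src i N E g = GE_tgt i N E h \<and>
     c = orbit i N (E, GE_mult i N E g h))"


section \<open>The gluing maps\<close>

text \<open>The coordinate \<open>b\<close> of an arrow \<open>a\<close> for local complex defining functions \<open>z\<close> around its target and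
  \<open>w\<close> around its source, extending \<open>w (s a') = z (t a') b\<close> by continuity.\<close>

definition has_b_coord :: "nat \<Rightarrow> 'a set \<Rightarrow> ('a cov set \<times> 'y) set \<Rightarrow> ('a \<Rightarrow> complex) \<Rightarrow> ('a \<Rightarrow> complex) \<Rightarrow> complex \<Rightarrow> bool" where
  "has_b_coord i N a z w b \<longleftrightarrow> b \<noteq> 0 \<and>
     limitin euclidean (\<lambda>a'. w (GN_src i N a') / z (GN_tgt i N a')) b
       (atin_within (mtop (GN i N)) a {a'. GN_src i N a' \<notin> D \<and> GN_tgt i N a' \<notin> D})"

text \<open>The graph of \<open>\<kappa> : \<G>\<^sub>N|\<^sub>S \<rightarrow> \<G>\<^sub>N\<^sub>'|\<^sub>N\<^sub>'\<close>, for \<open>S\<close> a component of \<open>N' \<inter> U\<^sub>N\<close> and \<open>N'\<close> of multiplicity \<open>j\<close>: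
  \<open>a\<close> and \<open>a'\<close> have the same endpoints \<open>y, x \<in> S\<close>, there is a path \<open>\<gamma>\<close> in \<open>S\<close> from \<open>y\<close> to \<open>x\<close> such that the
  isomorphisms of fibres of \<open>P\<^sub>N\<close> and \<open>P\<^sub>N\<^sub>'\<close> underlying \<open>a\<close> and \<open>a'\<close> are the parallel transports along \<open>\<gamma>\<close>,
  and the coordinates \<open>b \<in> (\<complex>\<^sup>*)\<^sup>j\<close> agree in normal crossing charts at \<open>x\<close> and \<open>y\<close> whose hyperplanes
  correspond under this transport.\<close>

definition kappa :: "nat \<Rightarrow> 'a set \<Rightarrow> nat \<Rightarrow> 'a set \<Rightarrow> 'a set \<Rightarrow>
    ('a cov set \<times> 'y) set \<Rightarrow> ('a cov set \<times> 'y) set \<Rightarrow> bool" where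
  "kappa i N j N' S a a' \<longleftrightarrow>
     a \<in> topspace (mtop (GN i N)) \<and> a' \<in> topspace (mtop (GN j N')) \<and>
     GN_src i N a \<in> S \<and> GN_tgt i N a \<in> S \<and>
     GN_src j N' a' = GN_src i N a \<and> GN_tgt j N' a' = GN_tgt i N a \<and>
     (\<exists>\<gamma> E g E' g' V \<phi> e W \<psi> e'.
        pathin (subtopology (mtop M) S) \<gamma> \<and> \<gamma> 0 = GN_src i N a \<and> \<gamma> 1 = GN_tgt i N a \<and>
        (E, g) \<in> a \<and> transports i N \<gamma> (GE_src i N E g) (GE_tgt i N E g) \<and>
        (E', g') \<in> a' \<and> transports j N' \<gamma> (GE_src j N' E' g') (GE_tgt j N' E' g') \<and>
        nc_chart M D I j (GN_tgt i N a) V \<phi> e \<and>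
        snd (GE_tgt j N' E' g') = framing M j \<phi> e (GN_tgt i N a) \<and>
        nc_chart M D I j (GN_src i N a) W \<psi> e' \<and>
        snd (GE_src j N' E' g') = framing M j \<psi> e' (GN_src i N a) \<and>
        (\<forall>m<j. \<exists>b. has_b_coord i N a (\<lambda>q. zc e m (\<phi> q)) (\<lambda>q. zc e' m (\<psi> q)) b \<and>
                   has_b_coord j N' a' (\<lambda>q. zc e m (\<phi> q)) (\<lambda>q. zc e' m (\<psi> q)) b))"

definition ell_arrows :: "((nat \<times> 'a set) \<times> ('a cov set \<times> 'y) set) set" where
  "ell_arrows = {((i, N), a) | i N a. N \<in> pieces i \<and> a \<in> topspace (mtop (GN i N)) \<and>
     GN_src i N a \<in> N \<and> GN_tgt i N a \<in> N}"

end


section \<open>The elliptic groupoid\<close>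

record ('p, 'e, 'g, 'f) gpd =
  objs :: "('p, 'e) mfd"
  arrs :: "('g, 'f) mfd"
  src :: "'g \<Rightarrow> 'p"
  tgt :: "'g \<Rightarrow> 'p"
  mult :: "'g \<Rightarrow> 'g \<Rightarrow> 'g"

text \<open>\<open>\<iota> i N\<close> is the map \<open>\<G>\<^sub>N \<rightarrow> \<G>\<close>: the inclusion on \<open>\<G>\<^sub>N|\<^sub>N\<close>, and given by the gluing maps over all
  components of \<open>N' \<inter> U\<^sub>N\<close>. The topology of \<open>\<G>\<close> is the quotient topology of the gluing, and its smooth
  structure is the one for which all \<open>\<iota> i N\<close> are local diffeomorphisms.\<close>

locale elliptic_groupoid = elliptic_blowups M D I U pr T Y \<beta>
  for M :: "('a, 'e::euclidean_space) mfd" and D :: "'a set" and I :: "('a, real) sheaf"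
    and U :: "nat \<Rightarrow> 'a set \<Rightarrow> 'a set"
    and pr :: "nat \<Rightarrow> 'a set \<Rightarrow> 'a \<Rightarrow> 'a"
    and T :: "nat \<Rightarrow> 'a set \<Rightarrow> ('a set \<times> ('a \<Rightarrow> 'e) \<times> (nat \<Rightarrow> 'e)) set"
    and Y :: "nat \<Rightarrow> 'a set \<Rightarrow> 'a cov set \<Rightarrow> ('y, 'e \<times> 'e) mfd"
    and \<beta> :: "nat \<Rightarrow> 'a set \<Rightarrow> 'a cov set \<Rightarrow> 'y \<Rightarrow> 'a cov \<times> 'a cov" +
  fixes \<G> :: "('a, 'e, (nat \<times> 'a set) \<times> ('a cov set \<times> 'y) set, 'e \<times> 'e) gpd"
  assumes objs: "objs \<G> = M"
    and arrows: "topspace (mtop (arrs \<G>)) = ell_arrows"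
    and src: "((i, N), a) \<in> ell_arrows \<Longrightarrow> src \<G> ((i, N), a) = GN_src i N a"
    and tgt: "((i, N), a) \<in> ell_arrows \<Longrightarrow> tgt \<G> ((i, N), a) = GN_tgt i N a"
    and mult: "\<lbrakk>((i, N), a) \<in> ell_arrows; ((i, N), b) \<in> ell_arrows; GN_src i N a = GN_tgt i N b\<rbrakk> \<Longrightarrow>
      mult \<G> ((i, N), a) ((i, N), b) = ((i, N), GN_mult i N a b)"
    and smooth: "smooth_mfd (arrs \<G>)"
    and gluing: "\<exists>\<iota>.
      (\<forall>i. \<forall>N\<in>pieces i. \<forall>a\<in>topspace (mtop (GN i N)).
         (GN_src i N a \<in> N \<and> GN_tgt i N a \<in> N \<longrightarrow> \<iota> i N a = ((i, N), a)) \<and>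
         (\<forall>j. \<forall>N'\<in>pieces j. \<forall>S\<in>connected_components_of (subtopology (mtop M) (N' \<inter> U i N)).
            GN_src i N a \<in> S \<and> GN_tgt i N a \<in> S \<longrightarrow>
              (\<exists>a'. \<iota> i N a = ((j, N'), a') \<and> kappa i N j N' S a a'))) \<and>
      (\<forall>i. \<forall>N\<in>pieces i. local_diffeo (GN i N) (arrs \<G>) (\<iota> i N)) \<and>
      (\<forall>W. openin (mtop (arrs \<G>)) W \<longleftrightarrow> W \<subseteq> ell_arrows \<and>
         (\<forall>i. \<forall>N\<in>pieces i. openin (mtop (GN i N)) {a \<in> topspace (mtop (GN i N)). \<iota> i N a \<in> W}))"

end

theory Submission
  imports Defs "HOL-Homology.Invariance_of_Domain"
begin

text \<open>An arrow over a point of multiplicity \<open>i\<close> comes from a point of an iterated blow-up. By induction over the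
  tower of blow-ups, suitable defining functions \<open>f\<^sub>j\<close> (at the target) and \<open>g\<^sub>j\<close> (at the source) of the \<open>j\<close>-th divisor
  pull back to \<open>a\<^sub>j\<close> and \<open>b\<^sub>j a\<^sub>j\<close> in some order, where \<open>a\<^sub>j\<close> and \<open>b\<^sub>j\<close> are part of a coordinate system. If some \<open>b\<^sub>j\<close>
  vanished at the arrow, there would be nearby arrows with exactly one end in the divisor, which the removal of the
  closures excludes. So \<open>b\<^sub>j\<close> is a unit, and both pullbacks of the ideal are generated by the product of the
  \<open>\<bar>a\<^sub>j\<bar>\<^sup>2\<close>. These coordinates descend to the elliptic groupoid, because the \<open>\<Gamma>\<^sub>i\<close>-orbit map is locally injective
  near arrows over the stratum and the gluing maps are local diffeomorphisms that preserve the ends.\<close>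

text \<open>Three obstacles shape the proof. The equations of a centre are not the coordinates in
  which \<open>complex_blowup\<close> describes it: a blow-up chart may use any generators of the
  pulled back ideal, and \<open>same_cohyp\<close> only relates differentials by \<alpha> w +
  \<beta> cnj w. So the tower is controlled through differentials, by tangent vectors acting on
  germs (\<open>tvec\<close>); the invariant is surjectivity of the joint differential of the
  \<open>a j\<close> and \<open>b j\<close>, which in the end makes them coordinates. Next, few of
  the spaces come with a proof of smoothness. That \<open>square\<close> is a smooth manifold
  follows from the bottom stage of the tower, which is diffeomorphic to it, by invariance of domain;
  charts of \<G> are obtained by inverting the map from the arrows of a sheet locally, without
  knowing that \<open>GN\<close> is smooth. Arrows need not be separated, so all separation takes
  place inside one chart. Finally, two charts of a tube are only known to differ linearly on fibres.
  That their fibre coordinates agree in modulus up to order and a unit is a fact about real-linear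
  maps that preserve the product of the moduli: \<open>linear_forms_monomial\<close> and
  \<open>tube_compare\<close>.\<close>

abbreviation opn :: "('p, 'e) mfd \<Rightarrow> 'p set \<Rightarrow> bool" where "opn X \<equiv> openin (mtop X)"

abbreviation pts :: "('p, 'e) mfd \<Rightarrow> 'p set" where "pts X \<equiv> topspace (mtop X)"

abbreviation zprod :: "(nat \<Rightarrow> 'e::euclidean_space) \<Rightarrow> nat \<Rightarrow> 'e \<Rightarrow> real" where
  "zprod e k v \<equiv> \<Prod>j<k. (cmod (zc e j v))\<^sup>2"

section \<open>Smooth functions on open subsets of normed spaces\<close>

lemma frechet_derivative_eqI:
  "(f has_derivative f') (at x) \<Longrightarrow> frechet_derivative f (at x) v = f' v" by (simp add: frechet_derivative_at[symmetric])

lemma Ck_on_cong: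
  assumes "open S" "\<And>x. x \<in> S \<Longrightarrow> f x = g x" "Ck_on k f S"
  shows "Ck_on k g S" using assms(2,3)
proof (induction k arbitrary: f g)
  case 0
  then show ?case by (simp cong: continuous_on_cong)
next
  case (Suc k)
  have d: "g differentiable at x" if "x \<in> S" for x
    using Suc.prems that has_derivative_transform_within_open[of f _ x UNIV S g] \<open>open S\<close>
    by (fastforce simp: differentiable_def)
  have e: "frechet_derivative g (at x) v = frechet_derivative f (at x) v" if "x \<in> S" for x v
    using Suc.prems that frechet_derivative_transform_within_open[of f x S g] \<open>open S\<close> by auto
  have "Ck_on k (\<lambda>x. frechet_derivative g (at x) v) S" for v
    using Suc.IH[of "\<lambda>x. frechet_derivative f (at x) v" "\<lambda>x. frechet_derivative g (at x) v"]
      Suc.prems e by auto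
  then show ?case using d by auto
qed

lemma Ck_on_subset: "Ck_on k f S \<Longrightarrow> T \<subseteq> S \<Longrightarrow> Ck_on k f T"
  by (induction k arbitrary: f) (auto intro: continuous_on_subset)

lemma Ck_on_continuous: "Ck_on k f S \<Longrightarrow> continuous_on S f"
  by (cases k) (auto intro!: continuous_at_imp_continuous_on differentiable_imp_continuous_within)

lemma Ck_on_Suc_D: "Ck_on (Suc k) f S \<Longrightarrow> Ck_on k f S"
proof (induction k arbitrary: f)
  case 0
  then show ?case using Ck_on_continuous by fastforce
next
  case (Suc k)
  then show ?case using Ck_on.simps(2) by metis
qed

lemma Ck_on_const [simp]: "Ck_on k (\<lambda>x. c) S" by (induction k arbitrary: c) auto

lemma Ck_on_bounded_linear:
  assumes "bounded_linear f" shows "Ck_on k f S"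
proof (cases k)
  case 0
  then show ?thesis using assms linear_continuous_on by auto
next
  case (Suc k)
  have "frechet_derivative f (at x) v = f v" for x v by (rule frechet_derivative_eqI) (rule bounded_linear_imp_has_derivative[OF assms])
  then show ?thesis using Suc bounded_linear_imp_differentiable[OF assms] by auto
qed

lemma Ck_on_add:
  assumes "open S" "Ck_on k f S" "Ck_on k g S"
  shows "Ck_on k (\<lambda>x. f x + g x) S" using assms(2,3)
proof (induction k arbitrary: f g)
  case 0
  then show ?case by (simp add: continuous_on_add)
next
  case (Suc k)
  have e: "frechet_derivative (\<lambda>x. f x + g x) (at x) v
      = frechet_derivative f (at x) v + frechet_derivative g (at x) v" if "x \<in> S" for x v using Suc.prems that
    by (intro frechet_derivative_eqI) (auto intro!: has_derivative_add simp: frechet_derivative_works[symmetric])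
  have "Ck_on k (\<lambda>x. frechet_derivative (\<lambda>x. f x + g x) (at x) v) S" for v
    by (rule Ck_on_cong[OF \<open>open S\<close> _ Suc.IH[of "\<lambda>x. frechet_derivative f (at x) v" "\<lambda>x. frechet_derivative g (at x) v"]])
      (use Suc.prems e in auto)
  then show ?case using Suc.prems by auto
qed

lemma Ck_on_bilinear:
  assumes "bounded_bilinear p" "open S" "Ck_on k f S" "Ck_on k g S"
  shows "Ck_on k (\<lambda>x. p (f x) (g x)) S" using assms(3,4)
proof (induction k arbitrary: f g)
  case 0
  then show ?case using bounded_bilinear.continuous_on[OF assms(1)] by auto
next
  case (Suc k)
  have D: "((\<lambda>x. p (f x) (g x)) has_derivative (\<lambda>v. p (f x) (frechet_derivative g (at x) v)
      + p (frechet_derivative f (at x) v) (g x))) (at x)" if "x \<in> S" for x using Suc.prems that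
    by (intro bounded_bilinear.FDERIV[OF assms(1)]) (auto simp: frechet_derivative_works[symmetric])
  have "Ck_on k (\<lambda>x. frechet_derivative (\<lambda>x. p (f x) (g x)) (at x) v) S" for v
  proof (rule Ck_on_cong[OF \<open>open S\<close>])
    show "Ck_on k (\<lambda>x. p (f x) (frechet_derivative g (at x) v)
      + p (frechet_derivative f (at x) v) (g x)) S" using Suc.prems Ck_on_Suc_D[of k f S] Ck_on_Suc_D[of k g S]
      by (intro Ck_on_add \<open>open S\<close> Suc.IH) auto
  qed (use frechet_derivative_eqI[OF D] in auto)
  then show ?case using D by (auto simp: differentiable_def)
qed

lemma Ck_on_sum:
  assumes "open S" "\<And>i. i \<in> A \<Longrightarrow> Ck_on k (f i) S"
  shows "Ck_on k (\<lambda>x. \<Sum>i\<in>A. f i x) S" using assms(2)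
  by (induction A rule: infinite_finite_induct) (auto intro!: Ck_on_add \<open>open S\<close>)

text \<open>The chain rule gives a linear map depending on x, applied to a vector depending on x.
  Expanding this vector in \<open>Basis\<close> leaves finitely many products of a coordinate of the
  derivative of \<open>f\<close> with a partial derivative of \<open>g\<close> along
  \<open>f\<close>, to which the induction hypothesis applies. This is why the middle space is
  Euclidean.\<close>

lemma Ck_on_compose:
  fixes f :: "'a::real_normed_vector \<Rightarrow> 'b::euclidean_space" and g :: "'b \<Rightarrow> 'c::real_normed_vector"
  assumes "open S" "f ` S \<subseteq> T" "Ck_on k f S" "Ck_on k g T"
  shows "Ck_on k (\<lambda>x. g (f x)) S" using assms(3,4)
proof (induction k arbitrary: g)
  case 0
  then show ?case using assms(2) by (auto intro: continuous_on_compose2)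
next
  case (Suc k)
  have D: "((\<lambda>x. g (f x)) has_derivative (\<lambda>v. frechet_derivative g (at (f x)) (frechet_derivative f (at x) v))) (at x)"
    if "x \<in> S" for x using Suc.prems that assms(2)
    by (intro has_derivative_compose[of f _ x UNIV g]) (auto simp: frechet_derivative_works[symmetric] image_subset_iff)
  have "Ck_on k (\<lambda>x. frechet_derivative (\<lambda>x. g (f x)) (at x) v) S" for v
  proof (rule Ck_on_cong[OF \<open>open S\<close>])
    show "Ck_on k (\<lambda>x. \<Sum>b\<in>Basis. (frechet_derivative f (at x) v \<bullet> b) *\<^sub>R frechet_derivative g (at (f x)) b) S"
    proof (intro Ck_on_sum Ck_on_bilinear[OF bounded_bilinear_scaleR] \<open>open S\<close>)
      fix b :: 'b assume "b \<in> Basis"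
      show "Ck_on k (\<lambda>x. frechet_derivative f (at x) v \<bullet> b) S"
        using Suc.prems by (intro Ck_on_bilinear[OF bounded_bilinear_inner \<open>open S\<close>]) auto
      show "Ck_on k (\<lambda>x. frechet_derivative g (at (f x)) b) S"
        using Suc.prems Ck_on_Suc_D[of k f S] by (intro Suc.IH[of "\<lambda>y. frechet_derivative g (at y) b"]) auto
    qed
    fix x assume x: "x \<in> S"
    have lin: "linear (frechet_derivative g (at (f x)))" using Suc.prems x assms(2) by (intro linear_frechet_derivative) auto
    have "frechet_derivative g (at (f x)) (frechet_derivative f (at x) v) =
       frechet_derivative g (at (f x)) (\<Sum>b\<in>Basis. (frechet_derivative f (at x) v \<bullet> b) *\<^sub>R b)"
      by (simp add: euclidean_representation)
    also have "\<dots> = (\<Sum>b\<in>Basis. (frechet_derivative f (at x) v \<bullet> b) *\<^sub>R frechet_derivative g (at (f x)) b)"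
      by (simp add: linear_sum[OF lin] linear_scale[OF lin])
    finally show "(\<Sum>b\<in>Basis. (frechet_derivative f (at x) v \<bullet> b) *\<^sub>R frechet_derivative g (at (f x)) b)
        = frechet_derivative (\<lambda>x. g (f x)) (at x) v" using frechet_derivative_eqI[OF D[OF x]] by simp
  qed
  then show ?case using D by (auto simp: differentiable_def)
qed

lemma Ck_on_inverse:
  fixes f :: "'a::real_normed_vector \<Rightarrow> 'k::real_normed_div_algebra"
  assumes "open S" "Ck_on k f S" "\<And>x. x \<in> S \<Longrightarrow> f x \<noteq> 0"
  shows "Ck_on k (\<lambda>x. inverse (f x)) S" using assms(2)
proof (induction k)
  case 0
  then show ?case using assms(3) by (auto intro: continuous_on_inverse)
next
  case (Suc k)
  have D: "((\<lambda>x. inverse (f x)) has_derivative (\<lambda>v. - (inverse (f x) * frechet_derivative f (at x) v * inverse (f x)))) (at x)"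
    if "x \<in> S" for x using Suc.prems that assms(3)
    by (intro Deriv.has_derivative_inverse) (auto simp: frechet_derivative_works[symmetric])
  have "Ck_on k (\<lambda>x. frechet_derivative (\<lambda>x. inverse (f x)) (at x) v) S" for v
  proof (rule Ck_on_cong[OF \<open>open S\<close>])
    show "Ck_on k (\<lambda>x. (-1) * (inverse (f x) * frechet_derivative f (at x) v * inverse (f x))) S"
      using Suc.prems Ck_on_Suc_D[of k f S]
      by (intro Ck_on_bilinear[OF bounded_bilinear_mult] \<open>open S\<close> Ck_on_const Suc.IH) auto
  qed (use frechet_derivative_eqI[OF D] in auto)
  then show ?case using D by (auto simp: differentiable_def)
qed

lemma Ck_on_local:
  assumes "\<And>x. x \<in> S \<Longrightarrow> \<exists>T. open T \<and> x \<in> T \<and> Ck_on k f T"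
  shows "Ck_on k f S" using assms
proof (induction k arbitrary: f)
  case 0
  then show ?case using continuous_on_eq_continuous_at continuous_at_imp_continuous_on by (metis Ck_on.simps(1))
next
  case (Suc k)
  then show ?case by (metis Ck_on.simps(2))
qed

lemma Cinf_on_cong:
  assumes "open S" "\<And>x. x \<in> S \<Longrightarrow> f x = g x" "Cinf_on S f"
  shows "Cinf_on S g" using Ck_on_cong[OF assms(1), of f g] assms(2,3) unfolding Cinf_on_def by blast

lemma Cinf_on_subset: "Cinf_on S f \<Longrightarrow> T \<subseteq> S \<Longrightarrow> Cinf_on T f"
  using Ck_on_subset unfolding Cinf_on_def by blast

lemma Cinf_on_continuous: "Cinf_on S f \<Longrightarrow> continuous_on S f" using Ck_on_continuous unfolding Cinf_on_def by blast

lemma Cinf_on_differentiable: "Cinf_on S f \<Longrightarrow> x \<in> S \<Longrightarrow> f differentiable at x"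
  unfolding Cinf_on_def using Ck_on.simps(2) by blast

lemma Cinf_on_derivative: "Cinf_on S f \<Longrightarrow> Cinf_on S (\<lambda>x. frechet_derivative f (at x) v)"
  unfolding Cinf_on_def using Ck_on.simps(2) by blast

lemma Cinf_on_const [simp]: "Cinf_on S (\<lambda>x. c)" unfolding Cinf_on_def by simp

lemma Cinf_on_bounded_linear: "bounded_linear f \<Longrightarrow> Cinf_on S f" unfolding Cinf_on_def by (simp add: Ck_on_bounded_linear)

lemma Cinf_on_ident [simp]: "Cinf_on S (\<lambda>x. x)" using Cinf_on_bounded_linear[OF bounded_linear_ident] .

lemma Cinf_on_add: "open S \<Longrightarrow> Cinf_on S f \<Longrightarrow> Cinf_on S g \<Longrightarrow> Cinf_on S (\<lambda>x. f x + g x)"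
  unfolding Cinf_on_def by (simp add: Ck_on_add)

lemma Cinf_on_bilinear:
  "bounded_bilinear p \<Longrightarrow> open S \<Longrightarrow> Cinf_on S f \<Longrightarrow> Cinf_on S g \<Longrightarrow> Cinf_on S (\<lambda>x. p (f x) (g x))"
  unfolding Cinf_on_def by (simp add: Ck_on_bilinear)

lemma Cinf_on_compose:
  fixes f :: "'a::real_normed_vector \<Rightarrow> 'b::euclidean_space"
  shows "open S \<Longrightarrow> f ` S \<subseteq> T \<Longrightarrow> Cinf_on S f \<Longrightarrow> Cinf_on T g \<Longrightarrow> Cinf_on S (\<lambda>x. g (f x))"
  unfolding Cinf_on_def using Ck_on_compose[of S f T _ g] by blast

lemma Cinf_on_inverse:
  fixes f :: "'a::real_normed_vector \<Rightarrow> 'k::real_normed_div_algebra"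
  shows "open S \<Longrightarrow> Cinf_on S f \<Longrightarrow> (\<And>x. x \<in> S \<Longrightarrow> f x \<noteq> 0) \<Longrightarrow> Cinf_on S (\<lambda>x. inverse (f x))"
  unfolding Cinf_on_def by (simp add: Ck_on_inverse)

lemma Cinf_on_local:
  assumes "\<And>x. x \<in> S \<Longrightarrow> \<exists>T. open T \<and> x \<in> T \<and> Cinf_on T f"
  shows "Cinf_on S f" using Ck_on_local assms unfolding Cinf_on_def by metis

text \<open>Complements \<open>Cinf_on_compose\<close> where the values of \<open>f\<close> lie in a
  space that is only normed. The derivative of the composite is again \<open>h\<close> after a
  derivative of \<open>f\<close>, so the induction must run over all smooth \<open>f\<close> at
  once.\<close>

lemma Cinf_on_bounded_linear_compose:
  assumes "bounded_linear h" "open S" "Cinf_on S f"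
  shows "Cinf_on S (\<lambda>x. h (f x))" unfolding Cinf_on_def
proof
  fix k
  show "Ck_on k (\<lambda>x. h (f x)) S" using assms(3)
  proof (induction k arbitrary: f)
    case 0
    then show ?case using bounded_linear.continuous_on[OF assms(1) Cinf_on_continuous] by simp
  next
    case (Suc k)
    have D: "((\<lambda>x. h (f x)) has_derivative (\<lambda>v. h (frechet_derivative f (at x) v))) (at x)" if "x \<in> S" for x
      using Cinf_on_differentiable[OF Suc.prems that]
      by (intro bounded_linear.has_derivative[OF assms(1)]) (auto simp: frechet_derivative_works[symmetric])
    have "Ck_on k (\<lambda>x. frechet_derivative (\<lambda>x. h (f x)) (at x) v) S" for v
      by (rule Ck_on_cong[OF \<open>open S\<close> _ Suc.IH[OF Cinf_on_derivative[OF Suc.prems]]])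
        (use frechet_derivative_eqI[OF D] in auto)
    then show ?case using D by (auto simp: differentiable_def)
  qed
qed

lemma Cinf_on_uminus: "open S \<Longrightarrow> Cinf_on S f \<Longrightarrow> Cinf_on S (\<lambda>x. - f x)"
  by (rule Cinf_on_bounded_linear_compose[OF bounded_linear_minus[OF bounded_linear_ident]])

lemma Cinf_on_diff: "open S \<Longrightarrow> Cinf_on S f \<Longrightarrow> Cinf_on S g \<Longrightarrow> Cinf_on S (\<lambda>x. f x - g x)"
  using Cinf_on_add[of S f "\<lambda>x. - g x"] Cinf_on_uminus[of S g] by simp

text \<open>Replacing one coordinate by a function whose partial derivative in that direction is nonzero has an
  explicitly invertible derivative, so that smoothness of the inverse is bootstrapped from its formula.\<close>

lemma exchange_coordinate:
  fixes f :: "'a::euclidean_space \<Rightarrow> real"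
  assumes "open S" "x0 \<in> S" "Cinf_on S f" and b: "b \<in> Basis"
    and nz: "frechet_derivative f (at x0) b \<noteq> 0"
  defines "F \<equiv> (\<lambda>x. x + (f x - x \<bullet> b) *\<^sub>R b)"
  obtains V W g where "open V" "V \<subseteq> S" "x0 \<in> V" "open W" "homeomorphism V W F g"
    "Cinf_on V F" "Cinf_on W g"
proof -
  define df where "df = (\<lambda>x. frechet_derivative f (at x))"
  have df: "(f has_derivative df x) (at x)" if "x \<in> S" for x
    using Cinf_on_differentiable[OF assms(3) that] unfolding df_def by (simp add: frechet_derivative_works[symmetric])
  have cdf: "continuous_on S (\<lambda>x. df x v)" for v using Cinf_on_continuous[OF Cinf_on_derivative[OF assms(3)]] unfolding df_def .
  define U where "U = {x \<in> S. df x b \<noteq> 0}"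
  have "open U"
  proof -
    have "U = S \<inter> (\<lambda>x. df x b) -` (- {0})" unfolding U_def by auto
    then show ?thesis using continuous_open_preimage[OF cdf[of b] \<open>open S\<close> open_Compl[OF closed_singleton]] by simp
  qed
  have "x0 \<in> U" using assms unfolding U_def df_def by simp
  have US: "U \<subseteq> S" unfolding U_def by auto
  \<comment> \<open>\<open>L x\<close> is the derivative of \<open>F\<close> at \<open>x\<close>: it
    replaces the component of \<open>v\<close> along \<open>b\<close> by \<open>df x v\<close>.
    Solving for that component needs one division by \<open>df x b\<close> and gives the inverse
    \<open>R x\<close>.\<close>
  define L where "L = (\<lambda>x v. v + (df x v - v \<bullet> b) *\<^sub>R b)"
  define R where "R = (\<lambda>x w. w + ((w \<bullet> b - df x (w - (w \<bullet> b) *\<^sub>R b)) / df x b - w \<bullet> b) *\<^sub>R b)"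
  have bl: "bounded_linear (df x)" if "x \<in> S" for x using df[OF that] has_derivative_bounded_linear by blast
  have blL: "bounded_linear (L x)" if "x \<in> S" for x unfolding L_def
    by (intro bounded_linear_add bounded_linear_ident bounded_linear_compose[OF bounded_linear_scaleR_left]
        bounded_linear_sub bl[OF that] bounded_linear_inner_left)
  have blR: "bounded_linear (R x)" if "x \<in> S" for x unfolding R_def
    by (intro bounded_linear_add bounded_linear_ident bounded_linear_compose[OF bounded_linear_scaleR_left]
        bounded_linear_sub bounded_linear_compose[OF bl[OF that]] bounded_linear_inner_left
        bounded_linear_compose[OF bounded_linear_divide])
  have bb: "b \<bullet> b = 1" using b by simp
  have dflin: "df x (v - c *\<^sub>R b) = df x v - c * df x b" if "x \<in> S" for x v c
  proof -
    interpret bounded_linear "df x" using bl[OF that] .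
    show ?thesis by (simp add: diff scaleR)
  qed
  have RL: "R x (L x v) = v" if "x \<in> U" for x v
  proof -
    have xS: "x \<in> S" and nz': "df x b \<noteq> 0" using that unfolding U_def by auto
    have i: "L x v \<bullet> b = df x v" unfolding L_def using bb by (simp add: inner_add_left)
    have "L x v - df x v *\<^sub>R b = v - (v \<bullet> b) *\<^sub>R b" unfolding L_def by (simp add: algebra_simps)
    then have "df x (L x v - df x v *\<^sub>R b) = df x v - (v \<bullet> b) * df x b" using dflin[OF xS] by simp
    then have "R x (L x v) = L x v + (((df x v - (df x v - (v \<bullet> b) * df x b)) / df x b) - df x v) *\<^sub>R b"
      unfolding R_def i by simp
    also have "\<dots> = v" unfolding L_def using nz' by (simp add: algebra_simps)
    finally show ?thesis .
  qed
  have LR: "L x (R x w) = w" if "x \<in> U" for x w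
  proof -
    have xS: "x \<in> S" and nz': "df x b \<noteq> 0" using that unfolding U_def by auto
    interpret bounded_linear "df x" using bl[OF xS] .
    define t where "t = (w \<bullet> b - df x (w - (w \<bullet> b) *\<^sub>R b)) / df x b"
    have R: "R x w = w + (t - w \<bullet> b) *\<^sub>R b" unfolding R_def t_def by simp
    have "df x (R x w) = w \<bullet> b" unfolding R add scaleR t_def diff using nz' by (simp add: field_simps)
    moreover have "R x w \<bullet> b = t" unfolding R using bb by (simp add: inner_add_left)
    ultimately have "L x (R x w) = R x w + (w \<bullet> b - t) *\<^sub>R b" unfolding L_def by simp
    then show ?thesis unfolding R by (simp add: algebra_simps)
  qed
  have blR0: "bounded_linear (R x0)" using blR \<open>x0 \<in> U\<close> US by auto
  have DF: "(F has_derivative blinfun_apply (Blinfun (L x))) (at x)" if "x \<in> U" for x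
  proof -
    have "(F has_derivative L x) (at x)" unfolding F_def L_def by (rule derivative_eq_intros df[of x] refl | use that US in force)+
    then show ?thesis using blL that US by (simp add: bounded_linear_Blinfun_apply subset_iff)
  qed
  have cont: "continuous_on U (\<lambda>x. Blinfun (L x))"
  proof (rule continuous_on_blinfun_componentwise)
    fix i :: 'a
    have "continuous_on U (\<lambda>x. L x i)" unfolding L_def by (intro continuous_intros continuous_on_subset[OF cdf US])
    then show "continuous_on U (\<lambda>x. blinfun_apply (Blinfun (L x)) i)"
      by (rule continuous_on_eq) (use blL US in \<open>auto simp: bounded_linear_Blinfun_apply subset_iff\<close>)
  qed
  have RL0: "Blinfun (R x0) o\<^sub>L Blinfun (L x0) = id_blinfun"
    by (rule blinfun_eqI) (use RL \<open>x0 \<in> U\<close> US in \<open>auto simp: bounded_linear_Blinfun_apply blL blR subset_iff\<close>)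
  obtain V W g g' where V: "open V" "V \<subseteq> U" "x0 \<in> V" "open W" "homeomorphism V W F g"
    and g: "\<And>y. y \<in> W \<Longrightarrow> (g has_derivative (g' y)) (at y)"
    and g': "\<And>y. y \<in> W \<Longrightarrow> g' y = inv_into UNIV (blinfun_apply (Blinfun (L (g y))))"
    by (rule inverse_function_theorem[OF \<open>open U\<close> DF cont \<open>x0 \<in> U\<close> RL0]) (assumption, rule that)
  have gV: "g y \<in> V" if "y \<in> W" for y using V(5) that unfolding homeomorphism_def by blast
  have g'R: "g' y = R (g y)" if "y \<in> W" for y
  proof -
    have gU: "g y \<in> U" using gV that V by auto
    then have "blinfun_apply (Blinfun (L (g y))) = L (g y)" using blL US by (simp add: bounded_linear_Blinfun_apply subset_iff)
    then show ?thesis unfolding g'[OF that] using inv_equality[of "R (g y)" "L (g y)"] RL[OF gU] LR[OF gU] by simp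
  qed
  have smF: "Cinf_on V F" unfolding F_def
    by (intro Cinf_on_add \<open>open V\<close> Cinf_on_ident Cinf_on_bilinear[OF bounded_bilinear_scaleR] Cinf_on_diff
        Cinf_on_const Cinf_on_bilinear[OF bounded_bilinear_inner] Cinf_on_subset[OF assms(3)]) (use V US in auto)
  have "Ck_on k g W" for k
  proof (induction k)
    case 0
    show ?case using V(5) by (simp add: homeomorphism_def)
  next
    case (Suc k)
    have "Ck_on k (\<lambda>y. df (g y) v) W" for v using Cinf_on_derivative[OF assms(3), of v] V US gV unfolding Cinf_on_def df_def
      by (intro Ck_on_compose[OF \<open>open W\<close> _ Suc.IH, where T = S and g = "\<lambda>y. frechet_derivative f (at y) v"])
         auto
    note dfg = this
    have "Ck_on k (\<lambda>y. R (g y) w) W" for w unfolding R_def divide_inverse diff_conv_add_uminus mult_minus_left[symmetric]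
      using V gV U_def by (intro Ck_on_add Ck_on_const \<open>open W\<close> Ck_on_bilinear[OF bounded_bilinear_scaleR]
        Ck_on_bilinear[OF bounded_bilinear_mult] Ck_on_inverse dfg
        Ck_on_compose[OF \<open>open W\<close> subset_UNIV _ Ck_on_bounded_linear[OF bounded_linear_minus[OF bounded_linear_ident]]]) auto
    moreover have "frechet_derivative g (at y) w = R (g y) w" if "y \<in> W" for y w
      using frechet_derivative_eqI[OF g[OF that]] g'R[OF that] by simp
    ultimately have "Ck_on k (\<lambda>y. frechet_derivative g (at y) w) W" for w
      using Ck_on_cong[OF \<open>open W\<close>, of "\<lambda>y. R (g y) w"] by simp
    then show ?case using g by (auto simp: differentiable_def)
  qed
  then have "Cinf_on W g" unfolding Cinf_on_def by simp
  then show thesis using that V smF US by blast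
qed

section \<open>Charts and smooth functions on manifolds\<close>

text \<open>A continuous open injection is a homeomorphism onto its image. Testing openness in the
  ambient spaces removes the subtopologies from all later arguments about charts.\<close>

lemma top_chart_iff:
  "top_chart X V \<phi> \<longleftrightarrow> opn X V \<and> inj_on \<phi> V \<and>
     (\<forall>W. opn X W \<and> W \<subseteq> V \<longrightarrow> open (\<phi> ` W)) \<and>
     (\<forall>A. open A \<longrightarrow> opn X {q \<in> V. \<phi> q \<in> A})"
proof
  assume L: "top_chart X V \<phi>"
  then have V: "opn X V" and o: "open (\<phi> ` V)"
    and h: "homeomorphic_map (subtopology (mtop X) V) (top_of_set (\<phi> ` V)) \<phi>" unfolding top_chart_def by auto
  have ts: "topspace (subtopology (mtop X) V) = V" using openin_subset[OF V] by auto
  have "open (\<phi> ` W)" if W: "opn X W" "W \<subseteq> V" for W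
  proof -
    have "openin (subtopology (mtop X) V) W" using W V by (simp add: openin_open_subtopology)
    then have "openin (top_of_set (\<phi> ` V)) (\<phi> ` W)" using homeomorphic_imp_open_map[OF h] unfolding open_map_def by blast
    then show ?thesis using o openin_open_trans by blast
  qed
  moreover have "opn X {q \<in> V. \<phi> q \<in> A}" if "open A" for A
  proof -
    have "openin (top_of_set (\<phi> ` V)) (\<phi> ` V \<inter> A)" using that by auto
    then have "openin (subtopology (mtop X) V) {q \<in> topspace (subtopology (mtop X) V). \<phi> q \<in> \<phi> ` V \<inter> A}"
      using openin_continuous_map_preimage[OF homeomorphic_imp_continuous_map[OF h]] by blast
    moreover have "{q \<in> topspace (subtopology (mtop X) V). \<phi> q \<in> \<phi> ` V \<inter> A} = {q \<in> V. \<phi> q \<in> A}"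
      using ts by auto
    ultimately show ?thesis using V by (simp add: openin_open_subtopology)
  qed
  ultimately show "opn X V \<and> inj_on \<phi> V \<and>
     (\<forall>W. opn X W \<and> W \<subseteq> V \<longrightarrow> open (\<phi> ` W)) \<and>
     (\<forall>A. open A \<longrightarrow> opn X {q \<in> V. \<phi> q \<in> A})" using V homeomorphic_imp_injective_map[OF h] ts by auto
next
  assume R: "opn X V \<and> inj_on \<phi> V \<and>
     (\<forall>W. opn X W \<and> W \<subseteq> V \<longrightarrow> open (\<phi> ` W)) \<and>
     (\<forall>A. open A \<longrightarrow> opn X {q \<in> V. \<phi> q \<in> A})"
  then have V: "opn X V" by auto
  have ts: "topspace (subtopology (mtop X) V) = V" using openin_subset[OF V] by auto
  have "homeomorphic_map (subtopology (mtop X) V) (top_of_set (\<phi> ` V)) \<phi>"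
  proof (rule bijective_open_imp_homeomorphic_map)
    show "continuous_map (subtopology (mtop X) V) (top_of_set (\<phi> ` V)) \<phi>" unfolding continuous_map_def ts
    proof (intro conjI allI impI)
      fix A assume "openin (top_of_set (\<phi> ` V)) A"
      then obtain A' where A': "open A'" "A = \<phi> ` V \<inter> A'" by (auto simp: openin_open)
      have "{q \<in> V. \<phi> q \<in> A} = {q \<in> V. \<phi> q \<in> A'}" using A' by auto
      then show "openin (subtopology (mtop X) V) {q \<in> V. \<phi> q \<in> A}" using R A' by (simp add: openin_open_subtopology)
    qed auto
    show "open_map (subtopology (mtop X) V) (top_of_set (\<phi> ` V)) \<phi>" unfolding open_map_def
    proof (intro allI impI)
      fix W assume "openin (subtopology (mtop X) V) W"
      then have "opn X W" "W \<subseteq> V" using V by (auto simp: openin_open_subtopology)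
      then have "open (\<phi> ` W)" using R by blast
      then show "openin (top_of_set (\<phi> ` V)) (\<phi> ` W)"
        using \<open>W \<subseteq> V\<close> by (metis image_mono openin_open inf.absorb2)
    qed
  qed (use ts R in auto)
  then show "top_chart X V \<phi>" unfolding top_chart_def using R by blast
qed

lemma chartD:
  assumes "chart X V \<phi>"
  shows "opn X V" "V \<subseteq> pts X" "inj_on \<phi> V"
    "\<And>q. q \<in> V \<Longrightarrow> inv_into V \<phi> (\<phi> q) = q"
    "\<And>U. opn X U \<Longrightarrow> open (\<phi> ` (U \<inter> V))"
    "\<And>U. opn X U \<Longrightarrow> U \<subseteq> V \<Longrightarrow> open (\<phi> ` U)"
    "open (\<phi> ` V)"
    "\<And>A. open A \<Longrightarrow> opn X {q \<in> V. \<phi> q \<in> A}"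
  using assms openin_subset[of "mtop X" V] unfolding chart_def top_chart_iff by auto

lemma chart_atlas: "smooth_mfd X \<Longrightarrow> (V, \<phi>) \<in> atlas X \<Longrightarrow> chart X V \<phi>"
  unfolding smooth_mfd_def chart_def by fast

lemma ex_atlas_chart:
  assumes "smooth_mfd X" "p \<in> pts X"
  obtains V \<phi> where "(V, \<phi>) \<in> atlas X" "p \<in> V"
proof -
  have "p \<in> \<Union> (fst ` atlas X)" using assms unfolding smooth_mfd_def by simp
  then show thesis using that by auto
qed

lemma ex_chart:
  assumes "smooth_mfd X" "p \<in> pts X"
  obtains V \<phi> where "chart X V \<phi>" "p \<in> V" by (rule ex_atlas_chart[OF assms]) (rule that[OF chart_atlas[OF assms(1)]])

text \<open>Charts of the maximal atlas are by definition compatible only with the charts of the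
  given atlas, so near each point the transition is factored through an atlas chart. The inner
  intersection with \<open>A\<close> makes the factorisation literal.\<close>

lemma chart_compatible:
  assumes X: "smooth_mfd X" and c: "chart X V \<phi>" "chart X W \<psi>"
  shows "Cinf_on (\<phi> ` (V \<inter> W)) (\<psi> \<circ> inv_into V \<phi>)"
proof (rule Cinf_on_local)
  fix x assume "x \<in> \<phi> ` (V \<inter> W)"
  then obtain q where q: "q \<in> V" "q \<in> W" "x = \<phi> q" by auto
  then obtain A \<alpha> where A: "(A, \<alpha>) \<in> atlas X" "q \<in> A" using ex_atlas_chart[OF X] chartD(2)[OF c(1)] by blast
  have cA: "chart X A \<alpha>" using chart_atlas[OF X A(1)] .
  let ?T = "\<phi> ` (V \<inter> W \<inter> A)"
  have o: "open ?T" using chartD(6)[OF c(1), of "V \<inter> W \<inter> A"] chartD(1)[OF c(1)] chartD(1)[OF c(2)] chartD(1)[OF cA] by auto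
  have c1: "Cinf_on (\<phi> ` (V \<inter> A)) (\<alpha> \<circ> inv_into V \<phi>)"
    and c2: "Cinf_on (\<alpha> ` (W \<inter> A)) (\<psi> \<circ> inv_into A \<alpha>)"
    using c A unfolding chart_def compatible_def by fast+
  have s1: "(\<alpha> \<circ> inv_into V \<phi>) ` ?T \<subseteq> \<alpha> ` (W \<inter> A)" by (auto simp: chartD(4)[OF c(1)])
  have s2: "Cinf_on ?T (\<alpha> \<circ> inv_into V \<phi>)" by (rule Cinf_on_subset[OF c1]) auto
  have "Cinf_on ?T (\<lambda>x. (\<psi> \<circ> inv_into A \<alpha>) ((\<alpha> \<circ> inv_into V \<phi>) x))"
    by (rule Cinf_on_compose[OF o s1 s2 c2])
  then have "Cinf_on ?T (\<psi> \<circ> inv_into V \<phi>)"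
    by (rule Cinf_on_cong[OF o, rotated]) (auto simp: chartD(4)[OF c(1)] chartD(4)[OF cA])
  then show "\<exists>T. open T \<and> x \<in> T \<and> Cinf_on T (\<psi> \<circ> inv_into V \<phi>)" using o q A by blast
qed

lemma chart_restrict:
  assumes "smooth_mfd X" "chart X V \<phi>" "opn X U"
  shows "chart X (V \<inter> U) \<phi>"
proof -
  have e: "inv_into (V \<inter> U) \<phi> (\<phi> q) = q" if "q \<in> V \<inter> U" for q
    using that chartD(3)[OF assms(2)] by (meson inf_le1 inj_on_subset inv_into_f_f)
  have tc: "top_chart X (V \<inter> U) \<phi>" unfolding top_chart_iff
  proof (intro conjI allI impI)
    show "opn X (V \<inter> U)" using assms chartD(1) by blast
    show "inj_on \<phi> (V \<inter> U)" using chartD(3)[OF assms(2)] by (meson inf_le1 inj_on_subset)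
    fix A :: "'b set" assume "open A"
    then have "opn X ({q \<in> V. \<phi> q \<in> A} \<inter> U)" using chartD(8)[OF assms(2)] assms(3) by blast
    moreover have "{q \<in> V \<inter> U. \<phi> q \<in> A} = {q \<in> V. \<phi> q \<in> A} \<inter> U" by auto
    ultimately show "opn X {q \<in> V \<inter> U. \<phi> q \<in> A}" by simp
  qed (use chartD(6)[OF assms(2)] in auto)
  have "compatible (V \<inter> U) \<phi> W \<psi>" if "(W, \<psi>) \<in> atlas X" for W \<psi>
  proof -
    have c: "Cinf_on (\<phi> ` (V \<inter> W)) (\<psi> \<circ> inv_into V \<phi>)" "Cinf_on (\<psi> ` (V \<inter> W)) (\<phi> \<circ> inv_into W \<psi>)"
      using assms that unfolding chart_def compatible_def by fast+
    show ?thesis unfolding compatible_def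
    proof
      show "Cinf_on (\<psi> ` (V \<inter> U \<inter> W)) (\<phi> \<circ> inv_into W \<psi>)" using c(2) by (rule Cinf_on_subset) auto
      have cs: "Cinf_on (\<phi> ` (V \<inter> U \<inter> W)) (\<psi> \<circ> inv_into V \<phi>)" using c(1) by (rule Cinf_on_subset) auto
      show "Cinf_on (\<phi> ` (V \<inter> U \<inter> W)) (\<psi> \<circ> inv_into (V \<inter> U) \<phi>)"
      proof -
        have o: "open (\<phi> ` (V \<inter> U \<inter> W))"
          using chartD(6)[OF assms(2), of "V \<inter> U \<inter> W"] chartD(1)[OF chart_atlas[OF assms(1) that]] assms(3)
            chartD(1)[OF assms(2)] by auto
        show ?thesis by (rule Cinf_on_cong[OF o _ cs]) (auto simp: e chartD(4)[OF assms(2)])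
      qed
    qed
  qed
  then show ?thesis using tc unfolding chart_def by blast
qed

text \<open>The way in which new charts are produced: a diffeomorphism of the image, given by
  \<open>F\<close> and its left inverse \<open>G\<close>, is composed with a known chart.
  Translations, coordinate exchanges and the charts of \<G> all pass through it.\<close>

lemma chart_transform:
  fixes X :: "('p, 'e::euclidean_space) mfd"
  assumes X: "smooth_mfd X" and c: "chart X V \<phi>"
    and F: "Cinf_on (\<phi> ` V) F" and oR: "open (F ` \<phi> ` V)" and G: "Cinf_on (F ` \<phi> ` V) G"
    and GF: "\<And>x. x \<in> \<phi> ` V \<Longrightarrow> G (F x) = x"
  shows "chart X V (F \<circ> \<phi>)"
proof -
  have oV: "open (\<phi> ` V)" using chartD(7)[OF c] .
  have inj: "inj_on (F \<circ> \<phi>) V" using GF chartD(3)[OF c] by (auto simp: inj_on_def) (metis image_eqI)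
  have contF: "continuous_on (\<phi> ` V) F" and contG: "continuous_on (F ` \<phi> ` V) G" using F G Cinf_on_continuous by auto
  have tc: "top_chart X V (F \<circ> \<phi>)" unfolding top_chart_iff
  proof (intro conjI allI impI)
    show "opn X V" using chartD(1)[OF c] .
    show "inj_on (F \<circ> \<phi>) V" by fact
    fix W assume W: "opn X W \<and> W \<subseteq> V"
    have o: "open (\<phi> ` W)" using chartD(6)[OF c] W by blast
    have "(F \<circ> \<phi>) ` W = (F ` \<phi> ` V) \<inter> G -` (\<phi> ` W)"
    proof (intro equalityI subsetI)
      fix y assume "y \<in> (F \<circ> \<phi>) ` W"
      then show "y \<in> (F ` \<phi> ` V) \<inter> G -` (\<phi> ` W)" using W GF by auto
    next
      fix y assume "y \<in> (F ` \<phi> ` V) \<inter> G -` (\<phi> ` W)"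
      then obtain v w where "v \<in> V" "y = F (\<phi> v)" "w \<in> W" "G y = \<phi> w" by auto
      then have "\<phi> v = \<phi> w" using GF by auto
      then show "y \<in> (F \<circ> \<phi>) ` W" using \<open>w \<in> W\<close> \<open>y = F (\<phi> v)\<close> by auto
    qed
    then show "open ((F \<circ> \<phi>) ` W)" using continuous_open_preimage[OF contG oR o] by simp
  next
    fix A :: "'e set" assume "open A"
    then have "open (\<phi> ` V \<inter> F -` A)" using continuous_open_preimage[OF contF oV] by blast
    from chartD(8)[OF c this] show "opn X {q \<in> V. (F \<circ> \<phi>) q \<in> A}" by (rule back_subst[of "opn X"]) auto
  qed
  have "compatible V (F \<circ> \<phi>) W \<psi>" if W: "(W, \<psi>) \<in> atlas X" for W \<psi>
  proof -
    have cW: "chart X W \<psi>" using chart_atlas[OF X W] .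
    have oW: "opn X (V \<inter> W)" using chartD(1)[OF c] chartD(1)[OF cW] by blast
    have o1: "open ((F \<circ> \<phi>) ` (V \<inter> W))" using tc oW unfolding top_chart_iff by blast
    have o2: "open (\<psi> ` (V \<inter> W))" using chartD(6)[OF cW oW] by blast
    have inv: "inv_into V (F \<circ> \<phi>) (F (\<phi> q)) = q" if "q \<in> V" for q using inv_into_f_f[OF inj that] by simp
    have "Cinf_on ((F \<circ> \<phi>) ` (V \<inter> W)) (\<lambda>x. (\<psi> \<circ> inv_into V \<phi>) (G x))"
    proof (rule Cinf_on_compose[OF o1 _ _ chart_compatible[OF X c cW]])
      show "G ` (F \<circ> \<phi>) ` (V \<inter> W) \<subseteq> \<phi> ` (V \<inter> W)" using GF by auto
      show "Cinf_on ((F \<circ> \<phi>) ` (V \<inter> W)) G" by (rule Cinf_on_subset[OF G]) auto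
    qed
    then have 1: "Cinf_on ((F \<circ> \<phi>) ` (V \<inter> W)) (\<psi> \<circ> inv_into V (F \<circ> \<phi>))"
      by (rule Cinf_on_cong[OF o1, rotated]) (auto simp: inv GF chartD(4)[OF c])
    have "Cinf_on (\<psi> ` (V \<inter> W)) (\<lambda>x. F ((\<phi> \<circ> inv_into W \<psi>) x))"
    proof (rule Cinf_on_compose[OF o2 _ _ F])
      show "Cinf_on (\<psi> ` (V \<inter> W)) (\<phi> \<circ> inv_into W \<psi>)"
        using chart_compatible[OF X cW c] by (simp add: Int_commute)
    qed (auto simp: chartD(4)[OF cW])
    then have "Cinf_on (\<psi> ` (V \<inter> W)) (F \<circ> \<phi> \<circ> inv_into W \<psi>)" by (simp add: comp_def)
    then show ?thesis using 1 unfolding compatible_def by simp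
  qed
  then show ?thesis using tc unfolding chart_def by blast
qed

lemma chart_translate:
  assumes "smooth_mfd X" "chart X V \<phi>"
  shows "chart X V (\<lambda>q. \<phi> q - c)"
proof -
  have "open ((\<lambda>x. x - c) ` \<phi> ` V)" using open_translation_subtract chartD(7)[OF assms(2)] by blast
  then have "chart X V ((\<lambda>x. x - c) \<circ> \<phi>)"
    by (intro chart_transform[OF assms, where G = "\<lambda>x. x - (- c)"] Cinf_on_diff chartD(7)[OF assms(2)]) auto
  then show ?thesis by (simp add: comp_def)
qed

lemma smooth_funs_chart:
  assumes X: "smooth_mfd X" and f: "f \<in> smooth_funs X U" and U: "opn X U" and c: "chart X V \<phi>"
  shows "Cinf_on (\<phi> ` (U \<inter> V)) (f \<circ> inv_into V \<phi>)"
proof (rule Cinf_on_local)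
  fix x assume "x \<in> \<phi> ` (U \<inter> V)"
  then obtain q where q: "q \<in> U" "q \<in> V" "x = \<phi> q" by auto
  then obtain A \<alpha> where A: "(A, \<alpha>) \<in> atlas X" "q \<in> A" using ex_atlas_chart[OF X] chartD(2)[OF c] by blast
  have cA: "chart X A \<alpha>" using chart_atlas[OF X A(1)] .
  let ?T = "\<phi> ` (V \<inter> U \<inter> A)"
  have o: "open ?T" using chartD(6)[OF c, of "V \<inter> U \<inter> A"] chartD(1)[OF c] chartD(1)[OF cA] U by auto
  have c1: "Cinf_on (\<phi> ` (V \<inter> A)) (\<alpha> \<circ> inv_into V \<phi>)" using c A unfolding chart_def compatible_def by fast
  have c2: "Cinf_on (\<alpha> ` (U \<inter> A)) (f \<circ> inv_into A \<alpha>)" using f A unfolding smooth_funs_def by blast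
  have s1: "(\<alpha> \<circ> inv_into V \<phi>) ` ?T \<subseteq> \<alpha> ` (U \<inter> A)" by (auto simp: chartD(4)[OF c])
  have s2: "Cinf_on ?T (\<alpha> \<circ> inv_into V \<phi>)" by (rule Cinf_on_subset[OF c1]) auto
  have "Cinf_on ?T (\<lambda>x. (f \<circ> inv_into A \<alpha>) ((\<alpha> \<circ> inv_into V \<phi>) x))"
    by (rule Cinf_on_compose[OF o s1 s2 c2])
  then have "Cinf_on ?T (f \<circ> inv_into V \<phi>)" by (rule Cinf_on_cong[OF o, rotated]) (auto simp: chartD(4)[OF c] chartD(4)[OF cA])
  then show "\<exists>T. open T \<and> x \<in> T \<and> Cinf_on T (f \<circ> inv_into V \<phi>)" using o q A by blast
qed

lemma smooth_funs_subset: "f \<in> smooth_funs X U \<Longrightarrow> W \<subseteq> U \<Longrightarrow> f \<in> smooth_funs X W"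
  unfolding smooth_funs_def by (fastforce elim: Cinf_on_subset)

lemma smooth_funs_local:
  assumes X: "smooth_mfd X"
    and "\<And>p. p \<in> U \<Longrightarrow> \<exists>W. opn X W \<and> p \<in> W \<and> f \<in> smooth_funs X W"
  shows "f \<in> smooth_funs X U" unfolding smooth_funs_def
proof (clarify, rule Cinf_on_local)
  fix V \<phi> x assume V: "(V, \<phi>) \<in> atlas X" and "x \<in> \<phi> ` (U \<inter> V)"
  then obtain q where q: "q \<in> U" "q \<in> V" "x = \<phi> q" by auto
  then obtain W where W: "opn X W" "q \<in> W" "f \<in> smooth_funs X W" using assms(2) by blast
  have "Cinf_on (\<phi> ` (W \<inter> V)) (f \<circ> inv_into V \<phi>)" using W V unfolding smooth_funs_def by blast
  moreover have "open (\<phi> ` (W \<inter> V))" using chartD(5)[OF chart_atlas[OF X V]] W by blast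
  ultimately show "\<exists>T. open T \<and> x \<in> T \<and> Cinf_on T (f \<circ> inv_into V \<phi>)" using q W by blast
qed

lemma smooth_funs_in_chart:
  assumes X: "smooth_mfd X" and c: "chart X V \<phi>" and U: "opn X U" "U \<subseteq> V"
    and f: "Cinf_on (\<phi> ` U) (f \<circ> inv_into V \<phi>)"
  shows "f \<in> smooth_funs X U" unfolding smooth_funs_def
proof clarify
  fix W \<psi> assume W: "(W, \<psi>) \<in> atlas X"
  have cW: "chart X W \<psi>" using chart_atlas[OF X W] .
  have o: "open (\<psi> ` (U \<inter> W))" using chartD(5)[OF cW U(1)] .
  have "Cinf_on (\<psi> ` (U \<inter> W)) (\<lambda>x. (f \<circ> inv_into V \<phi>) ((\<phi> \<circ> inv_into W \<psi>) x))"
  proof (rule Cinf_on_compose[OF o _ _ f])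
    show "(\<phi> \<circ> inv_into W \<psi>) ` \<psi> ` (U \<inter> W) \<subseteq> \<phi> ` U" by (auto simp: chartD(4)[OF cW])
    show "Cinf_on (\<psi> ` (U \<inter> W)) (\<phi> \<circ> inv_into W \<psi>)"
      by (rule Cinf_on_subset[OF chart_compatible[OF X cW c]]) (use U in auto)
  qed
  then show "Cinf_on (\<psi> ` (U \<inter> W)) (f \<circ> inv_into W \<psi>)"
    by (rule Cinf_on_cong[OF o, rotated]) (use U in \<open>auto simp: chartD(4)[OF cW] chartD(4)[OF c] subset_iff\<close>)
qed

lemma smooth_funs_chart_map: "chart X V \<phi> \<Longrightarrow> \<phi> \<in> smooth_funs X V"
  unfolding smooth_funs_def chart_def compatible_def by fast

lemma smooth_funs_post_compose:
  fixes X :: "('p, 'e::euclidean_space) mfd" and f :: "'p \<Rightarrow> 'f::euclidean_space"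
  assumes X: "smooth_mfd X" and U: "opn X U" and f: "f \<in> smooth_funs X U"
    and "f ` U \<subseteq> T" "Cinf_on T g"
  shows "(\<lambda>x. g (f x)) \<in> smooth_funs X U" unfolding smooth_funs_def
proof clarify
  fix V \<phi> assume V: "(V, \<phi>) \<in> atlas X"
  have cV: "chart X V \<phi>" using chart_atlas[OF X V] .
  have "Cinf_on (\<phi> ` (U \<inter> V)) (\<lambda>x. g ((f \<circ> inv_into V \<phi>) x))"
    by (rule Cinf_on_compose[OF chartD(5)[OF cV U] _ smooth_funs_chart[OF X f U cV] assms(5)])
      (use assms(4) in \<open>auto simp: chartD(4)[OF cV]\<close>)
  then show "Cinf_on (\<phi> ` (U \<inter> V)) ((\<lambda>x. g (f x)) \<circ> inv_into V \<phi>)" by (simp add: comp_def)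
qed

lemma smooth_funs_cong:
  assumes X: "smooth_mfd X" and U: "opn X U" and f: "f \<in> smooth_funs X U"
    and "\<And>x. x \<in> U \<Longrightarrow> g x = f x"
  shows "g \<in> smooth_funs X U" unfolding smooth_funs_def
proof clarify
  fix V \<phi> assume V: "(V, \<phi>) \<in> atlas X"
  have cV: "chart X V \<phi>" using chart_atlas[OF X V] .
  show "Cinf_on (\<phi> ` (U \<inter> V)) (g \<circ> inv_into V \<phi>)"
    by (rule Cinf_on_cong[OF chartD(5)[OF cV U] _ smooth_funs_chart[OF X f U cV]])
      (use assms(4) in \<open>auto simp: chartD(4)[OF cV]\<close>)
qed

lemma smooth_funs_const: "(\<lambda>_. c) \<in> smooth_funs X U" unfolding smooth_funs_def comp_def by simp

lemma smooth_funs_bilinear: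
  assumes "bounded_bilinear b" and X: "smooth_mfd X" and U: "opn X U"
    and "f \<in> smooth_funs X U" "g \<in> smooth_funs X U"
  shows "(\<lambda>x. b (f x) (g x)) \<in> smooth_funs X U"
proof -
  have "Cinf_on (\<phi> ` (U \<inter> V)) (\<lambda>x. b ((f \<circ> inv_into V \<phi>) x) ((g \<circ> inv_into V \<phi>) x))"
    if V: "(V, \<phi>) \<in> atlas X" for V \<phi>
  proof -
    have cV: "chart X V \<phi>" using chart_atlas[OF X V] .
    show ?thesis by (intro Cinf_on_bilinear[OF assms(1)] chartD(5)[OF cV U]
          smooth_funs_chart[OF X _ U cV] assms)
  qed
  then show ?thesis unfolding smooth_funs_def comp_def by blast
qed

lemma smooth_funs_linear:
  assumes "bounded_linear b" and X: "smooth_mfd X" and U: "opn X U" and "f \<in> smooth_funs X U"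
  shows "(\<lambda>x. b (f x)) \<in> smooth_funs X U"
proof -
  have "Cinf_on (\<phi> ` (U \<inter> V)) (\<lambda>x. b ((f \<circ> inv_into V \<phi>) x))"
    if V: "(V, \<phi>) \<in> atlas X" for V \<phi>
  proof -
    have cV: "chart X V \<phi>" using chart_atlas[OF X V] .
    show ?thesis by (intro Cinf_on_bounded_linear_compose[OF assms(1)] chartD(5)[OF cV U]
          smooth_funs_chart[OF X _ U cV] assms)
  qed
  then show ?thesis unfolding smooth_funs_def comp_def by blast
qed

lemma smooth_funs_add:
  assumes X: "smooth_mfd X" and U: "opn X U"
    and "f \<in> smooth_funs X U" "g \<in> smooth_funs X U"
  shows "(\<lambda>x. f x + g x) \<in> smooth_funs X U"
proof -
  have "Cinf_on (\<phi> ` (U \<inter> V)) (\<lambda>x. (f \<circ> inv_into V \<phi>) x + (g \<circ> inv_into V \<phi>) x)"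
    if V: "(V, \<phi>) \<in> atlas X" for V \<phi>
  proof -
    have cV: "chart X V \<phi>" using chart_atlas[OF X V] .
    show ?thesis by (intro Cinf_on_add chartD(5)[OF cV U] smooth_funs_chart[OF X _ U cV] assms)
  qed
  then show ?thesis unfolding smooth_funs_def comp_def by blast
qed

lemma smooth_funs_inverse:
  fixes X :: "('p, 'e::euclidean_space) mfd" and f :: "'p \<Rightarrow> 'k::real_normed_div_algebra"
  assumes X: "smooth_mfd X" and U: "opn X U"
    and "f \<in> smooth_funs X U" "\<And>x. x \<in> U \<Longrightarrow> f x \<noteq> 0"
  shows "(\<lambda>x. inverse (f x)) \<in> smooth_funs X U"
proof -
  have "Cinf_on (\<phi> ` (U \<inter> V)) (\<lambda>x. inverse ((f \<circ> inv_into V \<phi>) x))"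
    if V: "(V, \<phi>) \<in> atlas X" for V \<phi>
  proof -
    have cV: "chart X V \<phi>" using chart_atlas[OF X V] .
    show ?thesis by (intro Cinf_on_inverse chartD(5)[OF cV U] smooth_funs_chart[OF X _ U cV] assms)
        (use assms(4) in \<open>auto simp: chartD(4)[OF cV]\<close>)
  qed
  then show ?thesis unfolding smooth_funs_def comp_def by blast
qed

lemmas smooth_funs_mult = smooth_funs_bilinear[OF bounded_bilinear_mult]

lemma smooth_funs_sum:
  assumes X: "smooth_mfd X" and U: "opn X U" and "\<And>i. i \<in> A \<Longrightarrow> f i \<in> smooth_funs X U"
  shows "(\<lambda>x. \<Sum>i\<in>A. f i x) \<in> smooth_funs X U" using assms(3)
  by (induction A rule: infinite_finite_induct) (auto intro!: smooth_funs_add[OF X U] smooth_funs_const)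

lemma smooth_funs_prod:
  fixes X :: "('p, 'e::euclidean_space) mfd" and f :: "'i \<Rightarrow> 'p \<Rightarrow> 'k::real_normed_field"
  assumes X: "smooth_mfd X" and U: "opn X U" and "\<And>i. i \<in> A \<Longrightarrow> f i \<in> smooth_funs X U"
  shows "(\<lambda>x. \<Prod>i\<in>A. f i x) \<in> smooth_funs X U" using assms(3)
  by (induction A rule: infinite_finite_induct) (auto intro!: smooth_funs_mult[OF X U] smooth_funs_const)

lemma smooth_funs_continuous_map:
  assumes X: "smooth_mfd X" and f: "f \<in> smooth_funs X U" and U: "opn X U" and A: "open A"
  shows "opn X {x \<in> U. f x \<in> A}"
proof (subst openin_subopen, clarify)
  fix x assume x: "x \<in> U" "f x \<in> A"
  then obtain V \<phi> where c: "chart X V \<phi>" "x \<in> V" using ex_chart[OF X] openin_subset[OF U] by blast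
  have "continuous_on (\<phi> ` (U \<inter> V)) (f \<circ> inv_into V \<phi>)"
    using Cinf_on_continuous[OF smooth_funs_chart[OF X f U c(1)]] .
  then have "open (\<phi> ` (U \<inter> V) \<inter> (f \<circ> inv_into V \<phi>) -` A)"
    using continuous_open_preimage chartD(5)[OF c(1) U] A by blast
  from chartD(8)[OF c(1) this]
  have o: "opn X {q \<in> V. \<phi> q \<in> \<phi> ` (U \<inter> V) \<inter> (f \<circ> inv_into V \<phi>) -` A}" .
  have "\<exists>T. opn X T \<and> x \<in> T \<and> T \<subseteq> {x \<in> U. f x \<in> A}"
  proof (intro exI conjI, rule o)
    show "x \<in> {q \<in> V. \<phi> q \<in> \<phi> ` (U \<inter> V) \<inter> (f \<circ> inv_into V \<phi>) -` A}"
      using x c by (auto simp: chartD(4)[OF c(1)])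
    show "{q \<in> V. \<phi> q \<in> \<phi> ` (U \<inter> V) \<inter> (f \<circ> inv_into V \<phi>) -` A} \<subseteq> {x \<in> U. f x \<in> A}"
    proof clarify
      fix q r assume q: "q \<in> V" "(f \<circ> inv_into V \<phi>) (\<phi> q) \<in> A" "\<phi> q = \<phi> r" "r \<in> U" "r \<in> V"
      then have "q = r" using chartD(3)[OF c(1)] by (meson inj_onD)
      then show "q \<in> U \<and> f q \<in> A" using q chartD(4)[OF c(1)] by auto
    qed
  qed
  then show "\<exists>T. opn X T \<and> x \<in> T \<and> T \<subseteq> {x \<in> U. f x \<in> A}" .
qed

lemma smooth_funs_pre_compose:
  assumes X: "smooth_mfd X" and F: "smooth_map X Y F" and Y: "pts Y \<subseteq> \<Union> (fst ` atlas Y)"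
    and f: "f \<in> smooth_funs Y U" and U: "opn Y U"
    and oA: "\<And>V \<phi>. (V, \<phi>) \<in> atlas Y \<Longrightarrow> opn Y V \<and> inj_on \<phi> V"
  shows "f \<circ> F \<in> smooth_funs X {x \<in> pts X. F x \<in> U}"
proof (rule smooth_funs_local[OF X])
  fix p assume "p \<in> {x \<in> pts X. F x \<in> U}"
  then have p: "p \<in> pts X" "F p \<in> U" by auto
  have cont: "continuous_map (mtop X) (mtop Y) F" using F unfolding smooth_map_def by blast
  obtain V \<phi> where V: "(V, \<phi>) \<in> atlas Y" "F p \<in> V" using p Y openin_subset[OF U] by fastforce
  have inj: "inj_on \<phi> V" and oV: "opn Y V" using oA[OF V(1)] by auto
  let ?W = "{x \<in> pts X. F x \<in> U \<inter> V}"
  have oW: "opn X ?W" by (rule openin_continuous_map_preimage[OF cont]) (use U oV in blast)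
  have "\<phi> \<circ> F \<in> smooth_funs X {x \<in> pts X. F x \<in> V}" using F V unfolding smooth_map_def by blast
  then have s: "\<phi> \<circ> F \<in> smooth_funs X ?W" by (rule smooth_funs_subset) auto
  have c: "Cinf_on (\<phi> ` (U \<inter> V)) (f \<circ> inv_into V \<phi>)" using f V unfolding smooth_funs_def by blast
  have "(\<lambda>x. (f \<circ> inv_into V \<phi>) ((\<phi> \<circ> F) x)) \<in> smooth_funs X ?W"
    by (rule smooth_funs_post_compose[OF X oW s _ c]) auto
  then have "f \<circ> F \<in> smooth_funs X ?W" by (rule smooth_funs_cong[OF X oW]) (auto simp: inv_into_f_f[OF inj])
  then show "\<exists>W. opn X W \<and> p \<in> W \<and> f \<circ> F \<in> smooth_funs X W" using oW p V by blast
qed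

lemma smooth_funs_pullback:
  assumes X: "smooth_mfd X" and Y: "smooth_mfd Y" and F: "smooth_map X Y F"
    and f: "f \<in> smooth_funs Y U" and U: "opn Y U"
  shows "f \<circ> F \<in> smooth_funs X {x \<in> pts X. F x \<in> U}"
  using smooth_funs_pre_compose[OF X F _ f U] Y chartD(1,3)[OF chart_atlas[OF Y]] by (metis order_refl smooth_mfd_def)

lemma smooth_map_preimage_open:
  "smooth_map X Y F \<Longrightarrow> opn Y U \<Longrightarrow> opn X {x \<in> pts X. F x \<in> U}"
  unfolding smooth_map_def by (blast intro: openin_continuous_map_preimage)

lemma smooth_map_in_topspace: "smooth_map X Y F \<Longrightarrow> x \<in> pts X \<Longrightarrow> F x \<in> pts Y"
  unfolding smooth_map_def continuous_map_def by auto

text \<open>Continuity is a conclusion: near each point \<open>F\<close> takes values in a single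
  chart \<phi> and \<phi> after \<open>F\<close> is continuous, so preimages of open sets are open.
  The chart may be any chart of the maximal atlas and may depend on the point.\<close>

lemma smooth_map_local:
  assumes X: "smooth_mfd X" and Y: "smooth_mfd Y"
    and c: "\<And>p. p \<in> pts X \<Longrightarrow> \<exists>W V \<phi>. opn X W \<and> p \<in> W \<and> chart Y V \<phi> \<and> F ` W \<subseteq> V \<and>
      \<phi> \<circ> F \<in> smooth_funs X W"
  shows "smooth_map X Y F" unfolding smooth_map_def
proof
  have loc: "\<exists>W'. opn X W' \<and> p \<in> W' \<and> F ` W' \<subseteq> A \<and> W' \<subseteq> W"
    if W: "opn X W" "p \<in> W" "chart Y V \<phi>" "F ` W \<subseteq> V" "\<phi> \<circ> F \<in> smooth_funs X W"
      and A: "opn Y A" "F p \<in> A" for p W V \<phi> A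
  proof -
    have o: "open (\<phi> ` (A \<inter> V))" using chartD(5)[OF W(3) A(1)] .
    have "opn X {x \<in> W. (\<phi> \<circ> F) x \<in> \<phi> ` (A \<inter> V)}" by (rule smooth_funs_continuous_map[OF X W(5,1) o])
    moreover have "F ` {x \<in> W. (\<phi> \<circ> F) x \<in> \<phi> ` (A \<inter> V)} \<subseteq> A"
    proof clarify
      fix x y assume x: "x \<in> W" "(\<phi> \<circ> F) x = \<phi> y" "y \<in> A" "y \<in> V"
      then have "F x = y" using chartD(3)[OF W(3)] W(4) by (auto dest: inj_onD)
      then show "F x \<in> A" using x by simp
    qed
    moreover have "p \<in> {x \<in> W. (\<phi> \<circ> F) x \<in> \<phi> ` (A \<inter> V)}" using W A by auto
    ultimately show ?thesis by blast
  qed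
  show cont: "continuous_map (mtop X) (mtop Y) F" unfolding continuous_map_def
  proof (intro conjI allI impI)
    show "F \<in> pts X \<rightarrow> pts Y"
    proof
      fix p assume "p \<in> pts X"
      from c[OF this] obtain W V \<phi> where "p \<in> W" "chart Y V \<phi>" "F ` W \<subseteq> V" by blast
      then show "F p \<in> pts Y" using chartD(2)[of Y V \<phi>] by auto
    qed
    fix A assume A: "opn Y A"
    show "opn X {x \<in> pts X. F x \<in> A}"
    proof (subst openin_subopen, clarify)
      fix p assume p: "p \<in> pts X" "F p \<in> A"
      from c[OF p(1)] obtain W V \<phi> where W: "opn X W" "p \<in> W" "chart Y V \<phi>" "F ` W \<subseteq> V"
        "\<phi> \<circ> F \<in> smooth_funs X W" by blast
      from loc[OF W A p(2)] obtain W' where W': "opn X W'" "p \<in> W'" "F ` W' \<subseteq> A" by blast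
      show "\<exists>T. opn X T \<and> p \<in> T \<and> T \<subseteq> {x \<in> pts X. F x \<in> A}"
        using W' openin_subset[OF W'(1)] by blast
    qed
  qed
  show "\<forall>(W, \<psi>)\<in>atlas Y. \<psi> \<circ> F \<in> smooth_funs X {x \<in> pts X. F x \<in> W}"
  proof clarify
    fix A \<psi> assume A: "(A, \<psi>) \<in> atlas Y"
    have cA: "chart Y A \<psi>" using chart_atlas[OF Y A] .
    show "\<psi> \<circ> F \<in> smooth_funs X {x \<in> pts X. F x \<in> A}"
    proof (rule smooth_funs_local[OF X])
      fix p assume "p \<in> {x \<in> pts X. F x \<in> A}"
      then have p: "p \<in> pts X" "F p \<in> A" by auto
      from c[OF p(1)] obtain W V \<phi> where W: "opn X W" "p \<in> W" "chart Y V \<phi>" "F ` W \<subseteq> V"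
        "\<phi> \<circ> F \<in> smooth_funs X W" by blast
      from loc[OF W chartD(1)[OF cA] p(2)] obtain W' where
        W': "opn X W'" "p \<in> W'" "F ` W' \<subseteq> A" "W' \<subseteq> W" by blast
      have "(\<lambda>x. (\<psi> \<circ> inv_into V \<phi>) ((\<phi> \<circ> F) x)) \<in> smooth_funs X W'"
      proof (rule smooth_funs_post_compose[OF X W'(1) smooth_funs_subset[OF W(5) W'(4)] _
            chart_compatible[OF Y W(3) cA]])
        show "(\<phi> \<circ> F) ` W' \<subseteq> \<phi> ` (V \<inter> A)"
        proof clarify
          fix x assume "x \<in> W'"
          then have "F x \<in> V \<inter> A" using W W' by blast
          then show "(\<phi> \<circ> F) x \<in> \<phi> ` (V \<inter> A)" by simp
        qed
      qed
      then have "\<psi> \<circ> F \<in> smooth_funs X W'"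
        by (rule smooth_funs_cong[OF X W'(1)]) (use W W' in \<open>auto simp: chartD(4)[OF W(3)] image_subset_iff subset_iff\<close>)
      then show "\<exists>W. opn X W \<and> p \<in> W \<and> \<psi> \<circ> F \<in> smooth_funs X W" using W' by blast
    qed
  qed
qed

lemma smooth_map_compose:
  assumes X: "smooth_mfd X" and Y: "smooth_mfd Y" and Z: "smooth_mfd Z"
    and F: "smooth_map X Y F" and G: "smooth_map Y Z G"
  shows "smooth_map X Z (\<lambda>x. G (F x))" unfolding smooth_map_def
proof (intro conjI)
  show "continuous_map (mtop X) (mtop Z) (\<lambda>x. G (F x))"
    using continuous_map_compose[of "mtop X" "mtop Y" F "mtop Z" G] F G unfolding smooth_map_def comp_def by blast
  show "\<forall>(W, \<psi>)\<in>atlas Z. \<psi> \<circ> (\<lambda>x. G (F x)) \<in> smooth_funs X {x \<in> pts X. G (F x) \<in> W}"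
  proof clarify
    fix W \<psi> assume W: "(W, \<psi>) \<in> atlas Z"
    let ?U = "{y \<in> pts Y. G y \<in> W}"
    have oU: "opn Y ?U" using smooth_map_preimage_open[OF G] chartD(1)[OF chart_atlas[OF Z W]] by blast
    have "\<psi> \<circ> G \<in> smooth_funs Y ?U" using G W unfolding smooth_map_def by blast
    from smooth_funs_pullback[OF X Y F this oU]
    have "\<psi> \<circ> G \<circ> F \<in> smooth_funs X {x \<in> pts X. F x \<in> ?U}" .
    moreover have "{x \<in> pts X. F x \<in> ?U} = {x \<in> pts X. G (F x) \<in> W}" using smooth_map_in_topspace[OF F] by auto
    ultimately show "\<psi> \<circ> (\<lambda>x. G (F x)) \<in> smooth_funs X {x \<in> pts X. G (F x) \<in> W}" by (simp add: comp_def)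
  qed
qed

lemma smooth_map_cong:
  assumes X: "smooth_mfd X" and Y: "smooth_mfd Y" and F: "smooth_map X Y F"
    and e: "\<And>x. x \<in> pts X \<Longrightarrow> G x = F x"
  shows "smooth_map X Y G" unfolding smooth_map_def
proof (intro conjI)
  show "continuous_map (mtop X) (mtop Y) G" using F e continuous_map_eq[of "mtop X" "mtop Y" F G] unfolding smooth_map_def by auto
  show "\<forall>(W, \<psi>)\<in>atlas Y. \<psi> \<circ> G \<in> smooth_funs X {x \<in> pts X. G x \<in> W}"
  proof clarify
    fix W \<psi> assume W: "(W, \<psi>) \<in> atlas Y"
    have s: "{x \<in> pts X. G x \<in> W} = {x \<in> pts X. F x \<in> W}" using e by auto
    show "\<psi> \<circ> G \<in> smooth_funs X {x \<in> pts X. G x \<in> W}" unfolding s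
      by (rule smooth_funs_cong[OF X smooth_map_preimage_open[OF F chartD(1)[OF chart_atlas[OF Y W]]], of "\<psi> \<circ> F"])
        (use F W e in \<open>auto simp: smooth_map_def\<close>)
  qed
qed

lemma smooth_map_id:
  assumes X: "smooth_mfd X" shows "smooth_map X X (\<lambda>x. x)"
proof (rule smooth_map_local[OF X X])
  fix p assume "p \<in> pts X"
  then obtain V \<phi> where "chart X V \<phi>" "p \<in> V" using ex_chart[OF X] by blast
  then show "\<exists>W V \<phi>. opn X W \<and> p \<in> W \<and> chart X V \<phi> \<and> (\<lambda>x. x) ` W \<subseteq> V \<and>
      \<phi> \<circ> (\<lambda>x. x) \<in> smooth_funs X W"
    using chartD(1) smooth_funs_chart_map by (intro exI[of _ V] exI[of _ \<phi>]) (auto simp: comp_def)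
qed

section \<open>Tangent vectors and completion of functions to charts\<close>

definition smooth_at :: "('p, 'e::euclidean_space) mfd \<Rightarrow> 'p \<Rightarrow> ('p \<Rightarrow> 'k::real_normed_vector) \<Rightarrow> bool" where
  "smooth_at X p f \<longleftrightarrow> (\<exists>U. opn X U \<and> p \<in> U \<and> f \<in> smooth_funs X U)"

lemma smooth_atI: "f \<in> smooth_funs X U \<Longrightarrow> opn X U \<Longrightarrow> p \<in> U \<Longrightarrow> smooth_at X p f"
  unfolding smooth_at_def by blast

lemma smooth_at_common:
  assumes "smooth_at X p f" "smooth_at X p g"
  obtains U where "opn X U" "p \<in> U" "f \<in> smooth_funs X U" "g \<in> smooth_funs X U"
proof -
  obtain U W where U: "opn X U" "p \<in> U" "f \<in> smooth_funs X U"
    and W: "opn X W" "p \<in> W" "g \<in> smooth_funs X W" using assms unfolding smooth_at_def by blast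
  show thesis by (rule that[of "U \<inter> W"]) (use U W smooth_funs_subset[of _ X _ "U \<inter> W"] in auto)
qed

context
  fixes X :: "('p, 'e::euclidean_space) mfd" and p :: 'p
  assumes X: "smooth_mfd X"
begin

lemma smooth_at_add: "smooth_at X p f \<Longrightarrow> smooth_at X p g \<Longrightarrow> smooth_at X p (\<lambda>x. f x + g x)"
  by (rule smooth_at_common[of X p f g]) (auto intro: smooth_atI smooth_funs_add[OF X])

lemma smooth_at_bilinear:
  "bounded_bilinear b \<Longrightarrow> smooth_at X p f \<Longrightarrow> smooth_at X p g \<Longrightarrow> smooth_at X p (\<lambda>x. b (f x) (g x))"
  by (rule smooth_at_common[of X p f g]) (auto intro: smooth_atI smooth_funs_bilinear[OF _ X])

lemmas smooth_at_mult = smooth_at_bilinear[OF bounded_bilinear_mult]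

lemma smooth_at_linear: "bounded_linear b \<Longrightarrow> smooth_at X p f \<Longrightarrow> smooth_at X p (\<lambda>x. b (f x))"
  unfolding smooth_at_def using smooth_funs_linear[OF _ X] by blast

lemma smooth_at_cong:
  assumes "smooth_at X p f" "opn X U" "p \<in> U" "\<And>q. q \<in> U \<Longrightarrow> g q = f q"
  shows "smooth_at X p g"
proof -
  obtain W where W: "opn X W" "p \<in> W" "f \<in> smooth_funs X W" using assms unfolding smooth_at_def by blast
  have "g \<in> smooth_funs X (W \<inter> U)" by (rule smooth_funs_cong[OF X _ smooth_funs_subset[OF W(3)]]) (use W assms in auto)
  then show ?thesis using W assms by (intro smooth_atI[of _ _ "W \<inter> U"]) auto
qed

lemma smooth_at_continuous:
  assumes "smooth_at X p f" "open A" "f p \<in> A"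
  obtains U where "opn X U" "p \<in> U" "f \<in> smooth_funs X U" "\<And>q. q \<in> U \<Longrightarrow> f q \<in> A"
proof -
  obtain W where W: "opn X W" "p \<in> W" "f \<in> smooth_funs X W" using assms unfolding smooth_at_def by blast
  show thesis by (rule that[of "{x \<in> W. f x \<in> A}"])
      (use W assms smooth_funs_continuous_map[OF X W(3,1)] in \<open>auto intro: smooth_funs_subset\<close>)
qed

lemma smooth_at_inverse:
  fixes f :: "'p \<Rightarrow> 'k::real_normed_div_algebra"
  assumes "smooth_at X p f" "f p \<noteq> 0"
  shows "smooth_at X p (\<lambda>x. inverse (f x))"
proof -
  obtain U where U: "opn X U" "p \<in> U" "f \<in> smooth_funs X U" "\<And>q. q \<in> U \<Longrightarrow> f q \<in> - {0}"
    by (rule smooth_at_continuous[OF assms(1), of "- {0}"]) (use assms(2) in auto)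
  then show ?thesis by (intro smooth_atI[OF smooth_funs_inverse[OF X U(1,3)]]) auto
qed

lemma smooth_at_chart: "chart X V \<phi> \<Longrightarrow> p \<in> V \<Longrightarrow> smooth_at X p \<phi>"
  using smooth_funs_chart_map[of X V \<phi>] chartD(1)[of X V \<phi>] by (blast intro: smooth_atI)

text \<open>The directional derivative at the fixed point \<open>p\<close> along the coordinate
  vector \<open>v\<close>. Values in any normed space are allowed so that it also applies to charts
  themselves, which turns a change of chart into an instance of the chain rule.\<close>

definition dchart :: "'p set \<Rightarrow> ('p \<Rightarrow> 'e) \<Rightarrow> 'e \<Rightarrow> ('p \<Rightarrow> 'k::real_normed_vector) \<Rightarrow> 'k" where
  "dchart V \<phi> v f = frechet_derivative (f \<circ> inv_into V \<phi>) (at (\<phi> p)) v"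

lemma dchart_has_derivative:
  assumes "chart X V \<phi>" "p \<in> V" "smooth_at X p f"
  shows "((f \<circ> inv_into V \<phi>) has_derivative (\<lambda>v. dchart V \<phi> v f)) (at (\<phi> p))"
proof -
  obtain U where U: "opn X U" "p \<in> U" "f \<in> smooth_funs X U" using assms unfolding smooth_at_def by blast
  have "(f \<circ> inv_into V \<phi>) differentiable at (\<phi> p)"
    using Cinf_on_differentiable[OF smooth_funs_chart[OF X U(3,1) assms(1)]] U assms by blast
  then show ?thesis unfolding dchart_def by (simp add: frechet_derivative_works)
qed

lemma dchart_linear:
  assumes "chart X V \<phi>" "p \<in> V" "smooth_at X p f"
  shows "bounded_linear (\<lambda>v. dchart V \<phi> v f)" using dchart_has_derivative[OF assms] has_derivative_bounded_linear by blast

text \<open>The function \<open>k\<close> needs to agree with \<open>g\<close> after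
  \<open>h\<close> only near \<open>p\<close>; the locality is what makes this single form serve for
  charts, restrictions of functions and maps between manifolds.\<close>

lemma dchart_chain:
  assumes c: "chart X V \<phi>" "p \<in> V" and h: "smooth_at X p h" and g: "(g has_derivative Dg) (at (h p))"
    and U: "opn X U" "p \<in> U" and k: "\<And>q. q \<in> U \<Longrightarrow> k q = g (h q)"
  shows "dchart V \<phi> v k = Dg (dchart V \<phi> v h)"
proof -
  have o: "open (\<phi> ` (U \<inter> V))" using chartD(5)[OF c(1) U(1)] .
  have "((\<lambda>x. g ((h \<circ> inv_into V \<phi>) x)) has_derivative (\<lambda>v. Dg (dchart V \<phi> v h))) (at (\<phi> p))"
    by (rule has_derivative_compose[OF dchart_has_derivative[OF c h]])
      (use g in \<open>simp add: chartD(4)[OF c]\<close>)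
  then have "((k \<circ> inv_into V \<phi>) has_derivative (\<lambda>v. Dg (dchart V \<phi> v h))) (at (\<phi> p))"
    by (rule has_derivative_transform_within_open[OF _ o])
      (use U c k in \<open>auto simp: chartD(4)[OF c(1)]\<close>)
  then show ?thesis unfolding dchart_def by (rule frechet_derivative_eqI)
qed

lemma dchart_change:
  assumes c: "chart X V \<phi>" "p \<in> V" and c': "chart X W \<psi>" "p \<in> W" and f: "smooth_at X p f"
  shows "dchart V \<phi> v f = dchart W \<psi> (dchart V \<phi> v \<psi>) f"
  by (rule dchart_chain[OF c smooth_at_chart[OF c'] dchart_has_derivative[OF c' f] chartD(1)[OF c'(1)] c'(2)])
    (simp add: chartD(4)[OF c'(1)])

lemma dchart_self: "chart X V \<phi> \<Longrightarrow> p \<in> V \<Longrightarrow> dchart V \<phi> v \<phi> = v"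
proof -
  assume c: "chart X V \<phi>" "p \<in> V"
  have "((\<phi> \<circ> inv_into V \<phi>) has_derivative (\<lambda>v. v)) (at (\<phi> p))"
    by (rule has_derivative_transform_within_open[OF has_derivative_ident chartD(7)[OF c(1)]])
      (use c in \<open>auto simp: chartD(4)[OF c(1)]\<close>)
  then show ?thesis unfolding dchart_def by (rule frechet_derivative_eqI)
qed

text \<open>A real tangent vector, recorded by its action on complex-valued germs and left arbitrary
  on functions that are not smooth at \<open>p\<close>. The representation does not depend on a
  chart, so vectors can be pushed along the maps of the tower. Being real, it commutes with every
  real-linear map of \<complex>, in particular with \<open>cnj\<close>.\<close>

definition tvec :: "(('p \<Rightarrow> complex) \<Rightarrow> complex) \<Rightarrow> bool" where
  "tvec \<tau> \<longleftrightarrow> (\<exists>V \<phi> v. chart X V \<phi> \<and> p \<in> V \<and> (\<forall>f. smooth_at X p f \<longrightarrow> \<tau> f = dchart V \<phi> v f))"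

lemma tvec_dchart: "chart X V \<phi> \<Longrightarrow> p \<in> V \<Longrightarrow> tvec (dchart V \<phi> v)" unfolding tvec_def by blast

lemma tvec_rep:
  assumes "tvec \<tau>" "chart X W \<psi>" "p \<in> W"
  obtains w where "\<And>f. smooth_at X p f \<Longrightarrow> \<tau> f = dchart W \<psi> w f"
proof -
  obtain V \<phi> v where V: "chart X V \<phi>" "p \<in> V" "\<And>f. smooth_at X p f \<Longrightarrow> \<tau> f = dchart V \<phi> v f"
    using assms(1) unfolding tvec_def by blast
  show thesis by (rule that[of "dchart V \<phi> v \<psi>"]) (simp add: V(3) dchart_change[OF V(1,2) assms(2,3)])
qed

lemma tvec_point: "tvec \<tau> \<Longrightarrow> p \<in> pts X" unfolding tvec_def using chartD(2) by blast

lemma tvec_cong: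
  assumes "tvec \<tau>" "smooth_at X p f" "opn X U" "p \<in> U" "\<And>q. q \<in> U \<Longrightarrow> g q = f q"
  shows "\<tau> g = \<tau> f"
proof -
  obtain V \<phi> v where V: "chart X V \<phi>" "p \<in> V" "\<And>f. smooth_at X p f \<Longrightarrow> \<tau> f = dchart V \<phi> v f"
    using assms(1) unfolding tvec_def by blast
  have "dchart V \<phi> v g = dchart V \<phi> v f" by (rule dchart_chain[OF V(1,2) assms(2) has_derivative_ident assms(3,4,5)])
  then show ?thesis using V(3) assms(2) smooth_at_cong[OF assms(2-5)] by simp
qed

lemma tvec_linear:
  assumes "tvec \<tau>" "smooth_at X p f" "bounded_linear b"
  shows "\<tau> (\<lambda>x. b (f x)) = b (\<tau> f)"
proof -
  obtain V \<phi> v where V: "chart X V \<phi>" "p \<in> V" "\<And>f. smooth_at X p f \<Longrightarrow> \<tau> f = dchart V \<phi> v f"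
    using assms(1) unfolding tvec_def by blast
  have "dchart V \<phi> v (\<lambda>x. b (f x)) = b (dchart V \<phi> v f)"
    by (rule dchart_chain[OF V(1,2) assms(2) bounded_linear_imp_has_derivative[OF assms(3)] chartD(1)[OF V(1)] V(2)]) simp
  then show ?thesis using V(3) assms(2) smooth_at_linear[OF assms(3,2)] by simp
qed

lemma tvec_add:
  assumes "tvec \<tau>" "smooth_at X p f" "smooth_at X p g"
  shows "\<tau> (\<lambda>x. f x + g x) = \<tau> f + \<tau> g"
proof -
  obtain V \<phi> v where V: "chart X V \<phi>" "p \<in> V" "\<And>f. smooth_at X p f \<Longrightarrow> \<tau> f = dchart V \<phi> v f"
    using assms(1) unfolding tvec_def by blast
  have "((\<lambda>x. (f \<circ> inv_into V \<phi>) x + (g \<circ> inv_into V \<phi>) x) has_derivative (\<lambda>v. dchart V \<phi> v f + dchart V \<phi> v g)) (at (\<phi> p))"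
    by (intro has_derivative_add dchart_has_derivative V assms)
  then have "dchart V \<phi> v (\<lambda>x. f x + g x) = dchart V \<phi> v f + dchart V \<phi> v g"
    unfolding dchart_def comp_def by (rule frechet_derivative_eqI)
  then show ?thesis using V(3) assms smooth_at_add[OF assms(2,3)] by simp
qed

lemma tvec_mult:
  assumes "tvec \<tau>" "smooth_at X p f" "smooth_at X p g"
  shows "\<tau> (\<lambda>x. f x * g x) = f p * \<tau> g + \<tau> f * g p"
proof -
  obtain V \<phi> v where V: "chart X V \<phi>" "p \<in> V" "\<And>f. smooth_at X p f \<Longrightarrow> \<tau> f = dchart V \<phi> v f"
    using assms(1) unfolding tvec_def by blast
  have "((\<lambda>x. (f \<circ> inv_into V \<phi>) x * (g \<circ> inv_into V \<phi>) x) has_derivative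
      (\<lambda>v. (f \<circ> inv_into V \<phi>) (\<phi> p) * dchart V \<phi> v g + dchart V \<phi> v f * (g \<circ> inv_into V \<phi>) (\<phi> p))) (at (\<phi> p))"
    by (intro has_derivative_mult dchart_has_derivative V assms)
  then have "dchart V \<phi> v (\<lambda>x. f x * g x) = f p * dchart V \<phi> v g + dchart V \<phi> v f * g p"
    unfolding dchart_def comp_def chartD(4)[OF V(1,2)] by (rule frechet_derivative_eqI)
  then show ?thesis using V(3) assms smooth_at_mult[OF assms(2,3)] by simp
qed

lemma smooth_at_const: "p \<in> pts X \<Longrightarrow> smooth_at X p (\<lambda>_. c)"
  by (rule smooth_atI[OF smooth_funs_const openin_topspace])

lemma tvec_const:
  assumes "tvec \<tau>" shows "\<tau> (\<lambda>_. c) = 0"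
proof -
  have s: "smooth_at X p (\<lambda>_. 1::complex)" by (rule smooth_at_const[OF tvec_point[OF assms]])
  have "\<tau> (\<lambda>_. 1 * 1) = 1 * \<tau> (\<lambda>_. 1) + \<tau> (\<lambda>_. 1) * 1" by (rule tvec_mult[OF assms s s])
  then have "\<tau> (\<lambda>_. 1) = 0" by simp
  then show ?thesis using tvec_linear[OF assms s bounded_linear_mult_right[of c]] by simp
qed

text \<open>The functions become coordinates one after another, each in exchange for a coordinate
  not yet used. Surjectivity of the joint differential guarantees that such a coordinate is
  available.\<close>

lemma complete_to_chart_real:
  fixes f :: "nat \<Rightarrow> 'p \<Rightarrow> real"
  assumes "\<And>l. l < N \<Longrightarrow> smooth_at X p (f l)" and c0: "chart X V0 \<phi>0" "p \<in> V0"
    and surj: "\<And>c::nat \<Rightarrow> real. \<exists>v. \<forall>l<N. dchart V0 \<phi>0 v (f l) = c l"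
    and U: "opn X U" "p \<in> U"
  shows "\<exists>V \<phi> b. chart X V \<phi> \<and> p \<in> V \<and> V \<subseteq> U \<and> inj_on b {..<N} \<and> b ` {..<N} \<subseteq> Basis \<and>
    (\<forall>q\<in>V. \<forall>l<N. \<phi> q \<bullet> b l = f l q)" using assms(1) surj
proof (induction N)
  case 0
  show ?case by (rule exI[of _ "V0 \<inter> U"], rule exI[of _ \<phi>0]) (use chart_restrict[OF X c0(1) U(1)] c0 U in auto)
next
  case (Suc N)
  have "\<And>c::nat \<Rightarrow> real. \<exists>v. \<forall>l<N. dchart V0 \<phi>0 v (f l) = c l" using Suc.prems(2) less_SucI by meson
  with Suc.IH Suc.prems(1) obtain V \<phi> b where V: "chart X V \<phi>" "p \<in> V" "V \<subseteq> U" "inj_on b {..<N}"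
    "b ` {..<N} \<subseteq> Basis" and fb: "\<And>q l. q \<in> V \<Longrightarrow> l < N \<Longrightarrow> \<phi> q \<bullet> b l = f l q"
    by (metis less_SucI)
  obtain W where W: "opn X W" "p \<in> W" "f N \<in> smooth_funs X W" using Suc.prems(1)[of N] unfolding smooth_at_def by blast
  define V' where "V' = V \<inter> W"
  have c': "chart X V' \<phi>" unfolding V'_def by (rule chart_restrict[OF X V(1) W(1)])
  have pV': "p \<in> V'" using V W unfolding V'_def by auto
  define S where "S = \<phi> ` V'"
  define h where "h = f N \<circ> inv_into V' \<phi>"
  have oS: "open S" unfolding S_def using chartD(7)[OF c'] .
  have "Cinf_on (\<phi> ` (W \<inter> V')) h" unfolding h_def by (rule smooth_funs_chart[OF X W(3,1) c'])
  then have hS: "Cinf_on S h" unfolding S_def by (rule Cinf_on_subset) (auto simp: V'_def)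
  obtain v0 where v0: "\<forall>l<Suc N. dchart V0 \<phi>0 v0 (f l) = (if l = N then 1 else 0)"
    using Suc.prems(2)[of "\<lambda>l. if l = N then 1 else 0"] by blast
  define v where "v = dchart V0 \<phi>0 v0 \<phi>"
  have v: "dchart V' \<phi> v (f l) = (if l = N then 1 else 0)" if "l < Suc N" for l
    using v0 that dchart_change[OF c0 c' pV' Suc.prems(1)[OF that], of v0] unfolding v_def by simp
  have vb: "v \<bullet> b l = 0" if "l < N" for l
  proof -
    have "dchart V' \<phi> v (f l) = dchart V' \<phi> v \<phi> \<bullet> b l" by (rule dchart_chain[OF c' pV' smooth_at_chart[OF c' pV']
          bounded_linear_imp_has_derivative[OF bounded_linear_inner_left] chartD(1)[OF c'] pV'])
        (use fb that in \<open>auto simp: V'_def\<close>)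
    then show ?thesis using v[of l] that dchart_self[OF c' pV'] by simp
  qed
  have lin: "bounded_linear (\<lambda>v. dchart V' \<phi> v (f N))" by (rule dchart_linear[OF c' pV']) (use Suc.prems in simp)
  \<comment> \<open>By linearity the derivative 1 of \<open>f N\<close> along \<open>v\<close> comes
    from basis vectors occurring in \<open>v\<close>. One of them has nonzero partial derivative,
    and it differs from all \<open>b l\<close>, so exchanging it leaves the earlier coordinates
    intact.\<close>
  have "\<exists>i\<in>Basis. v \<bullet> i \<noteq> 0 \<and> dchart V' \<phi> i (f N) \<noteq> 0"
  proof (rule ccontr)
    assume "\<not> ?thesis"
    then have "(\<Sum>i\<in>Basis. (v \<bullet> i) * dchart V' \<phi> i (f N)) = 0" by (intro sum.neutral) auto
    moreover have "dchart V' \<phi> v (f N) = dchart V' \<phi> (\<Sum>i\<in>Basis. (v \<bullet> i) *\<^sub>R i) (f N)"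
      by (simp add: euclidean_representation)
    moreover have "\<dots> = (\<Sum>i\<in>Basis. (v \<bullet> i) * dchart V' \<phi> i (f N))"
      by (simp add: linear_sum[OF bounded_linear.linear[OF lin]] linear_scale[OF bounded_linear.linear[OF lin]])
    ultimately show False using v[of N] by simp
  qed
  then obtain i where i: "i \<in> Basis" "v \<bullet> i \<noteq> 0" "dchart V' \<phi> i (f N) \<noteq> 0" by blast
  have ib: "i \<noteq> b l" if "l < N" for l using vb[OF that] i by auto
  define F where "F = (\<lambda>x. x + (h x - x \<bullet> i) *\<^sub>R i)"
  obtain A B g where A: "open A" "A \<subseteq> S" "\<phi> p \<in> A" "open B" "homeomorphism A B F g" "Cinf_on A F" "Cinf_on B g"
  proof (rule exchange_coordinate[OF oS _ hS i(1)])
    show "\<phi> p \<in> S" unfolding S_def using pV' by blast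
    show "frechet_derivative h (at (\<phi> p)) i \<noteq> 0" using i(3) unfolding dchart_def h_def .
  qed (use F_def in auto)
  define V'' where "V'' = {q \<in> V'. \<phi> q \<in> A}"
  have oV'': "opn X V''" unfolding V''_def by (rule chartD(8)[OF c' A(1)])
  have "V' \<inter> V'' = V''" unfolding V''_def by auto
  then have c'': "chart X V'' \<phi>" using chart_restrict[OF X c' oV''] by simp
  have im: "\<phi> ` V'' = A" using A(2) unfolding V''_def S_def by auto
  have FA: "F ` A = B" using A(5) by (simp add: homeomorphism_def)
  have cF: "chart X V'' (F \<circ> \<phi>)"
    by (rule chart_transform[OF X c'', where G = g]) (use A im FA in \<open>auto simp: homeomorphism_def\<close>)
  define b' where "b' = b(N := i)"
  have ibas: "i \<bullet> i = 1" using i by simp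
  have ortho: "i \<bullet> b l = 0" if "l < N" for l using ib[OF that] i(1) V(5) that by (auto simp: inner_Basis image_subset_iff)
  have "(F \<circ> \<phi>) q \<bullet> b' l = f l q" if "q \<in> V''" "l < Suc N" for q l
  proof (cases "l = N")
    case True
    have "h (\<phi> q) = f N q" unfolding h_def using that chartD(4)[OF c'] unfolding V''_def by auto
    then show ?thesis using True ibas unfolding b'_def F_def by (simp add: inner_add_left)
  next
    case False
    then have "l < N" "q \<in> V" using that unfolding V''_def V'_def by auto
    then show ?thesis using False ortho fb unfolding b'_def F_def by (simp add: inner_add_left)
  qed
  moreover have "inj_on b' {..<Suc N}"
    using V(4) ib unfolding b'_def lessThan_Suc inj_on_def by (metis fun_upd_apply insert_iff lessThan_iff)
  moreover have "b' ` {..<Suc N} \<subseteq> Basis" using V(5) i(1) unfolding b'_def by auto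
  moreover have "p \<in> V''" "V'' \<subseteq> U" using pV' A V unfolding V''_def V'_def by auto
  ultimately show ?case using cF by blast
qed

text \<open>Real and imaginary parts are interleaved, at indices 2 l and 2 l + 1, so that
  \<open>zc\<close> reads \<open>f l\<close> back from the resulting chart.\<close>

lemma complete_to_chart:
  fixes f :: "nat \<Rightarrow> 'p \<Rightarrow> complex"
  assumes f: "\<And>l. l < n \<Longrightarrow> smooth_at X p (f l)" and p: "p \<in> pts X"
    and surj: "\<And>c::nat \<Rightarrow> complex. \<exists>\<tau>. tvec \<tau> \<and> (\<forall>l<n. \<tau> (f l) = c l)"
    and U: "opn X U" "p \<in> U"
  obtains V \<phi> e where "chart X V \<phi>" "p \<in> V" "V \<subseteq> U" "frame_enum e" "2 * n \<le> DIM('e)"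
    "\<And>q l. q \<in> V \<Longrightarrow> l < n \<Longrightarrow> zc e l (\<phi> q) = f l q"
proof -
  obtain V0 \<phi>0 where c0: "chart X V0 \<phi>0" "p \<in> V0" using ex_chart[OF X p] by blast
  define r where "r = (\<lambda>l q. if even l then Re (f (l div 2) q) else Im (f (l div 2) q))"
  have r: "r l = (if even l then (\<lambda>q. Re (f (l div 2) q)) else (\<lambda>q. Im (f (l div 2) q)))" for l unfolding r_def by auto
  have sr: "smooth_at X p (r l)" if "l < 2 * n" for l
    unfolding r using f[of "l div 2"] that smooth_at_linear[OF bounded_linear_Re] smooth_at_linear[OF bounded_linear_Im] by auto
  have dr: "dchart V0 \<phi>0 v (r l) = (if even l then Re (dchart V0 \<phi>0 v (f (l div 2))) else Im (dchart V0 \<phi>0 v (f (l div 2))))"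
    if "l < 2 * n" for l v
  proof -
    have s: "smooth_at X p (f (l div 2))" using f that by auto
    show ?thesis unfolding r using dchart_chain[OF c0 s bounded_linear_imp_has_derivative[OF bounded_linear_Re] chartD(1)[OF c0(1)] c0(2)]
        dchart_chain[OF c0 s bounded_linear_imp_has_derivative[OF bounded_linear_Im] chartD(1)[OF c0(1)] c0(2)] by auto
  qed
  have surj': "\<exists>v. \<forall>l<2 * n. dchart V0 \<phi>0 v (r l) = c l" for c :: "nat \<Rightarrow> real"
  proof -
    obtain \<tau> where d: "tvec \<tau>" "\<And>l. l < n \<Longrightarrow> \<tau> (f l) = Complex (c (2 * l)) (c (2 * l + 1))"
      using surj[of "\<lambda>l. Complex (c (2 * l)) (c (2 * l + 1))"] by blast
    obtain v where v: "\<And>f. smooth_at X p f \<Longrightarrow> \<tau> f = dchart V0 \<phi>0 v f" using tvec_rep[OF d(1) c0] by blast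
    have "dchart V0 \<phi>0 v (r l) = c l" if "l < 2 * n" for l
    proof -
      have l: "l div 2 < n" using that by auto
      have "dchart V0 \<phi>0 v (f (l div 2)) = Complex (c (2 * (l div 2))) (c (2 * (l div 2) + 1))"
        using v[OF f[OF l]] d(2)[OF l] by simp
      then show ?thesis unfolding dr[OF that] by (auto elim!: evenE oddE)
    qed
    then show ?thesis by blast
  qed
  from complete_to_chart_real[OF sr c0 surj' U] obtain V \<phi> b where V: "chart X V \<phi>" "p \<in> V" "V \<subseteq> U"
    "inj_on b {..<2 * n}" "b ` {..<2 * n} \<subseteq> Basis" "\<forall>q\<in>V. \<forall>l<2 * n. \<phi> q \<bullet> b l = r l q" by blast
  have card: "2 * n \<le> DIM('e)" using card_mono[OF finite_Basis V(5)] card_image[OF V(4)] by simp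
  define R where "R = Basis - b ` {..<2 * n}"
  have "card R = DIM('e) - 2 * n" unfolding R_def using card_Diff_subset[OF _ V(5)] card_image[OF V(4)] by simp
  then obtain h where h: "bij_betw h {0..<DIM('e) - 2 * n} R" using ex_bij_betw_nat_finite[of R] finite_Basis unfolding R_def by auto
  \<comment> \<open>The basis vectors found above come first, in the order dictated by the
    functions; the rest of \<open>Basis\<close> follows in an arbitrary order.\<close>
  define e where "e = (\<lambda>k. if k < 2 * n then b k else h (k - 2 * n))"
  have "bij_betw e ({..<2 * n} \<union> {2 * n..<DIM('e)}) (b ` {..<2 * n} \<union> R)"
  proof (rule bij_betw_combine)
    show "bij_betw e {..<2 * n} (b ` {..<2 * n})" using V(4) unfolding e_def by (auto simp: bij_betw_def inj_on_def)
    have "bij_betw (\<lambda>k. k - 2 * n) {2 * n..<DIM('e)} {0..<DIM('e) - 2 * n}"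
      by (rule bij_betw_byWitness[where f' = "\<lambda>k. k + 2 * n"]) (use card in auto)
    from bij_betw_trans[OF this h] have "bij_betw (h \<circ> (\<lambda>k. k - 2 * n)) {2 * n..<DIM('e)} R" .
    then show "bij_betw e {2 * n..<DIM('e)} R" by (rule bij_betw_cong[THEN iffD1, rotated]) (auto simp: e_def)
    show "b ` {..<2 * n} \<inter> R = {}" unfolding R_def by auto
  qed
  moreover have "{..<2 * n} \<union> {2 * n..<DIM('e)} = {..<DIM('e)}" using card by auto
  moreover have "b ` {..<2 * n} \<union> R = Basis" using V(5) unfolding R_def by auto
  ultimately have "frame_enum e" unfolding frame_enum_def by simp
  moreover have "zc e l (\<phi> q) = f l q" if "q \<in> V" "l < n" for q l
  proof -
    have "\<phi> q \<bullet> e (2 * l) = r (2 * l) q" "\<phi> q \<bullet> e (2 * l + 1) = r (2 * l + 1) q"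
      using V(6) that unfolding e_def by auto
    then show ?thesis unfolding zc_def r_def by (simp add: complex_eq_iff)
  qed
  ultimately show thesis using that V card by blast
qed

end

lemma smooth_at_pullback:
  assumes X: "smooth_mfd X" and Y: "smooth_mfd Y" and F: "smooth_map X Y F" and p: "p \<in> pts X"
    and f: "smooth_at Y (F p) f"
  shows "smooth_at X p (f \<circ> F)"
proof -
  obtain U where U: "opn Y U" "F p \<in> U" "f \<in> smooth_funs Y U" using f unfolding smooth_at_def by blast
  show ?thesis by (rule smooth_atI[OF smooth_funs_pullback[OF X Y F U(3,1)] smooth_map_preimage_open[OF F U(1)]])
      (simp add: U(2) p)
qed

lemma tvec_push:
  assumes X: "smooth_mfd X" and Y: "smooth_mfd Y" and F: "smooth_map X Y F" and t: "tvec X p \<tau>"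
  shows "tvec Y (F p) (\<lambda>f. \<tau> (f \<circ> F))"
proof -
  obtain V \<phi> v where V: "chart X V \<phi>" "p \<in> V" "\<And>f. smooth_at X p f \<Longrightarrow> \<tau> f = dchart p V \<phi> v f"
    using t unfolding tvec_def[OF X] by blast
  have "F p \<in> pts Y" using smooth_map_in_topspace[OF F] chartD(2)[OF V(1)] V(2) by blast
  then obtain W \<psi> where W: "chart Y W \<psi>" "F p \<in> W" using ex_chart[OF Y] by blast
  have pX: "p \<in> pts X" using chartD(2)[OF V(1)] V(2) by blast
  note pull = smooth_at_pullback[OF X Y F pX]
  have oW: "opn X {x \<in> pts X. F x \<in> W}" by (rule smooth_map_preimage_open[OF F chartD(1)[OF W(1)]])
  have pW: "p \<in> {x \<in> pts X. F x \<in> W}" using W V chartD(2)[OF V(1)] by auto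
  have "\<tau> (f \<circ> F) = dchart (F p) W \<psi> (dchart p V \<phi> v (\<psi> \<circ> F)) f" if f: "smooth_at Y (F p) f" for f
  proof -
    have D: "((f \<circ> inv_into W \<psi>) has_derivative (\<lambda>w. dchart (F p) W \<psi> w f)) (at ((\<psi> \<circ> F) p))"
      using dchart_has_derivative[OF Y W f] by simp
    have "dchart p V \<phi> v (f \<circ> F) = dchart (F p) W \<psi> (dchart p V \<phi> v (\<psi> \<circ> F)) f"
      by (rule dchart_chain[OF X V(1,2) pull[OF smooth_at_chart[OF Y W]] D oW pW])
        (simp add: chartD(4)[OF W(1)])
    then show ?thesis using V(3)[OF pull[OF f]] by simp
  qed
  then show ?thesis unfolding tvec_def[OF Y] using W by blast
qed

section \<open>The blow-up tower\<close>

lemma bounded_linear_zc: "bounded_linear (zc e j)"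
proof -
  have "zc e j = (\<lambda>v. of_real (v \<bullet> e (2 * j)) + \<i> * of_real (v \<bullet> e (2 * j + 1)))"
    unfolding zc_def by (auto simp: complex_eq_iff)
  moreover have "bounded_linear (\<lambda>v. of_real (v \<bullet> e (2 * j)) + \<i> * (of_real (v \<bullet> e (2 * j + 1)) :: complex))"
    by (intro bounded_linear_add bounded_linear_compose[OF bounded_linear_of_real bounded_linear_inner_left]
        bounded_linear_compose[OF bounded_linear_mult_right
          bounded_linear_compose[OF bounded_linear_of_real bounded_linear_inner_left]])
  ultimately show ?thesis by simp
qed

lemmas zc_add = bounded_linear.linear[OF bounded_linear_zc, THEN linear_add]
lemmas zc_diff = bounded_linear.linear[OF bounded_linear_zc, THEN linear_diff]
lemmas zc_scale = bounded_linear.linear[OF bounded_linear_zc, THEN linear_scale]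
lemmas zc_0 = bounded_linear.linear[OF bounded_linear_zc, THEN linear_0]

lemma frame_inner:
  assumes "frame_enum e" "r < DIM('e)" "r' < DIM('e::euclidean_space)"
  shows "(e r :: 'e) \<bullet> e r' = (if r = r' then 1 else 0)"
proof -
  have b: "e r \<in> Basis" "e r' \<in> Basis" "e r = e r' \<longleftrightarrow> r = r'"
    using assms unfolding frame_enum_def bij_betw_def inj_on_def by auto
  show ?thesis using inner_Basis[OF b(1,2)] b(3) by simp
qed

lemma frame_vector:
  assumes "frame_enum (e :: nat \<Rightarrow> 'e::euclidean_space)"
  obtains v where "\<And>r. r < DIM('e) \<Longrightarrow> v \<bullet> e r = c r"
proof (rule that)
  fix r assume r: "r < DIM('e)"
  have "(\<Sum>s<DIM('e). c s *\<^sub>R e s) \<bullet> e r = (\<Sum>s<DIM('e). if s = r then c s else 0)"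
    unfolding inner_sum_left by (rule sum.cong) (use frame_inner[OF assms _ r] in auto)
  then show "(\<Sum>s<DIM('e). c s *\<^sub>R e s) \<bullet> e r = c r" using r by simp
qed

lemma frame_eqI:
  assumes "frame_enum (e :: nat \<Rightarrow> 'e::euclidean_space)" "\<And>r. r < DIM('e) \<Longrightarrow> v \<bullet> e r = w \<bullet> e r"
  shows "v = w"
proof (rule euclidean_eqI)
  fix b :: 'e assume "b \<in> Basis"
  then obtain r where "r < DIM('e)" "b = e r" using assms(1) unfolding frame_enum_def bij_betw_def by auto
  then show "v \<bullet> b = w \<bullet> b" using assms(2) by simp
qed

lemma zc_vector:
  assumes e: "frame_enum (e :: nat \<Rightarrow> 'e::euclidean_space)" and k: "2 * k \<le> DIM('e)"
  obtains v where "\<And>j. j < k \<Longrightarrow> zc e j v = c j" "\<And>r. 2 * k \<le> r \<Longrightarrow> r < DIM('e) \<Longrightarrow> v \<bullet> e r = d r"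
proof -
  obtain v where v: "\<And>r. r < DIM('e) \<Longrightarrow> v \<bullet> e r =
     (if r < 2 * k then (if even r then Re (c (r div 2)) else Im (c (r div 2))) else d r)"
    using frame_vector[OF e, of "\<lambda>r. if r < 2 * k then (if even r then Re (c (r div 2)) else Im (c (r div 2))) else d r"] by blast
  show thesis
  proof (rule that[of v])
    fix j assume "j < k"
    then have j: "2 * j < 2 * k" "2 * j + 1 < 2 * k" by auto
    have "v \<bullet> e (2 * j) = Re (c j)" "v \<bullet> e (2 * j + 1) = Im (c j)" using v[of "2 * j"] v[of "2 * j + 1"] j k by auto
    then show "zc e j v = c j" unfolding zc_def by (simp add: complex_eq_iff)
  qed (use v in auto)
qed

lemma zc_eqI:
  assumes e: "frame_enum (e :: nat \<Rightarrow> 'e::euclidean_space)"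
    and "\<And>j. j < k \<Longrightarrow> zc e j v = zc e j w" "\<And>r. 2 * k \<le> r \<Longrightarrow> r < DIM('e) \<Longrightarrow> v \<bullet> e r = w \<bullet> e r"
  shows "v = w"
proof (rule frame_eqI[OF e])
  fix r assume r: "r < DIM('e)"
  show "v \<bullet> e r = w \<bullet> e r"
  proof (cases "r < 2 * k")
    case True
    then have "zc e (r div 2) v = zc e (r div 2) w" using assms(2) by auto
    then show ?thesis unfolding zc_def by (cases "even r") (auto elim!: evenE oddE)
  next
    case False
    then show ?thesis using assms(3)[of r] r by simp
  qed
qed

lemma smooth_at_zc_chart:
  assumes "smooth_mfd X" "chart X V \<phi>" "p \<in> V"
  shows "smooth_at X p (\<lambda>q. zc e j (\<phi> q))" using smooth_at_linear[OF assms(1) bounded_linear_zc smooth_at_chart[OF assms]] .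

lemma dchart_zc_chart:
  assumes "smooth_mfd X" "chart X V \<phi>" "p \<in> V"
  shows "dchart p V \<phi> v (\<lambda>q. zc e j (\<phi> q)) = zc e j v"
  using dchart_chain[OF assms(1,2,3) smooth_at_chart[OF assms] bounded_linear_imp_has_derivative[OF bounded_linear_zc]
      chartD(1)[OF assms(2)] assms(3), of "\<lambda>q. zc e j (\<phi> q)" e j v] dchart_self[OF assms] by simp

lemma blowup_overE:
  assumes "blowup_over X Y \<beta> c V \<phi> e"
  obtains W \<psi> where "{y \<in> pts Y. \<beta> y \<in> V} = (\<Union>m<c. W m)"
    "\<And>m. m < c \<Longrightarrow> chart Y (W m) (\<psi> m)"
    "\<And>m y. m < c \<Longrightarrow> y \<in> W m \<Longrightarrow> blow_rel e c m (\<psi> m y) (\<phi> (\<beta> y))"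
    "\<And>m l. m < c \<Longrightarrow> l < c \<Longrightarrow> l \<noteq> m \<Longrightarrow> W m \<inter> W l = {y \<in> W m. zc e l (\<psi> m y) \<noteq> 0}"
  using assms unfolding blowup_over_def
proof (elim exE conjE)
  fix W \<psi>
  assume W: "{y \<in> pts Y. \<beta> y \<in> V} = (\<Union>m<c. W m)"
    and c: "\<forall>m<c. chart Y (W m) (\<psi> m) \<and> (\<forall>y\<in>W m. blow_rel e c m (\<psi> m y) (\<phi> (\<beta> y))) \<and>
        \<psi> m ` W m = {v. \<exists>w\<in>\<phi> ` V. blow_rel e c m v w}"
    and l: "\<forall>m<c. \<forall>l<c. l \<noteq> m \<longrightarrow> W m \<inter> W l = {y \<in> W m. zc e l (\<psi> m y) \<noteq> 0}"
  show thesis by (rule that[OF W]) (use c l in blast)+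
qed

text \<open>The step of the induction over the tower: on the blow-up, one of two functions \<open>f 0, f 1\<close> that define the
  centre divides the other, and tangent vectors lift as soon as they satisfy the differentiated relation; the
  differential of the quotient is then free, because it is nonzero on the tangent space of the fibre.\<close>

lemma blow_step:
  fixes Z :: "('p, 'e::euclidean_space) mfd" and Y :: "('q, 'e) mfd" and f :: "nat \<Rightarrow> 'p \<Rightarrow> complex"
    and A :: "nat \<Rightarrow> nat \<Rightarrow> 'p \<Rightarrow> complex"
  assumes Z: "smooth_mfd Z" and Y: "smooth_mfd Y" and \<delta>: "smooth_map Y Z \<delta>"
    and cV: "chart Z V \<phi>" and e: "frame_enum e" and dim: "4 \<le> DIM('e)" and over: "blowup_over Z Y \<delta> 2 V \<phi> e"
    and y: "y \<in> pts Y" and z: "\<delta> y = z" "z \<in> V"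
    and w0: "\<And>l. l < 2 \<Longrightarrow> zc e l (\<phi> z) = 0"
    and A: "\<And>k l. k < 2 \<Longrightarrow> l < 2 \<Longrightarrow> smooth_at Z z (A k l)"
    and U: "opn Z U" "z \<in> U"
    and f: "\<And>k q. k < 2 \<Longrightarrow> q \<in> U \<Longrightarrow> f k q = A k 0 q * zc e 0 (\<phi> q) + A k 1 q * zc e 1 (\<phi> q)"
    and det: "A 0 0 z * A 1 1 z \<noteq> A 0 1 z * A 1 0 z"
  obtains k b where "k < 2" "smooth_at Y y b"
    "\<exists>U. opn Y U \<and> y \<in> U \<and> (\<forall>q\<in>U. f (1 - k) (\<delta> q) = b q * f k (\<delta> q))"
    "\<And>\<tau> d. tvec Z z \<tau> \<Longrightarrow> \<tau> (f (1 - k)) = b y * \<tau> (f k) \<Longrightarrow>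
      \<exists>\<tau>'. tvec Y y \<tau>' \<and> (\<forall>g. smooth_at Z z g \<longrightarrow> \<tau>' (g \<circ> \<delta>) = \<tau> g) \<and> \<tau>' b = d"
proof -
  obtain W \<psi> where W: "{y \<in> pts Y. \<delta> y \<in> V} = (\<Union>m<2. W m)"
    and cW: "\<And>m. m < 2 \<Longrightarrow> chart Y (W m) (\<psi> m)"
    and rel: "\<And>m y. m < 2 \<Longrightarrow> y \<in> W m \<Longrightarrow> blow_rel e 2 m (\<psi> m y) (\<phi> (\<delta> y))"
    and "\<And>m l. m < 2 \<Longrightarrow> l < 2 \<Longrightarrow> l \<noteq> m \<Longrightarrow> W m \<inter> W l = {y \<in> W m. zc e l (\<psi> m y) \<noteq> 0}"
    by (rule blowup_overE[OF over]) (rule that)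
  have "y \<in> (\<Union>m<2. W m)" using W y z by auto
  then obtain m where m: "m < 2" "y \<in> W m" by blast
  define l where "l = 1 - m"
  have l: "l < 2" "l \<noteq> m" "m = 0 \<and> l = 1 \<or> m = 1 \<and> l = 0"
  proof -
    have "m = 0 \<or> m = 1" using m(1) by linarith
    then show "l < 2" "l \<noteq> m" "m = 0 \<and> l = 1 \<or> m = 1 \<and> l = 0" unfolding l_def by auto
  qed
  note cWm = cW[OF m(1)]
  \<comment> \<open>In the affine chart \<open>m\<close> that contains \<open>y\<close>,
    \<open>t\<close> is the equation of the exceptional divisor and \<open>B\<close> is the ratio of
    the two centre coordinates.\<close>
  define B where "B = (\<lambda>q. zc e l (\<psi> m q))"
  define t where "t = (\<lambda>q. zc e m (\<psi> m q))"
  have sB: "smooth_at Y y B" unfolding B_def by (rule smooth_at_zc_chart[OF Y cWm m(2)])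
  have st: "smooth_at Y y t" unfolding t_def by (rule smooth_at_zc_chart[OF Y cWm m(2)])
  have wm: "zc e m (\<phi> (\<delta> q)) = t q" and wl: "zc e l (\<phi> (\<delta> q)) = B q * t q"
    and wr: "\<And>r. 4 \<le> r \<Longrightarrow> r < DIM('e) \<Longrightarrow> \<phi> (\<delta> q) \<bullet> e r = \<psi> m q \<bullet> e r" if "q \<in> W m" for q
    using rel[OF m(1) that] m l unfolding blow_rel_def B_def t_def by auto
  have ty: "t y = 0" using wm[OF m(2)] w0[OF m(1)] z by simp
  \<comment> \<open>\<open>u k\<close> is the pullback of \<open>f k\<close> divided by the
    exceptional equation \<open>t\<close>.\<close>
  define u where "u = (\<lambda>k q. A k m (\<delta> q) + A k l (\<delta> q) * B q)"
  have pA: "smooth_at Y y (\<lambda>q. A k j (\<delta> q))" if "k < 2" "j < 2" for k j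
    using smooth_at_pullback[OF Y Z \<delta> y, of "A k j"] A[OF that] z by (simp add: comp_def)
  have su: "smooth_at Y y (u k)" if "k < 2" for k unfolding u_def by (intro smooth_at_add[OF Y] smooth_at_mult[OF Y] pA sB that m l)
  define U1 where "U1 = {q \<in> pts Y. \<delta> q \<in> U} \<inter> W m"
  have U1: "opn Y U1" "y \<in> U1" unfolding U1_def using smooth_map_preimage_open[OF \<delta> U(1)] chartD(1)[OF cWm] y z U m by auto
  have fu: "f k (\<delta> q) = u k q * t q" if "k < 2" "q \<in> U1" for k q
  proof -
    have q: "\<delta> q \<in> U" "q \<in> W m" using that unfolding U1_def by auto
    show ?thesis using f[OF that(1) q(1)] wm[OF q(2)] wl[OF q(2)] l(3) unfolding u_def by (auto simp: algebra_simps)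
  qed
  \<comment> \<open>The two values are the image of the nonzero vector with entries 1 and
    \<open>B y\<close> under the invertible matrix of the \<open>A k l z\<close>. The index with
    nonzero value is the divisor; \<open>b\<close> will be the other \<open>u\<close> over this
    one.\<close>
  have "\<exists>k<2. u k y \<noteq> 0"
  proof (rule ccontr)
    assume "\<not> ?thesis"
    then have "A 0 m z + A 0 l z * B y = 0" "A 1 m z + A 1 l z * B y = 0" unfolding u_def z by (auto simp: less_2_cases_iff)
    then have "A 0 m z = - (A 0 l z * B y)" "A 1 m z = - (A 1 l z * B y)" by (auto simp: add_eq_0_iff2)
    then show False using det l(3) by auto
  qed
  then obtain k where k: "k < 2" "u k y \<noteq> 0" by blast
  define k' where "k' = 1 - k"
  have k': "k' < 2" "k = 0 \<and> k' = 1 \<or> k = 1 \<and> k' = 0"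
  proof -
    have "k = 0 \<or> k = 1" using k(1) by linarith
    then show "k' < 2" "k = 0 \<and> k' = 1 \<or> k = 1 \<and> k' = 0" unfolding k'_def by auto
  qed
  define \<Delta> where "\<Delta> = A k' l z * A k m z - A k' m z * A k l z"
  have det': "\<Delta> \<noteq> 0" unfolding \<Delta>_def using det k'(2) l(3) by (auto simp: algebra_simps)
  define b where "b = (\<lambda>q. u k' q * inverse (u k q))"
  have sb: "smooth_at Y y b" unfolding b_def by (intro smooth_at_mult[OF Y] smooth_at_inverse[OF Y] su k k')
  obtain U2 where U2: "opn Y U2" "y \<in> U2" "\<And>q. q \<in> U2 \<Longrightarrow> u k q \<in> - {0}"
    by (rule smooth_at_continuous[OF Y su[OF k(1)], of "- {0}"]) (use k in auto)
  have by': "b y * u k y = u k' y" unfolding b_def using k by simp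
  have rel_b: "\<exists>U. opn Y U \<and> y \<in> U \<and> (\<forall>q\<in>U. f (1 - k) (\<delta> q) = b q * f k (\<delta> q))"
  proof (intro exI conjI ballI)
    show "opn Y (U1 \<inter> U2)" "y \<in> U1 \<inter> U2" using U1 U2 by auto
    fix q assume q: "q \<in> U1 \<inter> U2"
    then show "f (1 - k) (\<delta> q) = b q * f k (\<delta> q)" using fu[OF k(1)] fu[OF k'(1)] U2(3) unfolding b_def k'_def by auto
  qed
  have s\<phi>: "smooth_at Y y (\<phi> \<circ> \<delta>)"
    using smooth_at_pullback[OF Y Z \<delta> y, of \<phi>] smooth_at_chart[OF Z cV] z by simp
  have bl: "bounded_linear (\<lambda>v. dchart y (W m) (\<psi> m) v h)" if "smooth_at Y y h" for h :: "'q \<Rightarrow> 'k::real_normed_vector"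
    by (rule dchart_linear[OF Y cWm m(2) that])
  have D\<delta>: "dchart y (W m) (\<psi> m) v (g \<circ> \<delta>) = dchart z V \<phi> (dchart y (W m) (\<psi> m) v (\<phi> \<circ> \<delta>)) g"
    if g: "smooth_at Z z g" for g :: "'p \<Rightarrow> complex" and v
  proof (rule dchart_chain[OF Y cWm m(2) s\<phi>])
    show "((g \<circ> inv_into V \<phi>) has_derivative (\<lambda>w. dchart z V \<phi> w g)) (at ((\<phi> \<circ> \<delta>) y))"
      using dchart_has_derivative[OF Z cV z(2) g] z by simp
    show "opn Y {q \<in> pts Y. \<delta> q \<in> V}" by (rule smooth_map_preimage_open[OF \<delta> chartD(1)[OF cV]])
    show "y \<in> {q \<in> pts Y. \<delta> q \<in> V}" using y z by simp
    show "(g \<circ> \<delta>) q = (g \<circ> inv_into V \<phi>) ((\<phi> \<circ> \<delta>) q)" if "q \<in> {q \<in> pts Y. \<delta> q \<in> V}" for q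
      using that by (simp add: chartD(4)[OF cV])
  qed
  \<comment> \<open>The differential of \<delta> in these coordinates keeps the \<open>m\<close>-th
    complex coordinate and the real ones from index 4 on. It sends the \<open>l\<close>-th one to
    \<open>B y\<close> times the \<open>m\<close>-th, because \<open>t y = 0\<close> kills the other
    term of the product rule. Its kernel is the \<open>l\<close>-th complex direction, the tangent
    space of the fibre.\<close>
  have zm: "zc e m (dchart y (W m) (\<psi> m) v (\<phi> \<circ> \<delta>)) = zc e m v" for v
  proof -
    have "dchart y (W m) (\<psi> m) v t = zc e m (dchart y (W m) (\<psi> m) v (\<phi> \<circ> \<delta>))"
      by (rule dchart_chain[OF Y cWm m(2) s\<phi> bounded_linear_imp_has_derivative[OF bounded_linear_zc]
            chartD(1)[OF cWm] m(2)]) (simp add: wm)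
    then show ?thesis unfolding t_def dchart_zc_chart[OF Y cWm m(2)] by simp
  qed
  have zl: "zc e l (dchart y (W m) (\<psi> m) v (\<phi> \<circ> \<delta>)) = B y * zc e m v" for v
  proof -
    have "dchart y (W m) (\<psi> m) v (\<lambda>q. B q * t q) = zc e l (dchart y (W m) (\<psi> m) v (\<phi> \<circ> \<delta>))"
      by (rule dchart_chain[OF Y cWm m(2) s\<phi> bounded_linear_imp_has_derivative[OF bounded_linear_zc]
            chartD(1)[OF cWm] m(2)]) (simp add: wl)
    moreover have "dchart y (W m) (\<psi> m) v (\<lambda>q. B q * t q) = B y * dchart y (W m) (\<psi> m) v t + dchart y (W m) (\<psi> m) v B * t y"
      by (rule tvec_mult[OF Y tvec_dchart[OF Y cWm m(2)] sB st])
    ultimately show ?thesis unfolding t_def dchart_zc_chart[OF Y cWm m(2)] using ty by (simp add: t_def)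
  qed
  have zr: "dchart y (W m) (\<psi> m) v (\<phi> \<circ> \<delta>) \<bullet> e r = v \<bullet> e r" if "4 \<le> r" "r < DIM('e)" for v r
  proof -
    have "dchart y (W m) (\<psi> m) v (\<lambda>q. \<psi> m q \<bullet> e r) = dchart y (W m) (\<psi> m) v (\<phi> \<circ> \<delta>) \<bullet> e r"
      by (rule dchart_chain[OF Y cWm m(2) s\<phi> bounded_linear_imp_has_derivative[OF bounded_linear_inner_left]
            chartD(1)[OF cWm] m(2)]) (simp add: wr that)
    moreover have "dchart y (W m) (\<psi> m) v (\<lambda>q. \<psi> m q \<bullet> e r) = dchart y (W m) (\<psi> m) v (\<psi> m) \<bullet> e r"
      by (rule dchart_chain[OF Y cWm m(2) smooth_at_chart[OF Y cWm m(2)]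
            bounded_linear_imp_has_derivative[OF bounded_linear_inner_left] chartD(1)[OF cWm] m(2)]) simp
    ultimately show ?thesis using dchart_self[OF Y cWm m(2)] by simp
  qed
  \<comment> \<open>On vectors already satisfying the relation that defines the image the
    differential acts as the identity in coordinates, so such a vector is its own lift.\<close>
  have fix_vec: "dchart y (W m) (\<psi> m) v (\<phi> \<circ> \<delta>) = v" if "zc e l v = B y * zc e m v" for v
  proof (rule zc_eqI[OF e, of 2])
    fix j :: nat assume "j < 2"
    then have "j = m \<or> j = l" using l by auto
    then show "zc e j (dchart y (W m) (\<psi> m) v (\<phi> \<circ> \<delta>)) = zc e j v" using zm[of v] zl[of v] that by auto
  qed (use zr[of _ v] in simp)
  have mult_vec: "\<exists>\<kappa>'. (\<forall>j<2. zc e j \<kappa>' = (if j = l then d else 0)) \<and> (\<forall>r. 4 \<le> r \<longrightarrow> r < DIM('e) \<longrightarrow> \<kappa>' \<bullet> e r = 0)" for d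
  proof -
    obtain v where "\<And>j. j < 2 \<Longrightarrow> zc e j v = (if j = l then d else 0)"
      "\<And>r. 2 * 2 \<le> r \<Longrightarrow> r < DIM('e) \<Longrightarrow> v \<bullet> e r = 0"
      using zc_vector[OF e, of 2 "\<lambda>j. if j = l then d else 0" "\<lambda>r. 0"] dim by auto
    then show ?thesis by (intro exI[of _ v] conjI allI impI) simp_all
  qed
  have lift: "\<exists>\<tau>'. tvec Y y \<tau>' \<and> (\<forall>g. smooth_at Z z g \<longrightarrow> \<tau>' (g \<circ> \<delta>) = \<tau> g) \<and> \<tau>' b = d"
    if \<tau>: "tvec Z z \<tau>" and r: "\<tau> (f k') = b y * \<tau> (f k)" for \<tau> d
  proof -
    obtain v where v: "\<And>g. smooth_at Z z g \<Longrightarrow> \<tau> g = dchart z V \<phi> v g"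
      using tvec_rep[OF Z \<tau> cV z(2)] by blast
    have sw: "smooth_at Z z (\<lambda>q. zc e j (\<phi> q))" for j by (rule smooth_at_zc_chart[OF Z cV z(2)])
    have tw: "\<tau> (\<lambda>q. zc e j (\<phi> q)) = zc e j v" for j using v[OF sw] dchart_zc_chart[OF Z cV z(2)] by simp
    have tf: "\<tau> (f j) = A j m z * zc e m v + A j l z * zc e l v" if j: "j < 2" for j
    proof -
      have s: "smooth_at Z z (\<lambda>q. A j i q * zc e i (\<phi> q))"
        and t': "\<tau> (\<lambda>q. A j i q * zc e i (\<phi> q)) = A j i z * zc e i v" if "i < 2" for i
        using smooth_at_mult[OF Z A[OF j that] sw] tvec_mult[OF Z \<tau> A[OF j that] sw] tw w0[OF that] by auto
      have "\<tau> (f j) = \<tau> (\<lambda>q. A j 0 q * zc e 0 (\<phi> q) + A j 1 q * zc e 1 (\<phi> q))"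
        by (rule tvec_cong[OF Z \<tau> smooth_at_add[OF Z s s] U]) (auto simp: f[OF j])
      also have "\<dots> = A j 0 z * zc e 0 v + A j 1 z * zc e 1 v" by (subst tvec_add[OF Z \<tau> s s]) (use t' in auto)
      finally show ?thesis using l(3) by auto
    qed
    \<comment> \<open>After substitution of \<open>tf\<close> the hypothesis on \<tau> becomes
      \<Delta> times the relation that puts \<open>v\<close> into the image of the differential of
      \<delta>.\<close>
    have "\<tau> (f k') * u k y = u k' y * \<tau> (f k)" using r by' by (simp add: mult.commute mult.left_commute)
    then have "\<Delta> * (zc e l v - B y * zc e m v) = 0"
      unfolding tf[OF k(1)] tf[OF k'(1)] u_def z \<Delta>_def by (simp add: algebra_simps)
    then have vl: "zc e l v = B y * zc e m v" using det' by simp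
    \<comment> \<open>The vector \<kappa> is \<open>c\<close> times the fibre direction, along which
      \<open>b\<close> has derivative \<open>c * \<Delta> / (u k y * u k y)\<close>; \<Delta> is, up
      to sign, the determinant. So \<open>c\<close> is what corrects the derivative of
      \<open>b\<close> to \<open>d\<close> without changing the image below.\<close>
    define c where "c = (d - dchart y (W m) (\<psi> m) v b) * (u k y * u k y) / \<Delta>"
    obtain \<kappa> where \<kappa>: "\<And>j. j < 2 \<Longrightarrow> zc e j \<kappa> = (if j = l then c else 0)"
      "\<And>r. 4 \<le> r \<Longrightarrow> r < DIM('e) \<Longrightarrow> \<kappa> \<bullet> e r = 0" using mult_vec[of c] by blast
    have \<kappa>0: "dchart y (W m) (\<psi> m) \<kappa> (\<phi> \<circ> \<delta>) = 0"
    proof (rule zc_eqI[OF e, of 2])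
      fix j :: nat assume "j < 2"
      then have "j = m \<or> j = l" using l by auto
      then show "zc e j (dchart y (W m) (\<psi> m) \<kappa> (\<phi> \<circ> \<delta>)) = zc e j 0"
        using zm[of \<kappa>] zl[of \<kappa>] \<kappa>(1)[OF m(1)] l by (auto simp: zc_0)
    qed (use zr[of _ \<kappa>] \<kappa>(2) in simp)
    have \<kappa>g: "dchart y (W m) (\<psi> m) \<kappa> (g \<circ> \<delta>) = 0" if "smooth_at Z z g" for g :: "'p \<Rightarrow> complex"
      using D\<delta>[OF that, of \<kappa>] \<kappa>0 linear_0[OF bounded_linear.linear[OF dchart_linear[OF Z cV z(2) that]]] by simp
    define K :: "('q \<Rightarrow> complex) \<Rightarrow> complex" where "K = dchart y (W m) (\<psi> m) \<kappa>"
    have tK: "tvec Y y K" unfolding K_def by (rule tvec_dchart[OF Y cWm m(2)])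
    have KB: "K B = c" unfolding K_def B_def dchart_zc_chart[OF Y cWm m(2)] using \<kappa>(1)[OF l(1)] by simp
    have KA: "K (\<lambda>q. A i j (\<delta> q)) = 0" if "i < 2" "j < 2" for i j
      using \<kappa>g[OF A[OF that]] unfolding K_def by (simp add: comp_def)
    have Ku: "K (u i) = A i l z * c" if "i < 2" for i unfolding u_def
      by (subst tvec_add[OF Y tK pA[OF that m(1)] smooth_at_mult[OF Y pA[OF that l(1)] sB]])
        (simp add: tvec_mult[OF Y tK pA[OF that l(1)] sB] KA that m l KB z)
    have "K (u k') = K (\<lambda>q. b q * u k q)" by (rule tvec_cong[OF Y tK smooth_at_mult[OF Y sb su[OF k(1)]] U2(1,2)])
        (use U2(3) in \<open>auto simp: b_def\<close>)
    also have "\<dots> = b y * K (u k) + K b * u k y" by (rule tvec_mult[OF Y tK sb su[OF k(1)]])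
    finally have Kbu: "K b * u k y = A k' l z * c - b y * (A k l z * c)" using Ku k k' by simp
    have "K b * (u k y * u k y) = (K b * u k y) * u k y" by simp
    also have "\<dots> = c * (A k' l z * u k y - (b y * u k y) * A k l z)" unfolding Kbu by (simp add: algebra_simps)
    also have "\<dots> = c * \<Delta>" unfolding by' unfolding u_def z \<Delta>_def by (simp add: algebra_simps)
    also have "\<dots> = (d - dchart y (W m) (\<psi> m) v b) * (u k y * u k y)" unfolding c_def using det' by simp
    finally have Kb: "K b = d - dchart y (W m) (\<psi> m) v b" using k(2) by simp
    define \<tau>' where "\<tau>' = (\<lambda>h::'q \<Rightarrow> complex. dchart y (W m) (\<psi> m) (v + \<kappa>) h)"
    have "tvec Y y \<tau>'" unfolding \<tau>'_def by (rule tvec_dchart[OF Y cWm m(2)])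
    moreover have split: "\<tau>' h = dchart y (W m) (\<psi> m) v h + K h" if "smooth_at Y y h" for h
      unfolding \<tau>'_def K_def using linear_add[OF bounded_linear.linear[OF bl[OF that]]] .
    moreover have "\<tau>' (g \<circ> \<delta>) = \<tau> g" if g: "smooth_at Z z g" for g
    proof -
      have "smooth_at Y y (g \<circ> \<delta>)" using smooth_at_pullback[OF Y Z \<delta> y, of g] g z by simp
      then show ?thesis using split \<kappa>g[OF g] D\<delta>[OF g, of v] fix_vec[OF vl] v[OF g] unfolding K_def by simp
    qed
    ultimately show ?thesis using Kb sb by auto
  qed
  show thesis by (rule that[OF k(1) sb rel_b lift[unfolded k'_def]])
qed

section \<open>Generated sheaves and the differentials of their sections at a point\<close>

lemma gen_sheaf_base:
  assumes "f \<in> smooth_funs X V" "opn X V" "(V, f) \<in> S"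
  shows "f \<in> gen_sheaf X S V" unfolding gen_sheaf_def
proof (clarify, intro conjI ballI)
  show "f \<in> smooth_funs X V" by fact
  fix x assume "x \<in> V"
  then show "\<exists>W (c::nat) h f'. opn X W \<and> x \<in> W \<and> W \<subseteq> V \<and>
     (\<forall>l<c. h l \<in> smooth_funs X W \<and> (\<exists>V. W \<subseteq> V \<and> (V, f' l) \<in> S)) \<and>
     (\<forall>y\<in>W. f y = (\<Sum>l<c. h l y * f' l y))" using assms smooth_funs_const[of 1 X V]
    by (intro exI[of _ V] exI[of _ "1::nat"] exI[of _ "\<lambda>_ _. 1"] exI[of _ "\<lambda>_. f"]) auto
qed

lemma gen_sheafE:
  fixes X :: "('p, 'e::euclidean_space) mfd" and g :: "'p \<Rightarrow> 'k::real_normed_field"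
  assumes "g \<in> gen_sheaf X S U" "x \<in> U"
  obtains V c h f where "opn X V" "x \<in> V" "V \<subseteq> U"
     "\<And>l. l < (c::nat) \<Longrightarrow> h l \<in> smooth_funs X V" "\<And>l. l < c \<Longrightarrow> \<exists>V'. V \<subseteq> V' \<and> (V', f l) \<in> S"
     "\<And>y. y \<in> V \<Longrightarrow> g y = (\<Sum>l<c. h l y * f l y)"
proof -
  have "\<exists>W (c::nat) h f. opn X W \<and> x \<in> W \<and> W \<subseteq> U \<and>
     (\<forall>l<c. h l \<in> smooth_funs X W \<and> (\<exists>V. W \<subseteq> V \<and> (V, f l) \<in> S)) \<and>
     (\<forall>y\<in>W. g y = (\<Sum>l<c. h l y * f l y))" using assms unfolding gen_sheaf_def by simp
  then show thesis
  proof (elim exE conjE)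
    fix V c h f
    assume "opn X V" "x \<in> V" "V \<subseteq> U"
     "\<forall>l<(c::nat). h l \<in> smooth_funs X V \<and> (\<exists>V'. V \<subseteq> V' \<and> (V', f l) \<in> S)"
     "\<forall>y\<in>V. g y = (\<Sum>l<c. h l y * f l y)"
    then show thesis by (intro that[of V c h f]) simp_all
  qed
qed

lemma gen_sheaf_restrict:
  assumes X: "smooth_mfd X" and g: "g \<in> gen_sheaf X S U" and W: "opn X W" "W \<subseteq> U"
  shows "g \<in> gen_sheaf X S W" unfolding gen_sheaf_def
proof (clarify, intro conjI ballI)
  show "g \<in> smooth_funs X W" using g smooth_funs_subset[OF _ W(2)] unfolding gen_sheaf_def by blast
  fix x assume x: "x \<in> W"
  then have xU: "x \<in> U" using W by blast
  obtain V c h f where V: "opn X V" "x \<in> V" "V \<subseteq> U"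
     "\<And>l. l < (c::nat) \<Longrightarrow> h l \<in> smooth_funs X V" "\<And>l. l < c \<Longrightarrow> \<exists>V'. V \<subseteq> V' \<and> (V', f l) \<in> S"
     "\<And>y. y \<in> V \<Longrightarrow> g y = (\<Sum>l<c. h l y * f l y)" by (rule gen_sheafE[OF g xU]) (rule that)
  show "\<exists>V (c::nat) h f. opn X V \<and> x \<in> V \<and> V \<subseteq> W \<and>
     (\<forall>l<c. h l \<in> smooth_funs X V \<and> (\<exists>V'. V \<subseteq> V' \<and> (V', f l) \<in> S)) \<and>
     (\<forall>y\<in>V. g y = (\<Sum>l<c. h l y * f l y))"
  proof (rule exI[of _ "V \<inter> W"], rule exI[of _ c], rule exI[of _ h], rule exI[of _ f], intro conjI allI impI)
    show "opn X (V \<inter> W)" using V W by auto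
    show "x \<in> V \<inter> W" using V x by auto
    fix l assume "l < c"
    then show "h l \<in> smooth_funs X (V \<inter> W)" using V(4) smooth_funs_subset[of "h l" X V "V \<inter> W"] by blast
    show "\<exists>V'. V \<inter> W \<subseteq> V' \<and> (V', f l) \<in> S" using V(5)[OF \<open>l < c\<close>] by blast
  qed (use V(6) in auto)
qed

text \<open>The flags \<open>bP\<close> and \<open>bQ\<close> record whether the differentials of \<open>P\<close> and \<open>Q\<close> may take part.\<close>

definition lin_form :: "('p, 'e::euclidean_space) mfd \<Rightarrow> 'p \<Rightarrow> ('p \<Rightarrow> complex) \<Rightarrow> ('p \<Rightarrow> complex) \<Rightarrow>
    bool \<Rightarrow> bool \<Rightarrow> ('p \<Rightarrow> complex) \<Rightarrow> bool" where
  "lin_form X p P Q bP bQ g \<longleftrightarrow> smooth_at X p g \<and> g p = 0 \<and>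
    (\<exists>p1 p2 q1 q2. (bP \<or> p1 = 0 \<and> p2 = 0) \<and> (bQ \<or> q1 = 0 \<and> q2 = 0) \<and>
      (\<forall>\<tau>. tvec X p \<tau> \<longrightarrow> \<tau> g = p1 * \<tau> P + p2 * cnj (\<tau> P) + q1 * \<tau> Q + q2 * cnj (\<tau> Q)))"

lemma lin_form_add:
  assumes X: "smooth_mfd X" and f: "lin_form X p P Q bP bQ f" and g: "lin_form X p P Q bP bQ g"
  shows "lin_form X p P Q bP bQ (\<lambda>x. f x + g x)"
proof -
  obtain p1 p2 q1 q2 where 1: "bP \<or> p1 = 0 \<and> p2 = 0" "bQ \<or> q1 = 0 \<and> q2 = 0"
    "\<And>\<tau>. tvec X p \<tau> \<Longrightarrow> \<tau> f = p1 * \<tau> P + p2 * cnj (\<tau> P) + q1 * \<tau> Q + q2 * cnj (\<tau> Q)"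
    using f unfolding lin_form_def by blast
  obtain r1 r2 s1 s2 where 2: "bP \<or> r1 = 0 \<and> r2 = 0" "bQ \<or> s1 = 0 \<and> s2 = 0"
    "\<And>\<tau>. tvec X p \<tau> \<Longrightarrow> \<tau> g = r1 * \<tau> P + r2 * cnj (\<tau> P) + s1 * \<tau> Q + s2 * cnj (\<tau> Q)"
    using g unfolding lin_form_def by blast
  have s: "smooth_at X p f" "smooth_at X p g" "f p = 0" "g p = 0" using f g unfolding lin_form_def by auto
  show ?thesis unfolding lin_form_def
  proof (intro conjI exI allI impI)
    show "smooth_at X p (\<lambda>x. f x + g x)" by (rule smooth_at_add[OF X s(1,2)])
    show "bP \<or> p1 + r1 = 0 \<and> p2 + r2 = 0" "bQ \<or> q1 + s1 = 0 \<and> q2 + s2 = 0" using 1 2 by auto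
    fix \<tau> assume t: "tvec X p \<tau>"
    show "\<tau> (\<lambda>x. f x + g x) = (p1 + r1) * \<tau> P + (p2 + r2) * cnj (\<tau> P) + (q1 + s1) * \<tau> Q + (q2 + s2) * cnj (\<tau> Q)"
      using tvec_add[OF X t s(1,2)] 1(3)[OF t] 2(3)[OF t] by (simp add: algebra_simps)
  qed (use s in auto)
qed

text \<open>Since \<open>f\<close> vanishes at \<open>p\<close>, the term with the derivative of
  \<open>h\<close> drops out and the coefficients are merely scaled by \<open>h p\<close>. Hence the
  form of the differential is stable under taking ideals.\<close>

lemma lin_form_mult:
  assumes X: "smooth_mfd X" and h: "smooth_at X p h" and f: "lin_form X p P Q bP bQ f"
  shows "lin_form X p P Q bP bQ (\<lambda>x. h x * f x)"
proof -
  obtain p1 p2 q1 q2 where 1: "bP \<or> p1 = 0 \<and> p2 = 0" "bQ \<or> q1 = 0 \<and> q2 = 0"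
    "\<And>\<tau>. tvec X p \<tau> \<Longrightarrow> \<tau> f = p1 * \<tau> P + p2 * cnj (\<tau> P) + q1 * \<tau> Q + q2 * cnj (\<tau> Q)"
    using f unfolding lin_form_def by blast
  have s: "smooth_at X p f" "f p = 0" using f unfolding lin_form_def by auto
  show ?thesis unfolding lin_form_def
  proof (intro conjI exI allI impI)
    show "smooth_at X p (\<lambda>x. h x * f x)" by (rule smooth_at_mult[OF X h s(1)])
    show "bP \<or> h p * p1 = 0 \<and> h p * p2 = 0" "bQ \<or> h p * q1 = 0 \<and> h p * q2 = 0" using 1 by auto
    fix \<tau> assume t: "tvec X p \<tau>"
    show "\<tau> (\<lambda>x. h x * f x) = (h p * p1) * \<tau> P + (h p * p2) * cnj (\<tau> P) + (h p * q1) * \<tau> Q + (h p * q2) * cnj (\<tau> Q)"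
      using tvec_mult[OF X t h s(1)] 1(3)[OF t] s(2) by (simp add: algebra_simps)
  qed (use s in auto)
qed

lemma lin_form_zero:
  assumes X: "smooth_mfd X" and p: "p \<in> pts X"
  shows "lin_form X p P Q bP bQ (\<lambda>_. 0)" unfolding lin_form_def by (intro conjI exI[of _ 0] allI impI)
    (use smooth_at_const[OF X p] tvec_const[OF X] in auto)

lemma lin_form_sum:
  assumes X: "smooth_mfd X" and p: "p \<in> pts X" and "finite A"
    and "\<And>l. l \<in> A \<Longrightarrow> smooth_at X p (h l) \<and> lin_form X p P Q bP bQ (f l)"
  shows "lin_form X p P Q bP bQ (\<lambda>x. \<Sum>l\<in>A. h l x * f l x)" using assms(3,4)
proof (induction A rule: finite_induct)
  case empty
  then show ?case using lin_form_zero[OF X p] by simp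
next
  case (insert l A)
  have "lin_form X p P Q bP bQ (\<lambda>x. h l x * f l x + (\<Sum>l\<in>A. h l x * f l x))"
    by (intro lin_form_add[OF X] lin_form_mult[OF X]) (use insert in auto)
  then show ?case using insert.hyps by simp
qed

lemma lin_form_cong:
  assumes X: "smooth_mfd X" and f: "lin_form X p P Q bP bQ f"
    and U: "opn X U" "p \<in> U" "\<And>q. q \<in> U \<Longrightarrow> g q = f q"
  shows "lin_form X p P Q bP bQ g"
proof -
  have s: "smooth_at X p f" "f p = 0" using f unfolding lin_form_def by auto
  have "smooth_at X p g" by (rule smooth_at_cong[OF X s(1) U])
  moreover have "\<tau> g = \<tau> f" if "tvec X p \<tau>" for \<tau> by (rule tvec_cong[OF X that s(1) U])
  moreover obtain p1 p2 q1 q2 where 1: "bP \<or> p1 = 0 \<and> p2 = 0" "bQ \<or> q1 = 0 \<and> q2 = 0"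
    "\<And>\<tau>. tvec X p \<tau> \<Longrightarrow> \<tau> f = p1 * \<tau> P + p2 * cnj (\<tau> P) + q1 * \<tau> Q + q2 * cnj (\<tau> Q)"
    using f unfolding lin_form_def by blast
  ultimately show ?thesis unfolding lin_form_def
    by (intro conjI exI[of _ p1] exI[of _ p2] exI[of _ q1] exI[of _ q2] 1(1,2)) (use U s 1(3) in auto)
qed

text \<open>Carries information about chosen generators over to every section of the sheaf, in
  particular to the unknown coordinates in which a blow-up is described.\<close>

lemma lin_form_gen_sheaf:
  assumes X: "smooth_mfd X" and g: "g \<in> gen_sheaf X S U" and p: "p \<in> U" "p \<in> pts X"
    and S: "\<And>V f. (V, f) \<in> S \<Longrightarrow> p \<in> V \<Longrightarrow> lin_form X p P Q bP bQ f"
  shows "lin_form X p P Q bP bQ g"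
proof -
  obtain V c h f where V: "opn X V" "p \<in> V" "V \<subseteq> U"
     "\<And>l. l < (c::nat) \<Longrightarrow> h l \<in> smooth_funs X V" "\<And>l. l < c \<Longrightarrow> \<exists>V'. V \<subseteq> V' \<and> (V', f l) \<in> S"
     "\<And>y. y \<in> V \<Longrightarrow> g y = (\<Sum>l<c. h l y * f l y)" by (rule gen_sheafE[OF g p(1)]) (rule that)
  have "lin_form X p P Q bP bQ (\<lambda>x. \<Sum>l<c. h l x * f l x)"
  proof (rule lin_form_sum[OF X p(2)])
    fix l assume "l \<in> {..<c}"
    then have l: "h l \<in> smooth_funs X V" "\<exists>V'. V \<subseteq> V' \<and> (V', f l) \<in> S" using V(4,5) by auto
    then obtain V' where V': "V \<subseteq> V'" "(V', f l) \<in> S" by blast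
    have "smooth_at X p (h l)" by (rule smooth_atI[OF l(1) V(1,2)])
    then show "smooth_at X p (h l) \<and> lin_form X p P Q bP bQ (f l)" using S[OF V'(2)] V V' by blast
  qed simp
  then show ?thesis by (rule lin_form_cong[OF X _ V(1,2)]) (rule V(6))
qed

lemma lin_form_pullback:
  assumes X: "smooth_mfd X" and Z: "smooth_mfd Z" and F: "smooth_map Z X F" and z: "z \<in> pts Z"
    and g: "lin_form X (F z) P Q bP bQ g"
  shows "lin_form Z z (P \<circ> F) (Q \<circ> F) bP bQ (g \<circ> F)"
proof -
  obtain p1 p2 q1 q2 where 1: "bP \<or> p1 = 0 \<and> p2 = 0" "bQ \<or> q1 = 0 \<and> q2 = 0"
    "\<And>\<tau>. tvec X (F z) \<tau> \<Longrightarrow> \<tau> g = p1 * \<tau> P + p2 * cnj (\<tau> P) + q1 * \<tau> Q + q2 * cnj (\<tau> Q)"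
    using g unfolding lin_form_def by blast
  have "\<tau> (g \<circ> F) = p1 * \<tau> (P \<circ> F) + p2 * cnj (\<tau> (P \<circ> F)) + q1 * \<tau> (Q \<circ> F) + q2 * cnj (\<tau> (Q \<circ> F))"
    if "tvec Z z \<tau>" for \<tau> using 1(3)[OF tvec_push[OF Z X F that]] .
  moreover have "smooth_at X (F z) g" using g unfolding lin_form_def by simp
  then have "smooth_at Z z (g \<circ> F)" by (rule smooth_at_pullback[OF Z X F z])
  moreover have "(g \<circ> F) z = 0" using g unfolding lin_form_def by simp
  ultimately show ?thesis unfolding lin_form_def by (intro conjI exI[of _ p1] exI[of _ p2] exI[of _ q1] exI[of _ q2] 1(1,2)) auto
qed

section \<open>Towers of blow-ups and their points off the centres\<close>

lemma smooth_map_diffeo: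
  "diffeo X Y F \<Longrightarrow> smooth_map X Y F" unfolding diffeo_def by blast

lemma iter_blowup_smooth:
  fixes X :: "('p, 'e::euclidean_space) mfd" and Z :: "('q, 'e) mfd"
  assumes X: "smooth_mfd X"
  shows "iter_blowup m X J Z \<gamma> \<Longrightarrow> smooth_mfd Z \<and> smooth_map Z X \<gamma>"
proof (induction m arbitrary: Z \<gamma>)
  case 0
  then show ?case using smooth_map_diffeo by auto
next
  case (Suc m)
  then obtain Z' :: "('q, 'e) mfd" and \<gamma>' \<delta> where Z': "iter_blowup m X J Z' \<gamma>'"
    "complex_blowup 2 Z' (pullback Z' X \<gamma>' (J m)) Z \<delta>" "\<forall>y\<in>pts Z. \<gamma> y = \<gamma>' (\<delta> y)" by auto
  have 1: "smooth_mfd Z'" "smooth_map Z' X \<gamma>'" using Suc.IH[OF Z'(1)] by auto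
  have 2: "smooth_mfd Z" "smooth_map Z Z' \<delta>" using Z'(2) unfolding complex_blowup_def by auto
  have "smooth_map Z X (\<lambda>y. \<gamma>' (\<delta> y))" by (rule smooth_map_compose[OF 2(1) 1(1) X 2(2) 1(2)])
  then have "smooth_map Z X \<gamma>" by (rule smooth_map_cong[OF 2(1) X]) (use Z'(3) in auto)
  then show ?case using 2 by simp
qed

text \<open>Unwinding the tower reaches a smooth manifold diffeomorphic to \<open>X\<close>. Here
  \<open>X\<close> itself is not yet known to be smooth: that will be deduced from this
  statement.\<close>

lemma iter_blowup_base:
  fixes X :: "('p, 'e::euclidean_space) mfd" and Z :: "('q, 'e) mfd"
  shows "iter_blowup m X J Z \<gamma> \<Longrightarrow> \<exists>(Z0 :: ('q, 'e) mfd) \<gamma>0. smooth_mfd Z0 \<and> diffeo Z0 X \<gamma>0"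
proof (induction m arbitrary: Z \<gamma>)
  case 0
  then show ?case by auto
next
  case (Suc m)
  then show ?case by auto
qed

text \<open>Over a point where some generator of the ideal is nonzero, one centre coordinate
  \<open>l\<close> is nonzero. Every point above then lies in the affine chart \<open>l\<close>,
  where the ratios and hence all coordinates are determined by the point below. Applied stage by
  stage, points off all centres have at most one preimage.\<close>

lemma iter_blowup_inj:
  fixes X :: "('p, 'e::euclidean_space) mfd" and Z :: "('q, 'e) mfd"
  assumes X: "smooth_mfd X" and J: "\<And>j. j < n \<Longrightarrow> J j = gen_sheaf X (S j)"
    and S: "\<And>j V f. j < n \<Longrightarrow> (V, f) \<in> S j \<Longrightarrow> opn X V \<and> f \<in> smooth_funs X V"
  shows "iter_blowup m X J Z \<gamma> \<Longrightarrow> m \<le> n \<Longrightarrow> y1 \<in> pts Z \<Longrightarrow> y2 \<in> pts Z \<Longrightarrow>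
    \<gamma> y1 = \<gamma> y2 \<Longrightarrow> (\<And>j. j < m \<Longrightarrow> \<exists>(V, f)\<in>S j. \<gamma> y1 \<in> V \<and> f (\<gamma> y1) \<noteq> 0) \<Longrightarrow> y1 = y2"
proof (induction m arbitrary: Z \<gamma> y1 y2)
  case 0
  then show ?case unfolding iter_blowup.simps diffeo_def by metis
next
  case (Suc m)
  then obtain Z' :: "('q, 'e) mfd" and \<gamma>' \<delta> where Z': "iter_blowup m X J Z' \<gamma>'"
    and bl: "complex_blowup 2 Z' (pullback Z' X \<gamma>' (J m)) Z \<delta>" and \<gamma>: "\<And>y. y\<in>pts Z \<Longrightarrow> \<gamma> y = \<gamma>' (\<delta> y)"
    by auto
  have sm: "smooth_mfd Z'" "smooth_map Z' X \<gamma>'" using iter_blowup_smooth[OF X Z'] by auto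
  have sZ: "smooth_mfd Z" "smooth_map Z Z' \<delta>" using bl unfolding complex_blowup_def by auto
  define z where "z = \<delta> y1"
  have zt: "z \<in> pts Z'" unfolding z_def by (rule smooth_map_in_topspace[OF sZ(2) Suc.prems(3)])
  have g1: "\<gamma> y1 = \<gamma>' z" using \<gamma> Suc.prems unfolding z_def by auto
  have "\<delta> y1 = \<delta> y2"
  proof (rule Suc.IH[OF Z'])
    show "\<gamma>' (\<delta> y1) = \<gamma>' (\<delta> y2)" using \<gamma> Suc.prems by metis
    show "\<exists>(V, f)\<in>S j. \<gamma>' (\<delta> y1) \<in> V \<and> f (\<gamma>' (\<delta> y1)) \<noteq> 0" if "j < m" for j
      using Suc.prems(6)[of j] that g1 unfolding z_def by auto
  qed (use Suc.prems smooth_map_in_topspace[OF sZ(2)] in auto)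
  then have z2: "\<delta> y2 = z" unfolding z_def by simp
  obtain V0 f where f: "(V0, f) \<in> S m" "\<gamma>' z \<in> V0" "f (\<gamma>' z) \<noteq> 0" using Suc.prems(6)[of m] g1 by auto
  have mn: "m < n" using Suc.prems by simp
  have sf: "opn X V0" "f \<in> smooth_funs X V0" using S[OF mn f(1)] by auto
  define V1 where "V1 = {q \<in> pts Z'. \<gamma>' q \<in> V0}"
  have oV1: "opn Z' V1" unfolding V1_def by (rule smooth_map_preimage_open[OF sm(2) sf(1)])
  have "f \<in> J m V0" unfolding J[OF mn] by (rule gen_sheaf_base[OF sf(2,1) f(1)])
  then have fK: "f \<circ> \<gamma>' \<in> pullback Z' X \<gamma>' (J m) V1" unfolding pullback_def
    by (intro gen_sheaf_base[OF _ oV1]) (use smooth_funs_pullback[OF sm(1) X sm(2) sf(2,1)] sf V1_def in auto)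
  from bl zt consider (a) V where "opn Z' V" "z \<in> V"
      "diffeo (open_sub Z {y \<in> pts Z. \<delta> y \<in> V}) (open_sub Z' V) \<delta>"
    | (b) V \<phi> e where "chart Z' V \<phi>" "z \<in> V" "frame_enum e" "2 * 2 \<le> DIM('e)"
      "generated_on Z' V (pullback Z' X \<gamma>' (J m)) 2 (\<lambda>l q. zc e l (\<phi> q))" "blowup_over Z' Z \<delta> 2 V \<phi> e"
    unfolding complex_blowup_def by blast
  then show ?case
  proof cases
    case a
    have "y1 \<in> pts (open_sub Z {y \<in> topspace (mtop Z). \<delta> y \<in> V})"
      "y2 \<in> pts (open_sub Z {y \<in> topspace (mtop Z). \<delta> y \<in> V})"
      using Suc.prems a z2 z_def unfolding open_sub_def by auto
    then show ?thesis using a(3) z2 z_def unfolding diffeo_def by metis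
  next
    case b
    define V2 where "V2 = V \<inter> V1"
    have oV2: "opn Z' V2" unfolding V2_def using chartD(1)[OF b(1)] oV1 by auto
    have "f \<circ> \<gamma>' \<in> pullback Z' X \<gamma>' (J m) V2"
      using gen_sheaf_restrict[OF sm(1) fK[unfolded pullback_def] oV2] unfolding pullback_def V2_def by blast
    then obtain h where h: "\<forall>x\<in>V2. (f \<circ> \<gamma>') x = (\<Sum>l<2. h l x * zc e l (\<phi> x))"
      using b(5) oV2 unfolding generated_on_def V2_def by blast
    have "z \<in> V2" unfolding V2_def V1_def using b(2) zt f(2) by auto
    then have "(\<Sum>l<2. h l z * zc e l (\<phi> z)) \<noteq> 0" using h f(3) by auto
    then have "\<exists>l<2. zc e l (\<phi> z) \<noteq> 0" by (rule contrapos_np) (auto intro!: sum.neutral)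
    then obtain l where l: "l < 2" "zc e l (\<phi> z) \<noteq> 0" by blast
    obtain W \<psi> where W: "{y \<in> pts Z. \<delta> y \<in> V} = (\<Union>m<2. W m)"
      and cW: "\<And>m. m < 2 \<Longrightarrow> chart Z (W m) (\<psi> m)"
      and rel: "\<And>m y. m < 2 \<Longrightarrow> y \<in> W m \<Longrightarrow> blow_rel e 2 m (\<psi> m y) (\<phi> (\<delta> y))"
      and ov: "\<And>m l. m < 2 \<Longrightarrow> l < 2 \<Longrightarrow> l \<noteq> m \<Longrightarrow> W m \<inter> W l = {y \<in> W m. zc e l (\<psi> m y) \<noteq> 0}"
      by (rule blowup_overE[OF b(6)]) (rule that)
    \<comment> \<open>In any other affine chart the \<open>l\<close>-th coordinate times the
      exceptional equation equals the nonzero \<open>l\<close>-th coordinate below, so the ratio is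
      nonzero and the overlap condition puts the point into \<open>W l\<close>.\<close>
    have inW: "y \<in> W l" if "y \<in> pts Z" "\<delta> y = z" for y
    proof -
      have "y \<in> (\<Union>m<2. W m)" using W that b(2) by auto
      then obtain m where m: "m < 2" "y \<in> W m" by blast
      show ?thesis
      proof (cases "m = l")
        case False
        have "zc e l (\<phi> z) = zc e l (\<psi> m y) * zc e m (\<psi> m y)" using rel[OF m] l False that unfolding blow_rel_def by auto
        then have "zc e l (\<psi> m y) \<noteq> 0" using l by auto
        then show ?thesis using ov[OF m(1) l(1)] m False by auto
      qed (use m in simp)
    qed
    have y12: "y1 \<in> W l" "y2 \<in> W l" using inW Suc.prems z2 z_def by auto
    have r1: "blow_rel e 2 l (\<psi> l y1) (\<phi> z)" and r2: "blow_rel e 2 l (\<psi> l y2) (\<phi> z)"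
      using rel[OF l(1) y12(1)] rel[OF l(1) y12(2)] z2 z_def by auto
    have el: "zc e l (\<psi> l y1) = zc e l (\<phi> z)" "zc e l (\<psi> l y2) = zc e l (\<phi> z)"
      using r1 r2 l(1) unfolding blow_rel_def by auto
    have "\<psi> l y1 = \<psi> l y2"
    proof (rule zc_eqI[OF b(3), of 2])
      fix j :: nat assume j: "j < 2"
      show "zc e j (\<psi> l y1) = zc e j (\<psi> l y2)"
      proof (cases "j = l")
        case False
        have "zc e j (\<phi> z) = zc e j (\<psi> l y1) * zc e l (\<phi> z)" "zc e j (\<phi> z) = zc e j (\<psi> l y2) * zc e l (\<phi> z)"
          using r1 r2 j False el unfolding blow_rel_def by auto
        then show ?thesis using l(2) by (metis mult_right_cancel)
      qed (use el in simp)
    next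
      fix r assume r: "2 * 2 \<le> r" "r < DIM('e)"
      have "\<phi> z \<bullet> e r = \<psi> l y1 \<bullet> e r" "\<phi> z \<bullet> e r = \<psi> l y2 \<bullet> e r"
        using r1 r2 r unfolding blow_rel_def by blast+
      then show "\<psi> l y1 \<bullet> e r = \<psi> l y2 \<bullet> e r" by simp
    qed
    then show ?thesis using chartD(3)[OF cW[OF l(1)]] y12 by (auto dest: inj_onD)
  qed
qed

text \<open>The real-linear map on the left has determinant the difference of the squared moduli of
  \<open>a\<close> and \<open>b\<close>, here positive; the witness is its explicit inverse.\<close>

lemma real_linear_plane_solve:
  assumes "cmod b < cmod a"
  obtains p where "a * p + b * cnj p = c"
proof -
  define D where "D = (cmod a)\<^sup>2 - (cmod b)\<^sup>2"
  have "(cmod b)\<^sup>2 < (cmod a)\<^sup>2" using assms by (intro power_strict_mono) auto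
  then have "D \<noteq> 0" unfolding D_def by linarith
  then have D: "of_real D \<noteq> (0::complex)" by simp
  have aa: "a * cnj a - b * cnj b = of_real D" unfolding D_def by (simp add: complex_norm_square[symmetric])
  show thesis
  proof (rule that[of "(cnj a * c - b * cnj c) / of_real D"])
    have "a * ((cnj a * c - b * cnj c) / of_real D) + b * cnj ((cnj a * c - b * cnj c) / of_real D)
       = (a * cnj a - b * cnj b) * c / of_real D" using D by (simp add: field_simps)
    then show "a * ((cnj a * c - b * cnj c) / of_real D) + b * cnj ((cnj a * c - b * cnj c) / of_real D) = c" unfolding aa using D by simp
  qed
qed

text \<open>Dimension count: a real plane has no linear image of real dimension four. It shows that
  two independent centre coordinates cannot depend on one end of an arrow alone.\<close>

lemma no_plane_surjection:
  assumes "\<And>c0 c1. \<exists>q. p0 * q + r0 * cnj q = c0 \<and> p1 * q + r1 * cnj q = (c1::complex)"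
  shows False
proof -
  define L where "L = (\<lambda>q. (p0 * q + r0 * cnj q, p1 * q + r1 * cnj q))"
  have "bounded_linear L" unfolding L_def by (intro bounded_linear_Pair bounded_linear_add bounded_linear_mult_right
        bounded_linear_compose[OF bounded_linear_mult_right bounded_linear_cnj])
  then have "dim (L ` UNIV) \<le> dim (UNIV :: complex set)" by (intro dim_image_le bounded_linear.linear)
  moreover have "L ` UNIV = UNIV"
  proof (intro equalityI subset_UNIV subsetI)
    fix x :: "complex \<times> complex"
    obtain q where "p0 * q + r0 * cnj q = fst x \<and> p1 * q + r1 * cnj q = snd x" using assms by blast
    then have "x = L q" unfolding L_def by (simp add: prod_eq_iff)
    then show "x \<in> L ` UNIV" by simp
  qed
  ultimately show False by (simp add: dim_UNIV)
qed

text \<open>\<open>SP\<close> and \<open>SQ\<close> are the generators coming from the two factors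
  of the square. \<open>P\<close> and \<open>Q\<close> are reference functions: at \<open>x\<close>
  a generator has the differential of \<open>P j\<close> or \<open>Q j\<close> followed by an
  orientation preserving real-linear map, which is what equal coorientation amounts to. That
  generators of both kinds exist at \<open>x\<close> is not among the assumptions;
  \<open>tower_step\<close> derives it from the shape of the blow-up.\<close>

locale blow_centres =
  fixes X :: "('p, 'e::euclidean_space) mfd" and x :: 'p and n :: nat
    and J :: "nat \<Rightarrow> ('p, complex) sheaf"
    and SP SQ :: "nat \<Rightarrow> ('p set \<times> ('p \<Rightarrow> complex)) set" and P Q :: "nat \<Rightarrow> 'p \<Rightarrow> complex"
  assumes X: "smooth_mfd X" and x: "x \<in> pts X"
    and J: "\<And>j. j < n \<Longrightarrow> J j = gen_sheaf X (SP j \<union> SQ j)"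
    and S: "\<And>j V f. j < n \<Longrightarrow> (V, f) \<in> SP j \<union> SQ j \<Longrightarrow> opn X V \<and> f \<in> smooth_funs X V"
    and SP: "\<And>j V f. j < n \<Longrightarrow> (V, f) \<in> SP j \<Longrightarrow> x \<in> V \<Longrightarrow>
      f x = 0 \<and> (\<exists>\<alpha> \<beta>. cmod \<beta> < cmod \<alpha> \<and> (\<forall>\<tau>. tvec X x \<tau> \<longrightarrow> \<tau> f = \<alpha> * \<tau> (P j) + \<beta> * cnj (\<tau> (P j))))"
    and SQ: "\<And>j V f. j < n \<Longrightarrow> (V, f) \<in> SQ j \<Longrightarrow> x \<in> V \<Longrightarrow>
      f x = 0 \<and> (\<exists>\<alpha> \<beta>. cmod \<beta> < cmod \<alpha> \<and> (\<forall>\<tau>. tvec X x \<tau> \<longrightarrow> \<tau> f = \<alpha> * \<tau> (Q j) + \<beta> * cnj (\<tau> (Q j))))"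
    and PQ: "\<And>j. j < n \<Longrightarrow> smooth_at X x (P j) \<and> smooth_at X x (Q j)"
    and submersive: "\<And>c d. \<exists>\<tau>. tvec X x \<tau> \<and> (\<forall>j<n. \<tau> (P j) = c j \<and> \<tau> (Q j) = d j)"
begin

lemma lin_form_centre:
  assumes j: "j < n" and f: "(V, f) \<in> SP j \<union> SQ j" and xV: "x \<in> V"
  shows "lin_form X x (P j) (Q j) (\<exists>(V, f)\<in>SP j. x \<in> V) (\<exists>(V, f)\<in>SQ j. x \<in> V) f"
proof -
  have sf: "smooth_at X x f" using S[OF j f] xV by (blast intro: smooth_atI)
  from f show ?thesis
  proof
    assume f: "(V, f) \<in> SP j"
    obtain \<alpha> \<beta> where ab: "f x = 0" "\<And>\<tau>. tvec X x \<tau> \<Longrightarrow> \<tau> f = \<alpha> * \<tau> (P j) + \<beta> * cnj (\<tau> (P j))"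
      using SP[OF j f xV] by blast
    have b: "\<exists>(V, f)\<in>SP j. x \<in> V" using f xV by blast
    show ?thesis unfolding lin_form_def
      by (intro conjI exI[of _ \<alpha>] exI[of _ \<beta>] exI[of _ 0] allI impI disjI1[OF b] sf ab(1)) (auto simp: ab(2))
  next
    assume f: "(V, f) \<in> SQ j"
    obtain \<alpha> \<beta> where ab: "f x = 0" "\<And>\<tau>. tvec X x \<tau> \<Longrightarrow> \<tau> f = \<alpha> * \<tau> (Q j) + \<beta> * cnj (\<tau> (Q j))"
      using SQ[OF j f xV] by blast
    have b: "\<exists>(V, f)\<in>SQ j. x \<in> V" using f xV by blast
    show ?thesis unfolding lin_form_def
      by (intro conjI exI[of _ 0] exI[of _ \<alpha>] exI[of _ \<beta>] allI impI disjI1[OF b] sf ab(1)) (auto simp: ab(2))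
  qed
qed

text \<open>Which of the two equations divides the other depends on the point of the exceptional
  fibre, but the choice is the same on a whole neighbourhood; hence the disjunction outside the
  quantifier over points.\<close>

definition divides_at :: "('q, 'g::euclidean_space) mfd \<Rightarrow> ('q \<Rightarrow> 'p) \<Rightarrow> 'q \<Rightarrow> ('p \<Rightarrow> complex) \<Rightarrow> ('p \<Rightarrow> complex) \<Rightarrow>
    ('q \<Rightarrow> complex) \<Rightarrow> ('q \<Rightarrow> complex) \<Rightarrow> bool" where
  "divides_at Z \<gamma> z f1 f2 a b \<longleftrightarrow> (\<exists>U. opn Z U \<and> z \<in> U \<and>
    ((\<forall>q\<in>U. f1 (\<gamma> q) = a q \<and> f2 (\<gamma> q) = b q * a q) \<or> (\<forall>q\<in>U. f2 (\<gamma> q) = a q \<and> f1 (\<gamma> q) = b q * a q)))"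

lemma divides_at_compose:
  assumes \<delta>: "smooth_map Y Z \<delta>" and y: "y \<in> pts Y"
    and d: "divides_at Z \<gamma> (\<delta> y) f1 f2 a b" and \<beta>: "\<And>y. y \<in> pts Y \<Longrightarrow> \<beta> y = \<gamma> (\<delta> y)"
  shows "divides_at Y \<beta> y f1 f2 (a \<circ> \<delta>) (b \<circ> \<delta>)"
proof -
  obtain U where U: "opn Z U" "\<delta> y \<in> U" and
    r: "(\<forall>q\<in>U. f1 (\<gamma> q) = a q \<and> f2 (\<gamma> q) = b q * a q) \<or> (\<forall>q\<in>U. f2 (\<gamma> q) = a q \<and> f1 (\<gamma> q) = b q * a q)"
    using d unfolding divides_at_def by blast
  show ?thesis unfolding divides_at_def
  proof (intro exI conjI)
    show "opn Y {q \<in> pts Y. \<delta> q \<in> U}" by (rule smooth_map_preimage_open[OF \<delta> U(1)])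
    show "(\<forall>q\<in>{q \<in> pts Y. \<delta> q \<in> U}. f1 (\<beta> q) = (a \<circ> \<delta>) q \<and> f2 (\<beta> q) = (b \<circ> \<delta>) q * (a \<circ> \<delta>) q) \<or>
      (\<forall>q\<in>{q \<in> pts Y. \<delta> q \<in> U}. f2 (\<beta> q) = (a \<circ> \<delta>) q \<and> f1 (\<beta> q) = (b \<circ> \<delta>) q * (a \<circ> \<delta>) q)"
      using r \<beta> by auto
  qed (use U y in auto)
qed

text \<open>The induction invariant after \<open>m\<close> blow-ups: the first \<open>m\<close>
  pairs \<open>P j\<close>, \<open>Q j\<close> have been traded for \<open>a j\<close>,
  \<open>b j\<close>, the remaining ones are still pulled back from below, and all
  \<open>2 * n\<close> differentials are jointly surjective at \<open>z\<close>.\<close>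

definition tower_coords :: "nat \<Rightarrow> ('q, 'e) mfd \<Rightarrow> ('q \<Rightarrow> 'p) \<Rightarrow> 'q \<Rightarrow> (nat \<Rightarrow> 'p \<Rightarrow> complex) \<Rightarrow> (nat \<Rightarrow> 'p \<Rightarrow> complex) \<Rightarrow>
    (nat \<Rightarrow> 'q \<Rightarrow> complex) \<Rightarrow> (nat \<Rightarrow> 'q \<Rightarrow> complex) \<Rightarrow> bool" where
  "tower_coords m Z \<gamma> z f1 f2 a b \<longleftrightarrow>
    (\<forall>j<m. (\<exists>V. (V, f1 j) \<in> SP j \<and> x \<in> V) \<and> (\<exists>V. (V, f2 j) \<in> SQ j \<and> x \<in> V) \<and>
       smooth_at Z z (a j) \<and> smooth_at Z z (b j) \<and> a j z = 0 \<and> divides_at Z \<gamma> z (f1 j) (f2 j) (a j) (b j)) \<and>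
    (\<forall>c d. \<exists>\<tau>. tvec Z z \<tau> \<and> (\<forall>j<n. \<tau> (if j < m then a j else P j \<circ> \<gamma>) = c j \<and>
       \<tau> (if j < m then b j else Q j \<circ> \<gamma>) = d j))"

lemma tower_base:
  assumes "iter_blowup 0 X J Z \<gamma>" "z \<in> pts Z" "\<gamma> z = x"
  shows "tower_coords 0 Z \<gamma> z f1 f2 a b"
proof -
  have Z: "smooth_mfd Z" using assms(1) by simp
  obtain G where G: "smooth_map Z X \<gamma>" "smooth_map X Z G" "\<forall>q\<in>pts Z. G (\<gamma> q) = q"
     "\<forall>y\<in>pts X. \<gamma> (G y) = y" using assms(1) unfolding iter_blowup.simps diffeo_def by blast
  have Gx: "G x = z" using G(3) assms by auto
  have "\<exists>\<tau>. tvec Z z \<tau> \<and> (\<forall>j<n. \<tau> (P j \<circ> \<gamma>) = c j \<and> \<tau> (Q j \<circ> \<gamma>) = d j)" for c d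
  proof -
    obtain \<tau> where t: "tvec X x \<tau>" "\<forall>j<n. \<tau> (P j) = c j \<and> \<tau> (Q j) = d j" using submersive by blast
    have "tvec Z z (\<lambda>f. \<tau> (f \<circ> G))" using tvec_push[OF X Z G(2) t(1)] Gx by simp
    moreover have "\<tau> (f \<circ> \<gamma> \<circ> G) = \<tau> f" if "smooth_at X x f" for f
      by (rule tvec_cong[OF X t(1) that openin_topspace x]) (use G(4) in simp)
    ultimately show ?thesis using t(2) PQ by (intro exI[of _ "\<lambda>f. \<tau> (f \<circ> G)"]) auto
  qed
  then show ?thesis unfolding tower_coords_def by simp
qed

lemma tower_step:
  fixes Z :: "('q, 'e) mfd" and Y :: "('q, 'e) mfd"
  assumes m: "m < n" and it: "iter_blowup m X J Z \<gamma>" and bl: "complex_blowup 2 Z (pullback Z X \<gamma> (J m)) Y \<delta>"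
    and \<beta>: "\<And>y. y \<in> pts Y \<Longrightarrow> \<beta> y = \<gamma> (\<delta> y)"
    and y: "y \<in> pts Y" "\<beta> y = x" and tc: "tower_coords m Z \<gamma> (\<delta> y) f1 f2 a b"
  shows "\<exists>f1 f2 a b. tower_coords (Suc m) Y \<beta> y f1 f2 a b"
proof -
  define z where "z = \<delta> y"
  have Z: "smooth_mfd Z" and \<gamma>: "smooth_map Z X \<gamma>" using iter_blowup_smooth[OF X it] by auto
  have Y: "smooth_mfd Y" and \<delta>: "smooth_map Y Z \<delta>" using bl unfolding complex_blowup_def by auto
  have zt: "z \<in> pts Z" unfolding z_def by (rule smooth_map_in_topspace[OF \<delta> y(1)])
  have \<gamma>z: "\<gamma> z = x" using \<beta>[OF y(1)] y unfolding z_def by simp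
  define bP where "bP = (\<exists>(V, f)\<in>SP m. x \<in> V)"
  define bQ where "bQ = (\<exists>(V, f)\<in>SQ m. x \<in> V)"
  let ?P = "P m \<circ> \<gamma>" and ?Q = "Q m \<circ> \<gamma>"
  let ?K = "pullback Z X \<gamma> (J m)"
  \<comment> \<open>Every section of the ideal of the next centre vanishes at \<open>z\<close> and
    its differential is a combination of those of \<open>P m\<close> and \<open>Q m\<close>. This is
    all that will be known about the coordinates in which the blow-up is given.\<close>
  have lfK: "lin_form Z z ?P ?Q bP bQ g" if g: "g \<in> ?K W" and zW: "z \<in> W" for g W
  proof (rule lin_form_gen_sheaf[OF Z g[unfolded pullback_def] zW zt])
    fix V f assume "(V, f) \<in> {({x \<in> pts Z. \<gamma> x \<in> V}, \<phi> \<circ> \<gamma>) |V \<phi>. opn X V \<and> \<phi> \<in> J m V}" "z \<in> V"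
    then obtain V' \<phi> where V': "f = \<phi> \<circ> \<gamma>" "opn X V'" "\<phi> \<in> J m V'" "\<gamma> z \<in> V'" by blast
    have "lin_form X x (P m) (Q m) bP bQ \<phi>" by (rule lin_form_gen_sheaf[OF X V'(3)[unfolded J[OF m]] _ x])
        (use V' \<gamma>z lin_form_centre[OF m] in \<open>auto simp: bP_def bQ_def\<close>)
    then show "lin_form Z z ?P ?Q bP bQ f" unfolding V'(1) using lin_form_pullback[OF X Z \<gamma> zt] \<gamma>z by simp
  qed
  have fam: "\<exists>\<tau>. tvec Z z \<tau> \<and> (\<forall>j<n. \<tau> (if j < m then a j else P j \<circ> \<gamma>) = c j \<and>
       \<tau> (if j < m then b j else Q j \<circ> \<gamma>) = d j)" for c d using tc unfolding tower_coords_def z_def by blast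
  \<comment> \<open>Sections vanish at \<open>z\<close>, so the constant 1 is none of them. This
    excludes the alternative of \<open>complex_blowup\<close> in which nothing is blown up near
    \<open>z\<close>.\<close>
  have "\<not> (\<exists>V. opn Z V \<and> z \<in> V \<and> (\<lambda>_. 1) \<in> ?K V)" using lfK unfolding lin_form_def by fastforce
  then obtain V \<phi> e where V: "chart Z V \<phi>" "z \<in> V" "frame_enum e" "2 * 2 \<le> DIM('e)"
    and gen: "generated_on Z V ?K 2 (\<lambda>l q. zc e l (\<phi> q))" and over: "blowup_over Z Y \<delta> 2 V \<phi> e"
    using bl zt unfolding complex_blowup_def by blast
  have oV: "opn Z V" by (rule chartD(1)[OF V(1)])
  have wK: "(\<lambda>q. zc e l (\<phi> q)) \<in> ?K V" if "l < 2" for l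
  proof -
    have "\<exists>h. (\<forall>i<2. h i \<in> smooth_funs Z V) \<and> (\<forall>q\<in>V. zc e l (\<phi> q) = (\<Sum>i<2. h i q * zc e i (\<phi> q)))"
    proof (rule exI[of _ "\<lambda>i _. if i = l then 1 else 0"], intro conjI allI impI ballI)
      fix i :: nat
      show "(\<lambda>_. if i = l then 1 else (0::complex)) \<in> smooth_funs Z V" by (rule smooth_funs_const)
    next
      fix q
      have "(\<Sum>i<2. (if i = l then 1 else 0) * zc e i (\<phi> q)) = (\<Sum>i<2. if i = l then zc e i (\<phi> q) else 0)"
        by (rule sum.cong) auto
      then show "zc e l (\<phi> q) = (\<Sum>i<2. (if i = l then 1 else 0) * zc e i (\<phi> q))" using that by simp
    qed
    then show ?thesis using gen oV unfolding generated_on_def by blast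
  qed
  have w0: "zc e l (\<phi> z) = 0" if "l < 2" for l using lfK[OF wK[OF that] V(2)] unfolding lin_form_def by blast
  have tw: "\<exists>\<tau>. tvec Z z \<tau> \<and> \<tau> (\<lambda>q. zc e 0 (\<phi> q)) = c0 \<and> \<tau> (\<lambda>q. zc e 1 (\<phi> q)) = c1" for c0 c1
  proof -
    obtain v where v: "\<And>j. j < 2 \<Longrightarrow> zc e j v = (if j = 0 then c0 else c1)"
      using zc_vector[OF V(3,4), of "\<lambda>j. if j = 0 then c0 else c1"] by blast
    show ?thesis by (rule exI[of _ "dchart z V \<phi> v"])
        (use tvec_dchart[OF Z V(1,2)] v[of 0] v[of 1] in \<open>auto simp: dchart_zc_chart[OF Z V(1,2)]\<close>)
  qed
  \<comment> \<open>Without a generator from the first factor at \<open>x\<close>, both centre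
    coordinates would have differentials depending on that of \<open>Q m\<close> alone. But these
    two differentials take arbitrary pairs of values.\<close>
  have dP: "bP"
  proof (rule ccontr)
    assume n: "\<not> bP"
    have "\<exists>q1 q2. \<forall>\<tau>. tvec Z z \<tau> \<longrightarrow> \<tau> (\<lambda>q. zc e l (\<phi> q)) = q1 * \<tau> ?Q + q2 * cnj (\<tau> ?Q)" if "l < 2" for l
      using lfK[OF wK[OF that] V(2)] n unfolding lin_form_def by auto
    then obtain p0 r0 p1 r1 where "\<And>\<tau>. tvec Z z \<tau> \<Longrightarrow> \<tau> (\<lambda>q. zc e 0 (\<phi> q)) = p0 * \<tau> ?Q + r0 * cnj (\<tau> ?Q)"
      "\<And>\<tau>. tvec Z z \<tau> \<Longrightarrow> \<tau> (\<lambda>q. zc e 1 (\<phi> q)) = p1 * \<tau> ?Q + r1 * cnj (\<tau> ?Q)"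
      by (metis one_less_numeral_iff pos2 semiring_norm(76))
    then have "\<exists>q. p0 * q + r0 * cnj q = c0 \<and> p1 * q + r1 * cnj q = c1" for c0 c1 using tw[of c0 c1] by metis
    then show False by (rule no_plane_surjection)
  qed
  have dQ: "bQ"
  proof (rule ccontr)
    assume n: "\<not> bQ"
    have "\<exists>q1 q2. \<forall>\<tau>. tvec Z z \<tau> \<longrightarrow> \<tau> (\<lambda>q. zc e l (\<phi> q)) = q1 * \<tau> ?P + q2 * cnj (\<tau> ?P)" if "l < 2" for l
      using lfK[OF wK[OF that] V(2)] n unfolding lin_form_def by auto
    then obtain p0 r0 p1 r1 where "\<And>\<tau>. tvec Z z \<tau> \<Longrightarrow> \<tau> (\<lambda>q. zc e 0 (\<phi> q)) = p0 * \<tau> ?P + r0 * cnj (\<tau> ?P)"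
      "\<And>\<tau>. tvec Z z \<tau> \<Longrightarrow> \<tau> (\<lambda>q. zc e 1 (\<phi> q)) = p1 * \<tau> ?P + r1 * cnj (\<tau> ?P)"
      by (metis one_less_numeral_iff pos2 semiring_norm(76))
    then have "\<exists>q. p0 * q + r0 * cnj q = c0 \<and> p1 * q + r1 * cnj q = c1" for c0 c1 using tw[of c0 c1] by metis
    then show False by (rule no_plane_surjection)
  qed
  obtain V1 g1 where g1: "(V1, g1) \<in> SP m" "x \<in> V1" using dP unfolding bP_def by blast
  obtain V2 g2 where g2: "(V2, g2) \<in> SQ m" "x \<in> V2" using dQ unfolding bQ_def by blast
  define f where "f = (\<lambda>k::nat. if k = 0 then g1 \<circ> \<gamma> else g2 \<circ> \<gamma>)"
  have gK: "g \<circ> \<gamma> \<in> ?K {q \<in> pts Z. \<gamma> q \<in> V'}" "smooth_at Z z (g \<circ> \<gamma>)"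
    "opn Z {q \<in> pts Z. \<gamma> q \<in> V'}"
    if g: "(V', g) \<in> SP m \<union> SQ m" "x \<in> V'" for V' g
  proof -
    have sf: "opn X V'" "g \<in> smooth_funs X V'" using S[OF m g(1)] by auto
    have "g \<in> J m V'" unfolding J[OF m] by (rule gen_sheaf_base[OF sf(2,1) g(1)])
    show o: "opn Z {q \<in> pts Z. \<gamma> q \<in> V'}" by (rule smooth_map_preimage_open[OF \<gamma> sf(1)])
    show "g \<circ> \<gamma> \<in> ?K {q \<in> pts Z. \<gamma> q \<in> V'}" unfolding pullback_def
      by (rule gen_sheaf_base[OF smooth_funs_pullback[OF Z X \<gamma> sf(2,1)] o]) (use sf \<open>g \<in> J m V'\<close> in blast)
    show "smooth_at Z z (g \<circ> \<gamma>)"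
      by (rule smooth_atI[OF smooth_funs_pullback[OF Z X \<gamma> sf(2,1)] o]) (use zt \<gamma>z g in simp)
  qed
  define U where "U = V \<inter> {q \<in> pts Z. \<gamma> q \<in> V1} \<inter> {q \<in> pts Z. \<gamma> q \<in> V2}"
  have oU: "opn Z U" "z \<in> U" "U \<subseteq> V"
    unfolding U_def using gK(3)[of V1 g1] gK(3)[of V2 g2] oV g1 g2 zt \<gamma>z V(2) by auto
  have fK: "f k \<in> ?K U" for k
  proof -
    have "g1 \<circ> \<gamma> \<in> ?K U"
      using gen_sheaf_restrict[OF Z gK(1)[of V1 g1, unfolded pullback_def] oU(1)] g1 unfolding pullback_def U_def by auto
    moreover have "g2 \<circ> \<gamma> \<in> ?K U"
      using gen_sheaf_restrict[OF Z gK(1)[of V2 g2, unfolded pullback_def] oU(1)] g2 unfolding pullback_def U_def by auto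
    ultimately show ?thesis unfolding f_def by simp
  qed
  have "\<exists>h. (\<forall>l<2. h l \<in> smooth_funs Z U) \<and> (\<forall>q\<in>U. f k q = (\<Sum>l<2. h l q * zc e l (\<phi> q)))" for k
    using fK[of k] gen oU unfolding generated_on_def by blast
  then obtain A where A: "\<And>k l. l < 2 \<Longrightarrow> A k l \<in> smooth_funs Z U"
    and fA: "\<And>k q. q \<in> U \<Longrightarrow> f k q = (\<Sum>l<2. A k l q * zc e l (\<phi> q))" by metis
  have two: "{..<2} = {0, 1::nat}" by auto
  have fA': "f k q = A k 0 q * zc e 0 (\<phi> q) + A k 1 q * zc e 1 (\<phi> q)" if "q \<in> U" for k q
    using fA[OF that] unfolding two by simp
  have sA: "smooth_at Z z (A k l)" if "l < 2" for k l by (rule smooth_atI[OF A[OF that] oU(1,2)])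
  have sf: "smooth_at Z z (f k)" for k unfolding f_def using gK(2) g1 g2 by auto
  have sw: "smooth_at Z z (\<lambda>q. zc e l (\<phi> q))" for l by (rule smooth_at_zc_chart[OF Z V(1,2)])
  have \<tau>f: "\<tau> (f k) = A k 0 z * \<tau> (\<lambda>q. zc e 0 (\<phi> q)) + A k 1 z * \<tau> (\<lambda>q. zc e 1 (\<phi> q))" if t: "tvec Z z \<tau>" for \<tau> k
  proof -
    have s: "smooth_at Z z (\<lambda>q. A k l q * zc e l (\<phi> q))"
      "\<tau> (\<lambda>q. A k l q * zc e l (\<phi> q)) = A k l z * \<tau> (\<lambda>q. zc e l (\<phi> q))" if "l < 2" for l
      using smooth_at_mult[OF Z sA[OF that] sw] tvec_mult[OF Z t sA[OF that] sw] w0[OF that] by auto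
    have s0: "smooth_at Z z (\<lambda>q. A k 0 q * zc e 0 (\<phi> q))" and s1: "smooth_at Z z (\<lambda>q. A k 1 q * zc e 1 (\<phi> q))"
      using s(1) by auto
    have "\<tau> (f k) = \<tau> (\<lambda>q. A k 0 q * zc e 0 (\<phi> q) + A k 1 q * zc e 1 (\<phi> q))"
      by (rule tvec_cong[OF Z t smooth_at_add[OF Z s0 s1] oU(1,2)]) (rule fA')
    also have "\<dots> = \<tau> (\<lambda>q. A k 0 q * zc e 0 (\<phi> q)) + \<tau> (\<lambda>q. A k 1 q * zc e 1 (\<phi> q))"
      by (rule tvec_add[OF Z t s0 s1])
    finally show ?thesis using s(2) by auto
  qed
  obtain \<alpha>1 \<beta>1 where ab1: "g1 x = 0" "cmod \<beta>1 < cmod \<alpha>1"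
    "\<And>\<tau>. tvec X x \<tau> \<Longrightarrow> \<tau> g1 = \<alpha>1 * \<tau> (P m) + \<beta>1 * cnj (\<tau> (P m))" using SP[OF m g1] by blast
  obtain \<alpha>2 \<beta>2 where ab2: "g2 x = 0" "cmod \<beta>2 < cmod \<alpha>2"
    "\<And>\<tau>. tvec X x \<tau> \<Longrightarrow> \<tau> g2 = \<alpha>2 * \<tau> (Q m) + \<beta>2 * cnj (\<tau> (Q m))" using SQ[OF m g2] by blast
  have push: "tvec X x (\<lambda>f. \<tau> (f \<circ> \<gamma>))" if "tvec Z z \<tau>" for \<tau>
    using tvec_push[OF Z X \<gamma> that] \<gamma>z by simp
  \<comment> \<open>Prescribed values on \<open>P m\<close> and \<open>Q m\<close> are exchanged for
    prescribed values on the two equations of the centre. This is possible because each equation has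
    the differential of its reference function followed by a bijective real-linear map.\<close>
  have famf: "\<exists>\<tau>. tvec Z z \<tau> \<and> (\<forall>j<n. j \<noteq> m \<longrightarrow> \<tau> (if j < m then a j else P j \<circ> \<gamma>) = c j \<and>
       \<tau> (if j < m then b j else Q j \<circ> \<gamma>) = d j) \<and> \<tau> (f 0) = c0 \<and> \<tau> (f 1) = c1" for c d c0 c1
  proof -
    obtain p where p: "\<alpha>1 * p + \<beta>1 * cnj p = c0" using real_linear_plane_solve[OF ab1(2)] by blast
    obtain q where q: "\<alpha>2 * q + \<beta>2 * cnj q = c1" using real_linear_plane_solve[OF ab2(2)] by blast
    obtain \<tau> where t: "tvec Z z \<tau>" "\<forall>j<n. \<tau> (if j < m then a j else P j \<circ> \<gamma>) = (c(m := p)) j \<and>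
       \<tau> (if j < m then b j else Q j \<circ> \<gamma>) = (d(m := q)) j" using fam[of "c(m := p)" "d(m := q)"] by blast
    have "\<tau> ?P = p" "\<tau> ?Q = q" using t(2) m by auto
    then have "\<tau> (f 0) = c0" "\<tau> (f 1) = c1" unfolding f_def using ab1(3)[OF push[OF t(1)]] ab2(3)[OF push[OF t(1)]] p q by auto
    then show ?thesis using t by (intro exI[of _ \<tau>]) auto
  qed
  \<comment> \<open>Vectors dual to \<open>f 0\<close> and \<open>f 1\<close> show that the matrix
    \<open>A\<close> at \<open>z\<close> times the matrix \<open>T\<close> of their values on the
    centre coordinates is the identity, so the determinant of \<open>A\<close> cannot
    vanish.\<close>
  have det: "A 0 0 z * A 1 1 z \<noteq> A 0 1 z * A 1 0 z"
  proof
    assume eq: "A 0 0 z * A 1 1 z = A 0 1 z * A 1 0 z"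
    obtain \<tau>1 where t1: "tvec Z z \<tau>1" "\<tau>1 (f 0) = 1" "\<tau>1 (f 1) = 0" using famf[of "\<lambda>_. 0" "\<lambda>_. 0" 1 0] by blast
    obtain \<tau>2 where t2: "tvec Z z \<tau>2" "\<tau>2 (f 0) = 0" "\<tau>2 (f 1) = 1" using famf[of "\<lambda>_. 0" "\<lambda>_. 0" 0 1] by blast
    define T where "T = (\<lambda>i l::nat. if i = (0::nat) then \<tau>1 (\<lambda>q. zc e l (\<phi> q)) else \<tau>2 (\<lambda>q. zc e l (\<phi> q)))"
    have 1: "A 0 0 z * T 0 0 + A 0 1 z * T 0 1 = 1" "A 1 0 z * T 0 0 + A 1 1 z * T 0 1 = 0"
      using \<tau>f[OF t1(1)] t1 unfolding T_def by auto
    have 2: "A 0 0 z * T 1 0 + A 0 1 z * T 1 1 = 0" "A 1 0 z * T 1 0 + A 1 1 z * T 1 1 = 1"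
      using \<tau>f[OF t2(1)] t2 unfolding T_def by auto
    have "(A 0 0 z * A 1 1 z - A 0 1 z * A 1 0 z) * (T 0 0 * T 1 1 - T 0 1 * T 1 0) =
      (A 0 0 z * T 0 0 + A 0 1 z * T 0 1) * (A 1 0 z * T 1 0 + A 1 1 z * T 1 1) -
      (A 1 0 z * T 0 0 + A 1 1 z * T 0 1) * (A 0 0 z * T 1 0 + A 0 1 z * T 1 1)" by (simp add: algebra_simps)
    then show False using 1 2 eq by simp
  qed
  have dim4: "4 \<le> DIM('e)" using V(4) by simp
  obtain k B where k: "k < 2" and sB: "smooth_at Y y B"
    and rel: "\<exists>U. opn Y U \<and> y \<in> U \<and> (\<forall>q\<in>U. f (1 - k) (\<delta> q) = B q * f k (\<delta> q))"
    and lift: "\<And>\<tau> d. tvec Z z \<tau> \<Longrightarrow> \<tau> (f (1 - k)) = B y * \<tau> (f k) \<Longrightarrow>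
      \<exists>\<tau>'. tvec Y y \<tau>' \<and> (\<forall>g. smooth_at Z z g \<longrightarrow> \<tau>' (g \<circ> \<delta>) = \<tau> g) \<and> \<tau>' B = d"
    by (rule blow_step[where f = f, OF Z Y \<delta> V(1,3) dim4 over y(1) z_def[symmetric] V(2) w0 sA oU(1,2) fA' det])
      (assumption+, rule that)
  have pull: "smooth_at Y y (g \<circ> \<delta>)" if "smooth_at Z z g" for g :: "'q \<Rightarrow> complex"
    using smooth_at_pullback[OF Y Z \<delta> y(1), of g] that z_def by simp
  define f1' where "f1' = f1(m := g1)"
  define f2' where "f2' = f2(m := g2)"
  define a' where "a' = (\<lambda>j. if j < m then a j \<circ> \<delta> else f k \<circ> \<delta>)"
  define b' where "b' = (\<lambda>j. if j < m then b j \<circ> \<delta> else B)"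
  have k2: "k = 0 \<or> k = 1" using k by linarith
  have fz: "f k z = 0" unfolding f_def using ab1 ab2 \<gamma>z by auto
  have coords: "(\<exists>V. (V, f1' j) \<in> SP j \<and> x \<in> V) \<and> (\<exists>V. (V, f2' j) \<in> SQ j \<and> x \<in> V) \<and>
       smooth_at Y y (a' j) \<and> smooth_at Y y (b' j) \<and> a' j y = 0 \<and> divides_at Y \<beta> y (f1' j) (f2' j) (a' j) (b' j)"
    if j: "j < Suc m" for j
  proof (cases "j = m")
    case True
    obtain U' where U': "opn Y U'" "y \<in> U'" "\<forall>q\<in>U'. f (1 - k) (\<delta> q) = B q * f k (\<delta> q)" using rel by blast
    have tU: "q \<in> pts Y" if "q \<in> U'" for q using openin_subset[OF U'(1)] that by blast
    have "(\<forall>q\<in>U'. g1 (\<beta> q) = a' m q \<and> g2 (\<beta> q) = b' m q * a' m q) \<or>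
      (\<forall>q\<in>U'. g2 (\<beta> q) = a' m q \<and> g1 (\<beta> q) = b' m q * a' m q)" using k2
    proof
      assume "k = 0"
      then show ?thesis using U'(3) \<beta>[OF tU] unfolding a'_def b'_def f_def by simp
    next
      assume "k = 1"
      then show ?thesis using U'(3) \<beta>[OF tU] unfolding a'_def b'_def f_def by simp
    qed
    then have "divides_at Y \<beta> y g1 g2 (a' m) (b' m)" unfolding divides_at_def using U' by blast
    then show ?thesis using True g1 g2 sB pull[OF sf] fz z_def unfolding f1'_def f2'_def a'_def b'_def by auto
  next
    case False
    then have jm: "j < m" using j by simp
    then have o: "(\<exists>V. (V, f1 j) \<in> SP j \<and> x \<in> V) \<and> (\<exists>V. (V, f2 j) \<in> SQ j \<and> x \<in> V) \<and>
       smooth_at Z z (a j) \<and> smooth_at Z z (b j) \<and> a j z = 0 \<and> divides_at Z \<gamma> z (f1 j) (f2 j) (a j) (b j)"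
      using tc unfolding tower_coords_def z_def by blast
    then have "divides_at Y \<beta> y (f1 j) (f2 j) (a j \<circ> \<delta>) (b j \<circ> \<delta>)"
      using divides_at_compose[where \<gamma> = \<gamma> and \<beta> = \<beta>, OF \<delta> y(1) _ \<beta>] z_def by blast
    then show ?thesis using jm o pull z_def unfolding f1'_def f2'_def a'_def b'_def by auto
  qed
  have "\<exists>\<tau>. tvec Y y \<tau> \<and> (\<forall>j<n. \<tau> (if j < Suc m then a' j else P j \<circ> \<beta>) = c j \<and>
       \<tau> (if j < Suc m then b' j else Q j \<circ> \<beta>) = d j)" for c d
  proof -
    \<comment> \<open>The value on \<open>f (1 - k)\<close> is forced to be \<open>B y\<close> times
      that on \<open>f k\<close>, the condition for lifting to the blow-up. The lost freedom is
      returned by the derivative of \<open>B\<close>, which is prescribed as \<open>d m\<close> when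
      the vector is lifted.\<close>
    obtain \<tau> where t: "tvec Z z \<tau>" and tj: "\<And>j. j < n \<Longrightarrow> j \<noteq> m \<Longrightarrow> \<tau> (if j < m then a j else P j \<circ> \<gamma>) = c j \<and>
       \<tau> (if j < m then b j else Q j \<circ> \<gamma>) = d j"
      and tk: "\<tau> (f k) = c m" "\<tau> (f (1 - k)) = B y * c m"
    proof (cases "k = 0")
      case True
      from famf[of c d "c m" "B y * c m"] show thesis using that True by auto
    next
      case False
      then have "k = 1" using k2 by simp
      from famf[of c d "B y * c m" "c m"] show thesis using that \<open>k = 1\<close> by auto
    qed
    from lift[OF t, of "d m"] tk obtain \<tau>' where t': "tvec Y y \<tau>'"
      "\<And>g. smooth_at Z z g \<Longrightarrow> \<tau>' (g \<circ> \<delta>) = \<tau> g" "\<tau>' B = d m" by auto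
    have "\<tau>' (g \<circ> \<beta>) = \<tau> (g \<circ> \<gamma>)" if "smooth_at X x g" for g
    proof -
      have s: "smooth_at Z z (g \<circ> \<gamma>)" using smooth_at_pullback[OF Z X \<gamma> zt] that \<gamma>z by simp
      have "\<tau>' (g \<circ> \<beta>) = \<tau>' (g \<circ> \<gamma> \<circ> \<delta>)"
        by (rule tvec_cong[OF Y t'(1) pull[OF s] openin_topspace y(1)]) (use \<beta> in simp)
      then show ?thesis using t'(2)[OF s] by simp
    qed
    note tPQ = this
    have "\<tau>' (if j < Suc m then a' j else P j \<circ> \<beta>) = c j \<and> \<tau>' (if j < Suc m then b' j else Q j \<circ> \<beta>) = d j"
      if j: "j < n" for j
    proof -
      consider "j < m" | "j = m" | "j > m" by linarith
      then show ?thesis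
      proof cases
        case 1
        have "smooth_at Z z (a j)" "smooth_at Z z (b j)" using tc 1 unfolding tower_coords_def z_def by auto
        then show ?thesis using 1 t'(2) tj[OF j] unfolding a'_def b'_def by simp
      next
        case 2
        then show ?thesis using t'(2)[OF sf] t'(3) tk unfolding a'_def b'_def by simp
      next
        case 3
        then show ?thesis using tPQ PQ[OF j] tj[OF j] by simp
      qed
    qed
    then show ?thesis using t'(1) by blast
  qed
  then have "tower_coords (Suc m) Y \<beta> y f1' f2' a' b'" unfolding tower_coords_def using coords by blast
  then show ?thesis by blast
qed

lemma tower:
  fixes Z :: "('q, 'e) mfd"
  shows "m \<le> n \<Longrightarrow> iter_blowup m X J Z \<gamma> \<Longrightarrow> z \<in> pts Z \<Longrightarrow> \<gamma> z = x \<Longrightarrow>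
    \<exists>f1 f2 a b. tower_coords m Z \<gamma> z f1 f2 a b"
proof (induction m arbitrary: Z \<gamma> z)
  case 0
  then have "tower_coords 0 Z \<gamma> z (\<lambda>_ _. 0) (\<lambda>_ _. 0) (\<lambda>_ _. 0) (\<lambda>_ _. 0)" by (intro tower_base)
  then show ?case by blast
next
  case (Suc m)
  then obtain Z' :: "('q, 'e) mfd" and \<gamma>' \<delta> where Z': "iter_blowup m X J Z' \<gamma>'"
    and bl: "complex_blowup 2 Z' (pullback Z' X \<gamma>' (J m)) Z \<delta>" and \<gamma>: "\<And>y. y \<in> pts Z \<Longrightarrow> \<gamma> y = \<gamma>' (\<delta> y)"
    by auto
  have "smooth_map Z Z' \<delta>" using bl unfolding complex_blowup_def by auto
  then have "\<delta> z \<in> pts Z'" by (rule smooth_map_in_topspace[OF _ Suc.prems(3)])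
  moreover have "\<gamma>' (\<delta> z) = x" using \<gamma>[OF Suc.prems(3)] Suc.prems(4) by simp
  moreover have "m \<le> n" using Suc.prems(1) by simp
  ultimately obtain f1 f2 a b where "tower_coords m Z' \<gamma>' (\<delta> z) f1 f2 a b" using Suc.IH[OF _ Z'] by blast
  from tower_step[OF _ Z' bl \<gamma> Suc.prems(3,4) this] Suc.prems(1) show ?case by auto
qed

end

section \<open>Normal crossing charts\<close>

lemma generated_on_one:
  fixes X :: "('p, 'e::euclidean_space) mfd" and \<rho> :: "'p \<Rightarrow> 'k::real_normed_field"
  shows "generated_on X V J 1 (\<lambda>_. \<rho>) \<longleftrightarrow> (\<forall>W. opn X W \<and> W \<subseteq> V \<longrightarrow>
     J W = {g. \<exists>h\<in>smooth_funs X W. \<forall>x\<in>W. g x = h x * \<rho> x})"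
proof -
  have "{g. \<exists>h. (\<forall>l<1::nat. h l \<in> smooth_funs X W) \<and> (\<forall>x\<in>W. g x = (\<Sum>l<1. h l x * \<rho> x))} =
    {g. \<exists>h\<in>smooth_funs X W. \<forall>x\<in>W. g x = h x * \<rho> x}" for W
  proof (intro equalityI subsetI CollectI)
    fix g assume "g \<in> {g. \<exists>h. (\<forall>l<1::nat. h l \<in> smooth_funs X W) \<and> (\<forall>x\<in>W. g x = (\<Sum>l<1. h l x * \<rho> x))}"
    then obtain h where h: "\<forall>l<1::nat. h l \<in> smooth_funs X W" "\<forall>x\<in>W. g x = (\<Sum>l<1. h l x * \<rho> x)" by blast
    then show "\<exists>h\<in>smooth_funs X W. \<forall>x\<in>W. g x = h x * \<rho> x" by (intro bexI[of _ "h 0"]) auto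
  next
    fix g assume "g \<in> {g. \<exists>h\<in>smooth_funs X W. \<forall>x\<in>W. g x = h x * \<rho> x}"
    then obtain h where h: "h \<in> smooth_funs X W" "\<forall>x\<in>W. g x = h x * \<rho> x" by blast
    then show "\<exists>h. (\<forall>l<1::nat. h l \<in> smooth_funs X W) \<and> (\<forall>x\<in>W. g x = (\<Sum>l<1. h l x * \<rho> x))"
      by (intro exI[of _ "\<lambda>_. h"]) auto
  qed
  then show ?thesis unfolding generated_on_def by simp
qed

lemma generated_on_compare:
  fixes X :: "('p, 'e::euclidean_space) mfd" and \<rho> \<rho>' :: "'p \<Rightarrow> 'k::real_normed_field"
  assumes "generated_on X V J 1 (\<lambda>_. \<rho>)" "generated_on X V' J 1 (\<lambda>_. \<rho>')"
    and W: "opn X W" "W \<subseteq> V" "W \<subseteq> V'"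
  obtains h where "h \<in> smooth_funs X W" "\<And>x. x \<in> W \<Longrightarrow> \<rho> x = h x * \<rho>' x"
proof -
  have "\<rho> \<in> J W" using assms(1) W smooth_funs_const[of 1 X W] unfolding generated_on_one by force
  then have "\<exists>h\<in>smooth_funs X W. \<forall>x\<in>W. \<rho> x = h x * \<rho>' x" using assms(2) W unfolding generated_on_one by blast
  then show thesis using that by blast
qed

lemma generated_on_change:
  fixes X :: "('p, 'e::euclidean_space) mfd" and \<rho> \<rho>' :: "'p \<Rightarrow> 'k::real_normed_field"
  assumes X: "smooth_mfd X" and g: "generated_on X V J 1 (\<lambda>_. \<rho>)" and V': "opn X V'" "V' \<subseteq> V"
    and u: "u \<in> smooth_funs X V'" "\<And>x. x \<in> V' \<Longrightarrow> u x \<noteq> 0" "\<And>x. x \<in> V' \<Longrightarrow> \<rho>' x = u x * \<rho> x"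
  shows "generated_on X V' J 1 (\<lambda>_. \<rho>')" unfolding generated_on_one
proof (intro allI impI)
  fix W assume W: "opn X W \<and> W \<subseteq> V'"
  have uW: "u \<in> smooth_funs X W" using smooth_funs_subset[OF u(1)] W by blast
  have iW: "(\<lambda>x. inverse (u x)) \<in> smooth_funs X W" by (rule smooth_funs_inverse[OF X _ uW]) (use W u(2) in auto)
  have "J W = {g. \<exists>h\<in>smooth_funs X W. \<forall>x\<in>W. g x = h x * \<rho> x}" using g W V' unfolding generated_on_one by blast
  also have "\<dots> = {g. \<exists>h\<in>smooth_funs X W. \<forall>x\<in>W. g x = h x * \<rho>' x}"
  proof (intro equalityI subsetI CollectI)
    fix g assume "g \<in> {g. \<exists>h\<in>smooth_funs X W. \<forall>x\<in>W. g x = h x * \<rho> x}"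
    then obtain h where h: "h \<in> smooth_funs X W" "\<forall>x\<in>W. g x = h x * \<rho> x" by blast
    have "(\<lambda>x. h x * inverse (u x)) \<in> smooth_funs X W" by (rule smooth_funs_mult[OF X _ h(1) iW]) (use W in simp)
    moreover have "\<forall>x\<in>W. g x = (h x * inverse (u x)) * \<rho>' x" using h(2) u(2,3) W by (auto simp: subset_iff)
    ultimately show "\<exists>h\<in>smooth_funs X W. \<forall>x\<in>W. g x = h x * \<rho>' x"
      by (intro bexI[of _ "\<lambda>x. h x * inverse (u x)"])
  next
    fix g assume "g \<in> {g. \<exists>h\<in>smooth_funs X W. \<forall>x\<in>W. g x = h x * \<rho>' x}"
    then obtain h where h: "h \<in> smooth_funs X W" "\<forall>x\<in>W. g x = h x * \<rho>' x" by blast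
    have "(\<lambda>x. h x * u x) \<in> smooth_funs X W" by (rule smooth_funs_mult[OF X _ h(1) uW]) (use W in simp)
    moreover have "\<forall>x\<in>W. g x = (h x * u x) * \<rho> x" using h(2) u(3) W by (auto simp: subset_iff)
    ultimately show "\<exists>h\<in>smooth_funs X W. \<forall>x\<in>W. g x = h x * \<rho> x" by (intro bexI[of _ "\<lambda>x. h x * u x"])
  qed
  finally show "J W = {g. \<exists>h\<in>smooth_funs X W. \<forall>x\<in>W. g x = h x * \<rho>' x}" .
qed

lemma nc_coordsD:
  assumes "nc_coords X D I k V \<phi> e"
  shows "chart X V \<phi>" "frame_enum e" "2 * k \<le> DIM('e::euclidean_space)"
    "\<And>q. q \<in> V \<Longrightarrow> q \<in> D \<longleftrightarrow> (\<exists>j<k. zc e j ((\<phi> :: 'p \<Rightarrow> 'e) q) = 0)"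
    "generated_on X V I 1 (\<lambda>_ q. \<Prod>j<k. (cmod (zc e j (\<phi> q)))\<^sup>2)"
proof -
  have "D \<inter> V = {q \<in> V. (\<Prod>j<k. zc e j (\<phi> q)) = 0}" using assms unfolding nc_coords_def by blast
  then have "q \<in> D \<longleftrightarrow> (\<Prod>j<k. zc e j (\<phi> q)) = 0" if "q \<in> V" for q using that by auto
  then show "\<And>q. q \<in> V \<Longrightarrow> q \<in> D \<longleftrightarrow> (\<exists>j<k. zc e j (\<phi> q) = 0)" by (auto simp: prod_zero_iff)
qed (use assms in \<open>auto simp: nc_coords_def\<close>)

text \<open>The order of vanishing of the generator along a generic line through \<open>p\<close> determines the multiplicity.\<close>

lemma multiplicity_le:
  assumes X: "smooth_mfd X" and c: "nc_chart X D I k p V \<phi> e" and c': "nc_chart X D I k' p V' \<phi>' e'"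
  shows "k' \<le> k"
proof (rule ccontr)
  assume "\<not> k' \<le> k"
  then have kk: "k < k'" by simp
  have n: "nc_coords X D I k V \<phi> e" "p \<in> V" "\<phi> p = 0" and n': "nc_coords X D I k' V' \<phi>' e'" "p \<in> V'" "\<phi>' p = 0"
    using c c' unfolding nc_chart_def by auto
  note N = nc_coordsD[OF n(1)] and N' = nc_coordsD[OF n'(1)]
  define W where "W = V \<inter> V'"
  have oW: "opn X W" unfolding W_def using chartD(1)[OF N(1)] chartD(1)[OF N'(1)] by blast
  have pW: "p \<in> W" unfolding W_def using n n' by auto
  have cW: "chart X W \<phi>" using chart_restrict[OF X N(1) chartD(1)[OF N'(1)]] unfolding W_def .
  obtain h where h: "h \<in> smooth_funs X W" "\<And>x. x \<in> W \<Longrightarrow>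
    (zprod e k (\<phi> x)) = h x * (\<Prod>j<k'. (cmod (zc e' j (\<phi>' x)))\<^sup>2)"
    using generated_on_compare[OF N(5) N'(5) oW] unfolding W_def by auto
  have oim: "open (\<phi> ` W)" "0 \<in> \<phi> ` W" using chartD(7)[OF cW] pW n by force+
  define \<sigma> where "\<sigma> = \<phi>' \<circ> inv_into W \<phi>"
  define H where "H = h \<circ> inv_into W \<phi>"
  have \<sigma>0: "\<sigma> 0 = 0" unfolding \<sigma>_def using chartD(4)[OF cW pW] n n' by simp
  have sp: "smooth_at X p \<phi>'" by (rule smooth_at_chart[OF X N'(1) n'(2)])
  obtain D where D: "(\<sigma> has_derivative D) (at 0)" using dchart_has_derivative[OF X cW pW sp] n unfolding \<sigma>_def by auto
  \<comment> \<open>Only linear growth of the transition map \<sigma> at its zero is needed: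
    \<open>K\<close> bounds the derivative and the additional 1 in the estimate absorbs the error of
    linear approximation.\<close>
  obtain K where K: "K > 0" "\<And>x. norm (D x) \<le> norm x * K"
    using has_derivative_bounded_linear[OF D] bounded_linear.pos_bounded by blast
  obtain d1 where d1: "d1 > 0" "\<And>y. norm y < d1 \<Longrightarrow> norm (\<sigma> y - D y) \<le> norm y"
    using D \<sigma>0 unfolding has_derivative_at_alt by (metis (no_types, opaque_lifting) diff_zero mult_1 zero_less_one)
  have \<sigma>b: "norm (\<sigma> y) \<le> (K + 1) * norm y" if "norm y < d1" for y
    using d1(2)[OF that] K(2)[of y] norm_triangle_ineq2[of "\<sigma> y" "D y"] by (simp add: algebra_simps)
  have contH: "continuous_on (\<phi> ` W) H" using Cinf_on_continuous[OF smooth_funs_chart[OF X h(1) oW cW]] unfolding H_def by simp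
  obtain d2 where d2: "d2 > 0" "\<And>y. y \<in> \<phi> ` W \<Longrightarrow> norm y \<le> d2 \<Longrightarrow> norm (H y - H 0) < 1"
    by (rule continuous_onE[OF contH oim(2), of 1]) (auto simp: dist_norm)
  obtain d3 where d3: "d3 > 0" "\<And>y. norm y < d3 \<Longrightarrow> y \<in> \<phi> ` W"
    using oim unfolding open_contains_ball by (auto simp: subset_iff dist_norm)
  define C where "C = norm (H 0) + 1"
  have HC: "norm (H y) \<le> C" if "norm y < d3" "norm y < d2" for y
    using d2(2)[OF d3(2)[OF that(1)] less_imp_le[OF that(2)]] norm_triangle_ineq2[of "H y" "H 0"] unfolding C_def by linarith
  \<comment> \<open>All \<open>k\<close> complex coordinates of \<open>v\<close> are 1, so along the
    ray through \<open>v\<close> the generator of the first chart is exactly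
    \<open>r ^ (2 * k)\<close>.\<close>
  obtain v where v: "\<And>j. j < k \<Longrightarrow> zc e j v = 1" using zc_vector[OF N(2,3), of "\<lambda>_. 1"] by blast
  define A where "A = norm v + 1"
  \<comment> \<open>The constant 2 works: a complex coordinate is bounded by the sum of two real
    ones, each at most the norm.\<close>
  have "\<exists>B. \<forall>w. (\<forall>j<k'. cmod (zc e' j w) \<le> B * norm w) \<and> B > 0" by (intro exI[of _ 2] allI conjI impI)
      (use N'(3) in \<open>auto simp: zc_def cmod_def intro!: order_trans[OF sqrt_sum_squares_le_sum_abs] order_trans[OF add_mono[OF Basis_le_norm Basis_le_norm]]
        N'(2)[unfolded frame_enum_def bij_betw_def, THEN conjunct2, THEN equalityD1, THEN subsetD] imageI\<close>)
  then obtain B where B: "B > 0" "\<And>w j. j < k' \<Longrightarrow> cmod (zc e' j w) \<le> B * norm w" by blast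
  define Q where "Q = B * ((K + 1) * A)"
  have Q: "Q > 0" unfolding Q_def A_def using B K by (simp add: add_nonneg_pos)
  \<comment> \<open>The generator of the second chart has \<open>k'\<close> factors of order
    \<open>r ^ 2\<close>. Division by \<open>r ^ (2 * k)\<close> leaves a positive even power of
    \<open>r\<close>, at most \<open>r ^ 2\<close> because \<open>r\<close> is at most 1.\<close>
  have main: "1 \<le> C * Q ^ (2 * k') * r ^ 2" if r: "0 < r" "r \<le> 1" "r * A < d1" "r * A < d2" "r * A < d3" for r
  proof -
    define y where "y = r *\<^sub>R v"
    have ny: "norm y \<le> r * A" unfolding y_def A_def using r by (simp add: algebra_simps)
    have y: "norm y < d1" "norm y < d2" "norm y < d3" using ny r by auto
    then obtain q where q: "q \<in> W" "y = \<phi> q" using d3(2) by blast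
    have iq: "inv_into W \<phi> y = q" using chartD(4)[OF cW q(1)] q by simp
    have "r ^ (2 * k) = zprod e k y" unfolding y_def zc_scale using v r by (simp add: power_mult)
    also have "\<dots> = H y * (\<Prod>j<k'. (cmod (zc e' j (\<sigma> y)))\<^sup>2)"
      using h(2)[OF q(1)] q iq unfolding H_def \<sigma>_def by simp
    also have "\<dots> \<le> C * (\<Prod>j<k'. (Q * r)\<^sup>2)"
    proof (rule mult_mono)
      show "H y \<le> C" using HC[OF y(3,2)] by simp
      show "(\<Prod>j<k'. (cmod (zc e' j (\<sigma> y)))\<^sup>2) \<le> (\<Prod>j<k'. (Q * r)\<^sup>2)"
      proof (intro prod_mono conjI power_mono)
        fix j assume "j \<in> {..<k'}"
        then have "cmod (zc e' j (\<sigma> y)) \<le> B * norm (\<sigma> y)" using B by simp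
        also have "\<dots> \<le> B * ((K + 1) * (r * A))"
          using \<sigma>b[OF y(1)] ny B K by (intro mult_left_mono) (auto intro: order_trans[OF _ mult_left_mono[OF ny]])
        finally show "cmod (zc e' j (\<sigma> y)) \<le> Q * r" unfolding Q_def by (simp add: algebra_simps)
      qed auto
      show "0 \<le> C" unfolding C_def by (simp add: add_nonneg_nonneg)
      show "0 \<le> (\<Prod>j<k'. (cmod (zc e' j (\<sigma> y)))\<^sup>2)" by (simp add: prod_nonneg)
    qed
    also have "\<dots> = C * Q ^ (2 * k') * r ^ (2 * k')" by (simp add: power_mult[symmetric] power_mult_distrib)
    also have "\<dots> = C * Q ^ (2 * k') * (r ^ (2 * k) * r ^ (2 * (k' - k)))" using kk by (simp flip: power_add add: algebra_simps)
    finally have "r ^ (2 * k) * 1 \<le> r ^ (2 * k) * (C * Q ^ (2 * k') * r ^ (2 * (k' - k)))" by (simp add: algebra_simps)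
    then have "1 \<le> C * Q ^ (2 * k') * r ^ (2 * (k' - k))" using r by (simp add: mult_le_cancel_left_pos)
    also have "\<dots> \<le> C * Q ^ (2 * k') * r ^ 2"
    proof (rule mult_left_mono)
      show "r ^ (2 * (k' - k)) \<le> r ^ 2" using r kk by (intro power_decreasing) auto
      show "0 \<le> C * Q ^ (2 * k')" using Q unfolding C_def by (simp add: add_nonneg_nonneg)
    qed
    finally show ?thesis .
  qed
  define T where "T = C * Q ^ (2 * k')"
  have T: "T > 0" unfolding T_def C_def using Q by (simp add: add_nonneg_pos)
  have A: "A > 0" unfolding A_def by (simp add: add_nonneg_pos)
  \<comment> \<open>Half the admissible radii, so that the strict bounds hold, and small enough that
    \<open>T * r\<close> stays below 1 in contradiction to \<open>main\<close>.\<close>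
  define r where "r = Min {1, d1 / (2 * A), d2 / (2 * A), d3 / (2 * A), 1 / (2 * (T + 1))}"
  have r: "r \<le> 1" "r \<le> d1 / (2 * A)" "r \<le> d2 / (2 * A)" "r \<le> d3 / (2 * A)" "r \<le> 1 / (2 * (T + 1))" "0 < r"
    unfolding r_def using d1 d2 d3 A T by auto
  have "r * A \<le> d1 / 2" "r * A \<le> d2 / 2" "r * A \<le> d3 / 2" using r A by (auto simp: field_simps)
  then have "1 \<le> T * r ^ 2" using main[OF r(6,1)] d1 d2 d3 unfolding T_def by auto
  also have "\<dots> \<le> T * r" using r T by (simp add: power2_eq_square)
  also have "\<dots> \<le> T * (1 / (2 * (T + 1)))" using r T by (intro mult_left_mono) auto
  also have "\<dots> < 1" using T by (simp add: field_simps)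
  finally show False by simp
qed

text \<open>Near \<open>q\<close> the coordinates that do not vanish at \<open>q\<close> are units
  and are absorbed into the generator. Those that vanish are moved to the front by reordering the
  frame; they are unaffected by the translation that centres the chart.\<close>

lemma nc_chart_recentre:
  fixes X :: "('p, 'e::euclidean_space) mfd"
  assumes X: "smooth_mfd X" and n: "nc_coords X D I k V \<phi> e" and q: "q \<in> V"
  shows "\<exists>W \<psi> e'. nc_chart X D I (card {j. j < k \<and> zc e j (\<phi> q) = 0}) q W \<psi> e'"
proof -
  define Z where "Z = {j. j < k \<and> zc e j (\<phi> q) = 0}"
  define l where "l = card Z"
  note N = nc_coordsD[OF n]
  have Zk: "Z \<subseteq> {..<k}" "finite Z" unfolding Z_def by auto
  have lk: "l \<le> k" unfolding l_def using card_mono[OF _ Zk(1)] by simp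
  obtain t1 where t1: "bij_betw t1 {0..<l} Z" using ex_bij_betw_nat_finite[OF Zk(2)] unfolding l_def by blast
  have "card ({..<k} - Z) = k - l" unfolding l_def using card_Diff_subset[OF Zk(2,1)] by simp
  then obtain t2 where t2: "bij_betw t2 {0..<k - l} ({..<k} - Z)" using ex_bij_betw_nat_finite[of "{..<k} - Z"] by auto
  \<comment> \<open>A permutation of the complex coordinates that lists those vanishing at
    \<open>q\<close> first; it is the identity from \<open>k\<close> on.\<close>
  define t where "t = (\<lambda>j. if j < l then t1 j else if j < k then t2 (j - l) else j)"
  have tl: "bij_betw t {..<l} Z"
  proof -
    have "bij_betw t {..<l} Z = bij_betw t1 {..<l} Z" by (rule bij_betw_cong) (simp add: t_def)
    then show ?thesis using t1 by (simp add: atLeast0LessThan)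
  qed
  have "bij_betw (t2 \<circ> (\<lambda>j. j - l)) {l..<k} ({..<k} - Z)"
    by (rule bij_betw_trans[OF _ t2], rule bij_betw_byWitness[where f' = "\<lambda>j. j + l"]) (use lk in auto)
  moreover have "bij_betw t {l..<k} ({..<k} - Z) = bij_betw (t2 \<circ> (\<lambda>j. j - l)) {l..<k} ({..<k} - Z)"
    by (rule bij_betw_cong) (auto simp: t_def)
  ultimately have tr: "bij_betw t {l..<k} ({..<k} - Z)" by simp
  have tk: "bij_betw t {..<k} {..<k}" using bij_betw_combine[OF tl tr] lk Zk(1) by (simp add: ivl_disj_un Un_absorb1 Int_Diff)
  \<comment> \<open>The permutation of the real basis vectors induced by \<open>t\<close>: real and
    imaginary parts move together, and real coordinates from index \<open>2 * k\<close> on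
    stay.\<close>
  define s where "s = (\<lambda>r. if r < 2 * k then 2 * t (r div 2) + r mod 2 else r)"
  have tlt: "t j < k" if "j < k" for j using tk that unfolding bij_betw_def by auto
  have tinj: "j = j'" if "t j = t j'" "j < k" "j' < k" for j j' using tk that unfolding bij_betw_def inj_on_def by auto
  have sb: "bij_betw s {..<DIM('e)} {..<DIM('e)}"
  proof -
    have "inj_on s {..<DIM('e)}"
    proof (rule inj_onI)
      fix r r' assume "r \<in> {..<DIM('e)}" "r' \<in> {..<DIM('e)}" and e: "s r = s r'"
      have lt: "s r < 2 * k" if "r < 2 * k" for r
      proof -
        have "t (r div 2) < k" using tlt[of "r div 2"] that by auto
        moreover have "r mod 2 < 2" by simp
        ultimately have "2 * t (r div 2) + r mod 2 < 2 * k" by linarith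
        then show ?thesis using that by (simp add: s_def)
      qed
      show "r = r'"
      proof (cases "r < 2 * k")
        case True
        then have r': "r' < 2 * k" using lt[OF True] e unfolding s_def by (auto split: if_splits)
        have "2 * t (r div 2) + r mod 2 = 2 * t (r' div 2) + r' mod 2" using e True r' unfolding s_def by simp
        then have "t (r div 2) = t (r' div 2)" "r mod 2 = r' mod 2" by presburger+
        moreover have "r div 2 < k" "r' div 2 < k" using True r' by auto
        ultimately have "r div 2 = r' div 2" "r mod 2 = r' mod 2" using tinj by auto
        then show ?thesis by (metis div_mult_mod_eq)
      next
        case False
        then have "\<not> r' < 2 * k" using lt[of r'] e unfolding s_def by (auto split: if_splits)
        then show ?thesis using False e unfolding s_def by simp
      qed
    qed
    moreover have "s ` {..<DIM('e)} \<subseteq> {..<DIM('e)}"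
    proof clarify
      fix r assume r: "r < DIM('e)"
      show "s r < DIM('e)"
      proof (cases "r < 2 * k")
        case True
        then have "t (r div 2) < k" using tlt by auto
        then show ?thesis using N(3) True unfolding s_def by auto
      qed (use r s_def in auto)
    qed
    ultimately show ?thesis unfolding bij_betw_def by (metis endo_inj_surj finite_lessThan)
  qed
  define e' where "e' = e \<circ> s"
  have fe': "frame_enum e'" unfolding frame_enum_def e'_def by (rule bij_betw_trans[OF sb N(2)[unfolded frame_enum_def]])
  have ze': "zc e' j w = zc e (t j) w" if "j < k" for j w using that unfolding zc_def e'_def s_def by auto
  define W where "W = {x \<in> V. \<forall>j\<in>{..<k} - Z. zc e j (\<phi> x) \<noteq> 0}"
  have oW: "opn X W"
  proof -
    have o: "opn X {x \<in> V. zc e j (\<phi> x) \<in> - {0}}" for j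
      by (rule smooth_funs_continuous_map[OF X smooth_funs_linear[OF bounded_linear_zc X chartD(1)[OF N(1)] smooth_funs_chart_map[OF N(1)]] chartD(1)[OF N(1)]]) auto
    have "opn X (V \<inter> (\<Inter>j\<in>{..<k} - Z. {x \<in> V. zc e j (\<phi> x) \<in> - {0}}))"
    proof (cases "{..<k} - Z = {}")
      case True
      show ?thesis unfolding True using chartD(1)[OF N(1)] by simp
    next
      case False
      have "opn X (\<Inter>j\<in>{..<k} - Z. {x \<in> V. zc e j (\<phi> x) \<in> - {0}})" by (rule openin_INT2) (use o False in auto)
      then show ?thesis using chartD(1)[OF N(1)] by blast
    qed
    moreover have "V \<inter> (\<Inter>j\<in>{..<k} - Z. {x \<in> V. zc e j (\<phi> x) \<in> - {0}}) = W" unfolding W_def by auto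
    ultimately show ?thesis by simp
  qed
  have WV: "W \<subseteq> V" unfolding W_def by auto
  have qW: "q \<in> W" unfolding W_def Z_def using q by auto
  have "chart X (V \<inter> W) \<phi>" by (rule chart_restrict[OF X N(1) oW])
  then have cW: "chart X W \<phi>" using WV by (simp add: Int_absorb1)
  define \<psi> where "\<psi> = (\<lambda>x. \<phi> x - \<phi> q)"
  have c\<psi>: "chart X W \<psi>" unfolding \<psi>_def by (rule chart_translate[OF X cW])
  have z\<psi>: "zc e' j (\<psi> x) = zc e (t j) (\<phi> x)" if "j < l" for j x
  proof -
    have "t j \<in> Z" using tl that unfolding bij_betw_def by auto
    then show ?thesis unfolding \<psi>_def zc_diff using ze'[of j] that lk unfolding Z_def by simp
  qed
  have nz: "zc e (t j) (\<phi> x) \<noteq> 0" if "x \<in> W" "l \<le> j" "j < k" for x j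
  proof -
    have "t j \<in> {..<k} - Z" using tr that unfolding bij_betw_def by auto
    then show ?thesis using that(1) unfolding W_def by blast
  qed
  have prod_split: "(\<Prod>j<k. g (t j)) = (\<Prod>j<l. g (t j)) * (\<Prod>j\<in>{l..<k}. g (t j))" for g :: "nat \<Rightarrow> real"
  proof -
    have "{..<k} = {..<l} \<union> {l..<k}" using lk by auto
    then show ?thesis by (simp add: prod.union_disjoint ivl_disj_int)
  qed
  have gen: "generated_on X W I 1 (\<lambda>_ x. \<Prod>j<l. (cmod (zc e' j (\<psi> x)))\<^sup>2)"
  proof (rule generated_on_change[OF X N(5) oW WV])
    let ?g = "\<lambda>x. \<Prod>j\<in>{l..<k}. (cmod (zc e (t j) (\<phi> x)))\<^sup>2"
    have sg: "?g \<in> smooth_funs X W"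
    proof (rule smooth_funs_prod[OF X oW])
      fix j
      have s: "(\<lambda>x. zc e (t j) (\<phi> x)) \<in> smooth_funs X W"
        by (rule smooth_funs_linear[OF bounded_linear_zc X oW smooth_funs_chart_map[OF cW]])
      have "(\<lambda>x. zc e (t j) (\<phi> x) \<bullet> zc e (t j) (\<phi> x)) \<in> smooth_funs X W"
        by (rule smooth_funs_bilinear[OF bounded_bilinear_inner X oW s s])
      then show "(\<lambda>x. (cmod (zc e (t j) (\<phi> x)))\<^sup>2) \<in> smooth_funs X W" by (simp add: power2_norm_eq_inner)
    qed
    have g0: "?g x \<noteq> 0" if "x \<in> W" for x using nz[OF that] by auto
    show "(\<lambda>x. inverse (?g x)) \<in> smooth_funs X W" by (rule smooth_funs_inverse[OF X oW sg g0])
    show "inverse (?g x) \<noteq> 0" if "x \<in> W" for x using g0[OF that] by simp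
    fix x assume x: "x \<in> W"
    have "zprod e k (\<phi> x) = (\<Prod>j<k. (cmod (zc e (t j) (\<phi> x)))\<^sup>2)"
      using prod.reindex_bij_betw[OF tk, of "\<lambda>j. (cmod (zc e j (\<phi> x)))\<^sup>2"] by simp
    also have "\<dots> = zprod e' l (\<psi> x) * ?g x"
      unfolding prod_split[of "\<lambda>j. (cmod (zc e j (\<phi> x)))\<^sup>2"] using z\<psi> by simp
    finally show "zprod e' l (\<psi> x) = inverse (?g x) * zprod e k (\<phi> x)" using g0[OF x] by (simp add: field_simps)
  qed
  have "D \<inter> W = {x \<in> W. (\<Prod>j<l. zc e' j (\<psi> x)) = 0}"
  proof -
    have "x \<in> D \<longleftrightarrow> (\<Prod>j<l. zc e' j (\<psi> x)) = 0" if x: "x \<in> W" for x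
    proof -
      have "x \<in> D \<longleftrightarrow> (\<exists>j<k. zc e j (\<phi> x) = 0)" using N(4) x WV by blast
      also have "\<dots> \<longleftrightarrow> (\<exists>j<k. zc e (t j) (\<phi> x) = 0)"
      proof
        assume "\<exists>j<k. zc e j (\<phi> x) = 0"
        then obtain j where "j < k" "zc e j (\<phi> x) = 0" by blast
        moreover from this obtain j' where "j' < k" "j = t j'" using tk unfolding bij_betw_def by auto
        ultimately show "\<exists>j<k. zc e (t j) (\<phi> x) = 0" by blast
      qed (use tlt in blast)
      also have "\<dots> \<longleftrightarrow> (\<exists>j<l. zc e (t j) (\<phi> x) = 0)" using nz[OF x] lk by (meson leI less_le_trans)
      also have "\<dots> \<longleftrightarrow> (\<Prod>j<l. zc e' j (\<psi> x)) = 0" using z\<psi> by (auto simp: prod_zero_iff)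
      finally show ?thesis .
    qed
    then show ?thesis by auto
  qed
  then have "nc_chart X D I l q W \<psi> e'"
    unfolding nc_chart_def nc_coords_def using c\<psi> fe' N(3) lk gen qW by (simp add: \<psi>_def)
  then show ?thesis unfolding l_def Z_def by blast
qed

text \<open>Applied to the transition maps between tubular charts, which are linear on the fibres.\<close>

lemma linear_forms_monomial:
  fixes g :: "nat \<Rightarrow> nat \<Rightarrow> complex \<Rightarrow> complex"
  assumes lin: "\<And>m l. linear (g m l)"
    and D: "\<And>z. (\<exists>m<i. (\<Sum>l<i. g m l (z l)) = 0) \<longleftrightarrow> (\<exists>l<i. z l = 0)"
    and H: "\<And>z. (\<Prod>m<i. (cmod (\<Sum>l<i. g m l (z l)))\<^sup>2) = c * (\<Prod>l<i. (cmod (z l))\<^sup>2)"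
  obtains \<pi> where "bij_betw \<pi> {..<i} {..<i}"
    "\<And>m l \<omega>. m < i \<Longrightarrow> l < i \<Longrightarrow> l \<noteq> \<pi> m \<Longrightarrow> g m l \<omega> = 0"
    "\<And>m \<omega>. m < i \<Longrightarrow> (cmod (g m (\<pi> m) \<omega>))\<^sup>2 = (cmod (g m (\<pi> m) 1))\<^sup>2 * (cmod \<omega>)\<^sup>2"
    "\<And>m. m < i \<Longrightarrow> g m (\<pi> m) 1 \<noteq> 0"
proof -
  have ex: "\<exists>l<i. inj (g m l) \<and> (\<forall>l'<i. l' \<noteq> l \<longrightarrow> (\<forall>\<omega>. g m l' \<omega> = 0))" if m: "m < i" for m
  proof -
    \<comment> \<open>Otherwise every block of the row kills a nonzero number, and the form vanishes
      at a point all of whose coordinates are nonzero.\<close>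
    have "\<exists>l<i. inj (g m l)"
    proof (rule ccontr)
      assume "\<not> ?thesis"
      then have "\<forall>l<i. \<exists>\<omega>. \<omega> \<noteq> 0 \<and> g m l \<omega> = 0" using lin linear_injective_0 by blast
      then obtain z where z: "\<And>l. l < i \<Longrightarrow> z l \<noteq> 0 \<and> g m l (z l) = 0" by metis
      then have "(\<Sum>l<i. g m l (z l)) = 0" by (intro sum.neutral) auto
      then show False using D[of z] m z by blast
    qed
    then obtain l where l: "l < i" "inj (g m l)" by blast
    have surj: "surj (g m l)" by (rule linear_injective_imp_surjective[OF lin l(2)]) (rule refl)
    have "g m l' \<omega> = 0" if l': "l' < i" "l' \<noteq> l" for l' \<omega>
    proof (rule ccontr)
      assume nz: "g m l' \<omega> \<noteq> 0"
      \<comment> \<open>If the other blocks contribute a nonzero sum, surjectivity of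
        \<open>g m l\<close> supplies an \<open>l\<close>-th coordinate, necessarily nonzero, that
        cancels it. The form then vanishes although no coordinate does.\<close>
      have key: False if z: "\<And>j. j < i \<Longrightarrow> z j \<noteq> 0" and s: "(\<Sum>j\<in>{..<i} - {l}. g m j (z j)) \<noteq> 0" for z
      proof -
        obtain \<eta> where \<eta>: "g m l \<eta> = - (\<Sum>j\<in>{..<i} - {l}. g m j (z j))" using surj by (metis surjD)
        have "\<eta> \<noteq> 0" using \<eta> s linear_0[OF lin] by auto
        define z' where "z' = z(l := \<eta>)"
        have "(\<Sum>j<i. g m j (z' j)) = g m l (z' l) + (\<Sum>j\<in>{..<i} - {l}. g m j (z' j))" using l by (intro sum.remove) auto
        also have "(\<Sum>j\<in>{..<i} - {l}. g m j (z' j)) = (\<Sum>j\<in>{..<i} - {l}. g m j (z j))"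
          by (rule sum.cong) (auto simp: z'_def)
        finally have "(\<Sum>j<i. g m j (z' j)) = 0" using \<eta> unfolding z'_def by simp
        then obtain j where "j < i" "z' j = 0" using D[of z'] m by blast
        then show False using z \<open>\<eta> \<noteq> 0\<close> unfolding z'_def by (auto split: if_splits)
      qed
      have shift: "(\<Sum>j\<in>{..<i} - {l}. g m j (((\<lambda>_. 1)(l' := \<eta>)) j)) =
        (\<Sum>j\<in>{..<i} - {l}. g m j 1) + (g m l' \<eta> - g m l' 1)" for \<eta>
      proof -
        have f: "finite ({..<i} - {l})" "l' \<in> {..<i} - {l}" using l' by auto
        have "(\<Sum>j\<in>{..<i} - {l} - {l'}. g m j (((\<lambda>_. 1)(l' := \<eta>)) j)) = (\<Sum>j\<in>{..<i} - {l} - {l'}. g m j 1)"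
          by (rule sum.cong) auto
        then show ?thesis using sum.remove[OF f, of "\<lambda>j. g m j (((\<lambda>_. 1)(l' := \<eta>)) j)"] sum.remove[OF f, of "\<lambda>j. g m j 1"]
          by simp
      qed
      have s0: "(\<Sum>j\<in>{..<i} - {l}. g m j 1) = 0" using key[of "\<lambda>_. 1"] by auto
      \<comment> \<open>So \<open>g m l'\<close> is constant on nonzero numbers. Comparing 2 with 1
        + 1 forces the constant to be 0.\<close>
      have all: "g m l' \<eta> = g m l' 1" if "\<eta> \<noteq> 0" for \<eta>
      proof (rule ccontr)
        assume ne: "g m l' \<eta> \<noteq> g m l' 1"
        have "((\<lambda>_. 1)(l' := \<eta>)) j \<noteq> 0" for j using that by simp
        moreover have "(\<Sum>j\<in>{..<i} - {l}. g m j (((\<lambda>_. 1)(l' := \<eta>)) j)) \<noteq> 0"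
          unfolding shift s0 using ne by simp
        ultimately show False using key by blast
      qed
      have "g m l' 2 = g m l' 1 + g m l' 1" using linear_add[OF lin, of m l' 1 1] by simp
      then have "g m l' 1 = 0" using all[of 2] by simp
      then show False using nz all[of \<omega>] linear_0[OF lin] by (cases "\<omega> = 0") auto
    qed
    then show ?thesis using l by blast
  qed
  then obtain \<pi> where L: "\<And>m. m < i \<Longrightarrow> \<pi> m < i" "\<And>m. m < i \<Longrightarrow> inj (g m (\<pi> m))"
    "\<And>m l \<omega>. m < i \<Longrightarrow> l < i \<Longrightarrow> l \<noteq> \<pi> m \<Longrightarrow> g m l \<omega> = 0" by metis
  have single: "(\<Sum>l<i. g m l (z l)) = g m (\<pi> m) (z (\<pi> m))" if "m < i" for m z
  proof -
    have "(\<Sum>l<i. g m l (z l)) = (\<Sum>l<i. if l = \<pi> m then g m l (z l) else 0)" by (rule sum.cong) (use L(3)[OF that] in auto)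
    then show ?thesis using L(1)[OF that] by simp
  qed
  have nz: "g m (\<pi> m) \<omega> \<noteq> 0" if "m < i" "\<omega> \<noteq> 0" for m \<omega>
    using L(2)[OF that(1)] linear_0[OF lin] that(2) by (metis injD)
  \<comment> \<open>If \<open>l\<close> were missed, the point whose only vanishing coordinate is
    the \<open>l\<close>-th would lie on the right hand divisor while no form vanishes
    there.\<close>
  have surj: "\<pi> ` {..<i} = {..<i}"
  proof (rule ccontr)
    assume "\<pi> ` {..<i} \<noteq> {..<i}"
    then obtain l where l: "l < i" "\<And>m. m < i \<Longrightarrow> \<pi> m \<noteq> l" using L(1) by blast
    define z where "z = (\<lambda>j. if j = l then 0 else (1::complex))"
    have "\<exists>l<i. z l = 0" using l(1) unfolding z_def by auto
    then obtain m where m: "m < i" "g m (\<pi> m) (z (\<pi> m)) = 0" using D[of z] single by auto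
    then show False using nz[OF m(1), of "z (\<pi> m)"] l(2)[OF m(1)] unfolding z_def by auto
  qed
  then have bij: "bij_betw \<pi> {..<i} {..<i}" unfolding bij_betw_def by (simp add: eq_card_imp_inj_on)
  \<comment> \<open>Vary the coordinate of index \<open>\<pi> m\<close> and keep all others at 1:
    the remaining factors of the product are then constant, so the block multiplies moduli by a
    constant.\<close>
  have conf: "(cmod (g m (\<pi> m) \<omega>))\<^sup>2 = (cmod (g m (\<pi> m) 1))\<^sup>2 * (cmod \<omega>)\<^sup>2" if m: "m < i" for m \<omega>
  proof -
    define R where "R = (\<Prod>m'\<in>{..<i} - {m}. (cmod (g m' (\<pi> m') 1))\<^sup>2)"
    have R: "R \<noteq> 0" unfolding R_def using nz by auto
    have e: "(cmod (g m (\<pi> m) \<omega>))\<^sup>2 * R = c * (cmod \<omega>)\<^sup>2" for \<omega>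
    proof -
      define z where "z = (\<lambda>_. 1)(\<pi> m := \<omega>)"
      have "(\<Prod>m'<i. (cmod (\<Sum>l<i. g m' l (z l)))\<^sup>2) = (\<Prod>m'<i. (cmod (g m' (\<pi> m') (z (\<pi> m'))))\<^sup>2)"
        by (rule prod.cong) (use single in auto)
      also have "\<dots> = (cmod (g m (\<pi> m) (z (\<pi> m))))\<^sup>2 * (\<Prod>m'\<in>{..<i} - {m}. (cmod (g m' (\<pi> m') (z (\<pi> m'))))\<^sup>2)"
        using m by (intro prod.remove) auto
      also have "(\<Prod>m'\<in>{..<i} - {m}. (cmod (g m' (\<pi> m') (z (\<pi> m'))))\<^sup>2) = R" unfolding R_def
      proof (rule prod.cong)
        fix m' assume m': "m' \<in> {..<i} - {m}"
        then have "\<pi> m' \<noteq> \<pi> m" using bij m unfolding bij_betw_def inj_on_def by auto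
        then show "(cmod (g m' (\<pi> m') (z (\<pi> m'))))\<^sup>2 = (cmod (g m' (\<pi> m') 1))\<^sup>2" unfolding z_def by simp
      qed simp
      finally have 1: "(\<Prod>m'<i. (cmod (\<Sum>l<i. g m' l (z l)))\<^sup>2) = (cmod (g m (\<pi> m) \<omega>))\<^sup>2 * R" unfolding z_def by simp
      have "(\<Prod>l<i. (cmod (z l))\<^sup>2) = (cmod (z (\<pi> m)))\<^sup>2 * (\<Prod>l\<in>{..<i} - {\<pi> m}. (cmod (z l))\<^sup>2)"
        using L(1)[OF m] by (intro prod.remove) auto
      also have "(\<Prod>l\<in>{..<i} - {\<pi> m}. (cmod (z l))\<^sup>2) = 1" by (intro prod.neutral) (auto simp: z_def)
      finally show ?thesis using 1 H[of z] unfolding z_def by simp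
    qed
    have "(cmod (g m (\<pi> m) \<omega>))\<^sup>2 * R = ((cmod (g m (\<pi> m) 1))\<^sup>2 * (cmod \<omega>)\<^sup>2) * R"
      using e[of \<omega>] e[of 1] by simp
    then show ?thesis using R by simp
  qed
  show thesis by (rule that[OF bij L(3) conf]) (use nz in auto)
qed

text \<open>A straight segment may meet a further hyperplane, namely when two corresponding
  coordinates have a negative real quotient. The detour through \<open>m\<close>, whose complex
  coordinates are those of \<open>p\<close> times \<open>1 + \<i> * of_real \<epsilon>\<close>,
  avoids this for all but finitely many small \<epsilon>.\<close>

lemma convex_stratum_connected:
  fixes e :: "nat \<Rightarrow> 'e::euclidean_space"
  assumes e: "frame_enum e" "2 * k \<le> DIM('e)" and C: "convex C" "open C"
  shows "connected {v \<in> C. \<forall>j<k. zc e j v = 0 \<longleftrightarrow> j \<in> Z}" (is "connected ?S")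
  unfolding connected_iff_connected_component
proof (intro ballI)
  fix p q assume p: "p \<in> ?S" and q: "q \<in> ?S"
  obtain w where w: "\<And>j. j < k \<Longrightarrow> zc e j w = \<i> * zc e j p" using zc_vector[OF e, of "\<lambda>j. \<i> * zc e j p"] by blast
  have "((\<lambda>\<epsilon>. p + \<epsilon> *\<^sub>R w) \<longlongrightarrow> p + 0 *\<^sub>R w) (at_right (0::real))"
    by (intro tendsto_intros)
  then have "eventually (\<lambda>\<epsilon>. p + \<epsilon> *\<^sub>R w \<in> C) (at_right (0::real))"
    using topological_tendstoD[OF _ C(2)] p by auto
  then obtain \<epsilon>0 where \<epsilon>0: "\<epsilon>0 > 0" "\<And>\<epsilon>. 0 < \<epsilon> \<Longrightarrow> \<epsilon> < \<epsilon>0 \<Longrightarrow> p + \<epsilon> *\<^sub>R w \<in> C"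
    unfolding eventually_at_right_field by auto
  define \<rho> where "\<rho> = (\<lambda>j. zc e j p / zc e j q)"
  \<comment> \<open>The values of \<epsilon> for which some quotient \<rho> j becomes real after
    rotation. Where the denominator is 0 the entry is 0 by convention and excludes nothing, since
    \<epsilon> is positive.\<close>
  define F where "F = (\<lambda>j. - Im (\<rho> j) / Re (\<rho> j)) ` {..<k}"
  have "infinite ({0<..<\<epsilon>0} - F)" using \<epsilon>0(1) unfolding F_def by (intro Diff_infinite_finite infinite_Ioo) auto
  then obtain \<epsilon> where "\<epsilon> \<in> {0<..<\<epsilon>0} - F" by (metis all_not_in_conv finite.emptyI)
  then have \<epsilon>: "0 < \<epsilon>" "\<epsilon> < \<epsilon>0" "\<epsilon> \<notin> F" by auto
  define m where "m = p + \<epsilon> *\<^sub>R w"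
  have zm: "zc e j m = zc e j p * (1 + \<i> * of_real \<epsilon>)" if "j < k" for j
    unfolding m_def zc_add zc_scale w[OF that] by (simp add: scaleR_conv_of_real algebra_simps)
  have mC: "m \<in> C" unfolding m_def using \<epsilon>0(2)[OF \<epsilon>(1,2)] .
  have s1: "closed_segment p m \<subseteq> ?S"
  proof
    fix x assume x: "x \<in> closed_segment p m"
    then obtain t where t: "0 \<le> t" "x = (1 - t) *\<^sub>R p + t *\<^sub>R m" unfolding closed_segment_def by blast
    have zx: "zc e j x = zc e j p * (1 + \<i> * of_real (\<epsilon> * t))" if "j < k" for j
      unfolding t zc_add zc_scale zm[OF that] by (simp add: scaleR_conv_of_real algebra_simps)
    have "1 + \<i> * of_real (\<epsilon> * t) \<noteq> 0" by (simp add: complex_eq_iff)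
    then have "\<forall>j<k. zc e j x = 0 \<longleftrightarrow> zc e j p = 0" using zx by simp
    moreover have "x \<in> C" using x p mC closed_segment_subset[OF _ _ C(1)] by blast
    ultimately show "x \<in> ?S" using p by blast
  qed
  have s2: "closed_segment m q \<subseteq> ?S"
  proof
    fix x assume x: "x \<in> closed_segment m q"
    then obtain t where t: "0 \<le> t" "t \<le> 1" "x = (1 - t) *\<^sub>R m + t *\<^sub>R q" unfolding closed_segment_def by blast
    have "zc e j x = 0 \<longleftrightarrow> j \<in> Z" if j: "j < k" for j
    proof (cases "j \<in> Z")
      case True
      then have "zc e j p = 0" "zc e j q = 0" using p q j by auto
      then show ?thesis using True zm[OF j] unfolding t zc_add zc_scale by simp
    next
      case False
      then have nz: "zc e j p \<noteq> 0" "zc e j q \<noteq> 0" using p q j by auto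
      have zp: "zc e j p = zc e j q * \<rho> j" unfolding \<rho>_def using nz by simp
      have zx: "zc e j x = zc e j q * (of_real (1 - t) * (\<rho> j * (1 + \<i> * of_real \<epsilon>)) + of_real t)"
        unfolding t(3) zc_add zc_scale zm[OF j] zp by (simp add: scaleR_conv_of_real algebra_simps)
      have "of_real (1 - t) * (\<rho> j * (1 + \<i> * of_real \<epsilon>)) + of_real t \<noteq> 0"
      proof
        assume 0: "of_real (1 - t) * (\<rho> j * (1 + \<i> * of_real \<epsilon>)) + of_real t = (0::complex)"
        have "Im (of_real (1 - t) * (\<rho> j * (1 + \<i> * of_real \<epsilon>)) + of_real t) = (1 - t) * (Im (\<rho> j) + \<epsilon> * Re (\<rho> j))"
          by (simp add: algebra_simps)
        then have "(1 - t) * (Im (\<rho> j) + \<epsilon> * Re (\<rho> j)) = 0" using 0 by (metis zero_complex.sel(2))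
        then consider "t = 1" | "Im (\<rho> j) + \<epsilon> * Re (\<rho> j) = 0" by auto
        then show False
        proof cases
          case 1
          then show False using 0 by simp
        next
          case 2
          show False
          proof (cases "Re (\<rho> j) = 0")
            case True
            then have "\<rho> j = 0" using 2 by (simp add: complex_eq_iff)
            then show False using nz unfolding \<rho>_def by simp
          next
            case False
            then have "\<epsilon> = - Im (\<rho> j) / Re (\<rho> j)" using 2 by (simp add: field_simps)
            then show False using \<epsilon>(3) j unfolding F_def by blast
          qed
        qed
      qed
      then show ?thesis using zx nz False by simp
    qed
    moreover have "x \<in> C" using x q mC closed_segment_subset[OF _ _ C(1)] by blast
    ultimately show "x \<in> ?S" by blast
  qed
  have "connected (closed_segment p m \<union> closed_segment m q)" by (rule connected_Un) auto
  then show "connected_component ?S p q" unfolding connected_component_def using s1 s2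
    by (intro exI[of _ "closed_segment p m \<union> closed_segment m q"]) auto
qed

text \<open>The vertical vector of a tube chart with prescribed fibre coordinates and no component
  along the base. The explicit sum makes linear maps applied to it split into contributions of the
  single hyperplanes.\<close>

definition vvec :: "(nat \<Rightarrow> 'e::euclidean_space) \<Rightarrow> nat \<Rightarrow> (nat \<Rightarrow> complex) \<Rightarrow> 'e" where
  "vvec e i z = (\<Sum>j<i. Re (z j) *\<^sub>R e (2 * j) + Im (z j) *\<^sub>R e (2 * j + 1))"

lemma vvec_inner:
  assumes e: "frame_enum (e :: nat \<Rightarrow> 'e::euclidean_space)" "2 * i \<le> DIM('e)" and r: "r < DIM('e)"
  shows "vvec e i z \<bullet> e r = (if r < 2 * i then (if even r then Re (z (r div 2)) else Im (z (r div 2))) else 0)"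
proof -
  have "vvec e i z \<bullet> e r = (\<Sum>j<i. Re (z j) * (if 2 * j = r then 1 else 0) + Im (z j) * (if 2 * j + 1 = r then 1 else 0))"
    unfolding vvec_def inner_sum_left by (rule sum.cong) (use e(2) r in \<open>auto simp: inner_add_left frame_inner[OF e(1)]\<close>)
  also have "\<dots> = (\<Sum>j<i. if j = r div 2 then (if even r then Re (z j) else Im (z j)) else 0)"
    by (rule sum.cong) (auto elim!: evenE oddE)
  also have "\<dots> = (if r div 2 < i then (if even r then Re (z (r div 2)) else Im (z (r div 2))) else 0)" by simp
  also have "r div 2 < i \<longleftrightarrow> r < 2 * i" by auto
  finally show ?thesis .
qed

lemma zc_vvec:
  assumes e: "frame_enum (e :: nat \<Rightarrow> 'e::euclidean_space)" "2 * i \<le> DIM('e)" and j: "j < i"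
  shows "zc e j (vvec e i z) = z j"
proof -
  have "2 * j < DIM('e)" "2 * j + 1 < DIM('e)" "2 * j < 2 * i" "2 * j + 1 < 2 * i" using e(2) j by auto
  then show ?thesis unfolding zc_def using vvec_inner[OF e] by (simp add: complex_eq_iff)
qed

lemma vvec_scale: "vvec e i (\<lambda>j. of_real r * z j) = r *\<^sub>R vvec e i z"
  unfolding vvec_def scaleR_sum_right by (rule sum.cong) (auto simp: scaleR_add_right)

lemma bounded_linear_vvec_zc: "bounded_linear (\<lambda>v. vvec e i (\<lambda>j. zc e j v))" unfolding vvec_def
  by (intro bounded_linear_sum bounded_linear_add bounded_linear_compose[OF bounded_linear_scaleR_left]
      bounded_linear_compose[OF bounded_linear_Re bounded_linear_zc]
      bounded_linear_compose[OF bounded_linear_Im bounded_linear_zc])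

section \<open>Strata of the divisor and comparison of charts of a tube\<close>

context elliptic_pair
begin

lemma M: "smooth_mfd M" using divisor unfolding nc_elliptic_divisor_def by blast

lemma stratum_unique: "p \<in> stratum k \<Longrightarrow> p \<in> stratum k' \<Longrightarrow> k = k'"
  unfolding stratum_def using multiplicity_le[OF M] by (blast intro: antisym)

lemma stratum_D: "p \<in> stratum k \<Longrightarrow> p \<in> D \<longleftrightarrow> 0 < k"
proof -
  assume "p \<in> stratum k"
  then obtain V \<phi> e where n: "nc_coords M D I k V \<phi> e" "p \<in> V" "\<phi> p = 0" unfolding stratum_def nc_chart_def by blast
  show ?thesis using nc_coordsD(4)[OF n(1,2)] n(3) by (auto simp: zc_0)
qed

lemma ex_stratum: "p \<in> pts M \<Longrightarrow> \<exists>k. p \<in> stratum k"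
  using divisor unfolding nc_elliptic_divisor_def stratum_def by blast

lemma stratum_count:
  assumes "nc_coords M D I k V \<phi> e" "q \<in> V"
  shows "q \<in> stratum (card {j. j < k \<and> zc e j (\<phi> q) = 0})"
  using nc_chart_recentre[OF M assms] unfolding stratum_def by blast

lemma pieces_subset: "N \<in> pieces i \<Longrightarrow> N \<subseteq> stratum i"
  unfolding pieces_def using connected_components_of_subset by fastforce

end

context elliptic_tubes
begin

lemma tubeD:
  assumes "N \<in> pieces i"
  shows "opn M (U i N)" "N \<subseteq> U i N" "\<And>p. p \<in> U i N \<Longrightarrow> pr i N p \<in> N" "\<And>p. p \<in> N \<Longrightarrow> pr i N p = p"
    "\<And>u. u \<in> U i N \<Longrightarrow> \<exists>(V, \<phi>, e)\<in>T i N. u \<in> V"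
  using tube[OF assms] unfolding nc_tube_def by fast+

lemma tube_chartD:
  assumes "N \<in> pieces i" "(V, \<phi>, e) \<in> T i N"
  shows "nc_coords M D I i V \<phi> e" "V \<subseteq> U i N" "\<And>u. u \<in> U i N \<Longrightarrow> u \<in> V \<longleftrightarrow> pr i N u \<in> V"
    "\<And>v w. v \<in> \<phi> ` V \<Longrightarrow> (\<And>r. 2 * i \<le> r \<Longrightarrow> r < DIM('e) \<Longrightarrow> w \<bullet> e r = v \<bullet> e r) \<Longrightarrow> w \<in> \<phi> ` V"
    "\<And>u j. u \<in> V \<Longrightarrow> j < i \<Longrightarrow> zc e j (\<phi> (pr i N u)) = 0"
    "\<And>u r. u \<in> V \<Longrightarrow> 2 * i \<le> r \<Longrightarrow> r < DIM('e) \<Longrightarrow> \<phi> (pr i N u) \<bullet> e r = \<phi> u \<bullet> e r"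
proof -
  have t: "nc_coords M D I i V \<phi> e \<and> V = {u \<in> U i N. pr i N u \<in> V} \<and>
        (\<forall>v\<in>\<phi> ` V. \<forall>w. (\<forall>r. 2 * i \<le> r \<and> r < DIM('e) \<longrightarrow> w \<bullet> e r = v \<bullet> e r) \<longrightarrow> w \<in> \<phi> ` V) \<and>
        (\<forall>u\<in>V. (\<forall>j<i. zc e j (\<phi> (pr i N u)) = 0) \<and>
           (\<forall>r. 2 * i \<le> r \<and> r < DIM('e) \<longrightarrow> \<phi> (pr i N u) \<bullet> e r = \<phi> u \<bullet> e r))"
    using bspec[OF tube[OF assms(1), unfolded nc_tube_def, THEN conjunct2, THEN conjunct2, THEN conjunct2, THEN conjunct2,
      THEN conjunct2, THEN conjunct1] assms(2)] by simp
  show "nc_coords M D I i V \<phi> e" using t by blast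
  show "V \<subseteq> U i N" "\<And>u. u \<in> U i N \<Longrightarrow> u \<in> V \<longleftrightarrow> pr i N u \<in> V" using t by blast+
  show "\<And>v w. v \<in> \<phi> ` V \<Longrightarrow> (\<And>r. 2 * i \<le> r \<Longrightarrow> r < DIM('e) \<Longrightarrow> w \<bullet> e r = v \<bullet> e r) \<Longrightarrow> w \<in> \<phi> ` V"
    using t by blast
  show "\<And>u j. u \<in> V \<Longrightarrow> j < i \<Longrightarrow> zc e j (\<phi> (pr i N u)) = 0" using t by blast
  show "\<And>u r. u \<in> V \<Longrightarrow> 2 * i \<le> r \<Longrightarrow> r < DIM('e) \<Longrightarrow> \<phi> (pr i N u) \<bullet> e r = \<phi> u \<bullet> e r" using t by blast
qed

lemma tube_transition:
  assumes "N \<in> pieces i" "(V, \<phi>, e) \<in> T i N" "(W, \<psi>, e') \<in> T i N" "p \<in> V" "p \<in> W" "p \<in> N"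
  obtains A where "linear A" "\<And>u. u \<in> V \<Longrightarrow> u \<in> W \<Longrightarrow> pr i N u = p \<Longrightarrow> \<psi> u - \<psi> p = A (\<phi> u - \<phi> p)"
proof -
  have "\<forall>(V, \<phi>, e)\<in>T i N. \<forall>(W, \<psi>, e')\<in>T i N. \<forall>p\<in>V \<inter> W \<inter> N. \<exists>A. linear A \<and>
        (\<forall>u\<in>V \<inter> W. pr i N u = p \<longrightarrow> \<psi> u - \<psi> p = A (\<phi> u - \<phi> p))"
    using tube[OF assms(1), unfolded nc_tube_def, THEN conjunct2, THEN conjunct2, THEN conjunct2, THEN conjunct2,
      THEN conjunct2, THEN conjunct2] .
  from bspec[OF this assms(2)] have "\<forall>(W, \<psi>, e')\<in>T i N. \<forall>p\<in>V \<inter> W \<inter> N. \<exists>A. linear A \<and>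
        (\<forall>u\<in>V \<inter> W. pr i N u = p \<longrightarrow> \<psi> u - \<psi> p = A (\<phi> u - \<phi> p))" by simp
  from bspec[OF this assms(3)] have "\<forall>p\<in>V \<inter> W \<inter> N. \<exists>A. linear A \<and>
        (\<forall>u\<in>V \<inter> W. pr i N u = p \<longrightarrow> \<psi> u - \<psi> p = A (\<phi> u - \<phi> p))" by simp
  from bspec[OF this, of p] assms(4-6) obtain A where A: "linear A \<and> (\<forall>u\<in>V \<inter> W. pr i N u = p \<longrightarrow> \<psi> u - \<psi> p = A (\<phi> u - \<phi> p))"
    by auto
  show thesis by (rule that[of A]) (use A in auto)
qed

text \<open>On each fibre the transition between two tube charts is linear, preserves the divisor
  and multiplies the generator by a constant; by \<open>linear_forms_monomial\<close> every new
  fibre coordinate is, up to a constant in modulus, one of the old ones. It remains to see that the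
  index is locally constant and the constant smooth in the base point.\<close>

lemma tube_compare:
  assumes N: "N \<in> pieces i" and T: "(V, \<phi>, e) \<in> T i N" "(W, \<psi>, e') \<in> T i N"
    and u: "u \<in> V" "u \<in> W" "u \<in> N" and m: "m < i"
  obtains l A c where "l < i" "opn M A" "u \<in> A" "A \<subseteq> V" "A \<subseteq> W" "c \<in> smooth_funs M A"
    "\<And>q. q \<in> A \<Longrightarrow> (c q :: real) \<noteq> 0 \<and> (cmod (zc e' m (\<psi> q)))\<^sup>2 = c q * (cmod (zc e l (\<phi> q)))\<^sup>2"
proof -
  note TD = tubeD[OF N] and TV = tube_chartD[OF N T(1)] and TW = tube_chartD[OF N T(2)]
  note NV = nc_coordsD[OF TV(1)] and NW = nc_coordsD[OF TW(1)]
  define VW where "VW = V \<inter> W"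
  have oVW: "opn M VW" unfolding VW_def using chartD(1)[OF NV(1)] chartD(1)[OF NW(1)] by blast
  \<comment> \<open>The point of the fibre over \<open>p\<close> with fibre coordinates
    \<open>z\<close>. It exists because the image of a tube chart contains whole fibres.\<close>
  define pt where "pt = (\<lambda>p z. inv_into V \<phi> (\<phi> p + vvec e i z))"
  have pt: "\<phi> (pt p z) = \<phi> p + vvec e i z" "pt p z \<in> V" if "p \<in> V" for p z
  proof -
    have "\<phi> p + vvec e i z \<in> \<phi> ` V"
      by (rule TV(4)[of "\<phi> p"]) (use that vvec_inner[OF NV(2,3)] in \<open>auto simp: inner_add_left\<close>)
    then show "\<phi> (pt p z) = \<phi> p + vvec e i z" "pt p z \<in> V" unfolding pt_def by (auto simp: f_inv_into_f inv_into_into)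
  qed
  have zp: "zc e j (\<phi> p) = 0" if "p \<in> V" "p \<in> N" "j < i" for p j using TV(5)[OF that(1,3)] TD(4)[OF that(2)] by simp
  have zp': "zc e' j (\<psi> p) = 0" if "p \<in> W" "p \<in> N" "j < i" for p j using TW(5)[OF that(1,3)] TD(4)[OF that(2)] by simp
  have prV: "pr i N q \<in> V" "pr i N q \<in> N" if "q \<in> V" for q using TV(3)[of q] TV(2) TD(3)[of q] that by auto
  have ptpr: "pr i N (pt p z) = p" if p: "p \<in> V" "p \<in> N" for p z
  proof -
    let ?q = "pt p z"
    have q: "?q \<in> V" using pt(2)[OF p(1)] .
    have "\<phi> (pr i N ?q) = \<phi> p"
    proof (rule zc_eqI[OF NV(2), of i])
      fix r assume r: "2 * i \<le> r" "r < DIM('e)"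
      show "\<phi> (pr i N ?q) \<bullet> e r = \<phi> p \<bullet> e r"
        using TV(6)[OF q r] pt(1)[OF p(1)] r vvec_inner[OF NV(2,3) r(2)] by (simp add: inner_add_left)
    qed (use TV(5)[OF q] zp[OF p] in simp)
    then show ?thesis using chartD(3)[OF NV(1)] prV(1)[OF q] p(1) by (auto dest: inj_onD)
  qed
  have ptW: "pt p z \<in> W" if p: "p \<in> V" "p \<in> W" "p \<in> N" for p z
    using TW(3)[of "pt p z"] ptpr[OF p(1,3), of z] pt(2)[OF p(1), of z] TV(2) p(2) by auto
  have self: "q = pt (pr i N q) (\<lambda>j. zc e j (\<phi> q))" if q: "q \<in> V" for q
  proof -
    have "\<phi> q = \<phi> (pr i N q) + vvec e i (\<lambda>j. zc e j (\<phi> q))"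
    proof (rule zc_eqI[OF NV(2), of i])
      fix j assume "j < i"
      then show "zc e j (\<phi> q) = zc e j (\<phi> (pr i N q) + vvec e i (\<lambda>j. zc e j (\<phi> q)))"
        unfolding zc_add using TV(5)[OF q] zc_vvec[OF NV(2,3)] by simp
    next
      fix r assume r: "2 * i \<le> r" "r < DIM('e)"
      then show "\<phi> q \<bullet> e r = (\<phi> (pr i N q) + vvec e i (\<lambda>j. zc e j (\<phi> q))) \<bullet> e r"
        using TV(6)[OF q r] vvec_inner[OF NV(2,3) r(2)] by (simp add: inner_add_left)
    qed
    then have "\<phi> q = \<phi> (pt (pr i N q) (\<lambda>j. zc e j (\<phi> q)))" using pt(1)[OF prV(1)[OF q]] by simp
    then show ?thesis using chartD(3)[OF NV(1)] q pt(2)[OF prV(1)[OF q]] by (auto dest: inj_onD)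
  qed
  obtain h where h: "h \<in> smooth_funs M VW"
    "\<And>x. x \<in> VW \<Longrightarrow> zprod e' i (\<psi> x) = h x * zprod e i (\<phi> x)"
    using generated_on_compare[OF NW(5) NV(5) oVW] unfolding VW_def by auto
  have contH: "continuous_on (\<phi> ` (VW \<inter> V)) (h \<circ> inv_into V \<phi>)"
    using Cinf_on_continuous[OF smooth_funs_chart[OF M h(1) oVW NV(1)]] .
  have fibre: "\<exists>\<pi>. \<pi> m < i \<and> (\<forall>l<i. l \<noteq> \<pi> m \<longrightarrow> zc e' m (\<psi> (pt p (\<lambda>j. if j = l then 1 else 0))) = 0) \<and>
     zc e' m (\<psi> (pt p (\<lambda>j. if j = \<pi> m then 1 else 0))) \<noteq> 0 \<and>
     (\<forall>z. (cmod (zc e' m (\<psi> (pt p z))))\<^sup>2 =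
       (cmod (zc e' m (\<psi> (pt p (\<lambda>j. if j = \<pi> m then 1 else 0)))))\<^sup>2 * (cmod (z (\<pi> m)))\<^sup>2)"
    if p: "p \<in> V" "p \<in> W" "p \<in> N" for p
  proof -
    obtain L where L: "linear L" "\<And>u. u \<in> V \<Longrightarrow> u \<in> W \<Longrightarrow> pr i N u = p \<Longrightarrow> \<psi> u - \<psi> p = L (\<phi> u - \<phi> p)"
      using tube_transition[OF N T p] by blast
    \<comment> \<open>The block (m, l) of the linear transition between the fibres over
      \<open>p\<close>, as a real-linear map of the complex plane.\<close>
    define g where "g = (\<lambda>m l \<omega>. zc e' m (L (Re \<omega> *\<^sub>R e (2 * l) + Im \<omega> *\<^sub>R e (2 * l + 1))))"
    have lin: "linear (g m l)" for m l
    proof (rule linearI)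
      fix a b :: complex
      have "Re (a + b) *\<^sub>R e (2 * l) + Im (a + b) *\<^sub>R e (2 * l + 1) =
        (Re a *\<^sub>R e (2 * l) + Im a *\<^sub>R e (2 * l + 1)) + (Re b *\<^sub>R e (2 * l) + Im b *\<^sub>R e (2 * l + 1))"
        by (simp add: scaleR_add_left)
      then show "g m l (a + b) = g m l a + g m l b" unfolding g_def by (simp only: linear_add[OF L(1)] zc_add)
    next
      fix r :: real and a :: complex
      have "Re (r *\<^sub>R a) *\<^sub>R e (2 * l) + Im (r *\<^sub>R a) *\<^sub>R e (2 * l + 1) =
        r *\<^sub>R (Re a *\<^sub>R e (2 * l) + Im a *\<^sub>R e (2 * l + 1))" by (simp add: scaleR_add_right)
      then show "g m l (r *\<^sub>R a) = r *\<^sub>R g m l a" unfolding g_def by (simp only: linear_scale[OF L(1)] zc_scale)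
    qed
    have sum: "(\<Sum>l<i. g m l (z l)) = zc e' m (\<psi> (pt p z))" if m: "m < i" for m z
    proof -
      have "\<psi> (pt p z) - \<psi> p = L (vvec e i z)" using L(2)[OF pt(2)[OF p(1)] ptW[OF p] ptpr[OF p(1,3)]] pt(1)[OF p(1)] by simp
      then have "zc e' m (\<psi> (pt p z)) = zc e' m (L (vvec e i z))"
        using zp'[OF p(2,3) m] zc_diff[of e' m "\<psi> (pt p z)" "\<psi> p"] by simp
      also have "\<dots> = (\<Sum>l<i. g m l (z l))"
        unfolding vvec_def g_def linear_sum[OF L(1)] linear_sum[OF bounded_linear.linear[OF bounded_linear_zc]] by simp
      finally show ?thesis by simp
    qed
    have zpt: "zc e l (\<phi> (pt p z)) = z l" if "l < i" for l z
      unfolding pt(1)[OF p(1)] zc_add using zp[OF p(1,3) that] zc_vvec[OF NV(2,3) that] by simp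
    have D': "(\<exists>m<i. (\<Sum>l<i. g m l (z l)) = 0) \<longleftrightarrow> (\<exists>l<i. z l = 0)" for z
      using NV(4)[OF pt(2)[OF p(1), of z]] NW(4)[OF ptW[OF p, of z]] sum zpt by auto
    \<comment> \<open>The ideal provides a factor \<open>h\<close> that may vary along the fibre. At
      the points with coordinates \<open>of_real r * z j\<close> both sides scale by the same power
      of \<open>r\<close>, so \<open>h\<close> is constant along the ray off the divisor, and
      letting \<open>r\<close> tend to 0 identifies it with \<open>h p\<close>.\<close>
    have H': "(\<Prod>m<i. (cmod (\<Sum>l<i. g m l (z l)))\<^sup>2) = h p * (\<Prod>l<i. (cmod (z l))\<^sup>2)" for z
    proof (cases "(\<Prod>l<i. (cmod (z l))\<^sup>2) = 0")
      case True
      then have "\<exists>l<i. z l = 0" by (auto simp: prod_zero_iff)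
      then have "\<exists>m<i. (\<Sum>l<i. g m l (z l)) = 0" using D'[of z] by blast
      then have "(\<Prod>m<i. (cmod (\<Sum>l<i. g m l (z l)))\<^sup>2) = 0" by (auto simp: prod_zero_iff)
      then show ?thesis unfolding True by (simp only: mult_zero_right)
    next
      case False
      have e: "(\<Prod>m<i. (cmod (\<Sum>l<i. g m l (z l)))\<^sup>2) = h (pt p (\<lambda>j. of_real r * z j)) * (\<Prod>l<i. (cmod (z l))\<^sup>2)"
        if r: "0 < r" for r
      proof -
        have "pt p (\<lambda>j. of_real r * z j) \<in> VW" unfolding VW_def using pt(2)[OF p(1)] ptW[OF p] by blast
        from h(2)[OF this]
        have "(\<Prod>m<i. (cmod (\<Sum>l<i. g m l (of_real r * z l)))\<^sup>2) =
          h (pt p (\<lambda>j. of_real r * z j)) * (\<Prod>l<i. (cmod (of_real r * z l))\<^sup>2)" using sum zpt by simp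
        moreover have "(\<Sum>l<i. g m l (of_real r * z l)) = of_real r * (\<Sum>l<i. g m l (z l))" for m
          using linear_scale[OF lin, of m _ r] by (simp add: scaleR_conv_of_real sum_distrib_left)
        ultimately have "(r\<^sup>2) ^ i * (\<Prod>m<i. (cmod (\<Sum>l<i. g m l (z l)))\<^sup>2) =
          (r\<^sup>2) ^ i * (h (pt p (\<lambda>j. of_real r * z j)) * (\<Prod>l<i. (cmod (z l))\<^sup>2))"
          by (simp add: norm_mult power_mult_distrib prod.distrib algebra_simps)
        then show ?thesis using r by simp
      qed
      have im: "\<phi> p \<in> \<phi> ` (VW \<inter> V)" using p unfolding VW_def by auto
      have o: "open (\<phi> ` (VW \<inter> V))" by (rule chartD(5)[OF NV(1) oVW])
      have "isCont (h \<circ> inv_into V \<phi>) (\<phi> p)" using contH im o continuous_on_eq_continuous_at by blast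
      moreover have "((\<lambda>r. \<phi> p + r *\<^sub>R vvec e i z) \<longlongrightarrow> \<phi> p + 0 *\<^sub>R vvec e i z) (at_right (0::real))"
        by (intro tendsto_intros)
      ultimately have lim: "((\<lambda>r. (h \<circ> inv_into V \<phi>) (\<phi> p + r *\<^sub>R vvec e i z)) \<longlongrightarrow> (h \<circ> inv_into V \<phi>) (\<phi> p)) (at_right (0::real))"
        using isCont_tendsto_compose by fastforce
      have ev: "eventually (\<lambda>r. (h \<circ> inv_into V \<phi>) (\<phi> p + r *\<^sub>R vvec e i z) =
         (\<Prod>m<i. (cmod (\<Sum>l<i. g m l (z l)))\<^sup>2) / (\<Prod>l<i. (cmod (z l))\<^sup>2)) (at_right (0::real))"
        using eventually_at_right_less[of 0]
      proof eventually_elim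
        fix r :: real assume "0 < r"
        from e[OF this] show "(h \<circ> inv_into V \<phi>) (\<phi> p + r *\<^sub>R vvec e i z) =
         (\<Prod>m<i. (cmod (\<Sum>l<i. g m l (z l)))\<^sup>2) / (\<Prod>l<i. (cmod (z l))\<^sup>2)"
          using False unfolding pt_def vvec_scale by (simp add: field_simps)
      qed
      have "((\<lambda>r::real. (\<Prod>m<i. (cmod (\<Sum>l<i. g m l (z l)))\<^sup>2) / (\<Prod>l<i. (cmod (z l))\<^sup>2)) \<longlongrightarrow> (h \<circ> inv_into V \<phi>) (\<phi> p)) (at_right 0)"
        using lim ev by (rule Lim_transform_eventually)
      then have "(h \<circ> inv_into V \<phi>) (\<phi> p) = (\<Prod>m<i. (cmod (\<Sum>l<i. g m l (z l)))\<^sup>2) / (\<Prod>l<i. (cmod (z l))\<^sup>2)"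
        using tendsto_unique[OF trivial_limit_at_right_real] tendsto_const by blast
      then show ?thesis using False chartD(4)[OF NV(1) p(1)] by (simp add: field_simps)
    qed
    obtain \<pi> where \<pi>: "bij_betw \<pi> {..<i} {..<i}"
      "\<And>m l \<omega>. m < i \<Longrightarrow> l < i \<Longrightarrow> l \<noteq> \<pi> m \<Longrightarrow> g m l \<omega> = 0"
      "\<And>m \<omega>. m < i \<Longrightarrow> (cmod (g m (\<pi> m) \<omega>))\<^sup>2 = (cmod (g m (\<pi> m) 1))\<^sup>2 * (cmod \<omega>)\<^sup>2"
      "\<And>m. m < i \<Longrightarrow> g m (\<pi> m) 1 \<noteq> 0" using linear_forms_monomial[OF lin D' H'] by blast
    have \<pi>m: "\<pi> m < i" using \<pi>(1) m unfolding bij_betw_def by auto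
    have single: "zc e' m (\<psi> (pt p z)) = g m (\<pi> m) (z (\<pi> m))" for z
    proof -
      have "zc e' m (\<psi> (pt p z)) = (\<Sum>l<i. g m l (z l))" using sum[OF m] by simp
      also have "\<dots> = (\<Sum>l<i. if l = \<pi> m then g m l (z l) else 0)" by (rule sum.cong) (use \<pi>(2)[OF m] in auto)
      finally show ?thesis using \<pi>m by simp
    qed
    show ?thesis
    proof (intro exI[of _ \<pi>] conjI allI impI)
      show "\<pi> m < i" by (rule \<pi>m)
      show "zc e' m (\<psi> (pt p (\<lambda>j. if j = l then 1 else 0))) = 0" if "l < i" "l \<noteq> \<pi> m" for l
        unfolding single using that(2) linear_0[OF lin] by simp
      show "zc e' m (\<psi> (pt p (\<lambda>j. if j = \<pi> m then 1 else 0))) \<noteq> 0" unfolding single using \<pi>(4)[OF m] by simp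
      show "(cmod (zc e' m (\<psi> (pt p z))))\<^sup>2 =
          (cmod (zc e' m (\<psi> (pt p (\<lambda>j. if j = \<pi> m then 1 else 0)))))\<^sup>2 * (cmod (z (\<pi> m)))\<^sup>2" for z
        unfolding single using \<pi>(3)[OF m, of "z (\<pi> m)"] by simp
    qed
  qed
  obtain \<pi> where \<pi>: "\<pi> m < i" "zc e' m (\<psi> (pt u (\<lambda>j. if j = \<pi> m then 1 else 0))) \<noteq> 0"
    using fibre[OF u] by blast
  define l where "l = \<pi> m"
  define \<epsilon> where "\<epsilon> = (\<lambda>j. if j = l then 1 else (0::complex))"
  \<comment> \<open>The value of the new coordinate on the unit vector of the \<open>l\<close>-th
    old hyperplane direction over the base point of \<open>q\<close>. Its squared modulus is the
    factor sought, and where it is nonzero the index is still \<open>l\<close>.\<close>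
  define \<kappa> where "\<kappa> = (\<lambda>q. zc e' m (\<psi> (pt (pr i N q) \<epsilon>)))"
  have prVW: "pr i N q \<in> V \<and> pr i N q \<in> W \<and> pr i N q \<in> N" if "q \<in> VW" for q
    using prV that TW(3)[of q] TW(2) unfolding VW_def by auto
  have s\<kappa>: "\<kappa> \<in> smooth_funs M VW"
  proof -
    \<comment> \<open>In the chart \<phi> this is the projection to the base followed by translation
      by the unit vertical vector; it exhibits \<kappa> as a composite of smooth maps.\<close>
    let ?B = "\<lambda>v. v - vvec e i (\<lambda>j. zc e j v) + vvec e i \<epsilon>"
    have \<phi>pr: "\<phi> (pr i N q) = \<phi> q - vvec e i (\<lambda>j. zc e j (\<phi> q))" if q: "q \<in> V" for q
    proof -
      have "\<phi> q = \<phi> (pr i N q) + vvec e i (\<lambda>j. zc e j (\<phi> q))" using self[OF q] pt(1)[OF prV(1)[OF q]] by metis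
      then show ?thesis by (simp add: algebra_simps)
    qed
    have 1: "Cinf_on (\<phi> ` (V \<inter> W)) (\<lambda>v. zc e' m ((\<psi> \<circ> inv_into V \<phi>) v))"
      using chartD(6)[OF NV(1), of "V \<inter> W"] oVW unfolding VW_def
      by (intro Cinf_on_bounded_linear_compose[OF bounded_linear_zc] chart_compatible[OF M NV(1) NW(1)]) auto
    have oU: "open (UNIV :: 'e set)" by simp
    have 2: "Cinf_on UNIV ?B"
      by (intro Cinf_on_add[OF oU] Cinf_on_diff[OF oU] Cinf_on_ident Cinf_on_const Cinf_on_bounded_linear bounded_linear_vvec_zc)
    have s\<phi>: "\<phi> \<in> smooth_funs M VW" using smooth_funs_subset[OF smooth_funs_chart_map[OF NV(1)]] unfolding VW_def by simp
    have s1: "(\<lambda>q. ?B (\<phi> q)) \<in> smooth_funs M VW" by (rule smooth_funs_post_compose[OF M oVW s\<phi> subset_UNIV 2])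
    have im: "?B (\<phi> q) = \<phi> (pt (pr i N q) \<epsilon>)" if "q \<in> VW" for q
      using \<phi>pr[of q] pt(1)[OF prV(1), of q \<epsilon>] that unfolding VW_def by auto
    have "(\<lambda>q. zc e' m ((\<psi> \<circ> inv_into V \<phi>) (?B (\<phi> q)))) \<in> smooth_funs M VW"
      by (rule smooth_funs_post_compose[OF M oVW s1 _ 1])
        (use im prVW pt(2) ptW in \<open>auto intro!: imageI\<close>)
    then show ?thesis
    proof (rule smooth_funs_cong[OF M oVW])
      fix q assume q: "q \<in> VW"
      show "\<kappa> q = zc e' m ((\<psi> \<circ> inv_into V \<phi>) (?B (\<phi> q)))"
        unfolding im[OF q] \<kappa>_def using chartD(4)[OF NV(1) pt(2)] prVW[OF q] by simp
    qed
  qed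
  define A where "A = {q \<in> VW. \<kappa> q \<in> - {0}}"
  have oA: "opn M A" unfolding A_def by (rule smooth_funs_continuous_map[OF M s\<kappa> oVW]) auto
  have "\<kappa> u \<noteq> 0" unfolding \<kappa>_def \<epsilon>_def l_def TD(4)[OF u(3)] using \<pi>(2) by simp
  then have uA: "u \<in> A" unfolding A_def VW_def using u by auto
  define c where "c = (\<lambda>q. (cmod (\<kappa> q))\<^sup>2)"
  have s\<kappa>A: "\<kappa> \<in> smooth_funs M A" by (rule smooth_funs_subset[OF s\<kappa>]) (auto simp: A_def)
  have "(\<lambda>q. \<kappa> q \<bullet> \<kappa> q) \<in> smooth_funs M A" by (rule smooth_funs_bilinear[OF bounded_bilinear_inner M oA s\<kappa>A s\<kappa>A])
  then have sc: "c \<in> smooth_funs M A" unfolding c_def by (simp add: power2_norm_eq_inner)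
  have main: "c q \<noteq> 0 \<and> (cmod (zc e' m (\<psi> q)))\<^sup>2 = c q * (cmod (zc e l (\<phi> q)))\<^sup>2" if q: "q \<in> A" for q
  proof -
    have qVW: "q \<in> VW" and k: "\<kappa> q \<noteq> 0" using q unfolding A_def by auto
    let ?p = "pr i N q"
    have p: "?p \<in> V" "?p \<in> W" "?p \<in> N" using prVW[OF qVW] by auto
    obtain \<pi>' where \<pi>': "\<pi>' m < i" "\<And>l. l < i \<Longrightarrow> l \<noteq> \<pi>' m \<Longrightarrow> zc e' m (\<psi> (pt ?p (\<lambda>j. if j = l then 1 else 0))) = 0"
      "\<And>z. (cmod (zc e' m (\<psi> (pt ?p z))))\<^sup>2 =
         (cmod (zc e' m (\<psi> (pt ?p (\<lambda>j. if j = \<pi>' m then 1 else 0)))))\<^sup>2 * (cmod (z (\<pi>' m)))\<^sup>2"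
      using fibre[OF p] by blast
    \<comment> \<open>All blocks other than the one of index \<open>\<pi>' m\<close> vanish over the
      base point of \<open>q\<close>, whereas \<kappa> q is not 0.\<close>
    have "l = \<pi>' m"
    proof (rule ccontr)
      assume "l \<noteq> \<pi>' m"
      then have "\<kappa> q = 0" unfolding \<kappa>_def \<epsilon>_def using \<pi>'(2)[of l] \<pi>(1) unfolding l_def by simp
      then show False using k by simp
    qed
    then have "(cmod (zc e' m (\<psi> (pt ?p (\<lambda>j. zc e j (\<phi> q))))))\<^sup>2 = c q * (cmod (zc e l (\<phi> q)))\<^sup>2"
      using \<pi>'(3)[of "\<lambda>j. zc e j (\<phi> q)"] unfolding c_def \<kappa>_def \<epsilon>_def by simp
    then show ?thesis using self[of q] qVW k unfolding VW_def c_def by simp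
  qed
  show thesis by (rule that[OF _ oA uA _ _ sc main]) (use \<pi>(1) l_def in \<open>auto simp: A_def VW_def\<close>)
qed

end

section \<open>The groupoid over a sheet\<close>

text \<open>A diffeomorphism in the sense of \<open>diffeo\<close> does not by itself make the
  target a manifold. Open images of its charts follow from invariance of domain, as both model
  spaces agree, and transition maps are smooth because they factor through charts of
  \<open>Z\<close>.\<close>

lemma smooth_mfd_of_diffeo:
  fixes X :: "('p, 'e::euclidean_space) mfd" and Z :: "('q, 'e) mfd"
  assumes Z: "smooth_mfd Z" and d: "diffeo Z X \<gamma>"
    and op: "\<And>V \<phi>. (V, \<phi>) \<in> atlas X \<Longrightarrow> opn X V"
    and inj: "\<And>V \<phi>. (V, \<phi>) \<in> atlas X \<Longrightarrow> inj_on \<phi> V"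
    and cont: "\<And>V \<phi> A. (V, \<phi>) \<in> atlas X \<Longrightarrow> open A \<Longrightarrow> opn X {q \<in> V. \<phi> q \<in> A}"
    and cov: "\<Union> (fst ` atlas X) = pts X"
  shows "smooth_mfd X"
proof -
  obtain G where G: "smooth_map Z X \<gamma>" "smooth_map X Z G" "\<And>q. q \<in> pts Z \<Longrightarrow> G (\<gamma> q) = q"
     "\<And>y. y \<in> pts X \<Longrightarrow> \<gamma> (G y) = y" using d unfolding diffeo_def by blast
  have im: "open (\<phi> ` W)" if V: "(V, \<phi>) \<in> atlas X" and W: "opn X W" "W \<subseteq> V" for V \<phi> W
  proof (subst open_subopen, clarify)
    fix q assume q: "q \<in> W"
    then have qt: "q \<in> pts X" using openin_subset[OF W(1)] by blast
    have zt: "G q \<in> pts Z" by (rule smooth_map_in_topspace[OF G(2) qt])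
    obtain A \<theta> where A: "chart Z A \<theta>" "G q \<in> A" by (rule ex_chart[OF Z zt])
    define B where "B = A \<inter> {z \<in> pts Z. \<gamma> z \<in> W}"
    have oB: "opn Z B" unfolding B_def using chartD(1)[OF A(1)] smooth_map_preimage_open[OF G(1) W(1)] by blast
    define f where "f = (\<phi> \<circ> \<gamma>) \<circ> inv_into A \<theta>"
    have oc: "open (\<theta> ` B)" by (rule chartD(6)[OF A(1) oB]) (auto simp: B_def)
    have oV: "opn Z {z \<in> pts Z. \<gamma> z \<in> V}" by (rule smooth_map_preimage_open[OF G(1) op[OF V]])
    have "\<phi> \<circ> \<gamma> \<in> smooth_funs Z {z \<in> pts Z. \<gamma> z \<in> V}" using G(1) V unfolding smooth_map_def by blast
    then have "continuous_on (\<theta> ` ({z \<in> pts Z. \<gamma> z \<in> V} \<inter> A)) f"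
      unfolding f_def using Cinf_on_continuous[OF smooth_funs_chart[OF Z _ oV A(1)]] by blast
    then have cf: "continuous_on (\<theta> ` B) f" by (rule continuous_on_subset) (use W(2) in \<open>auto simp: B_def\<close>)
    have fv: "f (\<theta> z) = \<phi> (\<gamma> z)" if "z \<in> B" for z using that unfolding f_def B_def by (simp add: chartD(4)[OF A(1)])
    have "inj_on f (\<theta> ` B)"
    proof (rule inj_onI, clarify)
      fix z z' assume z: "z \<in> B" "z' \<in> B" "f (\<theta> z) = f (\<theta> z')"
      then have "\<phi> (\<gamma> z) = \<phi> (\<gamma> z')" using fv by simp
      moreover have "\<gamma> z \<in> V" "\<gamma> z' \<in> V" using z W(2) unfolding B_def by auto
      ultimately have "\<gamma> z = \<gamma> z'" using inj[OF V] by (auto dest: inj_onD)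
      moreover have "z \<in> pts Z" "z' \<in> pts Z" using z unfolding B_def by auto
      ultimately have "z = z'" using G(3) by metis
      then show "\<theta> z = \<theta> z'" by simp
    qed
    then have "open (f ` \<theta> ` B)" using invariance_of_domain[OF cf oc] by blast
    moreover have "f ` \<theta> ` B \<subseteq> \<phi> ` W" using fv unfolding B_def by auto
    moreover have "\<phi> q \<in> f ` \<theta> ` B"
    proof -
      have "G q \<in> B" unfolding B_def using A zt G(4)[OF qt] q by simp
      then show ?thesis using fv[of "G q"] G(4)[OF qt] by force
    qed
    ultimately show "\<exists>T. open T \<and> \<phi> q \<in> T \<and> T \<subseteq> \<phi> ` W" by blast
  qed
  have tc: "top_chart X V \<phi>" if "(V, \<phi>) \<in> atlas X" for V \<phi>
    unfolding top_chart_iff using op[OF that] inj[OF that] im[OF that] cont[OF that] by blast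
  have comp: "Cinf_on (\<phi> ` (V \<inter> W)) (\<psi> \<circ> inv_into V \<phi>)" if V: "(V, \<phi>) \<in> atlas X" and W: "(W, \<psi>) \<in> atlas X" for V \<phi> W \<psi>
  proof (rule Cinf_on_local, clarify)
    fix q assume q: "q \<in> V" "q \<in> W"
    then have qt: "q \<in> pts X" using openin_subset[OF op[OF V]] by blast
    obtain A \<theta> where A: "(A, \<theta>) \<in> atlas Z" "G q \<in> A" by (rule ex_atlas_chart[OF Z smooth_map_in_topspace[OF G(2) qt]])
    have cA: "chart Z A \<theta>" by (rule chart_atlas[OF Z A(1)])
    define B where "B = V \<inter> W \<inter> {x \<in> pts X. G x \<in> A}"
    have oB: "opn X B" unfolding B_def using op[OF V] op[OF W] smooth_map_preimage_open[OF G(2) chartD(1)[OF cA]] by blast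
    have o: "open (\<phi> ` B)" by (rule im[OF V oB]) (auto simp: B_def)
    have s1: "Cinf_on (\<phi> ` ({x \<in> pts X. G x \<in> A} \<inter> V)) (\<theta> \<circ> G \<circ> inv_into V \<phi>)"
      using G(2) A V unfolding smooth_map_def smooth_funs_def by blast
    have s1': "Cinf_on (\<phi> ` B) (\<theta> \<circ> G \<circ> inv_into V \<phi>)" by (rule Cinf_on_subset[OF s1]) (auto simp: B_def)
    have oW: "opn Z {z \<in> pts Z. \<gamma> z \<in> W}" by (rule smooth_map_preimage_open[OF G(1) op[OF W]])
    have "\<psi> \<circ> \<gamma> \<in> smooth_funs Z {z \<in> pts Z. \<gamma> z \<in> W}" using G(1) W unfolding smooth_map_def by blast
    from smooth_funs_chart[OF Z this oW cA]
    have s2: "Cinf_on (\<theta> ` ({z \<in> pts Z. \<gamma> z \<in> W} \<inter> A)) (\<psi> \<circ> \<gamma> \<circ> inv_into A \<theta>)" .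
    have iv: "inv_into V \<phi> (\<phi> x) = x" if "x \<in> V" for x using inj[OF V] that by simp
    have "Cinf_on (\<phi> ` B) (\<lambda>v. (\<psi> \<circ> \<gamma> \<circ> inv_into A \<theta>) ((\<theta> \<circ> G \<circ> inv_into V \<phi>) v))"
    proof (rule Cinf_on_compose[OF o _ s1' s2], clarify)
      fix x assume x: "x \<in> B"
      then have "G x \<in> {z \<in> pts Z. \<gamma> z \<in> W} \<inter> A"
        unfolding B_def using smooth_map_in_topspace[OF G(2)] G(4) by auto
      then show "(\<theta> \<circ> G \<circ> inv_into V \<phi>) (\<phi> x) \<in> \<theta> ` ({z \<in> pts Z. \<gamma> z \<in> W} \<inter> A)"
        using iv x unfolding B_def by auto
    qed
    then have "Cinf_on (\<phi> ` B) (\<psi> \<circ> inv_into V \<phi>)"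
    proof (rule Cinf_on_cong[OF o, rotated], clarify)
      fix x assume x: "x \<in> B"
      then show "(\<psi> \<circ> \<gamma> \<circ> inv_into A \<theta>) ((\<theta> \<circ> G \<circ> inv_into V \<phi>) (\<phi> x)) = (\<psi> \<circ> inv_into V \<phi>) (\<phi> x)"
        unfolding B_def using iv[of x] chartD(4)[OF cA, of "G x"] G(4)[of x] by simp
    qed
    moreover have "\<phi> q \<in> \<phi> ` B" unfolding B_def using q qt A by blast
    ultimately show "\<exists>T. open T \<and> \<phi> q \<in> T \<and> Cinf_on T (\<psi> \<circ> inv_into V \<phi>)" using o by blast
  qed
  show ?thesis unfolding smooth_mfd_def compatible_def using tc cov comp by (auto simp: Int_commute) (metis Int_commute comp)+
qed

lemma connected_component_unique:
  assumes "C1 \<in> connected_components_of X" "C2 \<in> connected_components_of X" "connectedin X S"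
    "S \<inter> C1 \<noteq> {}" "S \<inter> C2 \<noteq> {}"
  shows "C1 = C2"
proof -
  have "S \<subseteq> C1" "S \<subseteq> C2"
    using connected_components_of_maximal[OF assms(1,3)] connected_components_of_maximal[OF assms(2,3)] assms(4,5)
    by (auto simp: disjnt_def Int_commute)
  then show ?thesis using connected_components_of_overlap[OF assms(1,2)] assms(4) by blast
qed

lemma same_cohypD:
  assumes M: "smooth_mfd M" and s: "same_cohyp M p f g"
  shows "f p = 0" "g p = 0" "\<exists>V. opn M V \<and> p \<in> V \<and> (\<forall>q\<in>V. f q = 0 \<longleftrightarrow> g q = 0)"
    "\<exists>\<alpha> \<beta>. cmod \<beta> < cmod \<alpha> \<and> (\<forall>\<tau>. tvec M p \<tau> \<longrightarrow> \<tau> f = \<alpha> * \<tau> g + \<beta> * cnj (\<tau> g))"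
proof -
  obtain V \<phi> f' g' a b where V: "chart M V \<phi>" "p \<in> V" "f \<in> smooth_funs M V" "g \<in> smooth_funs M V"
     "f p = 0" "g p = 0" "\<forall>q\<in>V. f q = 0 \<longleftrightarrow> g q = 0"
     "((f \<circ> inv_into V \<phi>) has_derivative f') (at (\<phi> p))" "((g \<circ> inv_into V \<phi>) has_derivative g') (at (\<phi> p))"
     "cmod b < cmod a" "\<forall>v. f' v = a * g' v + b * cnj (g' v)" using s unfolding same_cohyp_def by (elim exE conjE) (rule that)
  show "f p = 0" "g p = 0" by fact+
  show "\<exists>V. opn M V \<and> p \<in> V \<and> (\<forall>q\<in>V. f q = 0 \<longleftrightarrow> g q = 0)" using V chartD(1)[OF V(1)] by blast
  have sf: "smooth_at M p f" "smooth_at M p g" using V chartD(1)[OF V(1)] by (auto intro: smooth_atI)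
  have "\<tau> f = a * \<tau> g + b * cnj (\<tau> g)" if t: "tvec M p \<tau>" for \<tau>
  proof -
    obtain v where v: "\<And>f. smooth_at M p f \<Longrightarrow> \<tau> f = dchart p V \<phi> v f" by (rule tvec_rep[OF M t V(1,2)]) (rule that)
    have "\<tau> f = f' v" "\<tau> g = g' v" using v[OF sf(1)] v[OF sf(2)] frechet_derivative_eqI[OF V(8)] frechet_derivative_eqI[OF V(9)]
      unfolding dchart_def[OF M] by auto
    then show ?thesis using V(11) by simp
  qed
  then show "\<exists>\<alpha> \<beta>. cmod \<beta> < cmod \<alpha> \<and> (\<forall>\<tau>. tvec M p \<tau> \<longrightarrow> \<tau> f = \<alpha> * \<tau> g + \<beta> * cnj (\<tau> g))" using V(10) by blast
qed

text \<open>Reflexivity is not automatic, since \<open>same_cohyp\<close> includes surjectivity of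
  the differential. It puts a coordinate function into its own class, so that equality of classes
  yields a relation between functions.\<close>

lemma same_cohyp_refl:
  assumes M: "smooth_mfd M" and c: "chart M V \<phi>" "p \<in> V" and e: "frame_enum e" "2 * k \<le> DIM('e::euclidean_space)" "m < k"
    and z: "zc e m ((\<phi> :: 'p \<Rightarrow> 'e) p) = 0"
    and \<zeta>: "\<zeta> = (\<lambda>q. zc e m (\<phi> q)) \<or> \<zeta> = (\<lambda>q. cnj (zc e m (\<phi> q)))"
  shows "same_cohyp M p \<zeta> \<zeta>"
proof -
  define h where "h = (if \<zeta> = (\<lambda>q. zc e m (\<phi> q)) then (\<lambda>w. w) else cnj)"
  have h: "\<zeta> = (\<lambda>q. h (zc e m (\<phi> q)))" using \<zeta> unfolding h_def by auto
  have bh: "bounded_linear h" unfolding h_def by (simp add: bounded_linear_ident bounded_linear_cnj)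
  have "surj cnj" by (rule surjI[of cnj cnj]) simp
  then have sh: "surj h" unfolding h_def by simp
  have bl: "bounded_linear (\<lambda>v. h (zc e m v))" using bounded_linear_compose[OF bh bounded_linear_zc] .
  have s: "\<zeta> \<in> smooth_funs M V"
    unfolding h by (rule smooth_funs_linear[OF bl M chartD(1)[OF c(1)] smooth_funs_chart_map[OF c(1)]])
  have d: "((\<zeta> \<circ> inv_into V \<phi>) has_derivative (\<lambda>v. h (zc e m v))) (at (\<phi> p))"
    by (rule has_derivative_transform_within_open[OF bounded_linear_imp_has_derivative[OF bl] chartD(7)[OF c(1)]])
      (use c in \<open>auto simp: h chartD(4)[OF c(1)]\<close>)
  have sj: "surj (\<lambda>v. h (zc e m v))"
  proof (rule surjI)
    fix w
    obtain v where v: "\<And>j. j < k \<Longrightarrow> zc e j v = inv_into UNIV h w" using zc_vector[OF e(1,2), of "\<lambda>_. inv_into UNIV h w"] by blast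
    then have ex: "\<exists>v. zc e m v = inv_into UNIV h w" using e(3) by blast
    show "h (zc e m ((\<lambda>w. SOME v. zc e m v = inv_into UNIV h w) w)) = w" using someI_ex[OF ex] sh by (simp add: f_inv_into_f)
  qed
  have z0: "\<zeta> p = 0" unfolding h z using linear_0[OF bounded_linear.linear[OF bh]] .
  show ?thesis unfolding same_cohyp_def
    by (intro exI[of _ V] exI[of _ \<phi>] exI[of _ "\<lambda>v. h (zc e m v)"] exI[of _ 1] exI[of _ 0])
      (use c s d sj z0 in auto)
qed

section \<open>Sheets of the bundle of framings and their squares\<close>

context elliptic_tubes
begin

lemma mtop_PN [simp]: "mtop (PN i N) = PN_top i N" unfolding PN_def etale_mfd_def by simp

definition sect :: "nat \<Rightarrow> 'a set \<Rightarrow> 'a set \<Rightarrow> ('a \<Rightarrow> 'e) \<Rightarrow> (nat \<Rightarrow> 'e) \<Rightarrow> 'a cov set" where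
  "sect i N B \<phi> e = {(u, framing M i \<phi> e (pr i N u)) | u. u \<in> B}"

lemma sect_open:
  assumes "nc_coords M D I i V \<phi> e" "opn M B" "B \<subseteq> U i N" "pr i N ` B \<subseteq> V"
  shows "openin (PN_top i N) (sect i N B \<phi> e)"
  unfolding PN_top_def sect_def by (rule topology_generated_by_Basis) (use assms in blast)

lemma PN_point:
  assumes "x \<in> topspace (PN_top i N)"
  obtains B V \<phi> e where "nc_coords M D I i V \<phi> e" "opn M B" "B \<subseteq> U i N" "pr i N ` B \<subseteq> V"
    "fst x \<in> B" "snd x = framing M i \<phi> e (pr i N (fst x))"
proof -
  have "x \<in> \<Union> {{(u, framing M i \<phi> e (pr i N u)) | u. u \<in> B} | B V \<phi> e.
        nc_coords M D I i V \<phi> e \<and> opn M B \<and> B \<subseteq> U i N \<and> pr i N ` B \<subseteq> V}"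
    using assms unfolding PN_top_def topology_generated_by_topspace .
  then show thesis using that by auto
qed

lemma PN_fst: "x \<in> topspace (PN_top i N) \<Longrightarrow> fst x \<in> U i N \<and> fst x \<in> pts M"
  by (rule PN_point) (use openin_subset in fastforce)+

lemma length_snd_PN: "x \<in> topspace (PN_top i N) \<Longrightarrow> length (snd x) = i" by (rule PN_point) (auto simp: framing_def)

lemma PN_fst_open:
  assumes A: "opn M A"
  shows "openin (PN_top i N) {x \<in> topspace (PN_top i N). fst x \<in> A}"
proof (subst openin_subopen, clarify)
  fix u c assume x: "(u, c) \<in> topspace (PN_top i N)" "fst (u, c) \<in> A"
  obtain B V \<phi> e where B: "nc_coords M D I i V \<phi> e" "opn M B" "B \<subseteq> U i N" "pr i N ` B \<subseteq> V"
    "fst (u, c) \<in> B" "snd (u, c) = framing M i \<phi> e (pr i N (fst (u, c)))" by (rule PN_point[OF x(1)])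
  have o: "openin (PN_top i N) (sect i N (B \<inter> A) \<phi> e)" by (rule sect_open[OF B(1)]) (use B A in auto)
  show "\<exists>T. openin (PN_top i N) T \<and> (u, c) \<in> T \<and> T \<subseteq> {x \<in> topspace (PN_top i N). fst x \<in> A}"
    by (rule exI[of _ "sect i N (B \<inter> A) \<phi> e"]) (use o x B openin_subset[OF o] in \<open>auto simp: sect_def\<close>)
qed

lemma PN_fst_continuous: "continuous_map (PN_top i N) (mtop M) fst" unfolding continuous_map_def using PN_fst PN_fst_open by auto

lemma PN_local:
  assumes x: "x \<in> topspace (PN_top i N)" and A: "opn M A" "fst x \<in> A"
  obtains B where "openin (PN_top i N) B" "x \<in> B" "inj_on fst B" "fst ` B \<subseteq> A"
proof -
  obtain B V \<phi> e where B: "nc_coords M D I i V \<phi> e" "opn M B" "B \<subseteq> U i N" "pr i N ` B \<subseteq> V"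
    "fst x \<in> B" "snd x = framing M i \<phi> e (pr i N (fst x))" by (rule PN_point[OF x])
  have o: "openin (PN_top i N) (sect i N (B \<inter> A) \<phi> e)" by (rule sect_open[OF B(1)]) (use B A in auto)
  have "x \<in> sect i N (B \<inter> A) \<phi> e" using B A unfolding sect_def by (cases x) auto
  then show thesis by (rule that[OF o]) (auto simp: sect_def inj_on_def)
qed

lemma sheet_subset: "E \<in> sheets i N \<Longrightarrow> E \<subseteq> topspace (PN_top i N)"
  unfolding sheets_def using connected_components_of_subset by fastforce

lemma sheet_atlas:
  "(V, \<phi>) \<in> atlas (open_sub (PN i N) E) \<longleftrightarrow> (\<exists>B1 V1 \<phi>1. V = B1 \<inter> E \<and> \<phi> = \<phi>1 \<circ> fst \<and>
     openin (PN_top i N) B1 \<and> inj_on fst B1 \<and> (V1, \<phi>1) \<in> atlas M \<and> fst ` B1 \<subseteq> V1)"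
  unfolding open_sub_def PN_def etale_mfd_def by auto

lemma square_atlas:
  "(V, \<phi>) \<in> atlas (square i N E) \<longleftrightarrow> (\<exists>B1 V1 \<phi>1 B2 V2 \<phi>2. V = (B1 \<inter> E) \<times> (B2 \<inter> E) \<and> \<phi> = map_prod (\<phi>1 \<circ> fst) (\<phi>2 \<circ> fst) \<and>
     openin (PN_top i N) B1 \<and> inj_on fst B1 \<and> (V1, \<phi>1) \<in> atlas M \<and> fst ` B1 \<subseteq> V1 \<and>
     openin (PN_top i N) B2 \<and> inj_on fst B2 \<and> (V2, \<phi>2) \<in> atlas M \<and> fst ` B2 \<subseteq> V2)"
  (is "_ \<longleftrightarrow> ?R")
proof -
  have "(V, \<phi>) \<in> atlas (square i N E) \<longleftrightarrow> (\<exists>V' \<phi>' W' \<psi>'. V = V' \<times> W' \<and> \<phi> = map_prod \<phi>' \<psi>' \<and>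
    (V', \<phi>') \<in> atlas (open_sub (PN i N) E) \<and> (W', \<psi>') \<in> atlas (open_sub (PN i N) E))"
    unfolding square_def prod_mfd_def by simp
  also have "\<dots> \<longleftrightarrow> ?R" unfolding sheet_atlas
    by (rule iffI; elim exE conjE; hypsubst; intro exI conjI; (rule refl | assumption))
  finally show ?thesis .
qed

lemma mtop_square: "mtop (square i N E) = prod_topology (subtopology (PN_top i N) E) (subtopology (PN_top i N) E)"
  unfolding square_def prod_mfd_def open_sub_def by simp

lemma topspace_square: "E \<subseteq> topspace (PN_top i N) \<Longrightarrow> pts (square i N E) = E \<times> E"
  unfolding mtop_square by auto

lemma openin_square:
  "openin (PN_top i N) B1 \<Longrightarrow> openin (PN_top i N) B2 \<Longrightarrow> opn (square i N E) ((B1 \<inter> E) \<times> (B2 \<inter> E))"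
  unfolding mtop_square openin_prod_Times_iff openin_subtopology by blast

lemma square_cover:
  assumes E: "E \<subseteq> topspace (PN_top i N)" and x: "x1 \<in> E" "x2 \<in> E"
    and V: "(V1, \<phi>1) \<in> atlas M" "fst x1 \<in> V1" "(V2, \<phi>2) \<in> atlas M" "fst x2 \<in> V2"
  obtains B1 B2 where "((B1 \<inter> E) \<times> (B2 \<inter> E), map_prod (\<phi>1 \<circ> fst) (\<phi>2 \<circ> fst)) \<in> atlas (square i N E)"
    "x1 \<in> B1" "x2 \<in> B2" "fst ` B1 \<subseteq> V1" "fst ` B2 \<subseteq> V2" "inj_on fst B1" "inj_on fst B2"
    "openin (PN_top i N) B1" "openin (PN_top i N) B2"
proof -
  have xt: "x1 \<in> topspace (PN_top i N)" "x2 \<in> topspace (PN_top i N)" using x E by auto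
  have o: "opn M V1" "opn M V2" using V chartD(1)[OF chart_atlas[OF M]] by auto
  obtain B1 where B1: "openin (PN_top i N) B1" "x1 \<in> B1" "inj_on fst B1" "fst ` B1 \<subseteq> V1"
    by (rule PN_local[OF xt(1) o(1) V(2)])
  obtain B2 where B2: "openin (PN_top i N) B2" "x2 \<in> B2" "inj_on fst B2" "fst ` B2 \<subseteq> V2"
    by (rule PN_local[OF xt(2) o(2) V(4)])
  have "((B1 \<inter> E) \<times> (B2 \<inter> E), map_prod (\<phi>1 \<circ> fst) (\<phi>2 \<circ> fst)) \<in> atlas (square i N E)"
    unfolding square_atlas
    by (intro exI[of _ B1] exI[of _ V1] exI[of _ \<phi>1] exI[of _ B2] exI[of _ V2] exI[of _ \<phi>2]) (use B1 B2 V in simp)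
  then show thesis by (rule that[OF _ B1(2) B2(2) B1(4) B2(4) B1(3) B2(3) B1(1) B2(1)])
qed

end

context elliptic_blowups
begin

context
  fixes i :: nat and N :: "'a set" and E :: "'a cov set"
  assumes N: "N \<in> pieces i" and E: "E \<in> sheets i N"
begin

lemma E_sub: "E \<subseteq> topspace (PN_top i N)" by (rule sheet_subset[OF E])

text \<open>The topology of \<open>PN\<close> is generated by sections, and two of them meet over
  the set where two framings agree, whose openness is not visible from the generators. The openness
  of chart images is therefore taken from the bottom stage of the blow-up tower instead.\<close>

lemma square_smooth: "smooth_mfd (square i N E)"
proof -
  obtain Z0 :: "('y, 'e \<times> 'e) mfd" and \<gamma>0 where Z: "smooth_mfd Z0" "diffeo Z0 (square i N E) \<gamma>0"
    using iter_blowup_base[OF blowup[OF N E]] by blast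
  show ?thesis
  proof (rule smooth_mfd_of_diffeo[OF Z])
    fix V \<phi> assume "(V, \<phi>) \<in> atlas (square i N E)"
    then obtain B1 V1 \<phi>1 B2 V2 \<phi>2 where c: "V = (B1 \<inter> E) \<times> (B2 \<inter> E)" "\<phi> = map_prod (\<phi>1 \<circ> fst) (\<phi>2 \<circ> fst)"
     "openin (PN_top i N) B1" "inj_on fst B1" "(V1, \<phi>1) \<in> atlas M" "fst ` B1 \<subseteq> V1"
     "openin (PN_top i N) B2" "inj_on fst B2" "(V2, \<phi>2) \<in> atlas M" "fst ` B2 \<subseteq> V2"
      unfolding square_atlas by (elim exE conjE) (rule that)
    note c1 = chart_atlas[OF M c(5)] and c2 = chart_atlas[OF M c(9)]
    show "opn (square i N E) V" unfolding c(1) by (rule openin_square[OF c(3,7)])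
    show "inj_on \<phi> V"
    proof (rule inj_onI)
      fix q q' assume q: "q \<in> V" "q' \<in> V" "\<phi> q = \<phi> q'"
      obtain a b a' b' where ab: "q = (a, b)" "q' = (a', b')" by (cases q, cases q')
      then have B: "a \<in> B1" "a' \<in> B1" "b \<in> B2" "b' \<in> B2" and eq: "\<phi>1 (fst a) = \<phi>1 (fst a')" "\<phi>2 (fst b) = \<phi>2 (fst b')"
        using q unfolding c(1,2) by auto
      have "fst a = fst a'" by (rule inj_onD[OF chartD(3)[OF c1] eq(1)]) (use B c(6) in auto)
      moreover have "fst b = fst b'" by (rule inj_onD[OF chartD(3)[OF c2] eq(2)]) (use B c(10) in auto)
      ultimately show "q = q'" unfolding ab using inj_onD[OF c(4)] inj_onD[OF c(8)] B by blast
    qed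
    fix A :: "('e \<times> 'e) set" assume A: "open A"
    show "opn (square i N E) {q \<in> V. \<phi> q \<in> A}"
    proof (subst openin_subopen, intro ballI)
      fix q assume "q \<in> {q \<in> V. \<phi> q \<in> A}"
      then obtain a b where q: "q = (a, b)" "a \<in> B1" "a \<in> E" "b \<in> B2" "b \<in> E" "(\<phi>1 (fst a), \<phi>2 (fst b)) \<in> A"
        using c(1,2) by auto
      obtain A1 A2 where A12: "open A1" "open A2" "(\<phi>1 (fst a), \<phi>2 (fst b)) \<in> A1 \<times> A2" "A1 \<times> A2 \<subseteq> A"
        by (rule open_prod_elim[OF A q(6)])
      let ?C1 = "B1 \<inter> {x \<in> topspace (PN_top i N). fst x \<in> {v \<in> V1. \<phi>1 v \<in> A1}}"
      let ?C2 = "B2 \<inter> {x \<in> topspace (PN_top i N). fst x \<in> {v \<in> V2. \<phi>2 v \<in> A2}}"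
      have o: "openin (PN_top i N) ?C1" "openin (PN_top i N) ?C2"
        using PN_fst_open[OF chartD(8)[OF c1 A12(1)]] PN_fst_open[OF chartD(8)[OF c2 A12(2)]] c(3,7) by auto
      have "q \<in> (?C1 \<inter> E) \<times> (?C2 \<inter> E)" using q A12(3) c(6,10) E_sub by auto
      moreover have "(?C1 \<inter> E) \<times> (?C2 \<inter> E) \<subseteq> {q \<in> V. \<phi> q \<in> A}" using A12(4) c(1,2) by auto
      ultimately show "\<exists>T. opn (square i N E) T \<and> q \<in> T \<and> T \<subseteq> {q \<in> V. \<phi> q \<in> A}"
        using openin_square[OF o] by blast
    qed
  next
    show "\<Union> (fst ` atlas (square i N E)) = pts (square i N E)"
    proof (intro equalityI subsetI)
      fix q assume "q \<in> \<Union> (fst ` atlas (square i N E))"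
      then obtain V \<phi> where V: "(V, \<phi>) \<in> atlas (square i N E)" and "q \<in> V" by auto
      moreover from V have "V \<subseteq> E \<times> E" unfolding square_atlas by (elim exE conjE) auto
      ultimately show "q \<in> pts (square i N E)" unfolding topspace_square[OF E_sub] by blast
    next
      fix q assume "q \<in> pts (square i N E)"
      then obtain a b where q: "q = (a, b)" "a \<in> E" "b \<in> E" unfolding topspace_square[OF E_sub] by (elim SigmaE) (rule that)
      have "fst a \<in> pts M" "fst b \<in> pts M" using PN_fst q E_sub by blast+
      note top = this
      obtain V1 \<phi>1 where V1: "(V1, \<phi>1) \<in> atlas M" "fst a \<in> V1" by (rule ex_atlas_chart[OF M top(1)])
      obtain V2 \<phi>2 where V2: "(V2, \<phi>2) \<in> atlas M" "fst b \<in> V2" by (rule ex_atlas_chart[OF M top(2)])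
      note V = V1 V2
      obtain B1 B2 where "((B1 \<inter> E) \<times> (B2 \<inter> E), map_prod (\<phi>1 \<circ> fst) (\<phi>2 \<circ> fst)) \<in> atlas (square i N E)" "a \<in> B1" "b \<in> B2"
        by (rule square_cover[OF E_sub q(2,3) V])
      then show "q \<in> \<Union> (fst ` atlas (square i N E))" using q by force
    qed
  qed
qed

lemma square_proj_smooth:
  "smooth_map (square i N E) M (\<lambda>q. fst (fst q))" "smooth_map (square i N E) M (\<lambda>q. fst (snd q))"
proof -
  have *: "\<exists>W V1 \<phi>1 V2 \<phi>2. opn (square i N E) W \<and> p \<in> W \<and> chart M V1 \<phi>1 \<and> chart M V2 \<phi>2 \<and>
     (\<lambda>q. fst (fst q)) ` W \<subseteq> V1 \<and> (\<lambda>q. fst (snd q)) ` W \<subseteq> V2 \<and>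
     \<phi>1 \<circ> (\<lambda>q. fst (fst q)) \<in> smooth_funs (square i N E) W \<and> \<phi>2 \<circ> (\<lambda>q. fst (snd q)) \<in> smooth_funs (square i N E) W"
    if pt: "p \<in> pts (square i N E)" for p
  proof -
    obtain a b where q: "p = (a, b)" "a \<in> E" "b \<in> E" using pt unfolding topspace_square[OF E_sub] by (elim SigmaE) (rule that)
    have "fst a \<in> pts M" "fst b \<in> pts M" using PN_fst q E_sub by blast+
    note top = this
    obtain V1 \<phi>1 where V1: "(V1, \<phi>1) \<in> atlas M" "fst a \<in> V1" by (rule ex_atlas_chart[OF M top(1)])
    obtain V2 \<phi>2 where V2: "(V2, \<phi>2) \<in> atlas M" "fst b \<in> V2" by (rule ex_atlas_chart[OF M top(2)])
    note V = V1 V2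
    obtain B1 B2 where B: "((B1 \<inter> E) \<times> (B2 \<inter> E), map_prod (\<phi>1 \<circ> fst) (\<phi>2 \<circ> fst)) \<in> atlas (square i N E)"
      "a \<in> B1" "b \<in> B2" "fst ` B1 \<subseteq> V1" "fst ` B2 \<subseteq> V2" by (rule square_cover[OF E_sub q(2,3) V])
    note c = chart_atlas[OF square_smooth B(1)]
    have "(\<lambda>q. fst (map_prod (\<phi>1 \<circ> fst) (\<phi>2 \<circ> fst) q)) \<in> smooth_funs (square i N E) ((B1 \<inter> E) \<times> (B2 \<inter> E))"
      "(\<lambda>q. snd (map_prod (\<phi>1 \<circ> fst) (\<phi>2 \<circ> fst) q)) \<in> smooth_funs (square i N E) ((B1 \<inter> E) \<times> (B2 \<inter> E))"
      by (rule smooth_funs_linear[OF bounded_linear_fst square_smooth chartD(1)[OF c] smooth_funs_chart_map[OF c]]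
          smooth_funs_linear[OF bounded_linear_snd square_smooth chartD(1)[OF c] smooth_funs_chart_map[OF c]])+
    then have "\<phi>1 \<circ> (\<lambda>q. fst (fst q)) \<in> smooth_funs (square i N E) ((B1 \<inter> E) \<times> (B2 \<inter> E))"
      "\<phi>2 \<circ> (\<lambda>q. fst (snd q)) \<in> smooth_funs (square i N E) ((B1 \<inter> E) \<times> (B2 \<inter> E))"
      by (simp_all add: comp_def)
    moreover have "chart M V1 \<phi>1" "chart M V2 \<phi>2" using V chart_atlas[OF M] by auto
    moreover have "(\<lambda>q. fst (fst q)) ` ((B1 \<inter> E) \<times> (B2 \<inter> E)) \<subseteq> V1" "(\<lambda>q. fst (snd q)) ` ((B1 \<inter> E) \<times> (B2 \<inter> E)) \<subseteq> V2"
      using B(4,5) by auto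
    ultimately show ?thesis using chartD(1)[OF c] q B(2,3)
      by (intro exI[of _ "(B1 \<inter> E) \<times> (B2 \<inter> E)"] exI[of _ V1] exI[of _ \<phi>1] exI[of _ V2] exI[of _ \<phi>2]) auto
  qed
  show "smooth_map (square i N E) M (\<lambda>q. fst (fst q))"
  proof (rule smooth_map_local[OF square_smooth M])
    fix p assume "p \<in> pts (square i N E)"
    from *[OF this] show "\<exists>W V \<phi>. opn (square i N E) W \<and> p \<in> W \<and> chart M V \<phi> \<and>
      (\<lambda>q. fst (fst q)) ` W \<subseteq> V \<and> \<phi> \<circ> (\<lambda>q. fst (fst q)) \<in> smooth_funs (square i N E) W"
      by (elim exE conjE) (intro exI conjI)
  qed
  show "smooth_map (square i N E) M (\<lambda>q. fst (snd q))"
  proof (rule smooth_map_local[OF square_smooth M])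
    fix p assume "p \<in> pts (square i N E)"
    from *[OF this] show "\<exists>W V \<phi>. opn (square i N E) W \<and> p \<in> W \<and> chart M V \<phi> \<and>
      (\<lambda>q. fst (snd q)) ` W \<subseteq> V \<and> \<phi> \<circ> (\<lambda>q. fst (snd q)) \<in> smooth_funs (square i N E) W"
      by (elim exE conjE) (intro exI conjI)
  qed
qed

text \<open>Tangent vectors at the two ends can be chosen independently; this is the origin of the
  joint submersiveness with which the tower starts.\<close>

lemma square_tvec:
  assumes x: "x1 \<in> E" "x2 \<in> E" and t: "tvec M (fst x1) \<tau>1" "tvec M (fst x2) \<tau>2"
  obtains \<tau> where "tvec (square i N E) (x1, x2) \<tau>"
    "\<And>f. smooth_at M (fst x1) f \<Longrightarrow> \<tau> (\<lambda>q. f (fst (fst q))) = \<tau>1 f"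
    "\<And>f. smooth_at M (fst x2) f \<Longrightarrow> \<tau> (\<lambda>q. f (fst (snd q))) = \<tau>2 f"
proof -
  let ?X = "square i N E"
  have "fst x1 \<in> pts M" "fst x2 \<in> pts M" using PN_fst x E_sub by blast+
  note top = this
  obtain V1 \<phi>1 where V1: "(V1, \<phi>1) \<in> atlas M" "fst x1 \<in> V1" by (rule ex_atlas_chart[OF M top(1)])
  obtain V2 \<phi>2 where V2: "(V2, \<phi>2) \<in> atlas M" "fst x2 \<in> V2" by (rule ex_atlas_chart[OF M top(2)])
  note V = V1 V2
  obtain B1 B2 where B: "((B1 \<inter> E) \<times> (B2 \<inter> E), map_prod (\<phi>1 \<circ> fst) (\<phi>2 \<circ> fst)) \<in> atlas ?X"
    "x1 \<in> B1" "x2 \<in> B2" "fst ` B1 \<subseteq> V1" "fst ` B2 \<subseteq> V2" by (rule square_cover[OF E_sub x V])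
  let ?W = "(B1 \<inter> E) \<times> (B2 \<inter> E)" and ?\<Phi> = "map_prod (\<phi>1 \<circ> fst) (\<phi>2 \<circ> fst)"
  note c = chart_atlas[OF square_smooth B(1)]
  have xW: "(x1, x2) \<in> ?W" using B x by auto
  note c1 = chart_atlas[OF M V(1)] and c2 = chart_atlas[OF M V(3)]
  obtain v1 where v1: "\<And>f. smooth_at M (fst x1) f \<Longrightarrow> \<tau>1 f = dchart (fst x1) V1 \<phi>1 v1 f" by (rule tvec_rep[OF M t(1) c1 V(2)]) (rule that)
  obtain v2 where v2: "\<And>f. smooth_at M (fst x2) f \<Longrightarrow> \<tau>2 f = dchart (fst x2) V2 \<phi>2 v2 f" by (rule tvec_rep[OF M t(2) c2 V(4)]) (rule that)
  note sc = smooth_at_chart[OF square_smooth c xW]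
  note sl1 = smooth_at_linear[OF square_smooth bounded_linear_fst sc] and sl2 = smooth_at_linear[OF square_smooth bounded_linear_snd sc]
  have d1: "dchart (x1, x2) ?W ?\<Phi> (v1, v2) (\<lambda>q. fst (?\<Phi> q)) = v1"
    using dchart_chain[OF square_smooth c xW sc bounded_linear_imp_has_derivative[OF bounded_linear_fst] chartD(1)[OF c] xW,
        of "\<lambda>q. fst (?\<Phi> q)" "(v1, v2)"] dchart_self[OF square_smooth c xW] by simp
  have d2: "dchart (x1, x2) ?W ?\<Phi> (v1, v2) (\<lambda>q. snd (?\<Phi> q)) = v2"
    using dchart_chain[OF square_smooth c xW sc bounded_linear_imp_has_derivative[OF bounded_linear_snd] chartD(1)[OF c] xW,
        of "\<lambda>q. snd (?\<Phi> q)" "(v1, v2)"] dchart_self[OF square_smooth c xW] by simp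
  show thesis
  proof (rule that[OF tvec_dchart[OF square_smooth c xW, of "(v1, v2)"]])
    fix f :: "'a \<Rightarrow> complex" assume f: "smooth_at M (fst x1) f"
    have "dchart (x1, x2) ?W ?\<Phi> (v1, v2) (\<lambda>q. f (fst (fst q))) =
      dchart (fst x1) V1 \<phi>1 (dchart (x1, x2) ?W ?\<Phi> (v1, v2) (\<lambda>q. fst (?\<Phi> q))) f"
    proof (rule dchart_chain[OF square_smooth c xW sl1 _ chartD(1)[OF c] xW])
      show "((f \<circ> inv_into V1 \<phi>1) has_derivative (\<lambda>v. dchart (fst x1) V1 \<phi>1 v f)) (at (fst (?\<Phi> (x1, x2))))"
        using dchart_has_derivative[OF M c1 V(2) f] by simp
      show "f (fst (fst q)) = (f \<circ> inv_into V1 \<phi>1) (fst (?\<Phi> q))" if "q \<in> ?W" for q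
        using that B(4) chartD(4)[OF c1] by (cases q) auto
    qed
    then show "dchart (x1, x2) ?W ?\<Phi> (v1, v2) (\<lambda>q. f (fst (fst q))) = \<tau>1 f" unfolding d1 using v1[OF f] by simp
  next
    fix f :: "'a \<Rightarrow> complex" assume f: "smooth_at M (fst x2) f"
    have "dchart (x1, x2) ?W ?\<Phi> (v1, v2) (\<lambda>q. f (fst (snd q))) =
      dchart (fst x2) V2 \<phi>2 (dchart (x1, x2) ?W ?\<Phi> (v1, v2) (\<lambda>q. snd (?\<Phi> q))) f"
    proof (rule dchart_chain[OF square_smooth c xW sl2 _ chartD(1)[OF c] xW])
      show "((f \<circ> inv_into V2 \<phi>2) has_derivative (\<lambda>v. dchart (fst x2) V2 \<phi>2 v f)) (at (snd (?\<Phi> (x1, x2))))"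
        using dchart_has_derivative[OF M c2 V(4) f] by simp
      show "f (fst (snd q)) = (f \<circ> inv_into V2 \<phi>2) (snd (?\<Phi> q))" if "q \<in> ?W" for q
        using that B(5) chartD(4)[OF c2] by (cases q) auto
    qed
    then show "dchart (x1, x2) ?W ?\<Phi> (v1, v2) (\<lambda>q. f (fst (snd q))) = \<tau>2 f" unfolding d2 using v2[OF f] by simp
  qed
qed

lemma Y_smooth: "smooth_mfd (Y i N E)" "smooth_map (Y i N E) (square i N E) (\<beta> i N E)"
  using iter_blowup_smooth[OF square_smooth blowup[OF N E]] by auto

lemma \<beta>_in: "y \<in> pts (Y i N E) \<Longrightarrow> fst (\<beta> i N E y) \<in> E \<and> snd (\<beta> i N E y) \<in> E"
  using smooth_map_in_topspace[OF Y_smooth(2)] unfolding topspace_square[OF E_sub] by fastforce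

lemma Y_proj_smooth:
  "smooth_map (Y i N E) M (\<lambda>y. fst (GE_tgt i N E y))" "smooth_map (Y i N E) M (\<lambda>y. fst (GE_src i N E y))"
  unfolding GE_tgt_def GE_src_def using smooth_map_compose[OF Y_smooth(1) square_smooth M Y_smooth(2) square_proj_smooth(1)]
    smooth_map_compose[OF Y_smooth(1) square_smooth M Y_smooth(2) square_proj_smooth(2)] by auto

end

end

section \<open>The removed closures and openness of the set of arrows\<close>

context elliptic_blowups
begin

lemma GE_arrows_iff:
  "y \<in> GE_arrows i N E \<longleftrightarrow> y \<in> pts (Y i N E) \<and>
    (\<forall>N0 N1. N0 \<in> sheet_pieces i N E \<longrightarrow> N1 \<in> sheet_pieces i N E \<longrightarrow> N0 \<noteq> N1 \<longrightarrow>
      y \<notin> mtop (Y i N E) closure_of {y \<in> pts (Y i N E). \<beta> i N E y \<in> N0 \<times> N1})"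
  (is "_ \<longleftrightarrow> ?R")
proof
  assume h: "y \<in> GE_arrows i N E"
  have y: "y \<in> pts (Y i N E)" by (rule DiffD1[OF h[unfolded GE_arrows_def]])
  have n: "y \<notin> \<Union> {mtop (Y i N E) closure_of {y \<in> pts (Y i N E). \<beta> i N E y \<in> N0 \<times> N1} | N0 N1.
          N0 \<in> sheet_pieces i N E \<and> N1 \<in> sheet_pieces i N E \<and> N0 \<noteq> N1}"
    by (rule notI, rule DiffD2[OF h[unfolded GE_arrows_def]])
  show ?R
  proof (intro conjI y allI impI notI)
    fix N0 N1 assume a: "N0 \<in> sheet_pieces i N E" "N1 \<in> sheet_pieces i N E" "N0 \<noteq> N1"
      "y \<in> mtop (Y i N E) closure_of {y \<in> pts (Y i N E). \<beta> i N E y \<in> N0 \<times> N1}"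
    show False by (rule notE[OF n], rule UnionI[OF _ a(4)], intro CollectI exI[of _ N0] exI[of _ N1] conjI refl a)
  qed
next
  assume R: ?R
  show "y \<in> GE_arrows i N E" unfolding GE_arrows_def
  proof (rule DiffI)
    show "y \<in> pts (Y i N E)" using R by (rule conjunct1)
    show "y \<notin> \<Union> {mtop (Y i N E) closure_of {y \<in> pts (Y i N E). \<beta> i N E y \<in> N0 \<times> N1} | N0 N1.
          N0 \<in> sheet_pieces i N E \<and> N1 \<in> sheet_pieces i N E \<and> N0 \<noteq> N1}"
    proof (rule notI, elim UnionE CollectE exE conjE)
      fix X N0 N1 assume "y \<in> X" "X = mtop (Y i N E) closure_of {y \<in> pts (Y i N E). \<beta> i N E y \<in> N0 \<times> N1}"
        "N0 \<in> sheet_pieces i N E" "N1 \<in> sheet_pieces i N E" "N0 \<noteq> N1"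
      then show False using R by simp
    qed
  qed
qed

context
  fixes i :: nat and N :: "'a set" and E :: "'a cov set"
  assumes N: "N \<in> pieces i" and E: "E \<in> sheets i N"
begin

lemma E_piece:
  assumes "x \<in> E"
  obtains N0 where "N0 \<in> sheet_pieces i N E" "x \<in> N0"
proof -
  have xt: "x \<in> topspace (PN_top i N)" using assms E_sub[OF N E] by blast
  then have "fst x \<in> pts M" using PN_fst by blast
  then obtain k where k: "fst x \<in> stratum k" using ex_stratum by blast
  let ?S = "subtopology (PN_top i N) {x \<in> E. fst x \<in> stratum k}"
  have "x \<in> topspace ?S" using xt assms k by auto
  then have "x \<in> \<Union> (connected_components_of ?S)" by (simp only: Union_connected_components_of)
  then obtain N0 where N0: "N0 \<in> connected_components_of ?S" "x \<in> N0" by blast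
  have "N0 \<in> sheet_pieces i N E" unfolding sheet_pieces_def mtop_PN using N0(1) by blast
  then show thesis by (rule that[OF _ N0(2)])
qed

lemma sheet_piece_D:
  assumes "N0 \<in> sheet_pieces i N E"
  obtains k where "N0 \<in> connected_components_of (subtopology (PN_top i N) {x \<in> E. fst x \<in> stratum k})"
    "N0 \<subseteq> E" "\<And>x. x \<in> N0 \<Longrightarrow> fst x \<in> stratum k" "connectedin (PN_top i N) N0"
proof -
  obtain k where k: "N0 \<in> connected_components_of (subtopology (PN_top i N) {x \<in> E. fst x \<in> stratum k})"
    using assms unfolding sheet_pieces_def mtop_PN by (elim UN_E) (rule that)
  have s: "N0 \<subseteq> {x \<in> E. fst x \<in> stratum k}" using connected_components_of_subset[OF k] by simp
  have "connectedin (PN_top i N) N0" using connectedin_connected_components_of[OF k] by (simp add: connectedin_subtopology)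
  show thesis
  proof (rule that[OF k])
    show "N0 \<subseteq> E" using s by auto
    show "fst x \<in> stratum k" if "x \<in> N0" for x using s that by auto
  qed fact
qed

text \<open>A point lies in the closure of the set of points whose ends lie in the same two pieces
  as its own. If these pieces differed, the point would have been removed.\<close>

lemma GE_same_piece:
  assumes y: "y \<in> GE_arrows i N E"
  obtains N0 where "N0 \<in> sheet_pieces i N E" "GE_tgt i N E y \<in> N0" "GE_src i N E y \<in> N0"
proof -
  have yt: "y \<in> pts (Y i N E)" using y unfolding GE_arrows_iff by simp
  have b: "fst (\<beta> i N E y) \<in> E" "snd (\<beta> i N E y) \<in> E" using \<beta>_in[OF N E yt] by auto
  obtain N0 where N0: "N0 \<in> sheet_pieces i N E" "fst (\<beta> i N E y) \<in> N0" by (rule E_piece[OF b(1)])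
  obtain N1 where N1: "N1 \<in> sheet_pieces i N E" "snd (\<beta> i N E y) \<in> N1" by (rule E_piece[OF b(2)])
  have "N0 = N1"
  proof (rule ccontr)
    assume ne: "N0 \<noteq> N1"
    have "y \<in> {y \<in> pts (Y i N E). \<beta> i N E y \<in> N0 \<times> N1}" using yt N0 N1 by (simp add: mem_Times_iff)
    then have "y \<in> mtop (Y i N E) closure_of {y \<in> pts (Y i N E). \<beta> i N E y \<in> N0 \<times> N1}"
      by (rule subsetD[OF closure_of_subset, rotated]) simp
    then show False using y N0(1) N1(1) ne unfolding GE_arrows_iff by simp
  qed
  then show thesis by (intro that[OF N0(1)]) (use N0 N1 in \<open>simp_all add: GE_tgt_def GE_src_def\<close>)
qed

lemma GE_same_D:
  assumes y: "y \<in> GE_arrows i N E"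
  shows "fst (GE_tgt i N E y) \<in> D \<longleftrightarrow> fst (GE_src i N E y) \<in> D"
proof -
  obtain N0 where N0: "N0 \<in> sheet_pieces i N E" "GE_tgt i N E y \<in> N0" "GE_src i N E y \<in> N0" by (rule GE_same_piece[OF y])
  obtain k where k: "\<And>x. x \<in> N0 \<Longrightarrow> fst x \<in> stratum k" by (rule sheet_piece_D[OF N0(1)]) (rule that)
  show ?thesis using stratum_D[OF k[OF N0(2)]] stratum_D[OF k[OF N0(3)]] by blast
qed

text \<open>Openness in a single sheet is read off from the smooth structure of the square: a box
  with equal factors around the diagonal point has open image, and the projection of this product to
  one factor is open.\<close>

lemma E_fst_open:
  assumes B: "openin (PN_top i N) B" "inj_on fst B" and V: "chart M V \<phi>" "fst ` B \<subseteq> V"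
  shows "open ((\<phi> \<circ> fst) ` (B \<inter> E))"
proof (subst open_subopen, clarify)
  fix u c assume x: "(u, c) \<in> B" "(u, c) \<in> E"
  let ?x = "(u, c)"
  have "fst ?x \<in> pts M" using PN_fst x E_sub[OF N E] by blast
  then obtain V1 \<phi>1 where V1: "(V1, \<phi>1) \<in> atlas M" "fst ?x \<in> V1" by (rule ex_atlas_chart[OF M])
  note c1 = chart_atlas[OF M V1(1)]
  obtain B1 B2 where B1: "((B1 \<inter> E) \<times> (B2 \<inter> E), map_prod (\<phi>1 \<circ> fst) (\<phi>1 \<circ> fst)) \<in> atlas (square i N E)"
    "?x \<in> B1" "?x \<in> B2" "fst ` B1 \<subseteq> V1" "fst ` B2 \<subseteq> V1" "inj_on fst B1" "inj_on fst B2"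
    "openin (PN_top i N) B1" "openin (PN_top i N) B2" by (rule square_cover[OF E_sub[OF N E] x(2) x(2) V1 V1])
  note cX = chart_atlas[OF square_smooth[OF N E] B1(1)]
  define B3 where "B3 = B \<inter> B1 \<inter> B2"
  have o3: "openin (PN_top i N) B3" unfolding B3_def using B B1 by auto
  have x3: "?x \<in> B3" unfolding B3_def using x B1 by auto
  have "open (map_prod (\<phi>1 \<circ> fst) (\<phi>1 \<circ> fst) ` ((B3 \<inter> E) \<times> (B3 \<inter> E)))"
    by (rule chartD(6)[OF cX openin_square[OF o3 o3]]) (auto simp: B3_def)
  moreover have "map_prod (\<phi>1 \<circ> fst) (\<phi>1 \<circ> fst) ` ((B3 \<inter> E) \<times> (B3 \<inter> E)) = ((\<phi>1 \<circ> fst) ` (B3 \<inter> E)) \<times> ((\<phi>1 \<circ> fst) ` (B3 \<inter> E))"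
    by (rule map_prod_surj_on[OF refl refl])
  ultimately have "open (((\<phi>1 \<circ> fst) ` (B3 \<inter> E)) \<times> ((\<phi>1 \<circ> fst) ` (B3 \<inter> E)))" by simp
  from open_image_fst[OF this] have o1: "open ((\<phi>1 \<circ> fst) ` (B3 \<inter> E))" by (simp add: fst_image_times split: if_splits)
  define A where "A = {v \<in> V1. \<phi>1 v \<in> (\<phi>1 \<circ> fst) ` (B3 \<inter> E)}"
  have oA: "opn M A" unfolding A_def by (rule chartD(8)[OF c1 o1])
  have A: "A = fst ` (B3 \<inter> E)"
  proof (intro equalityI subsetI)
    fix v assume "v \<in> A"
    then obtain b where b: "v \<in> V1" "\<phi>1 v = \<phi>1 (fst b)" "b \<in> B3" "b \<in> E" unfolding A_def by auto
    then have "v = fst b" using inj_onD[OF chartD(3)[OF c1] b(2)] B1(4) unfolding B3_def by auto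
    then show "v \<in> fst ` (B3 \<inter> E)" using b by blast
  next
    fix v assume "v \<in> fst ` (B3 \<inter> E)"
    then show "v \<in> A" unfolding A_def using B1(4) unfolding B3_def by auto
  qed
  have "A \<subseteq> V" unfolding A B3_def using V(2) by auto
  then have "open (\<phi> ` A)" by (rule chartD(6)[OF V(1) oA])
  moreover have "\<phi> ` A \<subseteq> (\<phi> \<circ> fst) ` (B \<inter> E)" unfolding A B3_def by auto
  moreover have "(\<phi> \<circ> fst) ?x \<in> \<phi> ` A" unfolding A using x x3 by force
  ultimately show "\<exists>T. open T \<and> (\<phi> \<circ> fst) ?x \<in> T \<and> T \<subseteq> (\<phi> \<circ> fst) ` (B \<inter> E)" by blast
qed

text \<open>In a small coordinate ball at \<open>x\<close> the strata split according to the set of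
  coordinates that vanish. Each of these finitely many sets is connected and lies in one stratum,
  hence in one piece if it meets it.\<close>

lemma sheet_pieces_locally_finite:
  assumes x: "x \<in> E"
  obtains B where "openin (PN_top i N) B" "x \<in> B" "finite {N0 \<in> sheet_pieces i N E. N0 \<inter> B \<noteq> {}}"
proof -
  have xt: "x \<in> topspace (PN_top i N)" using x E_sub[OF N E] by blast
  then have "fst x \<in> pts M" using PN_fst by blast
  then obtain k where "fst x \<in> stratum k" using ex_stratum by blast
  then obtain V \<phi> e where n: "nc_coords M D I k V \<phi> e" "fst x \<in> V" "\<phi> (fst x) = 0"
    unfolding stratum_def nc_chart_def by blast
  note ND = nc_coordsD[OF n(1)]
  obtain B1 where B1: "openin (PN_top i N) B1" "x \<in> B1" "inj_on fst B1" "fst ` B1 \<subseteq> V"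
    by (rule PN_local[OF xt chartD(1)[OF ND(1)] n(2)])
  define f :: "'a cov \<Rightarrow> 'e" where "f = \<phi> \<circ> fst"
  have of: "open (f ` (W \<inter> E))" if "openin (PN_top i N) W" "W \<subseteq> B1" for W
    unfolding f_def by (rule E_fst_open[OF that(1) _ ND(1)]) (use that B1 in \<open>auto intro: inj_on_subset\<close>)
  have "0 \<in> f ` (B1 \<inter> E)" unfolding f_def using x B1(2) n(3) by force
  then obtain r where r: "r > 0" "ball 0 r \<subseteq> f ` (B1 \<inter> E)" using of[OF B1(1) order_refl] open_contains_ball by blast
  have injf: "inj_on f (B1 \<inter> E)"
  proof (rule inj_onI)
    fix a b assume ab: "a \<in> B1 \<inter> E" "b \<in> B1 \<inter> E" "f a = f b"
    then have "fst a = fst b" using inj_onD[OF chartD(3)[OF ND(1)], of "fst a" "fst b"] B1(4) unfolding f_def by auto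
    then show "a = b" using inj_onD[OF B1(3)] ab by blast
  qed
  define g where "g = inv_into (B1 \<inter> E) f"
  have gf: "g (f a) = a" if "a \<in> B1 \<inter> E" for a unfolding g_def using inv_into_f_f[OF injf that] .
  have gB: "g v \<in> B1 \<inter> E" "f (g v) = v" if "v \<in> ball 0 r" for v
  proof -
    have v: "v \<in> f ` (B1 \<inter> E)" using that r(2) by blast
    show "g v \<in> B1 \<inter> E" unfolding g_def by (rule inv_into_into[OF v])
    show "f (g v) = v" unfolding g_def by (rule f_inv_into_f[OF v])
  qed
  \<comment> \<open>The inverse of the chart on the sheet is continuous because the chart is open;
    connectedness in the ball is thus carried to the sheet.\<close>
  have contg: "continuous_map (top_of_set (ball 0 r)) (PN_top i N) g" unfolding continuous_map_def
  proof (intro conjI allI impI)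
    show "g \<in> topspace (top_of_set (ball 0 r)) \<rightarrow> topspace (PN_top i N)" using gB E_sub[OF N E] by auto
    fix W assume W: "openin (PN_top i N) W"
    have "{v \<in> topspace (top_of_set (ball 0 r)). g v \<in> W} = ball 0 r \<inter> f ` ((W \<inter> B1) \<inter> E)"
    proof (intro equalityI subsetI)
      fix v assume "v \<in> {v \<in> topspace (top_of_set (ball 0 r)). g v \<in> W}"
      then have v: "v \<in> ball 0 r" "g v \<in> W" by auto
      then show "v \<in> ball 0 r \<inter> f ` ((W \<inter> B1) \<inter> E)" using gB[OF v(1)] by (metis IntI Int_iff image_eqI)
    next
      fix v assume "v \<in> ball 0 r \<inter> f ` ((W \<inter> B1) \<inter> E)"
      then show "v \<in> {v \<in> topspace (top_of_set (ball 0 r)). g v \<in> W}" using gf by auto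
    qed
    then show "openin (top_of_set (ball 0 r)) {v \<in> topspace (top_of_set (ball 0 r)). g v \<in> W}"
      using of[of "W \<inter> B1"] W B1(1) by auto
  qed
  define B where "B = B1 \<inter> {a \<in> topspace (PN_top i N). fst a \<in> {q \<in> V. \<phi> q \<in> ball 0 r}}"
  have oB: "openin (PN_top i N) B" unfolding B_def using B1(1) PN_fst_open[OF chartD(8)[OF ND(1) open_ball]] by blast
  have xB: "x \<in> B" unfolding B_def using B1(2) xt n r(1) by auto
  define S where "S = (\<lambda>Z. {v \<in> ball 0 r. \<forall>j<k. zc e j v = 0 \<longleftrightarrow> j \<in> Z})"
  have conS: "connectedin (PN_top i N) (g ` S Z)" for Z
  proof (rule connectedin_continuous_map_image[OF contg])
    show "connectedin (top_of_set (ball 0 r)) (S Z)"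
      using convex_stratum_connected[OF ND(2,3) convex_ball open_ball, of 0 r Z] unfolding S_def by (auto simp: connectedin_subtopology)
  qed
  have strat: "g ` S Z \<subseteq> {a \<in> E. fst a \<in> stratum (card (Z \<inter> {..<k}))}" for Z
  proof (rule image_subsetI)
    fix v assume v: "v \<in> S Z"
    then have vb: "v \<in> ball 0 r" unfolding S_def by blast
    have q: "fst (g v) \<in> V" "\<phi> (fst (g v)) = v" using gB[OF vb] B1(4) unfolding f_def by auto
    have "{j. j < k \<and> zc e j (\<phi> (fst (g v))) = 0} = Z \<inter> {..<k}" using v q(2) unfolding S_def by auto
    then show "g v \<in> {a \<in> E. fst a \<in> stratum (card (Z \<inter> {..<k}))}" using stratum_count[OF n(1) q(1)] gB[OF vb] by simp
  qed
  let ?F = "{N0 \<in> sheet_pieces i N E. N0 \<inter> B \<noteq> {}}"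
  have ex: "\<exists>Z. Z \<subseteq> {..<k} \<and> g ` S Z \<inter> N0 \<noteq> {}" if N0: "N0 \<in> ?F" for N0
  proof -
    obtain a where a: "a \<in> N0" "a \<in> B" using N0 by blast
    have "N0 \<in> sheet_pieces i N E" using N0 by blast
    then have "N0 \<subseteq> E" by (rule sheet_piece_D)
    then have aE: "a \<in> B1 \<inter> E" using a unfolding B_def by blast
    define Z where "Z = {j. j < k \<and> zc e j (f a) = 0}"
    have "f a \<in> S Z" using a(2) unfolding S_def Z_def B_def f_def by auto
    then have "a \<in> g ` S Z" using gf[OF aE] by force
    then show ?thesis using a(1) unfolding Z_def by (intro exI[of _ Z]) (auto simp: Z_def)
  qed
  define c where "c = (\<lambda>N0. SOME Z. Z \<subseteq> {..<k} \<and> g ` S Z \<inter> N0 \<noteq> {})"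
  have c: "c N0 \<subseteq> {..<k} \<and> g ` S (c N0) \<inter> N0 \<noteq> {}" if "N0 \<in> ?F" for N0
    unfolding c_def by (rule someI_ex[OF ex[OF that]])
  \<comment> \<open>Two pieces with the same set of vanishing coordinates both meet one connected
    subset of a stratum, and multiplicity being unique they are components of the same stratum,
    hence equal.\<close>
  have "inj_on c ?F"
  proof (rule inj_onI)
    fix N0 N1 assume N01: "N0 \<in> ?F" "N1 \<in> ?F" "c N0 = c N1"
    have sp: "N0 \<in> sheet_pieces i N E" "N1 \<in> sheet_pieces i N E" using N01 by auto
    obtain k0 where k0: "N0 \<in> connected_components_of (subtopology (PN_top i N) {x \<in> E. fst x \<in> stratum k0})"
      "\<And>x. x \<in> N0 \<Longrightarrow> fst x \<in> stratum k0" by (rule sheet_piece_D[OF sp(1)]) (rule that)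
    obtain k1 where k1: "N1 \<in> connected_components_of (subtopology (PN_top i N) {x \<in> E. fst x \<in> stratum k1})"
      "\<And>x. x \<in> N1 \<Longrightarrow> fst x \<in> stratum k1" by (rule sheet_piece_D[OF sp(2)]) (rule that)
    let ?l = "card (c N0 \<inter> {..<k})"
    obtain a where a: "a \<in> g ` S (c N0)" "a \<in> N0" using c[OF N01(1)] by blast
    obtain b where b: "b \<in> g ` S (c N0)" "b \<in> N1" using c[OF N01(2)] N01(3) by auto
    have "k0 = ?l" using stratum_unique[OF k0(2)[OF a(2)]] strat a(1) by blast
    moreover have "k1 = ?l" using stratum_unique[OF k1(2)[OF b(2)]] strat b(1) by blast
    ultimately have kk: "k1 = k0" "?l = k0" by auto
    have con: "connectedin (subtopology (PN_top i N) {x \<in> E. fst x \<in> stratum k0}) (g ` S (c N0))"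
      unfolding connectedin_subtopology using conS strat[of "c N0"] kk by auto
    show "N0 = N1" by (rule connected_component_unique[OF k0(1) k1(1)[unfolded kk(1)] con]) (use a b in auto)
  qed
  moreover have "c ` ?F \<subseteq> Pow {..<k}" using c by blast
  ultimately have "finite ?F" by (rule inj_on_finite) simp
  then show thesis by (rule that[OF oB xB])
qed

text \<open>A union of infinitely many closures need not be closed. Over small neighbourhoods of
  both ends only finitely many pairs of pieces matter, and a point of such a neighbourhood in one of
  the closures has nearby points realising one of these pairs.\<close>

lemma GE_arrows_open: "opn (Y i N E) (GE_arrows i N E)"
proof (subst openin_subopen, intro ballI)
  let ?Y = "mtop (Y i N E)"
  fix y assume y: "y \<in> GE_arrows i N E"
  have yt: "y \<in> topspace ?Y" using y unfolding GE_arrows_iff by simp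
  have b: "fst (\<beta> i N E y) \<in> E" "snd (\<beta> i N E y) \<in> E" using \<beta>_in[OF N E yt] by auto
  obtain B1 where B1: "openin (PN_top i N) B1" "fst (\<beta> i N E y) \<in> B1" "finite {N0 \<in> sheet_pieces i N E. N0 \<inter> B1 \<noteq> {}}"
    by (rule sheet_pieces_locally_finite[OF b(1)])
  obtain B2 where B2: "openin (PN_top i N) B2" "snd (\<beta> i N E y) \<in> B2" "finite {N0 \<in> sheet_pieces i N E. N0 \<inter> B2 \<noteq> {}}"
    by (rule sheet_pieces_locally_finite[OF b(2)])
  define P where "P = {q \<in> topspace ?Y. \<beta> i N E q \<in> (B1 \<inter> E) \<times> (B2 \<inter> E)}"
  have oP: "openin ?Y P" unfolding P_def by (rule smooth_map_preimage_open[OF Y_smooth(2)[OF N E] openin_square[OF B1(1) B2(1)]])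
  have yP: "y \<in> P" unfolding P_def using yt b B1(2) B2(2) by (simp add: mem_Times_iff)
  define cl where "cl = (\<lambda>(N0, N1). ?Y closure_of {y \<in> topspace ?Y. \<beta> i N E y \<in> N0 \<times> N1})"
  define F where "F = {(N0, N1). N0 \<in> sheet_pieces i N E \<and> N1 \<in> sheet_pieces i N E \<and> N0 \<noteq> N1 \<and> N0 \<inter> B1 \<noteq> {} \<and> N1 \<inter> B2 \<noteq> {}}"
  have "finite F" by (rule finite_subset[OF _ finite_cartesian_product[OF B1(3) B2(3)]]) (auto simp: F_def)
  then have cF: "closedin ?Y (\<Union> (cl ` F))" by (intro closedin_Union) (auto simp: cl_def)
  define W where "W = P - \<Union> (cl ` F)"
  have oW: "openin ?Y W" unfolding W_def using oP cF by (rule openin_diff)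
  have "y \<notin> \<Union> (cl ` F)"
  proof
    assume "y \<in> \<Union> (cl ` F)"
    then obtain N0 N1 where "(N0, N1) \<in> F" "y \<in> cl (N0, N1)" by auto
    then show False using y unfolding F_def cl_def GE_arrows_iff by simp
  qed
  then have yW: "y \<in> W" unfolding W_def using yP by blast
  have "W \<subseteq> GE_arrows i N E"
  proof
    fix q assume q: "q \<in> W"
    show "q \<in> GE_arrows i N E"
    proof (rule ccontr)
      assume "q \<notin> GE_arrows i N E"
      moreover have "q \<in> topspace ?Y" using q oW openin_subset by blast
      ultimately obtain N0 N1 where n: "N0 \<in> sheet_pieces i N E" "N1 \<in> sheet_pieces i N E" "N0 \<noteq> N1"
        and qc: "q \<in> ?Y closure_of {y \<in> topspace ?Y. \<beta> i N E y \<in> N0 \<times> N1}" unfolding GE_arrows_iff by blast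
      have qP: "q \<in> P" using q unfolding W_def by blast
      from qc[unfolded in_closure_of, THEN conjunct2, rule_format, OF conjI[OF qP oP]]
      obtain q' where "q' \<in> P" "\<beta> i N E q' \<in> N0 \<times> N1" by auto
      then have "(N0, N1) \<in> F" unfolding F_def P_def using n by auto
      then have "q \<in> \<Union> (cl ` F)" using qc unfolding cl_def by auto
      then show False using q unfolding W_def by blast
    qed
  qed
  then show "\<exists>T. openin ?Y T \<and> y \<in> T \<and> T \<subseteq> GE_arrows i N E" using oW yW by blast
qed

end

end

lemma chart_ray:
  assumes c: "chart X V \<phi>" "p \<in> V" and A: "opn X A" "p \<in> A"
  obtains r0 where "r0 > 0" "\<And>r. 0 < r \<Longrightarrow> r < r0 \<Longrightarrow> \<exists>q\<in>A \<inter> V. \<phi> q = \<phi> p + r *\<^sub>R w"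
proof -
  have o: "open (\<phi> ` (A \<inter> V))" by (rule chartD(5)[OF c(1) A(1)])
  have "((\<lambda>r. \<phi> p + r *\<^sub>R w) \<longlongrightarrow> \<phi> p + 0 *\<^sub>R w) (at_right (0::real))"
    by (intro tendsto_intros)
  then have "eventually (\<lambda>r. \<phi> p + r *\<^sub>R w \<in> \<phi> ` (A \<inter> V)) (at_right (0::real))"
    using topological_tendstoD[OF _ o] A c by auto
  then obtain r0 where "r0 > 0" "\<And>r. 0 < r \<Longrightarrow> r < r0 \<Longrightarrow> \<phi> p + r *\<^sub>R w \<in> \<phi> ` (A \<inter> V)"
    unfolding eventually_at_right_field by auto
  then show thesis by (intro that[of r0]) force+
qed

lemma finite_nbhd:
  assumes "p \<in> topspace X" "\<And>j. j < (i::nat) \<Longrightarrow> \<exists>U. openin X U \<and> p \<in> U \<and> (\<forall>q\<in>U. R j q)"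
  obtains U where "openin X U" "p \<in> U" "\<And>j q. j < i \<Longrightarrow> q \<in> U \<Longrightarrow> R j q" using assms(2)
proof (induction i arbitrary: thesis)
  case 0
  then show ?case using assms(1) by blast
next
  case (Suc i)
  obtain U where U: "openin X U" "p \<in> U" "\<And>j q. j < i \<Longrightarrow> q \<in> U \<Longrightarrow> R j q"
    by (rule Suc.IH) (use Suc.prems(2) in auto)
  obtain W where W: "openin X W" "p \<in> W" "\<forall>q\<in>W. R i q" using Suc.prems(2)[of i] by auto
  show ?case by (rule Suc.prems(1)[of "U \<inter> W"]) (use U W in \<open>auto simp: less_Suc_eq\<close>)
qed

lemma smooth_at_nbhd:
  assumes "smooth_at X p f"
  shows "\<exists>U. opn X U \<and> p \<in> U \<and> (\<forall>q\<in>U. smooth_at X q f)" using assms unfolding smooth_at_def by blast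

lemma smooth_funs_at:
  assumes "smooth_mfd X" "\<And>q. q \<in> U \<Longrightarrow> smooth_at X q f" shows "f \<in> smooth_funs X U"
  by (rule smooth_funs_local[OF assms(1)]) (use assms(2) in \<open>simp add: smooth_at_def\<close>)

lemma smooth_funs_norm2:
  fixes f :: "'p \<Rightarrow> complex"
  assumes "smooth_mfd X" "opn X U" "f \<in> smooth_funs X U"
  shows "(\<lambda>q. (cmod (f q))\<^sup>2) \<in> smooth_funs X U"
  using smooth_funs_bilinear[OF bounded_bilinear_inner assms(1,2,3,3)] by (simp add: power2_norm_eq_inner)

section \<open>Defining functions of the hyperplanes and coordinates at an arrow\<close>

context elliptic_tubes
begin

lemma defining_funsE:
  assumes "(B, f) \<in> defining_funs i N E j"
  obtains \<zeta> V \<phi> e m where "f = \<zeta> \<circ> fst" "openin (PN_top i N) B" "B \<subseteq> E" "(V, \<phi>, e) \<in> T i N" "fst ` B \<subseteq> V" "m < i"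
    "\<zeta> = (\<lambda>q. zc e m (\<phi> q)) \<or> \<zeta> = (\<lambda>q. cnj (zc e m (\<phi> q)))"
    "\<And>x. x \<in> B \<Longrightarrow> snd x ! j = cohyp M (pr i N (fst x)) \<zeta>"
proof -
  have "\<exists>\<zeta>. f = \<zeta> \<circ> fst \<and> openin (PN_top i N) B \<and> B \<subseteq> E \<and>
     (\<exists>(V, \<phi>, e)\<in>T i N. fst ` B \<subseteq> V \<and>
        (\<exists>m<i. \<zeta> = (\<lambda>q. zc e m (\<phi> q)) \<or> \<zeta> = (\<lambda>q. cnj (zc e m (\<phi> q)))) \<and>
        (\<forall>(u, c)\<in>B. c ! j = cohyp M (pr i N u) \<zeta>))" using assms unfolding defining_funs_def mtop_PN by simp
  then show thesis
  proof (elim exE conjE bexE, clarify)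
    fix \<zeta> V \<phi> e m
    assume a: "openin (PN_top i N) B" "B \<subseteq> E" "(V, \<phi>, e) \<in> T i N" "fst ` B \<subseteq> V" "m < i"
      "\<zeta> = (\<lambda>q. zc e m (\<phi> q)) \<or> \<zeta> = (\<lambda>q. cnj (zc e m (\<phi> q)))" "\<forall>(u, c)\<in>B. c ! j = cohyp M (pr i N u) \<zeta>" "f = \<zeta> \<circ> fst"
    show thesis by (rule that[OF a(8,1-6)]) (use a(7) in auto)
  qed
qed

lemma defining_smooth:
  assumes N: "N \<in> pieces i" and V: "(V, \<phi>, e) \<in> T i N" "m < i" "\<zeta> = (\<lambda>q. zc e m (\<phi> q)) \<or> \<zeta> = (\<lambda>q. cnj (zc e m (\<phi> q)))"
  shows "\<zeta> \<in> smooth_funs M V"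
proof -
  note c = nc_coordsD(1)[OF tube_chartD(1)[OF N V(1)]]
  note s = smooth_funs_linear[OF bounded_linear_zc M chartD(1)[OF c] smooth_funs_chart_map[OF c]]
  show ?thesis using V(3) s smooth_funs_linear[OF bounded_linear_cnj M chartD(1)[OF c] s] by auto
qed

text \<open>The entry \<open>c ! j\<close> is the class of \<zeta> by choice of the defining
  function and the class of the \<open>j\<close>-th coordinate by choice of the framing; \<zeta>
  belongs to its own class and therefore to the other one. Over \<open>N\<close> the projection is
  the identity, so both classes are taken at \<open>u\<close>.\<close>

lemma defining_cohyp:
  assumes N: "N \<in> pieces i" and V: "(V, \<phi>, e) \<in> T i N" "m < i" "\<zeta> = (\<lambda>q. zc e m (\<phi> q)) \<or> \<zeta> = (\<lambda>q. cnj (zc e m (\<phi> q)))"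
    and u: "u \<in> N" "u \<in> V" and c: "c ! j = cohyp M (pr i N u) \<zeta>" "c = framing M i \<phi>' e' u" and j: "j < i"
  shows "same_cohyp M u \<zeta> (\<lambda>q. zc e' j (\<phi>' q))"
proof -
  note n = nc_coordsD[OF tube_chartD(1)[OF N V(1)]]
  have pu: "pr i N u = u" by (rule tubeD(4)[OF N u(1)])
  have "zc e m (\<phi> u) = 0" using tube_chartD(5)[OF N V(1) u(2) V(2)] pu by simp
  then have "same_cohyp M u \<zeta> \<zeta>" by (rule same_cohyp_refl[OF M n(1) u(2) n(2,3) V(2) _ V(3)])
  then have "\<zeta> \<in> c ! j" unfolding c(1) pu cohyp_def by simp
  moreover have "c ! j = cohyp M u (\<lambda>q. zc e' j (\<phi>' q))" unfolding c(2) framing_def using j by simp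
  ultimately show ?thesis unfolding cohyp_def by simp
qed

lemma framing_at:
  assumes N: "N \<in> pieces i" and x: "x \<in> topspace (PN_top i N)" "fst x \<in> N"
  obtains V \<phi> e where "nc_coords M D I i V \<phi> e" "fst x \<in> V" "snd x = framing M i \<phi> e (fst x)"
proof -
  obtain B V \<phi> e where B: "nc_coords M D I i V \<phi> e" "opn M B" "B \<subseteq> U i N" "pr i N ` B \<subseteq> V"
    "fst x \<in> B" "snd x = framing M i \<phi> e (pr i N (fst x))" by (rule PN_point[OF x(1)])
  have "pr i N (fst x) = fst x" by (rule tubeD(4)[OF N x(2)])
  then show thesis using that[OF B(1)] B(4,5,6) by force
qed

text \<open>The defining functions of the different hyperplanes may come from different tube charts.
  By \<open>tube_compare\<close> each equals in squared modulus a unit times one fibre coordinate of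
  the given chart, and distinct hyperplanes use distinct coordinates, so the product is a unit times
  the generator of the ideal.\<close>

lemma sheet_generator:
  assumes N: "N \<in> pieces i" and x: "x \<in> topspace (PN_top i N)" "fst x \<in> N"
    and B: "\<And>j. j < i \<Longrightarrow> (B j, g j) \<in> defining_funs i N E j \<and> x \<in> B j"
    and T: "(V, \<phi>, e) \<in> T i N" "fst x \<in> V"
  obtains A c where "opn M A" "fst x \<in> A" "A \<subseteq> V" "c \<in> smooth_funs M A"
    "\<And>q. fst q \<in> A \<Longrightarrow> (c (fst q) :: real) \<noteq> 0 \<and>
      (\<Prod>j<i. (cmod (g j q))\<^sup>2) = c (fst q) * zprod e i (\<phi> (fst q))"
proof -
  let ?u = "fst x"
  obtain V' \<phi>' e' where n': "nc_coords M D I i V' \<phi>' e'" "?u \<in> V'" "snd x = framing M i \<phi>' e' ?u"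
    by (rule framing_at[OF N x])
  note N' = nc_coordsD[OF n'(1)]
  note NT = nc_coordsD[OF tube_chartD(1)[OF N T(1)]]
  \<comment> \<open>\<open>l\<close> is the coordinate of the given tube chart that belongs to the
    \<open>j\<close>-th hyperplane and \<open>c\<close> the unit. The comparison of zero sets with
    the framing coordinate serves to tell hyperplanes apart.\<close>
  define R where "R = (\<lambda>j l A c. l < i \<and> opn M A \<and> ?u \<in> A \<and> A \<subseteq> V \<and> c \<in> smooth_funs M A \<and>
     (\<forall>q. fst q \<in> A \<longrightarrow> (c (fst q) :: real) \<noteq> 0 \<and> (cmod (g j q))\<^sup>2 = c (fst q) * (cmod (zc e l (\<phi> (fst q))))\<^sup>2) \<and>
     (\<forall>q\<in>A. zc e l (\<phi> q) = 0 \<longleftrightarrow> zc e' j (\<phi>' q) = 0) \<and> zc e' j (\<phi>' ?u) = 0)"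
  have ex: "\<exists>l A c. R j l A c" if j: "j < i" for j
  proof -
    have d: "(B j, g j) \<in> defining_funs i N E j" and xB: "x \<in> B j" using B[OF j] by auto
    obtain \<zeta> V1 \<phi>1 e1 m where z: "g j = \<zeta> \<circ> fst" "openin (PN_top i N) (B j)" "B j \<subseteq> E" "(V1, \<phi>1, e1) \<in> T i N" "fst ` B j \<subseteq> V1"
      "m < i" "\<zeta> = (\<lambda>q. zc e1 m (\<phi>1 q)) \<or> \<zeta> = (\<lambda>q. cnj (zc e1 m (\<phi>1 q)))"
      "\<And>x. x \<in> B j \<Longrightarrow> snd x ! j = cohyp M (pr i N (fst x)) \<zeta>" by (rule defining_funsE[OF d]) (rule that)
    have u1: "?u \<in> V1" using z(5) xB by blast
    have s: "same_cohyp M ?u \<zeta> (\<lambda>q. zc e' j (\<phi>' q))"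
      by (rule defining_cohyp[OF N z(4,6,7) x(2) u1 z(8)[OF xB] n'(3) j])
    note sd = same_cohypD[OF M s]
    obtain W where W: "opn M W" "?u \<in> W" "\<forall>q\<in>W. \<zeta> q = 0 \<longleftrightarrow> zc e' j (\<phi>' q) = 0" using sd(3) by blast
    obtain l A c where l: "l < i" "opn M A" "?u \<in> A" "A \<subseteq> V" "A \<subseteq> V1" "c \<in> smooth_funs M A"
      "\<And>q. q \<in> A \<Longrightarrow> (c q :: real) \<noteq> 0 \<and> (cmod (zc e1 m (\<phi>1 q)))\<^sup>2 = c q * (cmod (zc e l (\<phi> q)))\<^sup>2"
      by (rule tube_compare[OF N T(1) z(4) T(2) u1 x(2) z(6)]) (rule that)
    have nz: "cmod (\<zeta> q) = cmod (zc e1 m (\<phi>1 q))" for q using z(7) by auto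
    show ?thesis
    proof (intro exI)
      show "R j l (A \<inter> W) c" unfolding R_def
      proof (intro conjI)
        show "opn M (A \<inter> W)" using l W by blast
        show "c \<in> smooth_funs M (A \<inter> W)" by (rule smooth_funs_subset[OF l(6)]) blast
        show "\<forall>q. fst q \<in> A \<inter> W \<longrightarrow> c (fst q) \<noteq> 0 \<and> (cmod (g j q))\<^sup>2 = c (fst q) * (cmod (zc e l (\<phi> (fst q))))\<^sup>2"
          using l(7) nz unfolding z(1) by simp
        show "\<forall>q\<in>A \<inter> W. zc e l (\<phi> q) = 0 \<longleftrightarrow> zc e' j (\<phi>' q) = 0"
        proof
          fix q assume q: "q \<in> A \<inter> W"
          have "c q \<noteq> 0" "(cmod (\<zeta> q))\<^sup>2 = c q * (cmod (zc e l (\<phi> q)))\<^sup>2" using l(7) nz q by auto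
          then have "\<zeta> q = 0 \<longleftrightarrow> zc e l (\<phi> q) = 0" by (metis mult_eq_0_iff norm_eq_zero power_eq_0_iff zero_power2)
          then show "zc e l (\<phi> q) = 0 \<longleftrightarrow> zc e' j (\<phi>' q) = 0" using W(3) q by blast
        qed
        show "zc e' j (\<phi>' ?u) = 0" using sd(2) .
      qed (use l W in auto)
    qed
  qed
  then have "\<forall>j. \<exists>l A c. j < i \<longrightarrow> R j l A c" by blast
  then obtain l A c where R: "\<And>j. j < i \<Longrightarrow> R j (l j) (A j) (c j)" by metis
  have Rl: "l j < i" "opn M (A j)" "?u \<in> A j" "A j \<subseteq> V" "c j \<in> smooth_funs M (A j)"
     "\<And>q. fst q \<in> A j \<Longrightarrow> c j (fst q) \<noteq> 0 \<and> (cmod (g j q))\<^sup>2 = c j (fst q) * (cmod (zc e (l j) (\<phi> (fst q))))\<^sup>2"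
     "\<And>q. q \<in> A j \<Longrightarrow> zc e (l j) (\<phi> q) = 0 \<longleftrightarrow> zc e' j (\<phi>' q) = 0" "zc e' j (\<phi>' ?u) = 0" if "j < i" for j
    using R[OF that] unfolding R_def by (elim conjE; simp del: split_paired_All)+
  \<comment> \<open>If two indices led to the same \<open>l\<close>, the framing coordinates
    \<open>j\<close> and \<open>j'\<close> would have the same zeros near the point. On the ray
    along \<open>w\<close> the first is nonzero and the second is zero.\<close>
  have inj: "inj_on l {..<i}"
  proof (rule inj_onI, rule ccontr)
    fix j j' assume jj: "j \<in> {..<i}" "j' \<in> {..<i}" "l j = l j'" "j \<noteq> j'"
    then have j: "j < i" "j' < i" by auto
    obtain w where w: "\<And>k. k < i \<Longrightarrow> zc e' k w = (if k = j then 1 else 0)"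
      by (rule zc_vector[OF N'(2,3), of "\<lambda>k. if k = j then 1 else 0" "\<lambda>_. 0"]) (rule that)
    obtain r0 where r0: "r0 > 0" "\<And>r. 0 < r \<Longrightarrow> r < r0 \<Longrightarrow> \<exists>q\<in>(A j \<inter> A j') \<inter> V'. \<phi>' q = \<phi>' ?u + r *\<^sub>R w"
      by (rule chart_ray[OF N'(1) n'(2), of "A j \<inter> A j'"]) (use Rl j in auto)
    obtain q where q: "q \<in> A j" "q \<in> A j'" "\<phi>' q = \<phi>' ?u + (r0 / 2) *\<^sub>R w" using r0(2)[of "r0 / 2"] r0(1) by auto
    have "zc e' j (\<phi>' q) \<noteq> 0" "zc e' j' (\<phi>' q) = 0"
      unfolding q(3) zc_add zc_scale using w[OF j(1)] w[OF j(2)] Rl(8)[OF j(1)] Rl(8)[OF j(2)] jj(4) r0(1) by auto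
    then show False using Rl(7)[OF j(1) q(1)] Rl(7)[OF j(2) q(2)] jj(3) by simp
  qed
  have bij: "bij_betw l {..<i} {..<i}"
    unfolding bij_betw_def using inj Rl(1) by (metis endo_inj_surj finite_lessThan image_subsetI lessThan_iff)
  have uM: "?u \<in> pts M" using chartD(2)[OF NT(1)] T(2) by blast
  have nb: "\<exists>B. opn M B \<and> ?u \<in> B \<and> (\<forall>q\<in>B. q \<in> A j)" if "j < i" for j
    using Rl(2,3)[OF that] by (intro exI[of _ "A j"]) simp
  obtain A0 where A0: "opn M A0" "?u \<in> A0" "\<And>j q. j < i \<Longrightarrow> q \<in> A0 \<Longrightarrow> q \<in> A j"
    by (rule finite_nbhd[of ?u "mtop M" i "\<lambda>j q. q \<in> A j", OF uM nb]; (assumption | rule that))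
  define A' where "A' = A0 \<inter> V"
  have oA': "opn M A'" unfolding A'_def using A0 chartD(1)[OF NT(1)] by blast
  show thesis
  proof (rule that[OF oA'])
    show "?u \<in> A'" "A' \<subseteq> V" unfolding A'_def using A0 T(2) by auto
    show "(\<lambda>q. \<Prod>j<i. c j q) \<in> smooth_funs M A'"
    proof (rule smooth_funs_prod[OF M oA'])
      fix j assume "j \<in> {..<i}"
      then show "c j \<in> smooth_funs M A'" using smooth_funs_subset[OF Rl(5)[of j], of A'] A0(3) unfolding A'_def by auto
    qed
    fix q :: "'a cov" assume q: "fst q \<in> A'"
    have qA: "fst q \<in> A j" if "j < i" for j using A0(3)[OF that] q unfolding A'_def by blast
    have "(\<Prod>j<i. (cmod (g j q))\<^sup>2) = (\<Prod>j<i. c j (fst q) * (cmod (zc e (l j) (\<phi> (fst q))))\<^sup>2)"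
      by (rule prod.cong) (use Rl(6) qA in auto)
    also have "\<dots> = (\<Prod>j<i. c j (fst q)) * (\<Prod>j<i. (cmod (zc e (l j) (\<phi> (fst q))))\<^sup>2)" by (simp add: prod.distrib)
    also have "(\<Prod>j<i. (cmod (zc e (l j) (\<phi> (fst q))))\<^sup>2) = zprod e i (\<phi> (fst q))"
      using prod.reindex_bij_betw[OF bij, of "\<lambda>l. (cmod (zc e l (\<phi> (fst q))))\<^sup>2"] by simp
    finally show "(\<Prod>j<i. c j (fst q)) \<noteq> 0 \<and>
      (\<Prod>j<i. (cmod (g j q))\<^sup>2) = (\<Prod>j<i. c j (fst q)) * zprod e i (\<phi> (fst q))" using Rl(6) qA by simp
  qed
qed

end

context elliptic_blowups
begin

context
  fixes i :: nat and N :: "'a set" and E :: "'a cov set"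
  assumes N: "N \<in> pieces i" and E: "E \<in> sheets i N"
begin

lemma square_point_fst:
  "y \<in> pts (Y i N E) \<Longrightarrow> GE_tgt i N E y \<in> E \<and> GE_src i N E y \<in> E"
  unfolding GE_tgt_def GE_src_def using \<beta>_in[OF N E] by blast

text \<open>The reference functions are the coordinates of charts that realise the framings of the
  two ends. The real-linear relations between differentials demanded by the locale are those
  contained in equality of cooriented hyperplanes.\<close>

lemma centre_blow_centres:
  assumes x: "x1 \<in> E" "x2 \<in> E" "fst x1 \<in> N" "fst x2 \<in> N"
    and n1: "nc_coords M D I i V1 \<phi>1 e1" "fst x1 \<in> V1" "snd x1 = framing M i \<phi>1 e1 (fst x1)"
    and n2: "nc_coords M D I i V2 \<phi>2 e2" "fst x2 \<in> V2" "snd x2 = framing M i \<phi>2 e2 (fst x2)"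
  shows "blow_centres (square i N E) (x1, x2) i (centre_ideal i N E)
    (\<lambda>j. {(B \<times> E, \<zeta> \<circ> fst) | B \<zeta>. (B, \<zeta>) \<in> defining_funs i N E j})
    (\<lambda>j. {(E \<times> B, \<zeta> \<circ> snd) | B \<zeta>. (B, \<zeta>) \<in> defining_funs i N E j})
    (\<lambda>j q. zc e1 j (\<phi>1 (fst (fst q)))) (\<lambda>j q. zc e2 j (\<phi>2 (fst (snd q))))"
proof -
  let ?X = "square i N E"
  note X = square_smooth[OF N E] and p1 = square_proj_smooth(1)[OF N E] and p2 = square_proj_smooth(2)[OF N E]
  note D1 = nc_coordsD[OF n1(1)] and D2 = nc_coordsD[OF n2(1)]
  have xt: "(x1, x2) \<in> pts ?X" unfolding topspace_square[OF E_sub[OF N E]] using x by blast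
  have EE: "B \<inter> E = B" if "B \<subseteq> E" for B using that by blast
  have topE: "topspace (PN_top i N) \<inter> E = E" using E_sub[OF N E] by blast
  have sm: "opn ?X (B \<times> E)" "opn ?X (E \<times> B)"
    "\<zeta> \<circ> fst \<in> smooth_funs ?X (B \<times> E)" "\<zeta> \<circ> snd \<in> smooth_funs ?X (E \<times> B)"
    if d: "(B, \<zeta>) \<in> defining_funs i N E j" for B \<zeta> j
  proof -
    obtain \<zeta>' V \<phi> e m where z: "\<zeta> = \<zeta>' \<circ> fst" "openin (PN_top i N) B" "B \<subseteq> E" "(V, \<phi>, e) \<in> T i N" "fst ` B \<subseteq> V"
      "m < i" "\<zeta>' = (\<lambda>q. zc e m (\<phi> q)) \<or> \<zeta>' = (\<lambda>q. cnj (zc e m (\<phi> q)))"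
      "\<And>x. x \<in> B \<Longrightarrow> snd x ! j = cohyp M (pr i N (fst x)) \<zeta>'" by (rule defining_funsE[OF d]) (rule that)
    show "opn ?X (B \<times> E)" "opn ?X (E \<times> B)"
      using openin_square[OF z(2) openin_topspace, of E] openin_square[OF openin_topspace z(2), of E] EE[OF z(3)] topE by simp_all
    have oV: "opn M V" by (rule chartD(1)[OF nc_coordsD(1)[OF tube_chartD(1)[OF N z(4)]]])
    note s = defining_smooth[OF N z(4,6,7)]
    have zz: "\<zeta> \<circ> fst = \<zeta>' \<circ> (\<lambda>q. fst (fst q))" "\<zeta> \<circ> snd = \<zeta>' \<circ> (\<lambda>q. fst (snd q))" unfolding z(1) by auto
    have sub: "B \<times> E \<subseteq> {q \<in> pts ?X. fst (fst q) \<in> V}" "E \<times> B \<subseteq> {q \<in> pts ?X. fst (snd q) \<in> V}"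
      unfolding topspace_square[OF E_sub[OF N E]] using z(3,5) by auto
    show "\<zeta> \<circ> fst \<in> smooth_funs ?X (B \<times> E)" unfolding zz(1)
      by (rule smooth_funs_subset[OF smooth_funs_pullback[OF X M p1 s oV] sub(1)])
    show "\<zeta> \<circ> snd \<in> smooth_funs ?X (E \<times> B)" unfolding zz(2)
      by (rule smooth_funs_subset[OF smooth_funs_pullback[OF X M p2 s oV] sub(2)])
  qed
  have type: "\<zeta> xk = 0 \<and> (\<exists>\<alpha> \<beta>. cmod \<beta> < cmod \<alpha> \<and> (\<forall>\<tau>. tvec ?X (x1, x2) \<tau> \<longrightarrow>
      \<tau> (\<zeta> \<circ> p) = \<alpha> * \<tau> (\<lambda>q. zc e j (\<phi> (fst (p q)))) + \<beta> * cnj (\<tau> (\<lambda>q. zc e j (\<phi> (fst (p q)))))))"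
    if d: "(B, \<zeta>) \<in> defining_funs i N E j" and j: "j < i" and xk: "xk \<in> B" "fst xk \<in> N" "p (x1, x2) = xk"
      and fr: "snd xk = framing M i \<phi> e (fst xk)" and ps: "smooth_map ?X M (\<lambda>q. fst (p q))"
    for B \<zeta> j xk and p :: "'a cov \<times> 'a cov \<Rightarrow> 'a cov" and \<phi> e
  proof -
    obtain \<zeta>' V \<phi>' e' m where z: "\<zeta> = \<zeta>' \<circ> fst" "openin (PN_top i N) B" "B \<subseteq> E" "(V, \<phi>', e') \<in> T i N" "fst ` B \<subseteq> V"
      "m < i" "\<zeta>' = (\<lambda>q. zc e' m (\<phi>' q)) \<or> \<zeta>' = (\<lambda>q. cnj (zc e' m (\<phi>' q)))"
      "\<And>x. x \<in> B \<Longrightarrow> snd x ! j = cohyp M (pr i N (fst x)) \<zeta>'" by (rule defining_funsE[OF d]) (rule that)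
    have uV: "fst xk \<in> V" using z(5) xk(1) by blast
    have s: "same_cohyp M (fst xk) \<zeta>' (\<lambda>q. zc e j (\<phi> q))"
      by (rule defining_cohyp[OF N z(4,6,7) xk(2) uV z(8)[OF xk(1)] fr j])
    note sd = same_cohypD[OF M s]
    obtain \<alpha> \<beta> where ab: "cmod \<beta> < cmod \<alpha>"
      "\<And>\<tau>. tvec M (fst xk) \<tau> \<Longrightarrow> \<tau> \<zeta>' = \<alpha> * \<tau> (\<lambda>q. zc e j (\<phi> q)) + \<beta> * cnj (\<tau> (\<lambda>q. zc e j (\<phi> q)))"
      using sd(4) by blast
    have "\<tau> (\<zeta> \<circ> p) = \<alpha> * \<tau> (\<lambda>q. zc e j (\<phi> (fst (p q)))) + \<beta> * cnj (\<tau> (\<lambda>q. zc e j (\<phi> (fst (p q)))))"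
      if t: "tvec ?X (x1, x2) \<tau>" for \<tau>
    proof -
      have "tvec M (fst xk) (\<lambda>f. \<tau> (f \<circ> (\<lambda>q. fst (p q))))" using tvec_push[OF X M ps t] xk(3) by simp
      from ab(2)[OF this] show ?thesis unfolding z(1) by (simp add: comp_def)
    qed
    then show ?thesis using ab(1) sd(1) unfolding z(1) by auto
  qed
  show ?thesis
  proof
    show "smooth_mfd ?X" "(x1, x2) \<in> pts ?X" by fact+
    show "centre_ideal i N E j = gen_sheaf ?X ({(B \<times> E, \<zeta> \<circ> fst) | B \<zeta>. (B, \<zeta>) \<in> defining_funs i N E j} \<union>
       {(E \<times> B, \<zeta> \<circ> snd) | B \<zeta>. (B, \<zeta>) \<in> defining_funs i N E j})" for j
      unfolding centre_ideal_def by (rule refl)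
    show "opn ?X V \<and> f \<in> smooth_funs ?X V"
      if "(V, f) \<in> {(B \<times> E, \<zeta> \<circ> fst) | B \<zeta>. (B, \<zeta>) \<in> defining_funs i N E j} \<union>
        {(E \<times> B, \<zeta> \<circ> snd) | B \<zeta>. (B, \<zeta>) \<in> defining_funs i N E j}" for j V f using that
    proof
      assume "(V, f) \<in> {(B \<times> E, \<zeta> \<circ> fst) | B \<zeta>. (B, \<zeta>) \<in> defining_funs i N E j}"
      then obtain B \<zeta> where "V = B \<times> E" "f = \<zeta> \<circ> fst" "(B, \<zeta>) \<in> defining_funs i N E j" by blast
      then show ?thesis using sm(1,3) by simp
    next
      assume "(V, f) \<in> {(E \<times> B, \<zeta> \<circ> snd) | B \<zeta>. (B, \<zeta>) \<in> defining_funs i N E j}"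
      then obtain B \<zeta> where "V = E \<times> B" "f = \<zeta> \<circ> snd" "(B, \<zeta>) \<in> defining_funs i N E j" by blast
      then show ?thesis using sm(2,4) by simp
    qed
  next
    fix j V and f :: "'a cov \<times> 'a cov \<Rightarrow> complex" assume j: "j < i" and "(V, f) \<in> {(B \<times> E, \<zeta> \<circ> fst) | B \<zeta>. (B, \<zeta>) \<in> defining_funs i N E j}" and xV: "(x1, x2) \<in> V"
    then obtain B \<zeta> where B: "V = B \<times> E" "f = \<zeta> \<circ> fst" "(B, \<zeta>) \<in> defining_funs i N E j" by blast
    have "x1 \<in> B" using xV B(1) by blast
    from type[OF B(3) j this x(3) _ n1(3) p1]
    show "f (x1, x2) = 0 \<and> (\<exists>\<alpha> \<beta>. cmod \<beta> < cmod \<alpha> \<and> (\<forall>\<tau>. tvec ?X (x1, x2) \<tau> \<longrightarrow>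
      \<tau> f = \<alpha> * \<tau> (\<lambda>q. zc e1 j (\<phi>1 (fst (fst q)))) + \<beta> * cnj (\<tau> (\<lambda>q. zc e1 j (\<phi>1 (fst (fst q)))))))"
      unfolding B(2) by simp
  next
    fix j V and f :: "'a cov \<times> 'a cov \<Rightarrow> complex" assume j: "j < i" and "(V, f) \<in> {(E \<times> B, \<zeta> \<circ> snd) | B \<zeta>. (B, \<zeta>) \<in> defining_funs i N E j}" and xV: "(x1, x2) \<in> V"
    then obtain B \<zeta> where B: "V = E \<times> B" "f = \<zeta> \<circ> snd" "(B, \<zeta>) \<in> defining_funs i N E j" by blast
    have "x2 \<in> B" using xV B(1) by blast
    from type[OF B(3) j this x(4) _ n2(3) p2]
    show "f (x1, x2) = 0 \<and> (\<exists>\<alpha> \<beta>. cmod \<beta> < cmod \<alpha> \<and> (\<forall>\<tau>. tvec ?X (x1, x2) \<tau> \<longrightarrow>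
      \<tau> f = \<alpha> * \<tau> (\<lambda>q. zc e2 j (\<phi>2 (fst (snd q)))) + \<beta> * cnj (\<tau> (\<lambda>q. zc e2 j (\<phi>2 (fst (snd q)))))))"
      unfolding B(2) by simp
  next
    fix j
    have "smooth_at ?X (x1, x2) ((\<lambda>q. zc e1 j (\<phi>1 q)) \<circ> (\<lambda>q. fst (fst q)))"
      by (rule smooth_at_pullback[OF X M p1 xt]) (use smooth_at_zc_chart[OF M D1(1) n1(2)] in simp)
    moreover have "smooth_at ?X (x1, x2) ((\<lambda>q. zc e2 j (\<phi>2 q)) \<circ> (\<lambda>q. fst (snd q)))"
      by (rule smooth_at_pullback[OF X M p2 xt]) (use smooth_at_zc_chart[OF M D2(1) n2(2)] in simp)
    ultimately show "smooth_at ?X (x1, x2) (\<lambda>q. zc e1 j (\<phi>1 (fst (fst q)))) \<and> smooth_at ?X (x1, x2) (\<lambda>q. zc e2 j (\<phi>2 (fst (snd q))))"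
      by (simp add: comp_def)
  next
    fix c d :: "nat \<Rightarrow> complex"
    obtain v1 where v1: "\<And>j. j < i \<Longrightarrow> zc e1 j v1 = c j" by (rule zc_vector[OF D1(2,3), of c "\<lambda>_. 0"]) (rule that)
    obtain v2 where v2: "\<And>j. j < i \<Longrightarrow> zc e2 j v2 = d j" by (rule zc_vector[OF D2(2,3), of d "\<lambda>_. 0"]) (rule that)
    obtain \<tau> where t: "tvec ?X (x1, x2) \<tau>"
      "\<And>f. smooth_at M (fst x1) f \<Longrightarrow> \<tau> (\<lambda>q. f (fst (fst q))) = dchart (fst x1) V1 \<phi>1 v1 f"
      "\<And>f. smooth_at M (fst x2) f \<Longrightarrow> \<tau> (\<lambda>q. f (fst (snd q))) = dchart (fst x2) V2 \<phi>2 v2 f"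
      by (rule square_tvec[OF N E x(1,2) tvec_dchart[OF M D1(1) n1(2)] tvec_dchart[OF M D2(1) n2(2)]]) (rule that)
    have "\<tau> (\<lambda>q. zc e1 j (\<phi>1 (fst (fst q)))) = c j \<and> \<tau> (\<lambda>q. zc e2 j (\<phi>2 (fst (snd q)))) = d j" if "j < i" for j
      using t(2)[OF smooth_at_zc_chart[OF M D1(1) n1(2)]] t(3)[OF smooth_at_zc_chart[OF M D2(1) n2(2)]]
        v1[OF that] v2[OF that] dchart_zc_chart[OF M D1(1) n1(2)] dchart_zc_chart[OF M D2(1) n2(2)] by simp
    then show "\<exists>\<tau>. tvec ?X (x1, x2) \<tau> \<and> (\<forall>j<i. \<tau> (\<lambda>q. zc e1 j (\<phi>1 (fst (fst q)))) = c j \<and>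
       \<tau> (\<lambda>q. zc e2 j (\<phi>2 (fst (snd q)))) = d j)" using t(1) by blast
  qed
qed

text \<open>Besides the common generator for both ends, the last conclusion records that an arrow
  off the hyperplanes is determined by its ends; the local injectivity of the orbit map rests on
  it.\<close>

lemma local_model:
  assumes y: "y \<in> GE_arrows i N E" and yN: "fst (GE_tgt i N E y) \<in> N" "fst (GE_src i N E y) \<in> N"
  obtains W \<phi> e V1 \<phi>1 e1 \<upsilon>1 V2 \<phi>2 e2 \<upsilon>2 where
    "chart (Y i N E) W \<phi>" "y \<in> W" "W \<subseteq> GE_arrows i N E" "frame_enum e" "2 * i \<le> DIM('e \<times> 'e)"
    "\<And>j. j < i \<Longrightarrow> zc e j (\<phi> y) = 0"
    "(V1, \<phi>1, e1) \<in> T i N" "\<And>q. q \<in> W \<Longrightarrow> fst (GE_tgt i N E q) \<in> V1" "\<upsilon>1 \<in> smooth_funs (Y i N E) W"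
    "\<And>q. q \<in> W \<Longrightarrow> (\<upsilon>1 q :: real) \<noteq> 0 \<and>
      (zprod e1 i (\<phi>1 (fst (GE_tgt i N E q)))) = \<upsilon>1 q * zprod e i (\<phi> q)"
    "(V2, \<phi>2, e2) \<in> T i N" "\<And>q. q \<in> W \<Longrightarrow> fst (GE_src i N E q) \<in> V2" "\<upsilon>2 \<in> smooth_funs (Y i N E) W"
    "\<And>q. q \<in> W \<Longrightarrow> (\<upsilon>2 q :: real) \<noteq> 0 \<and>
      (zprod e2 i (\<phi>2 (fst (GE_src i N E q)))) = \<upsilon>2 q * zprod e i (\<phi> q)"
    "\<And>q q'. q \<in> W \<Longrightarrow> q' \<in> pts (Y i N E) \<Longrightarrow> \<beta> i N E q' = \<beta> i N E q \<Longrightarrow>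
      \<forall>j<i. zc e j (\<phi> q) \<noteq> 0 \<Longrightarrow> q' = q"
proof -
  let ?Y = "Y i N E" and ?X = "square i N E" and ?b = "\<beta> i N E"
  note YS = Y_smooth(1)[OF N E] and bs = Y_smooth(2)[OF N E] and X = square_smooth[OF N E]
  have yt: "y \<in> pts ?Y" using y unfolding GE_arrows_def by blast
  define x1 where "x1 = GE_tgt i N E y"
  define x2 where "x2 = GE_src i N E y"
  have bx: "?b y = (x1, x2)" unfolding x1_def x2_def GE_tgt_def GE_src_def by simp
  have x: "x1 \<in> E" "x2 \<in> E" "fst x1 \<in> N" "fst x2 \<in> N" using square_point_fst[OF yt] yN unfolding x1_def x2_def by auto
  have xt: "x1 \<in> topspace (PN_top i N)" "x2 \<in> topspace (PN_top i N)" using x E_sub[OF N E] by auto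
  obtain V1' \<phi>1' e1' where n1: "nc_coords M D I i V1' \<phi>1' e1'" "fst x1 \<in> V1'" "snd x1 = framing M i \<phi>1' e1' (fst x1)"
    by (rule framing_at[OF N xt(1) x(3)])
  obtain V2' \<phi>2' e2' where n2: "nc_coords M D I i V2' \<phi>2' e2'" "fst x2 \<in> V2'" "snd x2 = framing M i \<phi>2' e2' (fst x2)"
    by (rule framing_at[OF N xt(2) x(4)])
  note BC = centre_blow_centres[OF x n1 n2]
  obtain f1 f2 a b where tc: "blow_centres.tower_coords (x1, x2) i
    (\<lambda>j. {(B \<times> E, \<zeta> \<circ> fst) | B \<zeta>. (B, \<zeta>) \<in> defining_funs i N E j})
    (\<lambda>j. {(E \<times> B, \<zeta> \<circ> snd) | B \<zeta>. (B, \<zeta>) \<in> defining_funs i N E j})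
    (\<lambda>j q. zc e1' j (\<phi>1' (fst (fst q)))) (\<lambda>j q. zc e2' j (\<phi>2' (fst (snd q)))) i ?Y ?b y f1 f2 a b"
    using blow_centres.tower[OF BC order_refl blowup[OF N E] yt bx] by (elim exE)
  note tc' = tc[unfolded blow_centres.tower_coords_def[OF BC]]
  have tj: "\<exists>B g B' g' . (B, g) \<in> defining_funs i N E j \<and> x1 \<in> B \<and> f1 j = g \<circ> fst \<and>
      (B', g') \<in> defining_funs i N E j \<and> x2 \<in> B' \<and> f2 j = g' \<circ> snd" if j: "j < i" for j
  proof -
    obtain V V' where V: "(V, f1 j) \<in> {(B \<times> E, \<zeta> \<circ> fst) | B \<zeta>. (B, \<zeta>) \<in> defining_funs i N E j}" "(x1, x2) \<in> V"
      "(V', f2 j) \<in> {(E \<times> B, \<zeta> \<circ> snd) | B \<zeta>. (B, \<zeta>) \<in> defining_funs i N E j}" "(x1, x2) \<in> V'"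
      using tc'[THEN conjunct1, rule_format, OF j] by (elim conjE exE)
    from V(1) obtain B \<zeta> where B: "V = B \<times> E" "f1 j = \<zeta> \<circ> fst" "(B, \<zeta>) \<in> defining_funs i N E j" by blast
    from V(3) obtain B' \<zeta>' where B': "V' = E \<times> B'" "f2 j = \<zeta>' \<circ> snd" "(B', \<zeta>') \<in> defining_funs i N E j" by blast
    show ?thesis by (intro exI[of _ B] exI[of _ \<zeta>] exI[of _ B'] exI[of _ \<zeta>'] conjI B B') (use V(2,4) B(1) B'(1) in auto)
  qed
  define good where "good = (\<lambda>j B g B' g'. (B, g) \<in> defining_funs i N E j \<and> x1 \<in> B \<and> f1 j = g \<circ> fst \<and>
      (B', g') \<in> defining_funs i N E j \<and> x2 \<in> B' \<and> f2 j = g' \<circ> snd)"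
  have "\<forall>j. \<exists>B g B' g'. j < i \<longrightarrow> good j B g B' g'" using tj unfolding good_def by blast
  then obtain B1 g1 B2 g2 where "\<forall>j. j < i \<longrightarrow> good j (B1 j) (g1 j) (B2 j) (g2 j)" by metis
  then have g: "(B1 j, g1 j) \<in> defining_funs i N E j \<and> x1 \<in> B1 j" "f1 j = g1 j \<circ> fst"
      "(B2 j, g2 j) \<in> defining_funs i N E j \<and> x2 \<in> B2 j" "f2 j = g2 j \<circ> snd" if "j < i" for j
    using that unfolding good_def by auto
  have ab: "smooth_at ?Y y (a j)" "smooth_at ?Y y (b j)" "a j y = 0" if "j < i" for j
    using tc'[THEN conjunct1, rule_format, OF that] by auto
  have dv: "\<exists>U. opn ?Y U \<and> y \<in> U \<and> ((\<forall>q\<in>U. f1 j (?b q) = a j q \<and> f2 j (?b q) = b j q * a j q) \<or>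
      (\<forall>q\<in>U. f2 j (?b q) = a j q \<and> f1 j (?b q) = b j q * a j q))" if "j < i" for j
    using tc'[THEN conjunct1, rule_format, OF that] unfolding blow_centres.divides_at_def[OF BC] by (elim conjE)
  have surj: "\<exists>\<tau>. tvec ?Y y \<tau> \<and> (\<forall>j<i. \<tau> (a j) = c j \<and> \<tau> (b j) = d j)" for c d
    using tc'[THEN conjunct2, rule_format, of c d] by simp
  \<comment> \<open>Marks the indices for which the target carries \<open>a j\<close> alone and the
    source the product \<open>b j * a j\<close>; for the others the roles are exchanged.\<close>
  define ty where "ty = (\<lambda>j. \<exists>U. opn ?Y U \<and> y \<in> U \<and> (\<forall>q\<in>U. f1 j (?b q) = a j q \<and> f2 j (?b q) = b j q * a j q))"
  define R where "R = (\<lambda>j q. smooth_at ?Y q (a j) \<and> smooth_at ?Y q (b j) \<and> ?b q \<in> B1 j \<times> E \<and>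
     (if ty j then f1 j (?b q) = a j q \<and> f2 j (?b q) = b j q * a j q else f2 j (?b q) = a j q \<and> f1 j (?b q) = b j q * a j q))"
  have Rn: "\<exists>U. opn ?Y U \<and> y \<in> U \<and> (\<forall>q\<in>U. R j q)" if j: "j < i" for j
  proof -
    obtain U1 where U1: "opn ?Y U1" "y \<in> U1" "\<forall>q\<in>U1. smooth_at ?Y q (a j)" using smooth_at_nbhd[OF ab(1)[OF j]] by blast
    obtain U2 where U2: "opn ?Y U2" "y \<in> U2" "\<forall>q\<in>U2. smooth_at ?Y q (b j)" using smooth_at_nbhd[OF ab(2)[OF j]] by blast
    obtain U3 where U3: "opn ?Y U3" "y \<in> U3"
      "\<forall>q\<in>U3. if ty j then f1 j (?b q) = a j q \<and> f2 j (?b q) = b j q * a j q else f2 j (?b q) = a j q \<and> f1 j (?b q) = b j q * a j q"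
    proof (cases "ty j")
      case True
      then show thesis using that unfolding ty_def by auto
    next
      case False
      from dv[OF j] obtain U where U: "opn ?Y U" "y \<in> U" "(\<forall>q\<in>U. f1 j (?b q) = a j q \<and> f2 j (?b q) = b j q * a j q) \<or>
        (\<forall>q\<in>U. f2 j (?b q) = a j q \<and> f1 j (?b q) = b j q * a j q)" by (elim exE conjE)
      have "\<not> (\<forall>q\<in>U. f1 j (?b q) = a j q \<and> f2 j (?b q) = b j q * a j q)"
        using False U(1,2) unfolding ty_def by blast
      with U(3) have "\<forall>q\<in>U. f2 j (?b q) = a j q \<and> f1 j (?b q) = b j q * a j q" by blast
      then show thesis using False by (intro that[OF U(1,2)]) simp
    qed
    have "opn ?X (B1 j \<times> E)" using blow_centres.S[OF BC j, of "B1 j \<times> E" "g1 j \<circ> fst"] g(1)[OF j] by blast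
    then have "opn ?Y {q \<in> pts ?Y. ?b q \<in> B1 j \<times> E}" by (rule smooth_map_preimage_open[OF bs])
    moreover have "?b y \<in> B1 j \<times> E" unfolding bx using g(1)[OF j] x by blast
    ultimately show ?thesis unfolding R_def
      by (intro exI[of _ "U1 \<inter> U2 \<inter> U3 \<inter> {q \<in> pts ?Y. ?b q \<in> B1 j \<times> E}"]) (use U1 U2 U3 yt in auto)
  qed
  obtain UR where UR: "opn ?Y UR" "y \<in> UR" "\<And>j q. j < i \<Longrightarrow> q \<in> UR \<Longrightarrow> R j q"
    by (rule finite_nbhd[of y "mtop ?Y" i R, OF yt Rn]; (assumption | rule that))
  obtain V1 \<phi>1 e1 where T1: "(V1, \<phi>1, e1) \<in> T i N" "fst x1 \<in> V1" using tubeD(5)[OF N] tubeD(2)[OF N] x(3) by blast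
  obtain V2 \<phi>2 e2 where T2: "(V2, \<phi>2, e2) \<in> T i N" "fst x2 \<in> V2" using tubeD(5)[OF N] tubeD(2)[OF N] x(4) by blast
  obtain A1 c1 where A1: "opn M A1" "fst x1 \<in> A1" "A1 \<subseteq> V1" "c1 \<in> smooth_funs M A1"
    "\<And>q. fst q \<in> A1 \<Longrightarrow> (c1 (fst q) :: real) \<noteq> 0 \<and>
      (\<Prod>j<i. (cmod (g1 j q))\<^sup>2) = c1 (fst q) * zprod e1 i (\<phi>1 (fst q))"
    by (rule sheet_generator[OF N xt(1) x(3) g(1) T1]; (assumption | rule that))
  obtain A2 c2 where A2: "opn M A2" "fst x2 \<in> A2" "A2 \<subseteq> V2" "c2 \<in> smooth_funs M A2"
    "\<And>q. fst q \<in> A2 \<Longrightarrow> (c2 (fst q) :: real) \<noteq> 0 \<and>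
      (\<Prod>j<i. (cmod (g2 j q))\<^sup>2) = c2 (fst q) * zprod e2 i (\<phi>2 (fst q))"
    by (rule sheet_generator[OF N xt(2) x(4) g(3) T2]; (assumption | rule that))
  note ps = Y_proj_smooth[OF N E]
  define U0 where "U0 = UR \<inter> GE_arrows i N E \<inter> {q \<in> pts ?Y. fst (GE_tgt i N E q) \<in> A1} \<inter>
    {q \<in> pts ?Y. fst (GE_src i N E q) \<in> A2}"
  have U0: "opn ?Y U0" "y \<in> U0" unfolding U0_def
    using UR GE_arrows_open[OF N E] smooth_map_preimage_open[OF ps(1) A1(1)] smooth_map_preimage_open[OF ps(2) A2(1)]
      y yt A1(2) A2(2) x1_def x2_def by auto
  have R0: "R j q" if "q \<in> U0" "j < i" for j q using UR(3) that unfolding U0_def by blast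
  have A0: "q \<in> GE_arrows i N E" "fst (GE_tgt i N E q) \<in> A1" "fst (GE_src i N E q) \<in> A2" "q \<in> pts ?Y"
    if "q \<in> U0" for q using that unfolding U0_def by auto
  let ?F1 = "\<lambda>q. \<Prod>j<i. (cmod (g1 j (GE_tgt i N E q)))\<^sup>2" and ?F2 = "\<lambda>q. \<Prod>j<i. (cmod (g2 j (GE_src i N E q)))\<^sup>2"
  have f12: "f1 j (?b q) = g1 j (GE_tgt i N E q)" "f2 j (?b q) = g2 j (GE_src i N E q)" if "j < i" for j q
    unfolding g(2)[OF that] g(4)[OF that] GE_tgt_def GE_src_def by simp_all
  have gab: "g1 j (GE_tgt i N E q) = (if ty j then 1 else b j q) * a j q \<and>
     g2 j (GE_src i N E q) = (if ty j then b j q else 1) * a j q" if "j < i" "q \<in> U0" for j q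
    using R0[OF that(2,1)] f12[OF that(1)] unfolding R_def by (auto split: if_splits)
  have T1V: "fst (GE_tgt i N E q) \<in> V1" "fst (GE_src i N E q) \<in> V2" if "q \<in> U0" for q using A0[OF that] A1(3) A2(3) by auto
  have D1: "fst (GE_tgt i N E q) \<in> D \<longleftrightarrow> (\<exists>j<i. g1 j (GE_tgt i N E q) = 0)" if q: "q \<in> U0" for q
  proof -
    have "(\<exists>j<i. g1 j (GE_tgt i N E q) = 0) \<longleftrightarrow> ?F1 q = 0" by auto
    also have "\<dots> \<longleftrightarrow> (\<exists>l<i. zc e1 l (\<phi>1 (fst (GE_tgt i N E q))) = 0)" using A1(5)[OF A0(2)[OF q]] by auto
    finally show ?thesis using nc_coordsD(4)[OF tube_chartD(1)[OF N T1(1)] T1V(1)[OF q]] by simp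
  qed
  have D2: "fst (GE_src i N E q) \<in> D \<longleftrightarrow> (\<exists>j<i. g2 j (GE_src i N E q) = 0)" if q: "q \<in> U0" for q
  proof -
    have "(\<exists>j<i. g2 j (GE_src i N E q) = 0) \<longleftrightarrow> ?F2 q = 0" by auto
    also have "\<dots> \<longleftrightarrow> (\<exists>l<i. zc e2 l (\<phi>2 (fst (GE_src i N E q))) = 0)" using A2(5)[OF A0(3)[OF q]] by auto
    finally show ?thesis using nc_coordsD(4)[OF tube_chartD(1)[OF N T2(1)] T1V(2)[OF q]] by simp
  qed
  have bnz: "b j0 y \<noteq> 0" if j0: "j0 < i" for j0
  proof
    assume b0: "b j0 y = 0"
    define f where "f = (\<lambda>l. if l < i then a l else b (l - i))"
    have fs: "smooth_at ?Y y (f l)" if "l < 2 * i" for l using ab that unfolding f_def by auto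
    have sf: "\<exists>\<tau>. tvec ?Y y \<tau> \<and> (\<forall>l<2 * i. \<tau> (f l) = c l)" for c
    proof -
      obtain \<tau> where t: "tvec ?Y y \<tau>" "\<forall>j<i. \<tau> (a j) = c j \<and> \<tau> (b j) = c (i + j)"
        using surj[of c "\<lambda>j. c (i + j)"] by blast
      have "\<tau> (f l) = c l" if "l < 2 * i" for l
        using t(2)[rule_format, of l] t(2)[rule_format, of "l - i"] that unfolding f_def by (auto simp: not_less)
      then show ?thesis using t(1) by blast
    qed
    obtain V \<phi> e where V: "chart ?Y V \<phi>" "y \<in> V" "V \<subseteq> U0" "frame_enum e" "2 * (2 * i) \<le> DIM('e \<times> 'e)"
      "\<And>q l. q \<in> V \<Longrightarrow> l < 2 * i \<Longrightarrow> zc e l (\<phi> q) = f l q"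
      by (rule complete_to_chart[OF YS fs yt sf U0]; (assumption | rule that))
    \<comment> \<open>In direction \<open>w\<close> the coordinate \<open>b j0\<close> stays 0, the
      other coordinates that vanish at \<open>y\<close> become nonzero, and those nonzero at
      \<open>y\<close> are rescaled by a positive factor. So exactly one of the \<open>2 * i\<close>
      functions vanishes at \<open>q\<close>, and exactly one end of \<open>q\<close> lies in the
      divisor.\<close>
    define w0 where "w0 = (\<lambda>l. if l = i + j0 then 0 else if f l y = 0 then 1 else f l y)"
    obtain w where w: "\<And>l. l < 2 * i \<Longrightarrow> zc e l w = w0 l" by (rule zc_vector[OF V(4,5), of w0 "\<lambda>_. 0"]) (rule that)
    obtain r0 where r0: "r0 > 0" "\<And>r. 0 < r \<Longrightarrow> r < r0 \<Longrightarrow> \<exists>q\<in>V \<inter> V. \<phi> q = \<phi> y + r *\<^sub>R w"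
      by (rule chart_ray[OF V(1,2) chartD(1)[OF V(1)] V(2), of w]) (rule that)
    obtain q where q: "q \<in> V" "\<phi> q = \<phi> y + (r0 / 2) *\<^sub>R w" using r0(2)[of "r0 / 2"] r0(1) by auto
    have qU: "q \<in> U0" using q V(3) by blast
    have fq: "f l q = f l y + of_real (r0 / 2) * w0 l" if "l < 2 * i" for l
      using V(6)[OF q(1) that] V(6)[OF V(2) that] w[OF that] unfolding q(2) zc_add zc_scale by (simp add: scaleR_conv_of_real)
    have f0: "f l q = 0 \<longleftrightarrow> l = i + j0" if l: "l < 2 * i" for l
    proof (cases "l = i + j0")
      case True
      then show ?thesis using fq[OF l] b0 unfolding w0_def f_def by simp
    next
      case False
      show ?thesis
      proof (cases "f l y = 0")
        case True
        then have "f l q = of_real (r0 / 2)" using fq[OF l] False unfolding w0_def by simp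
        then show ?thesis using False r0(1) by (simp only: of_real_eq_0_iff) simp
      next
        case fl: False
        have "f l q = of_real (1 + r0 / 2) * f l y" using fq[OF l] False fl unfolding w0_def by (simp add: algebra_simps)
        moreover have "of_real (1 + r0 / 2) \<noteq> (0::complex)" unfolding of_real_eq_0_iff using r0(1) by linarith
        ultimately show ?thesis using False fl by simp
      qed
    qed
    have aq: "a l q \<noteq> 0" if "l < i" for l using f0[of l] that j0 unfolding f_def by auto
    have bq: "b l q = 0 \<longleftrightarrow> l = j0" if "l < i" for l using f0[of "i + l"] that unfolding f_def by auto
    have g0: "g1 j (GE_tgt i N E q) = 0 \<longleftrightarrow> j = j0 \<and> \<not> ty j" "g2 j (GE_src i N E q) = 0 \<longleftrightarrow> j = j0 \<and> ty j" if "j < i" for j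
      using gab[OF that qU] aq[OF that] bq[OF that] by (cases "ty j"; force)+
    have "(\<exists>j<i. g1 j (GE_tgt i N E q) = 0) \<longleftrightarrow> \<not> ty j0" using g0(1) j0 by blast
    moreover have "(\<exists>j<i. g2 j (GE_src i N E q) = 0) \<longleftrightarrow> ty j0" using g0(2) j0 by blast
    ultimately show False using D1[OF qU] D2[OF qU] GE_same_D[OF N E A0(1)[OF qU]] by blast
  qed
  have bnb: "\<exists>U. opn ?Y U \<and> y \<in> U \<and> (\<forall>q\<in>U. b j q \<noteq> 0)" if j: "j < i" for j
  proof -
    obtain U where "opn ?Y U" "y \<in> U" "\<And>q. q \<in> U \<Longrightarrow> b j q \<in> - {0}"
      by (rule smooth_at_continuous[OF YS ab(2)[OF j], of "- {0}"]) (use bnz[OF j] in \<open>auto intro: that\<close>)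
    then show ?thesis by blast
  qed
  obtain Ub where Ub: "opn ?Y Ub" "y \<in> Ub" "\<And>j q. j < i \<Longrightarrow> q \<in> Ub \<Longrightarrow> b j q \<noteq> 0"
    by (rule finite_nbhd[of y "mtop ?Y" i "\<lambda>j q. b j q \<noteq> 0", OF yt bnb]; (assumption | rule that))
  have oU: "opn ?Y (U0 \<inter> Ub)" "y \<in> U0 \<inter> Ub" using U0 Ub by auto
  have sa: "\<exists>\<tau>. tvec ?Y y \<tau> \<and> (\<forall>l<i. \<tau> (a l) = c l)" for c using surj[of c c] by blast
  obtain W \<phi> e where W: "chart ?Y W \<phi>" "y \<in> W" "W \<subseteq> U0 \<inter> Ub" "frame_enum e" "2 * i \<le> DIM('e \<times> 'e)"
    "\<And>q l. q \<in> W \<Longrightarrow> l < i \<Longrightarrow> zc e l (\<phi> q) = a l q"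
    by (rule complete_to_chart[OF YS ab(1) yt sa oU]; (assumption | rule that))
  have WU: "q \<in> U0" "q \<in> Ub" if "q \<in> W" for q using W(3) that by auto
  note oW = chartD(1)[OF W(1)]
  have bsm: "b j \<in> smooth_funs ?Y W" if "j < i" for j
    by (rule smooth_funs_at[OF YS]) (use R0[OF WU(1) that] in \<open>simp add: R_def\<close>)
  have fac: "(\<lambda>q. if P j then 1 else (cmod (b j q))\<^sup>2) \<in> smooth_funs ?Y W" if "j < i" for j P
    using smooth_funs_norm2[OF YS oW bsm[OF that]] smooth_funs_const[of 1 ?Y W] by (cases "P j") auto
  \<comment> \<open>The unit at one end consists of the inverse of the unit from the tube and of the
    squared moduli of those \<open>b j\<close> which this end carries; \<open>P\<close> marks the
    indices where it carries \<open>a j\<close> alone.\<close>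
  have ups: "(\<lambda>q. inverse (c (fst (p q))) * (\<Prod>j<i. if P j then 1 else (cmod (b j q))\<^sup>2)) \<in> smooth_funs ?Y W"
    if c: "c \<in> smooth_funs M A" "opn M A" and p: "smooth_map ?Y M (\<lambda>q. fst (p q))"
      "\<And>q. q \<in> W \<Longrightarrow> fst (p q) \<in> A" and nz: "\<And>q. q \<in> W \<Longrightarrow> c (fst (p q)) \<noteq> (0::real)"
    for c A P and p :: "_ \<Rightarrow> 'a cov"
  proof (intro smooth_funs_bilinear[OF bounded_bilinear_mult YS oW] smooth_funs_inverse[OF YS oW] smooth_funs_prod[OF YS oW])
    have "W \<subseteq> {q \<in> pts ?Y. fst (p q) \<in> A}" using p(2) chartD(2)[OF W(1)] by blast
    from smooth_funs_subset[OF smooth_funs_pullback[OF YS M p(1) c] this]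
    show "(\<lambda>q. c (fst (p q))) \<in> smooth_funs ?Y W" by (simp add: comp_def)
    show "c (fst (p q)) \<noteq> 0" if "q \<in> W" for q by (rule nz[OF that])
    show "(\<lambda>q. if P j then 1 else (cmod (b j q))\<^sup>2) \<in> smooth_funs ?Y W" if "j \<in> {..<i}" for j using fac that by simp
  qed
  have eqn: "inverse cc * (\<Prod>j<i. if P j then 1 else (cmod (b j q))\<^sup>2) \<noteq> 0 \<and>
      z = inverse cc * (\<Prod>j<i. if P j then 1 else (cmod (b j q))\<^sup>2) * zprod e i (\<phi> q)"
    if q: "q \<in> W" and c: "cc \<noteq> (0::real)" "(\<Prod>j<i. (cmod (gg j))\<^sup>2) = cc * z"
      and gg: "\<And>j. j < i \<Longrightarrow> gg j = (if P j then 1 else b j q) * a j q" for q cc z gg P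
  proof
    show "inverse cc * (\<Prod>j<i. if P j then 1 else (cmod (b j q))\<^sup>2) \<noteq> 0" using c(1) Ub(3) WU(2)[OF q] by auto
    have "(\<Prod>j<i. (cmod (gg j))\<^sup>2) = (\<Prod>j<i. (if P j then 1 else (cmod (b j q))\<^sup>2) * (cmod (zc e j (\<phi> q)))\<^sup>2)"
      by (rule prod.cong) (auto simp: gg W(6)[OF q] norm_mult power_mult_distrib)
    then have "cc * z = (\<Prod>j<i. if P j then 1 else (cmod (b j q))\<^sup>2) * zprod e i (\<phi> q)"
      unfolding c(2) by (simp add: prod.distrib)
    then show "z = inverse cc * (\<Prod>j<i. if P j then 1 else (cmod (b j q))\<^sup>2) * zprod e i (\<phi> q)"
      using c(1) by (simp add: field_simps)
  qed
  show thesis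
  proof (rule that[OF W(1,2) _ W(4,5) _ T1(1) _ ups[OF A1(4,1) ps(1)] _ T2(1) _ ups[OF A2(4,1) ps(2)]])
    show "W \<subseteq> GE_arrows i N E" using A0(1) WU(1) by blast
    show "zc e j (\<phi> y) = 0" if "j < i" for j using W(6)[OF W(2) that] ab(3)[OF that] by simp
    fix q assume q: "q \<in> W"
    show "fst (GE_tgt i N E q) \<in> V1" "fst (GE_src i N E q) \<in> V2" using T1V[OF WU(1)[OF q]] .
    show "fst (GE_tgt i N E q) \<in> A1" "fst (GE_src i N E q) \<in> A2" using A0[OF WU(1)[OF q]] by auto
    show "c1 (fst (GE_tgt i N E q)) \<noteq> 0" "c2 (fst (GE_src i N E q)) \<noteq> 0" using A1(5) A2(5) A0[OF WU(1)[OF q]] by auto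
    show "inverse (c1 (fst (GE_tgt i N E q))) * (\<Prod>j<i. if ty j then 1 else (cmod (b j q))\<^sup>2) \<noteq> 0 \<and>
      (zprod e1 i (\<phi>1 (fst (GE_tgt i N E q)))) =
      inverse (c1 (fst (GE_tgt i N E q))) * (\<Prod>j<i. if ty j then 1 else (cmod (b j q))\<^sup>2) * zprod e i (\<phi> q)"
      by (rule eqn[OF q _ A1(5)[THEN conjunct2]]) (use A1(5) A0[OF WU(1)[OF q]] gab[OF _ WU(1)[OF q]] in auto)
    show "inverse (c2 (fst (GE_src i N E q))) * (\<Prod>j<i. if \<not> ty j then 1 else (cmod (b j q))\<^sup>2) \<noteq> 0 \<and>
      (zprod e2 i (\<phi>2 (fst (GE_src i N E q)))) =
      inverse (c2 (fst (GE_src i N E q))) * (\<Prod>j<i. if \<not> ty j then 1 else (cmod (b j q))\<^sup>2) * zprod e i (\<phi> q)"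
      by (rule eqn[OF q _ A2(5)[THEN conjunct2]]) (use A2(5) A0[OF WU(1)[OF q]] gab[OF _ WU(1)[OF q]] in auto)
    fix q' assume q': "q' \<in> pts ?Y" "?b q' = ?b q" and nz: "\<forall>j<i. zc e j (\<phi> q) \<noteq> 0"
    \<comment> \<open>Since no \<open>a j\<close> vanishes at \<open>q\<close> and the
      \<open>b j\<close> are units, the defining function \<open>f1 j\<close> is nonzero for each
      \<open>j\<close>, so \<open>q\<close> lies off all centres, where the tower is
      injective.\<close>
    have "q = q'"
    proof (rule iter_blowup_inj[OF X blow_centres.J[OF BC] blow_centres.S[OF BC] blowup[OF N E] order_refl A0(4)[OF WU(1)[OF q]] q'(1)])
      show "?b q = ?b q'" using q'(2) by simp
      fix j assume j: "j < i"
      have "f1 j (?b q) \<noteq> 0" using gab[OF j WU(1)[OF q]] f12(1)[OF j] Ub(3)[OF j WU(2)[OF q]] nz[rule_format, OF j] W(6)[OF q j] by auto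
      moreover have "?b q \<in> B1 j \<times> E" using R0[OF WU(1)[OF q] j] unfolding R_def by blast
      moreover have "(B1 j \<times> E, f1 j) \<in> {(B \<times> E, \<zeta> \<circ> fst) | B \<zeta>. (B, \<zeta>) \<in> defining_funs i N E j}"
        unfolding g(2)[OF j] using g(1)[OF j] by blast
      ultimately show "\<exists>(V, f)\<in>{(B \<times> E, \<zeta> \<circ> fst) | B \<zeta>. (B, \<zeta>) \<in> defining_funs i N E j} \<union>
          {(E \<times> B, \<zeta> \<circ> snd) | B \<zeta>. (B, \<zeta>) \<in> defining_funs i N E j}. ?b q \<in> V \<and> f (?b q) \<noteq> 0"
        by (intro bexI[of _ "(B1 j \<times> E, f1 j)"] case_prodI conjI UnI1)
    qed
    then show "q' = q" by simp
  qed
qed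

end

end

section \<open>Orbits and gluing\<close>

lemma reverse_coor_reverse_coor [simp]: "reverse_coor (reverse_coor C) = C" unfolding reverse_coor_def image_image by (simp add: comp_def)

lemma Gam_act_compose:
  assumes "\<delta> \<in> Gam i" "\<delta>' \<in> Gam i"
  shows "Gam_act i \<delta>' (Gam_act i \<delta> c) = Gam_act i (\<lambda>j. fst \<delta>' j \<noteq> fst \<delta> (snd \<delta>' j), snd \<delta> \<circ> snd \<delta>') c"
proof -
  have "snd \<delta>' permutes {..<i}" using assms(2) unfolding Gam_def by auto
  then have "snd \<delta>' j < i" if "j < i" for j using permutes_in_image[of "snd \<delta>'" "{..<i}" j] that by auto
  then show ?thesis unfolding Gam_act_def by auto
qed

lemma Gam_compose:
  assumes "\<delta> \<in> Gam i" "\<delta>' \<in> Gam i"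
  shows "(\<lambda>j. fst \<delta>' j \<noteq> fst \<delta> (snd \<delta>' j), snd \<delta> \<circ> snd \<delta>') \<in> Gam i"
  using assms permutes_compose[of "snd \<delta>'" "{..<i}" "snd \<delta>"] unfolding Gam_def by auto

lemma Gam_id: "(\<lambda>_. False, id) \<in> Gam i" unfolding Gam_def using permutes_id by simp

lemma Gam_act_id: "length c = i \<Longrightarrow> Gam_act i (\<lambda>_. False, id) c = c"
  unfolding Gam_act_def using map_nth[of c] by simp

lemma Gam_inverse:
  assumes "\<delta> \<in> Gam i"
  obtains \<delta>' where "\<delta>' \<in> Gam i" "\<And>c. length c = i \<Longrightarrow> Gam_act i \<delta>' (Gam_act i \<delta> c) = c"
proof -
  let ?\<sigma> = "snd \<delta>"
  have p: "?\<sigma> permutes {..<i}" using assms unfolding Gam_def by auto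
  let ?d = "(\<lambda>j. fst \<delta> (inv_into UNIV ?\<sigma> j), inv_into UNIV ?\<sigma>)"
  have d: "?d \<in> Gam i" unfolding Gam_def using permutes_inv[OF p] by simp
  have "?\<sigma> \<circ> inv_into UNIV ?\<sigma> = id" by (rule permutes_inv_o(1)[OF p])
  then show thesis by (intro that[OF d]) (simp add: Gam_act_compose[OF assms d] Gam_act_id)
qed

section \<open>Open submanifolds, disjoint unions and quotient topologies\<close>

lemma openin_open_sub:
  "opn X A \<Longrightarrow> opn (open_sub X A) W \<longleftrightarrow> opn X W \<and> W \<subseteq> A"
  unfolding open_sub_def by (simp add: openin_open_subtopology)

lemma topspace_open_sub: "opn X A \<Longrightarrow> pts (open_sub X A) = A"
  using openin_subset[of "mtop X" A] unfolding open_sub_def by auto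

lemma atlas_open_sub: "(W, \<psi>) \<in> atlas (open_sub X A) \<longleftrightarrow> (\<exists>V. W = V \<inter> A \<and> (V, \<psi>) \<in> atlas X)"
  unfolding open_sub_def by auto

lemma smooth_mfd_open_sub:
  assumes X: "smooth_mfd X" and A: "opn X A"
  shows "smooth_mfd (open_sub X A)"
proof -
  have top: "top_chart (open_sub X A) (V \<inter> A) \<phi>" if V: "(V, \<phi>) \<in> atlas X" for V \<phi>
  proof -
    note c = chartD[OF chart_restrict[OF X chart_atlas[OF X V] A]]
    show ?thesis unfolding top_chart_iff openin_open_sub[OF A] using c by auto
  qed
  have comp: "Cinf_on (\<phi> ` ((V \<inter> A) \<inter> (W \<inter> A))) (\<psi> \<circ> inv_into (V \<inter> A) \<phi>)"
    if "(V, \<phi>) \<in> atlas X" "(W, \<psi>) \<in> atlas X" for V \<phi> W \<psi>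
    by (rule chart_compatible[OF X chart_restrict[OF X chart_atlas[OF X that(1)] A] chart_restrict[OF X chart_atlas[OF X that(2)] A]])
  have "\<Union> (fst ` atlas (open_sub X A)) = \<Union> (fst ` atlas X) \<inter> A" unfolding open_sub_def by force
  also have "\<dots> = pts (open_sub X A)" using X openin_subset[OF A] topspace_open_sub[OF A] unfolding smooth_mfd_def by auto
  finally have cov: "\<Union> (fst ` atlas (open_sub X A)) = pts (open_sub X A)" .
  have T: "top_chart (open_sub X A) V \<phi>" if "(V, \<phi>) \<in> atlas (open_sub X A)" for V \<phi>
    using that top unfolding atlas_open_sub by blast
  have C: "compatible V \<phi> W \<psi>" if VW: "(V, \<phi>) \<in> atlas (open_sub X A)" "(W, \<psi>) \<in> atlas (open_sub X A)" for V \<phi> W \<psi>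
  proof -
    obtain V' W' where e: "V = V' \<inter> A" "(V', \<phi>) \<in> atlas X" "W = W' \<inter> A" "(W', \<psi>) \<in> atlas X"
      using VW unfolding atlas_open_sub by blast
    show ?thesis unfolding e compatible_def using comp[OF e(2,4)] comp[OF e(4,2)] by (simp only: Int_commute)
  qed
  show ?thesis unfolding smooth_mfd_def by (intro conjI ballI cov) (auto simp: T C)
qed

lemma openin_sum_slice: "a \<in> A \<Longrightarrow> opn (sum_mfd X A) ({a} \<times> V) \<longleftrightarrow> opn (X a) V"
proof -
  assume a: "a \<in> A"
  then have e: "{a} \<times> V = Sigma A (\<lambda>b. if b = a then V else {})" by (auto split: if_splits)
  show ?thesis unfolding sum_mfd_def e using a by (auto simp: openin_disjoint_union)
qed

lemma openin_sum_section: "a \<in> A \<Longrightarrow> opn (sum_mfd X A) W \<Longrightarrow> opn (X a) {x. (a, x) \<in> W}"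
  unfolding sum_mfd_def by (auto simp: openin_sum_topology)

lemma topspace_sum_mfd: "pts (sum_mfd X A) = (SIGMA a:A. pts (X a))" unfolding sum_mfd_def by (simp add: comp_def)

lemma atlas_sum_mfd: "(W, \<psi>) \<in> atlas (sum_mfd X A) \<longleftrightarrow>
    (\<exists>a V \<phi>. W = {a} \<times> V \<and> \<psi> = \<phi> \<circ> snd \<and> a \<in> A \<and> (V, \<phi>) \<in> atlas (X a))"
  unfolding sum_mfd_def by auto

lemma smooth_mfd_sum:
  fixes X :: "'i \<Rightarrow> ('p, 'e::euclidean_space) mfd"
  assumes X: "\<And>a. a \<in> A \<Longrightarrow> smooth_mfd (X a)"
  shows "smooth_mfd (sum_mfd X A)"
proof -
  let ?S = "sum_mfd X A"
  have top: "top_chart ?S ({a} \<times> V) (\<phi> \<circ> snd)" if a: "a \<in> A" and V: "(V, \<phi>) \<in> atlas (X a)" for a V \<phi>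
  proof -
    note c = chartD[OF chart_atlas[OF X[OF a] V]]
    show ?thesis unfolding top_chart_iff
    proof (intro conjI allI impI)
      show "opn ?S ({a} \<times> V)" using openin_sum_slice[OF a] c(1) by blast
      show "inj_on (\<phi> \<circ> snd) ({a} \<times> V)" using c(3) by (auto simp: inj_on_def)
    next
      fix W assume W: "opn ?S W \<and> W \<subseteq> {a} \<times> V"
      have "(\<phi> \<circ> snd) ` W = \<phi> ` {x. (a, x) \<in> W}" using W by force
      moreover have "{x. (a, x) \<in> W} \<subseteq> V" using W by auto
      ultimately show "open ((\<phi> \<circ> snd) ` W)" using c(6)[OF openin_sum_section[OF a, of X W]] W by simp
    next
      fix B :: "'e set" assume "open B"
      moreover have "{q \<in> {a} \<times> V. (\<phi> \<circ> snd) q \<in> B} = {a} \<times> {x \<in> V. \<phi> x \<in> B}" by auto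
      ultimately show "opn ?S {q \<in> {a} \<times> V. (\<phi> \<circ> snd) q \<in> B}"
        using c(8) openin_sum_slice[OF a, of X "{x \<in> V. \<phi> x \<in> B}"] by simp
    qed
  qed
  have comp: "Cinf_on ((\<phi> \<circ> snd) ` (({a} \<times> V) \<inter> ({b} \<times> W))) ((\<psi> \<circ> snd) \<circ> inv_into ({a} \<times> V) (\<phi> \<circ> snd))"
    if a: "a \<in> A" "(V, \<phi>) \<in> atlas (X a)" and b: "b \<in> A" "(W, \<psi>) \<in> atlas (X b)" for a b V \<phi> W \<psi>
  proof (cases "a = b")
    case False
    then have e: "({a} \<times> V) \<inter> ({b} \<times> W) = {}" by auto
    show ?thesis unfolding e by (rule Cinf_on_local) simp
  next
    case True
    note ca = chart_atlas[OF X[OF a(1)] a(2)] and cb = chart_atlas[OF X[OF b(1)] b(2)]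
    have i: "inv_into ({a} \<times> V) (\<phi> \<circ> snd) (\<phi> x) = (a, x)" if "x \<in> V" for x
      using inv_into_f_f[of "\<phi> \<circ> snd" "{a} \<times> V" "(a, x)"] chartD(3)[OF ca] that by (auto simp: inj_on_def)
    have im: "(\<phi> \<circ> snd) ` (({a} \<times> V) \<inter> ({b} \<times> W)) = \<phi> ` (V \<inter> W)" using True by force
    show ?thesis unfolding im
    proof (rule Cinf_on_cong)
      show "open (\<phi> ` (V \<inter> W))" using chartD(5)[OF ca chartD(1)[OF cb[folded True]]] by (simp add: Int_commute)
      show "Cinf_on (\<phi> ` (V \<inter> W)) (\<psi> \<circ> inv_into V \<phi>)" by (rule chart_compatible[OF X[OF a(1)] ca cb[folded True]])
      show "(\<psi> \<circ> inv_into V \<phi>) x = ((\<psi> \<circ> snd) \<circ> inv_into ({a} \<times> V) (\<phi> \<circ> snd)) x" if "x \<in> \<phi> ` (V \<inter> W)" for x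
        using that i chartD(4)[OF ca] by auto
    qed
  qed
  have cov: "\<Union> (fst ` atlas ?S) = pts ?S"
  proof -
    have "\<Union> (fst ` atlas ?S) = (SIGMA a:A. \<Union> (fst ` atlas (X a)))" unfolding sum_mfd_def by force
    then show ?thesis using X unfolding topspace_sum_mfd smooth_mfd_def by auto
  qed
  have T: "top_chart ?S V \<phi>" if "(V, \<phi>) \<in> atlas ?S" for V \<phi> using that top unfolding atlas_sum_mfd by blast
  have C: "compatible V \<phi> W \<psi>" if VW: "(V, \<phi>) \<in> atlas ?S" "(W, \<psi>) \<in> atlas ?S" for V \<phi> W \<psi>
  proof -
    obtain a V' \<phi>' where e: "V = {a} \<times> V'" "\<phi> = \<phi>' \<circ> snd" "a \<in> A" "(V', \<phi>') \<in> atlas (X a)"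
      using VW(1) unfolding atlas_sum_mfd by blast
    obtain b W' \<psi>' where e': "W = {b} \<times> W'" "\<psi> = \<psi>' \<circ> snd" "b \<in> A" "(W', \<psi>') \<in> atlas (X b)"
      using VW(2) unfolding atlas_sum_mfd by blast
    show ?thesis unfolding e(1,2) e'(1,2) compatible_def using comp[OF e(3,4) e'(3,4)] comp[OF e'(3,4) e(3,4)] by (simp only: Int_commute)
  qed
  show ?thesis unfolding smooth_mfd_def by (intro conjI ballI cov) (auto simp: T C)
qed

text \<open>Move from \<open>p\<close> in the direction that is 1 on the vanishing coordinates and
  proportional to the others: a vanishing coordinate becomes positive, the others are multiplied by
  a real number above 1.\<close>

lemma dense_complement:
  fixes X :: "('p, 'e::euclidean_space) mfd"
  assumes c: "chart X V \<phi>" "p \<in> V" and e: "frame_enum e" "2 * k \<le> DIM('e)" and A: "opn X A" "p \<in> A"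
  obtains q where "q \<in> A" "q \<in> V" "\<And>j. j < k \<Longrightarrow> zc e j (\<phi> q) \<noteq> 0"
proof -
  define w0 where "w0 = (\<lambda>j. if zc e j (\<phi> p) = 0 then 1 else zc e j (\<phi> p))"
  obtain w where w: "\<And>j. j < k \<Longrightarrow> zc e j w = w0 j" by (rule zc_vector[OF e, of w0 "\<lambda>_. 0"]) (rule that)
  obtain r0 where r0: "r0 > 0" "\<And>r. 0 < r \<Longrightarrow> r < r0 \<Longrightarrow> \<exists>q\<in>A \<inter> V. \<phi> q = \<phi> p + r *\<^sub>R w"
    by (rule chart_ray[OF c A, of w]) (rule that)
  obtain q where q: "q \<in> A" "q \<in> V" "\<phi> q = \<phi> p + (r0 / 2) *\<^sub>R w" using r0(2)[of "r0 / 2"] r0(1) by auto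
  have "zc e j (\<phi> q) \<noteq> 0" if j: "j < k" for j
  proof (cases "zc e j (\<phi> p) = 0")
    case True
    then have "zc e j (\<phi> q) = of_real (r0 / 2)" unfolding q(3) zc_add zc_scale w[OF j] w0_def by (simp add: scaleR_conv_of_real)
    then show ?thesis using r0(1) by (simp only: of_real_eq_0_iff; simp)
  next
    case False
    then have "zc e j (\<phi> q) = of_real (1 + r0 / 2) * zc e j (\<phi> p)"
      unfolding q(3) zc_add zc_scale w[OF j] w0_def by (simp add: scaleR_conv_of_real algebra_simps)
    moreover have "of_real (1 + r0 / 2) \<noteq> (0::complex)" unfolding of_real_eq_0_iff using r0(1) by linarith
    ultimately show ?thesis using False by simp
  qed
  then show thesis using that q(1,2) by blast
qed

text \<open>The quotient topology is defined by applying \<open>topology\<close> to a predicate, so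
  it describes the open sets only once the predicate is shown to be a topology.\<close>

lemma openin_quot:
  fixes X :: "('p, 'f) mfd" and q :: "'p \<Rightarrow> 'q"
  shows "opn (quot_mfd X q) W \<longleftrightarrow> W \<subseteq> q ` pts X \<and> opn X {x \<in> pts X. q x \<in> W}"
proof -
  have "istopology (\<lambda>W. W \<subseteq> q ` pts X \<and> opn X {x \<in> pts X. q x \<in> W})" unfolding istopology_def
  proof (intro conjI allI impI)
    fix S T assume a: "S \<subseteq> q ` pts X \<and> opn X {x \<in> pts X. q x \<in> S}"
      "T \<subseteq> q ` pts X \<and> opn X {x \<in> pts X. q x \<in> T}"
    show "S \<inter> T \<subseteq> q ` pts X" using a by blast
    have "{x \<in> pts X. q x \<in> S \<inter> T} = {x \<in> pts X. q x \<in> S} \<inter> {x \<in> pts X. q x \<in> T}" by blast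
    then show "opn X {x \<in> pts X. q x \<in> S \<inter> T}" using a by (simp add: openin_Int)
  next
    fix \<K> assume a: "\<forall>K\<in>\<K>. K \<subseteq> q ` pts X \<and> opn X {x \<in> pts X. q x \<in> K}"
    show "\<Union>\<K> \<subseteq> q ` pts X" using a by blast
    have "{x \<in> pts X. q x \<in> \<Union>\<K>} = (\<Union>K\<in>\<K>. {x \<in> pts X. q x \<in> K})" by blast
    then show "opn X {x \<in> pts X. q x \<in> \<Union>\<K>}" using a by auto
  qed
  then show ?thesis unfolding quot_mfd_def by (simp add: topology_inverse')
qed

section \<open>The group of lifts and its orbits\<close>

context elliptic_blowups
begin

context
  fixes i :: nat and N :: "'a set"
  assumes N: "N \<in> pieces i"
begin

lemma GE_open: "E \<in> sheets i N \<Longrightarrow> opn (GE i N E) W \<longleftrightarrow> opn (Y i N E) W \<and> W \<subseteq> GE_arrows i N E"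
  unfolding GE_def by (rule openin_open_sub[OF GE_arrows_open[OF N]])

lemma GE_topspace: "E \<in> sheets i N \<Longrightarrow> pts (GE i N E) = GE_arrows i N E"
  unfolding GE_def by (rule topspace_open_sub[OF GE_arrows_open[OF N]])

lemma GE_smooth: "E \<in> sheets i N \<Longrightarrow> smooth_mfd (GE i N E)"
  unfolding GE_def by (rule smooth_mfd_open_sub[OF Y_smooth(1)[OF N] GE_arrows_open[OF N]])

lemma Gsum_smooth: "smooth_mfd (Gsum i N)" unfolding Gsum_def by (rule smooth_mfd_sum[OF GE_smooth])

lemma Gsum_point: "(E, y) \<in> pts (Gsum i N) \<longleftrightarrow> E \<in> sheets i N \<and> y \<in> GE_arrows i N E"
  unfolding Gsum_def topspace_sum_mfd using GE_topspace by auto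

lemma Gsum_slice: "E \<in> sheets i N \<Longrightarrow> opn (Gsum i N) ({E} \<times> W) \<longleftrightarrow>
    opn (Y i N E) W \<and> W \<subseteq> GE_arrows i N E" unfolding Gsum_def by (simp add: openin_sum_slice GE_open)

lemma Gsum_ends:
  assumes "x \<in> pts (Gsum i N)"
  shows "length (snd (case_prod (GE_tgt i N) x)) = i" "length (snd (case_prod (GE_src i N) x)) = i"
proof -
  obtain E y where x: "x = (E, y)" by (cases x)
  have E: "E \<in> sheets i N" "y \<in> GE_arrows i N E" using assms unfolding x Gsum_point by auto
  have "y \<in> pts (Y i N E)" using E(2) unfolding GE_arrows_def by blast
  from square_point_fst[OF N E(1) this] E_sub[OF N E(1)]
  show "length (snd (case_prod (GE_tgt i N) x)) = i" "length (snd (case_prod (GE_src i N) x)) = i"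
    unfolding x by (auto intro!: length_snd_PN)
qed

lemma act_id: "length (snd c) = i \<Longrightarrow> act i (\<lambda>_. False, id) c = c"
  unfolding act_def by (cases c) (simp add: Gam_act_id)

lemma Gam_liftsE:
  assumes "F \<in> Gam_lifts i N"
  obtains H \<delta> where "smooth_map (Gsum i N) (Gsum i N) F" "smooth_map (Gsum i N) (Gsum i N) H" "\<delta> \<in> Gam i"
    "\<And>x. x \<in> pts (Gsum i N) \<Longrightarrow> H (F x) = x" "\<And>x. x \<in> pts (Gsum i N) \<Longrightarrow> F (H x) = x"
    "\<And>x. x \<in> pts (Gsum i N) \<Longrightarrow> case_prod (GE_tgt i N) (F x) = act i \<delta> (case_prod (GE_tgt i N) x)"
    "\<And>x. x \<in> pts (Gsum i N) \<Longrightarrow> case_prod (GE_src i N) (F x) = act i \<delta> (case_prod (GE_src i N) x)"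
proof -
  obtain H \<delta> where f: "smooth_map (Gsum i N) (Gsum i N) F" "smooth_map (Gsum i N) (Gsum i N) H"
    "\<forall>x\<in>pts (Gsum i N). H (F x) = x" "\<forall>x\<in>pts (Gsum i N). F (H x) = x" "\<delta> \<in> Gam i"
    "\<forall>x\<in>pts (Gsum i N). case_prod (GE_tgt i N) (F x) = act i \<delta> (case_prod (GE_tgt i N) x) \<and>
       case_prod (GE_src i N) (F x) = act i \<delta> (case_prod (GE_src i N) x)"
    using assms unfolding Gam_lifts_def diffeo_def by (elim CollectE conjE exE bexE) (rule that)
  show thesis
    by (rule that[OF f(1,2,5)]) (erule f(3)[THEN bspec] f(4)[THEN bspec] f(6)[THEN bspec, THEN conjunct1] f(6)[THEN bspec, THEN conjunct2])+
qed

lemma Gam_liftsI: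
  assumes "smooth_map (Gsum i N) (Gsum i N) F" "smooth_map (Gsum i N) (Gsum i N) H" "\<delta> \<in> Gam i"
    "\<And>x. x \<in> pts (Gsum i N) \<Longrightarrow> H (F x) = x" "\<And>x. x \<in> pts (Gsum i N) \<Longrightarrow> F (H x) = x"
    "\<And>x. x \<in> pts (Gsum i N) \<Longrightarrow> case_prod (GE_tgt i N) (F x) = act i \<delta> (case_prod (GE_tgt i N) x)"
    "\<And>x. x \<in> pts (Gsum i N) \<Longrightarrow> case_prod (GE_src i N) (F x) = act i \<delta> (case_prod (GE_src i N) x)"
  shows "F \<in> Gam_lifts i N" unfolding Gam_lifts_def diffeo_def by (intro CollectI conjI exI[of _ H] ballI bexI[OF _ assms(3)] assms)

lemma Gam_lifts_id: "(\<lambda>x. x) \<in> Gam_lifts i N"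
  by (rule Gam_liftsI[OF smooth_map_id[OF Gsum_smooth] smooth_map_id[OF Gsum_smooth] Gam_id refl refl])
    (erule act_id[OF Gsum_ends(1), symmetric] act_id[OF Gsum_ends(2), symmetric])+

lemma Gam_lifts_compose:
  assumes F: "F \<in> Gam_lifts i N" and F': "F' \<in> Gam_lifts i N"
  shows "(\<lambda>x. F' (F x)) \<in> Gam_lifts i N"
proof -
  note S = Gsum_smooth
  obtain H \<delta> where f: "smooth_map (Gsum i N) (Gsum i N) F" "smooth_map (Gsum i N) (Gsum i N) H" "\<delta> \<in> Gam i"
    "\<And>x. x \<in> pts (Gsum i N) \<Longrightarrow> H (F x) = x" "\<And>x. x \<in> pts (Gsum i N) \<Longrightarrow> F (H x) = x"
    "\<And>x. x \<in> pts (Gsum i N) \<Longrightarrow> case_prod (GE_tgt i N) (F x) = act i \<delta> (case_prod (GE_tgt i N) x)"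
    "\<And>x. x \<in> pts (Gsum i N) \<Longrightarrow> case_prod (GE_src i N) (F x) = act i \<delta> (case_prod (GE_src i N) x)"
    by (rule Gam_liftsE[OF F]) (rule that)
  obtain H' \<delta>' where f': "smooth_map (Gsum i N) (Gsum i N) F'" "smooth_map (Gsum i N) (Gsum i N) H'" "\<delta>' \<in> Gam i"
    "\<And>x. x \<in> pts (Gsum i N) \<Longrightarrow> H' (F' x) = x" "\<And>x. x \<in> pts (Gsum i N) \<Longrightarrow> F' (H' x) = x"
    "\<And>x. x \<in> pts (Gsum i N) \<Longrightarrow> case_prod (GE_tgt i N) (F' x) = act i \<delta>' (case_prod (GE_tgt i N) x)"
    "\<And>x. x \<in> pts (Gsum i N) \<Longrightarrow> case_prod (GE_src i N) (F' x) = act i \<delta>' (case_prod (GE_src i N) x)"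
    by (rule Gam_liftsE[OF F']) (rule that)
  note tF = smooth_map_in_topspace[OF f(1)] and tH' = smooth_map_in_topspace[OF f'(2)]
  have act: "act i \<delta>' (act i \<delta> c) = act i (\<lambda>j. fst \<delta>' j \<noteq> fst \<delta> (snd \<delta>' j), snd \<delta> \<circ> snd \<delta>') c" for c
    unfolding act_def by (cases c) (simp add: Gam_act_compose[OF f(3) f'(3)])
  show ?thesis
    by (rule Gam_liftsI[OF smooth_map_compose[OF S S S f(1) f'(1)] smooth_map_compose[OF S S S f'(2) f(2)] Gam_compose[OF f(3) f'(3)]])
      (simp_all only: f f' tF tH' act)
qed

lemma Gam_lifts_inverse:
  assumes F: "F \<in> Gam_lifts i N"
  obtains H where "H \<in> Gam_lifts i N" "\<And>x. x \<in> pts (Gsum i N) \<Longrightarrow> H (F x) = x"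
proof -
  obtain H \<delta> where f: "smooth_map (Gsum i N) (Gsum i N) F" "smooth_map (Gsum i N) (Gsum i N) H" "\<delta> \<in> Gam i"
    "\<And>x. x \<in> pts (Gsum i N) \<Longrightarrow> H (F x) = x" "\<And>x. x \<in> pts (Gsum i N) \<Longrightarrow> F (H x) = x"
    "\<And>x. x \<in> pts (Gsum i N) \<Longrightarrow> case_prod (GE_tgt i N) (F x) = act i \<delta> (case_prod (GE_tgt i N) x)"
    "\<And>x. x \<in> pts (Gsum i N) \<Longrightarrow> case_prod (GE_src i N) (F x) = act i \<delta> (case_prod (GE_src i N) x)"
    by (rule Gam_liftsE[OF F]) (rule that)
  obtain \<delta>' where d: "\<delta>' \<in> Gam i" "\<And>c :: ('a \<Rightarrow> complex) set list. length c = i \<Longrightarrow> Gam_act i \<delta>' (Gam_act i \<delta> c) = c"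
    by (rule Gam_inverse[OF f(3)]) (rule that)
  have act: "act i \<delta>' (act i \<delta> c) = c" if "length (snd c) = i" for c
    using that unfolding act_def by (cases c) (simp add: d(2))
  have "H \<in> Gam_lifts i N"
  proof (rule Gam_liftsI[OF f(2,1) d(1) f(5,4)])
    fix x assume x: "x \<in> pts (Gsum i N)"
    note tH = smooth_map_in_topspace[OF f(2) x]
    show "case_prod (GE_tgt i N) (H x) = act i \<delta>' (case_prod (GE_tgt i N) x)"
      using f(6)[OF tH] act[OF Gsum_ends(1)[OF tH]] unfolding f(5)[OF x] by simp
    show "case_prod (GE_src i N) (H x) = act i \<delta>' (case_prod (GE_src i N) x)"
      using f(7)[OF tH] act[OF Gsum_ends(2)[OF tH]] unfolding f(5)[OF x] by simp
  qed
  then show thesis by (rule that[OF _ f(4)])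
qed

lemma orbit_iff: "z \<in> orbit i N x \<longleftrightarrow> (\<exists>F\<in>Gam_lifts i N. z = F x)"
proof
  assume "z \<in> orbit i N x"
  then show "\<exists>F\<in>Gam_lifts i N. z = F x" unfolding orbit_def by (elim CollectE exE conjE) (rule bexI)
next
  assume "\<exists>F\<in>Gam_lifts i N. z = F x"
  then show "z \<in> orbit i N x" unfolding orbit_def by (elim bexE) (intro CollectI exI conjI)
qed

lemma orbit_self: "x \<in> orbit i N x" unfolding orbit_iff by (intro bexI[OF _ Gam_lifts_id] refl)

text \<open>An orbit is defined as a set of images under all lifts. That it does not change when the
  point is moved by a lift uses that lifts are closed under composition and inverses.\<close>

lemma orbit_lift:
  assumes F: "F \<in> Gam_lifts i N" and x: "x \<in> pts (Gsum i N)"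
  shows "orbit i N (F x) = orbit i N x"
proof (intro equalityI subsetI)
  fix z assume "z \<in> orbit i N (F x)"
  then obtain F' where F': "F' \<in> Gam_lifts i N" "z = F' (F x)" unfolding orbit_iff by (elim bexE)
  show "z \<in> orbit i N x" unfolding orbit_iff F'(2) by (rule bexI[OF refl Gam_lifts_compose[OF F F'(1)]])
next
  fix z assume "z \<in> orbit i N x"
  then obtain F' where F': "F' \<in> Gam_lifts i N" "z = F' x" unfolding orbit_iff by (elim bexE)
  obtain H where H: "H \<in> Gam_lifts i N" "\<And>x. x \<in> pts (Gsum i N) \<Longrightarrow> H (F x) = x"
    by (rule Gam_lifts_inverse[OF F]) (rule that)
  have "z = F' (H (F x))" unfolding F'(2) H(2)[OF x] ..
  then show "z \<in> orbit i N (F x)" unfolding orbit_iff by (rule bexI[OF _ Gam_lifts_compose[OF H(1) F'(1)]])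
qed

lemma openin_GN: "opn (GN i N) W \<longleftrightarrow> W \<subseteq> orbit i N ` pts (Gsum i N) \<and>
    opn (Gsum i N) {x \<in> pts (Gsum i N). orbit i N x \<in> W}" unfolding GN_def by (rule openin_quot)

text \<open>The saturation of \<open>B\<close> is the union of its preimages under all lifts, and
  lifts are continuous.\<close>

lemma orbit_image_open:
  assumes B: "opn (Gsum i N) B"
  shows "opn (GN i N) (orbit i N ` B)"
proof -
  have Bt: "B \<subseteq> pts (Gsum i N)" by (rule openin_subset[OF B])
  have "{x \<in> pts (Gsum i N). orbit i N x \<in> orbit i N ` B} =
    (\<Union>F\<in>Gam_lifts i N. {x \<in> pts (Gsum i N). F x \<in> B})" (is "?L = ?R")
  proof (intro equalityI subsetI)
    fix x assume "x \<in> ?L"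
    then obtain b where b: "x \<in> pts (Gsum i N)" "b \<in> B" "orbit i N x = orbit i N b" by blast
    have "b \<in> orbit i N x" unfolding b(3) by (rule orbit_self)
    then obtain F where "F \<in> Gam_lifts i N" "b = F x" unfolding orbit_iff by (elim bexE)
    then show "x \<in> ?R" using b by blast
  next
    fix x assume "x \<in> ?R"
    then obtain F where F: "F \<in> Gam_lifts i N" "x \<in> pts (Gsum i N)" "F x \<in> B" by blast
    show "x \<in> ?L" using F(2) imageI[OF F(3), of "orbit i N"] unfolding orbit_lift[OF F(1,2)] by simp
  qed
  moreover have "opn (Gsum i N) ?R"
  proof (rule openin_Union, clarify)
    fix F assume "F \<in> Gam_lifts i N"
    then have "smooth_map (Gsum i N) (Gsum i N) F" unfolding Gam_lifts_def diffeo_def by blast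
    then show "opn (Gsum i N) {x \<in> pts (Gsum i N). F x \<in> B}" by (rule smooth_map_preimage_open[OF _ B])
  qed
  ultimately show ?thesis unfolding openin_GN using Bt by auto
qed

lemma topspace_GN: "pts (GN i N) = orbit i N ` pts (Gsum i N)"
proof
  show "pts (GN i N) \<subseteq> orbit i N ` pts (Gsum i N)" by (rule openin_GN[THEN iffD1, OF openin_topspace, THEN conjunct1])
  show "orbit i N ` pts (Gsum i N) \<subseteq> pts (GN i N)" by (rule openin_subset[OF orbit_image_open[OF openin_topspace]])
qed

text \<open>Lifts act on the ends by changing the framing and leave the point of \<open>M\<close>
  below untouched. So the images defining \<open>GN_tgt\<close> and \<open>GN_src\<close> are
  singletons, as \<open>the_elem\<close> requires.\<close>

lemma GN_ends:
  assumes "E \<in> sheets i N" "y \<in> GE_arrows i N E"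
  shows "GN_tgt i N (orbit i N (E, y)) = fst (GE_tgt i N E y)" "GN_src i N (orbit i N (E, y)) = fst (GE_src i N E y)"
proof -
  have x: "(E, y) \<in> pts (Gsum i N)" using assms unfolding Gsum_point by blast
  have l: "fst (case_prod (GE_tgt i N) z) = fst (GE_tgt i N E y) \<and> fst (case_prod (GE_src i N) z) = fst (GE_src i N E y)"
    if z: "z \<in> orbit i N (E, y)" for z
  proof -
    obtain F where F: "F \<in> Gam_lifts i N" "z = F (E, y)" using z unfolding orbit_iff by (elim bexE)
    obtain \<delta> where "\<And>x. x \<in> pts (Gsum i N) \<Longrightarrow> case_prod (GE_tgt i N) (F x) = act i \<delta> (case_prod (GE_tgt i N) x)"
      "\<And>x. x \<in> pts (Gsum i N) \<Longrightarrow> case_prod (GE_src i N) (F x) = act i \<delta> (case_prod (GE_src i N) x)"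
      by (rule Gam_liftsE[OF F(1)]) (rule that)
    from this[OF x] show ?thesis unfolding F(2) act_def by (simp add: case_prod_beta)
  qed
  have "(\<lambda>(E, g). fst (GE_tgt i N E g)) ` orbit i N (E, y) = {fst (GE_tgt i N E y)}"
    using l orbit_self[of "(E, y)"] by (auto simp: case_prod_beta image_iff intro!: bexI[of _ "(E, y)"])
  then show "GN_tgt i N (orbit i N (E, y)) = fst (GE_tgt i N E y)" unfolding GN_tgt_def by simp
  have "(\<lambda>(E, g). fst (GE_src i N E g)) ` orbit i N (E, y) = {fst (GE_src i N E y)}"
    using l orbit_self[of "(E, y)"] by (auto simp: case_prod_beta image_iff intro!: bexI[of _ "(E, y)"])
  then show "GN_src i N (orbit i N (E, y)) = fst (GE_src i N E y)" unfolding GN_src_def by simp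
qed

text \<open>A lift that fixes an end of an arrow fixes the nearby arrows outside the divisor, because there
  an arrow is determined by its ends; these arrows are dense.\<close>

lemma orbit_locally_injective:
  assumes E: "E \<in> sheets i N" and y: "y \<in> GE_arrows i N E"
    and yN: "fst (GE_tgt i N E y) \<in> N" "fst (GE_src i N E y) \<in> N"
  obtains O1 where "opn (Y i N E) O1" "y \<in> O1" "O1 \<subseteq> GE_arrows i N E" "inj_on (orbit i N) ({E} \<times> O1)"
proof -
  let ?Y = "Y i N E"
  obtain W \<phi> e where W: "chart ?Y W \<phi>" "y \<in> W" "W \<subseteq> GE_arrows i N E" "frame_enum e" "2 * i \<le> DIM('e \<times> 'e)"
    "\<And>q q'. q \<in> W \<Longrightarrow> q' \<in> pts ?Y \<Longrightarrow> \<beta> i N E q' = \<beta> i N E q \<Longrightarrow>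
      \<forall>j<i. zc e j (\<phi> q) \<noteq> 0 \<Longrightarrow> q' = q" by (rule local_model[OF N E y yN]) (rule that)
  have top: "GE_arrows i N E \<subseteq> pts ?Y" unfolding GE_arrows_def by blast
  have ends: "GE_tgt i N E q \<in> E" "GE_src i N E q \<in> E" if "q \<in> GE_arrows i N E" for q
    using square_point_fst[OF N E] top that by auto
  have endsP: "GE_tgt i N E y \<in> topspace (PN_top i N)" "GE_src i N E y \<in> topspace (PN_top i N)"
    using ends[OF y] E_sub[OF N E] by auto
  obtain B1 where B1: "openin (PN_top i N) B1" "GE_tgt i N E y \<in> B1" "inj_on fst B1"
    by (rule PN_local[OF endsP(1) openin_topspace PN_fst[OF endsP(1), THEN conjunct2]]) (rule that)
  obtain B2 where B2: "openin (PN_top i N) B2" "GE_src i N E y \<in> B2" "inj_on fst B2"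
    by (rule PN_local[OF endsP(2) openin_topspace PN_fst[OF endsP(2), THEN conjunct2]]) (rule that)
  \<comment> \<open>Small enough that \<open>fst\<close> is injective near both ends: inside
    \<open>O1\<close> an end is determined by its point in \<open>M\<close>, although lifts change
    framings.\<close>
  define O1 where "O1 = {q \<in> W. \<beta> i N E q \<in> (B1 \<inter> E) \<times> (B2 \<inter> E)}"
  have O1e: "O1 = W \<inter> {q \<in> pts ?Y. \<beta> i N E q \<in> (B1 \<inter> E) \<times> (B2 \<inter> E)}" unfolding O1_def using W(3) top by blast
  have O1: "opn ?Y O1" unfolding O1e
    by (rule openin_Int[OF chartD(1)[OF W(1)] smooth_map_preimage_open[OF Y_smooth(2)[OF N E] openin_square[OF B1(1) B2(1), of E]]])
  have yO: "y \<in> O1" unfolding O1_def using W(2) B1(2) B2(2) ends[OF y] unfolding GE_tgt_def GE_src_def by (simp add: mem_Times_iff)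
  have OG: "O1 \<subseteq> GE_arrows i N E" unfolding O1_def using W(3) by blast
  have OB: "GE_tgt i N E q \<in> B1" "GE_src i N E q \<in> B2" if "q \<in> O1" for q
    using that unfolding O1_def GE_tgt_def GE_src_def by auto
  have inj: "u = v" if uv': "u \<in> O1" "v \<in> O1" "orbit i N (E, u) = orbit i N (E, v)" for u v
  proof (rule ccontr)
    assume uv'': "u \<noteq> v"
    note uv = uv' uv''
    have uW: "u \<in> W" "v \<in> W" using uv(1,2) unfolding O1_def by auto
    have "(E, v) \<in> orbit i N (E, u)" unfolding uv(3) by (rule orbit_self)
    then obtain F where F: "F \<in> Gam_lifts i N" "(E, v) = F (E, u)" unfolding orbit_iff by (elim bexE)
    obtain \<delta> where f: "smooth_map (Gsum i N) (Gsum i N) F"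
      "\<And>x. x \<in> pts (Gsum i N) \<Longrightarrow> case_prod (GE_tgt i N) (F x) = act i \<delta> (case_prod (GE_tgt i N) x)"
      "\<And>x. x \<in> pts (Gsum i N) \<Longrightarrow> case_prod (GE_src i N) (F x) = act i \<delta> (case_prod (GE_src i N) x)"
      by (rule Gam_liftsE[OF F(1)]) (rule that)
    have "\<phi> u \<noteq> \<phi> v" using inj_onD[OF chartD(3)[OF W(1)]] uW uv(4) by blast
    \<comment> \<open>Separation is carried out in the Euclidean image of the chart that contains
      both points.\<close>
    then obtain P1 P2 where P: "open P1" "open P2" "\<phi> u \<in> P1" "\<phi> v \<in> P2" "P1 \<inter> P2 = {}" unfolding separation_t2 by (elim exE conjE)
    define Q1 where "Q1 = O1 \<inter> {q \<in> W. \<phi> q \<in> P1}"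
    define Q2 where "Q2 = O1 \<inter> {q \<in> W. \<phi> q \<in> P2}"
    have Q: "opn ?Y Q1" "opn ?Y Q2" unfolding Q1_def Q2_def using O1 chartD(8)[OF W(1)] P by auto
    have Qs: "Q1 \<subseteq> GE_arrows i N E" "Q2 \<subseteq> GE_arrows i N E" unfolding Q1_def Q2_def using OG by auto
    have oF: "opn (Gsum i N) {x \<in> pts (Gsum i N). F x \<in> {E} \<times> Q2}"
      by (rule smooth_map_preimage_open[OF f(1)]) (simp add: Gsum_slice[OF E] Q Qs)
    define A where "A = Q1 \<inter> {q. (E, q) \<in> {x \<in> pts (Gsum i N). F x \<in> {E} \<times> Q2}}"
    have "opn (GE i N E) {q. (E, q) \<in> {x \<in> pts (Gsum i N). F x \<in> {E} \<times> Q2}}"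
      using openin_sum_section[OF E, of "GE i N"] oF unfolding Gsum_def by blast
    then have oA: "opn ?Y A" unfolding A_def GE_open[OF E] using Q(1) by blast
    have uG: "(E, u) \<in> pts (Gsum i N)" unfolding Gsum_point using E OG uv(1) by blast
    have uA: "u \<in> A" unfolding A_def Q1_def Q2_def using uv(1,2) uW P(3,4) uG F(2)[symmetric] by simp
    \<comment> \<open>An arrow near \<open>u\<close> off the hyperplanes. Its image under the lift
      lies near \<open>v\<close> and has the same ends, hence is the same arrow; but the two
      neighbourhoods are disjoint.\<close>
    obtain q where q: "q \<in> A" "q \<in> W" "\<And>j. j < i \<Longrightarrow> zc e j (\<phi> q) \<noteq> 0"
      by (rule dense_complement[OF W(1) uW(1) W(4,5) oA uA]) (rule that)
    obtain q' where q': "F (E, q) = (E, q')" "q' \<in> Q2" using q(1) unfolding A_def by blast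
    have qG: "(E, q) \<in> pts (Gsum i N)" "q \<in> O1" "q' \<in> O1" using q(1) q'(2) unfolding A_def Q1_def Q2_def by auto
    have "fst (GE_tgt i N E q') = fst (GE_tgt i N E q)" "fst (GE_src i N E q') = fst (GE_src i N E q)"
      using f(2,3)[OF qG(1)] unfolding q'(1) by (simp_all add: act_def case_prod_beta)
    then have "GE_tgt i N E q' = GE_tgt i N E q" "GE_src i N E q' = GE_src i N E q"
      using inj_onD[OF B1(3)] inj_onD[OF B2(3)] OB[OF qG(2)] OB[OF qG(3)] by blast+
    then have "\<beta> i N E q' = \<beta> i N E q" unfolding GE_tgt_def GE_src_def by (simp add: prod_eq_iff)
    moreover have "q' \<in> pts ?Y" using qG(3) OG top by blast
    ultimately have "q' = q" using W(6)[OF q(2)] q(3) by blast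
    moreover have "\<phi> q \<in> P1" "\<phi> q' \<in> P2" using q(1) q'(2) unfolding A_def Q1_def Q2_def by auto
    ultimately show False using P(5) by blast
  qed
  have "inj_on (orbit i N) ({E} \<times> O1)"
  proof (rule inj_onI)
    fix p q assume a: "p \<in> {E} \<times> O1" "q \<in> {E} \<times> O1" "orbit i N p = orbit i N q"
    then have "p = (E, snd p)" "q = (E, snd q)" "snd p \<in> O1" "snd q \<in> O1" by auto
    then show "p = q" using inj[of "snd p" "snd q"] a(3) by simp
  qed
  then show thesis by (rule that[OF O1 yO OG])
qed

end

end

text \<open>The quotient itself is not known to be a smooth manifold. The composite of \<iota> with
  the quotient map is open, continuous and injective on a small \<open>B\<close>, and charts of
  \<open>X\<close> are carried along it; its compatibility with the atlas of \<open>G\<close> is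
  extracted from the smoothness of \<iota> and of its local inverse.\<close>

lemma chart_via_quotient:
  fixes X :: "('p, 'f::euclidean_space) mfd" and q :: "'p \<Rightarrow> 'q" and G :: "('g, 'f) mfd"
  assumes X: "smooth_mfd X" and G: "smooth_mfd G"
    and op: "\<And>B. opn X B \<Longrightarrow> opn (quot_mfd X q) (q ` B)"
    and ld: "local_diffeo (quot_mfd X q) G \<iota>"
    and B0: "opn X B0" "x \<in> B0" "inj_on q B0"
  obtains B V \<phi> where "opn X B" "x \<in> B" "B \<subseteq> B0" "(V, \<phi>) \<in> atlas X" "B \<subseteq> V"
    "inj_on (\<lambda>y. \<iota> (q y)) B" "chart G ((\<lambda>y. \<iota> (q y)) ` B) (\<phi> \<circ> inv_into B (\<lambda>y. \<iota> (q y)))"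
proof -
  let ?Q = "quot_mfd X q"
  have xt: "x \<in> pts X" using B0(2) openin_subset[OF B0(1)] by blast
  have "q x \<in> pts ?Q" using openin_subset[OF op[OF openin_topspace]] xt by blast
  then obtain W where W: "opn ?Q W" "q x \<in> W" "opn G (\<iota> ` W)"
    "diffeo (open_sub ?Q W) (open_sub G (\<iota> ` W)) \<iota>" using ld unfolding local_diffeo_def by blast
  note tW = topspace_open_sub[OF W(1)] and tG = topspace_open_sub[OF W(3)]
  obtain H where H: "smooth_map (open_sub ?Q W) (open_sub G (\<iota> ` W)) \<iota>"
    "smooth_map (open_sub G (\<iota> ` W)) (open_sub ?Q W) H" "\<And>w. w \<in> W \<Longrightarrow> H (\<iota> w) = w"
    using W(4) unfolding diffeo_def tW by (elim exE conjE) (erule (1) that, erule (1) bspec)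
  obtain V \<phi> where V: "(V, \<phi>) \<in> atlas X" "x \<in> V" by (rule ex_atlas_chart[OF X xt])
  note cV = chartD[OF chart_atlas[OF X V(1)]]
  define B where "B = B0 \<inter> V \<inter> {y \<in> pts X. q y \<in> W}"
  define \<kappa> where "\<kappa> = (\<lambda>y. \<iota> (q y))"
  have oq: "opn X {y \<in> pts X. q y \<in> P}" if "opn ?Q P" for P using that unfolding openin_quot by blast
  have oB: "opn X B" unfolding B_def using B0(1) cV(1) oq[OF W(1)] by blast
  have xB: "x \<in> B" "B \<subseteq> B0" "B \<subseteq> V" "\<And>y. y \<in> B \<Longrightarrow> q y \<in> W" "B \<subseteq> pts X"
    unfolding B_def using B0(2) V(2) W(2) xt by auto
  have qinj: "inj_on q B" by (rule inj_on_subset[OF B0(3) xB(2)])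
  have \<kappa>inj: "inj_on \<kappa> B"
  proof (rule inj_onI)
    fix u v assume uv: "u \<in> B" "v \<in> B" "\<kappa> u = \<kappa> v"
    have "q u = H (\<kappa> u)" unfolding \<kappa>_def by (rule H(3)[OF xB(4)[OF uv(1)], symmetric])
    also have "\<dots> = H (\<kappa> v)" by (simp only: uv(3))
    also have "\<dots> = q v" unfolding \<kappa>_def by (rule H(3)[OF xB(4)[OF uv(2)]])
    finally have "q u = q v" .
    then show "u = v" by (rule inj_onD[OF qinj _ uv(1,2)])
  qed
  have qB: "q ` B \<subseteq> W" using xB(4) by blast
  define \<theta> where "\<theta> = \<phi> \<circ> inv_into B q"
  define \<psi> where "\<psi> = \<phi> \<circ> inv_into B \<kappa>"
  have \<theta>: "\<theta> (q y) = \<phi> y" and \<psi>: "\<psi> (\<kappa> y) = \<phi> y" if "y \<in> B" for y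
    unfolding \<theta>_def \<psi>_def using inv_into_f_f[OF qinj that] inv_into_f_f[OF \<kappa>inj that] by simp_all
  have \<phi>inj: "inj_on \<phi> B" by (rule inj_on_subset[OF cV(3) xB(3)])
  have i1: "inv_into (q ` B) \<theta> (\<phi> y) = q y" if y: "y \<in> B" for y
  proof -
    have "inj_on \<theta> (q ` B)" using \<phi>inj by (auto simp: inj_on_def \<theta>)
    from inv_into_f_f[OF this, of "q y"] y \<theta>[OF y] show ?thesis by simp
  qed
  have \<psi>inj: "inj_on \<psi> (\<kappa> ` B)" using \<phi>inj by (auto simp: inj_on_def \<psi>)
  have i2: "inv_into (\<kappa> ` B) \<psi> (\<phi> y) = \<kappa> y" if y: "y \<in> B" for y
    using inv_into_f_f[OF \<psi>inj, of "\<kappa> y"] y \<psi>[OF y] by simp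
  \<comment> \<open>By construction of \<open>quot_mfd\<close> the chart of \<open>X\<close>
    transported along an injective piece of the quotient map belongs to its atlas; this is where
    smoothness of maps to and from the quotient can be tested.\<close>
  have at: "(q ` B, \<theta>) \<in> atlas (open_sub ?Q W)"
  proof -
    have "(q ` B, \<theta>) \<in> atlas ?Q" unfolding quot_mfd_def \<theta>_def using oB qinj V(1) xB(3) by auto
    moreover have "q ` B = q ` B \<inter> W" using qB by blast
    ultimately show ?thesis unfolding atlas_open_sub by (intro exI[of _ "q ` B"] conjI)
  qed
  have Hset: "{p \<in> \<iota> ` W. H p \<in> q ` B'} = \<kappa> ` B'" if "B' \<subseteq> B" for B'
  proof (intro equalityI subsetI)
    fix p assume "p \<in> {p \<in> \<iota> ` W. H p \<in> q ` B'}"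
    then obtain w y where "w \<in> W" "p = \<iota> w" "y \<in> B'" "H p = q y" by blast
    then show "p \<in> \<kappa> ` B'" using H(3)[of w] unfolding \<kappa>_def by auto
  next
    fix p assume "p \<in> \<kappa> ` B'"
    then obtain y where "y \<in> B'" "p = \<iota> (q y)" unfolding \<kappa>_def by blast
    then show "p \<in> {p \<in> \<iota> ` W. H p \<in> q ` B'}" using H(3)[of "q y"] xB(4) that by auto
  qed
  have \<kappa>open: "opn G (\<kappa> ` B')" if B': "opn X B'" "B' \<subseteq> B" for B'
  proof -
    have "opn (open_sub ?Q W) (q ` B')" unfolding openin_open_sub[OF W(1)] using op[OF B'(1)] qB B'(2) by blast
    from smooth_map_preimage_open[OF H(2) this]
    show ?thesis unfolding tG Hset[OF B'(2)] openin_open_sub[OF W(3)] by blast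
  qed
  have \<kappa>cont: "opn X {y \<in> B. \<kappa> y \<in> P}" if P: "opn G P" for P
  proof -
    have "opn (open_sub G (\<iota> ` W)) (P \<inter> \<iota> ` W)" unfolding openin_open_sub[OF W(3)] using P W(3) by blast
    from smooth_map_preimage_open[OF H(1) this]
    have "opn ?Q {w \<in> W. \<iota> w \<in> P \<inter> \<iota> ` W}" unfolding tW openin_open_sub[OF W(1)] by blast
    from openin_Int[OF oB oq[OF this]] show ?thesis
      by (rule back_subst[where P = "opn X"]) (use xB(4,5) in \<open>auto simp: \<kappa>_def\<close>)
  qed
  have c: "chart G (\<kappa> ` B) \<psi>" unfolding chart_def
  proof (intro conjI ballI, unfold top_chart_iff, intro conjI allI impI)
    show "opn G (\<kappa> ` B)" by (rule \<kappa>open[OF oB order_refl])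
    show "inj_on \<psi> (\<kappa> ` B)" by (rule \<psi>inj)
  next
    fix P assume P: "opn G P \<and> P \<subseteq> \<kappa> ` B"
    have "\<psi> ` P = \<phi> ` {y \<in> B. \<kappa> y \<in> P}"
    proof (intro equalityI subsetI)
      fix v assume "v \<in> \<psi> ` P"
      then obtain y where "y \<in> B" "\<kappa> y \<in> P" "v = \<psi> (\<kappa> y)" using P by blast
      then show "v \<in> \<phi> ` {y \<in> B. \<kappa> y \<in> P}" using \<psi> by auto
    next
      fix v assume "v \<in> \<phi> ` {y \<in> B. \<kappa> y \<in> P}"
      then obtain y where "y \<in> B" "\<kappa> y \<in> P" "v = \<phi> y" by blast
      then show "v \<in> \<psi> ` P" using \<psi>[of y] by force
    qed
    moreover have "{y \<in> B. \<kappa> y \<in> P} \<subseteq> V" using xB(3) by blast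
    ultimately show "open (\<psi> ` P)" using cV(6)[OF \<kappa>cont] P by simp
  next
    fix A :: "'f set" assume A: "open A"
    have "{p \<in> \<kappa> ` B. \<psi> p \<in> A} = \<kappa> ` (B \<inter> {y \<in> V. \<phi> y \<in> A})" using xB(3) by (auto simp: \<psi>)
    then show "opn G {p \<in> \<kappa> ` B. \<psi> p \<in> A}" using \<kappa>open[OF openin_Int[OF oB cV(8)[OF A]]] by simp
  next
    fix z assume z: "z \<in> atlas G"
    obtain P \<omega> where zP: "z = (P, \<omega>)" by (cases z)
    have P: "(P, \<omega>) \<in> atlas G" using z unfolding zP .
    note cP = chartD[OF chart_atlas[OF G P]]
    have PW: "(P \<inter> \<iota> ` W, \<omega>) \<in> atlas (open_sub G (\<iota> ` W))" unfolding atlas_open_sub using P by blast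
    have s1: "\<omega> \<circ> \<iota> \<in> smooth_funs (open_sub ?Q W) {w \<in> W. \<iota> w \<in> P \<inter> \<iota> ` W}"
      using H(1) PW unfolding smooth_map_def tW by blast
    have s2: "\<theta> \<circ> H \<in> smooth_funs (open_sub G (\<iota> ` W)) (\<kappa> ` B)"
      using H(2) at unfolding smooth_map_def tG Hset[OF order_refl, symmetric] by blast
    have im: "\<psi> ` (\<kappa> ` B \<inter> P) = \<phi> ` {y \<in> B. \<kappa> y \<in> P}"
    proof (intro equalityI subsetI)
      fix v assume "v \<in> \<psi> ` (\<kappa> ` B \<inter> P)"
      then obtain y where "y \<in> B" "\<kappa> y \<in> P" "v = \<psi> (\<kappa> y)" by blast
      then show "v \<in> \<phi> ` {y \<in> B. \<kappa> y \<in> P}" using \<psi> by auto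
    next
      fix v assume "v \<in> \<phi> ` {y \<in> B. \<kappa> y \<in> P}"
      then obtain y where "y \<in> B" "\<kappa> y \<in> P" "v = \<phi> y" by blast
      then show "v \<in> \<psi> ` (\<kappa> ` B \<inter> P)" using \<psi>[of y] by force
    qed
    have o1: "open (\<phi> ` {y \<in> B. \<kappa> y \<in> P})" by (rule cV(6)[OF \<kappa>cont[OF cP(1)]]) (use xB(3) in blast)
    have im': "\<theta> ` ({w \<in> W. \<iota> w \<in> P \<inter> \<iota> ` W} \<inter> q ` B) = \<phi> ` {y \<in> B. \<kappa> y \<in> P}"
    proof (intro equalityI subsetI)
      fix v assume "v \<in> \<theta> ` ({w \<in> W. \<iota> w \<in> P \<inter> \<iota> ` W} \<inter> q ` B)"
      then obtain y where "y \<in> B" "\<kappa> y \<in> P" "v = \<theta> (q y)" unfolding \<kappa>_def by blast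
      then show "v \<in> \<phi> ` {y \<in> B. \<kappa> y \<in> P}" using \<theta> by auto
    next
      fix v assume "v \<in> \<phi> ` {y \<in> B. \<kappa> y \<in> P}"
      then obtain y where y: "y \<in> B" "\<kappa> y \<in> P" "v = \<phi> y" by blast
      then have "q y \<in> {w \<in> W. \<iota> w \<in> P \<inter> \<iota> ` W} \<inter> q ` B" using xB(4) unfolding \<kappa>_def by auto
      from imageI[OF this, of \<theta>] show "v \<in> \<theta> ` ({w \<in> W. \<iota> w \<in> P \<inter> \<iota> ` W} \<inter> q ` B)" unfolding y(3) \<theta>[OF y(1)] .
    qed
    have "compatible (\<kappa> ` B) \<psi> P \<omega>" unfolding compatible_def
    proof
      have "Cinf_on (\<phi> ` {y \<in> B. \<kappa> y \<in> P}) ((\<omega> \<circ> \<iota>) \<circ> inv_into (q ` B) \<theta>)"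
        using s1 at unfolding smooth_funs_def im'[symmetric] by blast
      then show "Cinf_on (\<psi> ` (\<kappa> ` B \<inter> P)) (\<omega> \<circ> inv_into (\<kappa> ` B) \<psi>)" unfolding im
      proof (rule Cinf_on_cong[OF o1, rotated])
        fix v assume "v \<in> \<phi> ` {y \<in> B. \<kappa> y \<in> P}"
        then obtain y where y: "y \<in> B" "v = \<phi> y" by blast
        have "\<iota> (q y) = \<kappa> y" unfolding \<kappa>_def ..
        then show "((\<omega> \<circ> \<iota>) \<circ> inv_into (q ` B) \<theta>) v = (\<omega> \<circ> inv_into (\<kappa> ` B) \<psi>) v"
          unfolding y(2) using i1[OF y(1)] i2[OF y(1)] by simp
      qed
      have set: "\<kappa> ` B \<inter> (P \<inter> \<iota> ` W) = \<kappa> ` B \<inter> P" using xB(4) unfolding \<kappa>_def by blast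
      have "Cinf_on (\<omega> ` (\<kappa> ` B \<inter> (P \<inter> \<iota> ` W))) ((\<theta> \<circ> H) \<circ> inv_into (P \<inter> \<iota> ` W) \<omega>)"
        using s2 PW unfolding smooth_funs_def by blast
      then have "Cinf_on (\<omega> ` (\<kappa> ` B \<inter> P)) ((\<theta> \<circ> H) \<circ> inv_into (P \<inter> \<iota> ` W) \<omega>)" unfolding set .
      then show "Cinf_on (\<omega> ` (\<kappa> ` B \<inter> P)) (\<psi> \<circ> inv_into P \<omega>)"
      proof (rule Cinf_on_cong[OF cP(5)[OF \<kappa>open[OF oB order_refl]], rotated])
        fix v assume "v \<in> \<omega> ` (\<kappa> ` B \<inter> P)"
        then obtain y where y: "y \<in> B" "\<kappa> y \<in> P" "v = \<omega> (\<kappa> y)" by blast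
        have "\<kappa> y \<in> P \<inter> \<iota> ` W" using y xB(4) unfolding \<kappa>_def by blast
        then have "inv_into (P \<inter> \<iota> ` W) \<omega> v = \<kappa> y" unfolding y(3) by (rule inv_into_f_f[OF inj_on_subset[OF cP(3) Int_lower1]])
        moreover have "inv_into P \<omega> v = \<kappa> y" unfolding y(3) by (rule cP(4)[OF y(2)])
        moreover have "H (\<kappa> y) = q y" unfolding \<kappa>_def by (rule H(3)[OF xB(4)[OF y(1)]])
        ultimately show "((\<theta> \<circ> H) \<circ> inv_into (P \<inter> \<iota> ` W) \<omega>) v = (\<psi> \<circ> inv_into P \<omega>) v" using \<theta>[OF y(1)] \<psi>[OF y(1)] by simp
      qed
    qed
    then show "case z of (W, \<psi>') \<Rightarrow> compatible (\<kappa> ` B) \<psi> W \<psi>'" unfolding zP by simp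
  qed
  show thesis by (rule that[OF oB xB(1,2) V(1) xB(3) \<kappa>inj[unfolded \<kappa>_def] c[unfolded \<psi>_def \<kappa>_def]])
qed

text \<open>On \<open>W\<close> the function \<open>\<rho>\<close> generates the pullback of the ideal \<open>I\<close> along \<open>F\<close>.\<close>

definition pulls_generator :: "('g, 'f::euclidean_space) mfd \<Rightarrow> ('a, 'e::euclidean_space) mfd \<Rightarrow> 'a set \<Rightarrow> ('a, real) sheaf \<Rightarrow>
    'g set \<Rightarrow> ('g \<Rightarrow> 'a) \<Rightarrow> ('g \<Rightarrow> real) \<Rightarrow> bool" where
  "pulls_generator G M D I W F \<rho> \<longleftrightarrow> (\<exists>i V \<phi> e \<upsilon>. nc_coords M D I i V \<phi> e \<and> (\<forall>p\<in>W. F p \<in> V) \<and>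
     (\<lambda>p. \<phi> (F p)) \<in> smooth_funs G W \<and> \<upsilon> \<in> smooth_funs G W \<and>
     (\<forall>p\<in>W. \<upsilon> p \<noteq> 0 \<and> zprod e i (\<phi> (F p)) = \<upsilon> p * \<rho> p))"

section \<open>Charts of the elliptic groupoid around an arrow\<close>

context elliptic_groupoid
begin

lemma gluing_map:
  obtains \<iota> where "\<And>i N a. N \<in> pieces i \<Longrightarrow> a \<in> pts (GN i N) \<Longrightarrow> GN_src i N a \<in> N \<Longrightarrow> GN_tgt i N a \<in> N \<Longrightarrow>
      \<iota> i N a = ((i, N), a)"
    "\<And>i N a j N' S. N \<in> pieces i \<Longrightarrow> a \<in> pts (GN i N) \<Longrightarrow> N' \<in> pieces j \<Longrightarrow>
      S \<in> connected_components_of (subtopology (mtop M) (N' \<inter> U i N)) \<Longrightarrow> GN_src i N a \<in> S \<Longrightarrow> GN_tgt i N a \<in> S \<Longrightarrow>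
      \<exists>a'. \<iota> i N a = ((j, N'), a') \<and> kappa i N j N' S a a'"
    "\<And>i N. N \<in> pieces i \<Longrightarrow> local_diffeo (GN i N) (arrs \<G>) (\<iota> i N)"
proof -
  obtain \<iota> where g: "\<forall>i. \<forall>N\<in>pieces i. \<forall>a\<in>pts (GN i N).
         (GN_src i N a \<in> N \<and> GN_tgt i N a \<in> N \<longrightarrow> \<iota> i N a = ((i, N), a)) \<and>
         (\<forall>j. \<forall>N'\<in>pieces j. \<forall>S\<in>connected_components_of (subtopology (mtop M) (N' \<inter> U i N)).
            GN_src i N a \<in> S \<and> GN_tgt i N a \<in> S \<longrightarrow>
              (\<exists>a'. \<iota> i N a = ((j, N'), a') \<and> kappa i N j N' S a a'))"
    "\<forall>i. \<forall>N\<in>pieces i. local_diffeo (GN i N) (arrs \<G>) (\<iota> i N)" using gluing by (elim exE conjE) (rule that)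
  show thesis
  proof (rule that[of \<iota>])
    fix i N a assume N: "N \<in> pieces i" and a: "a \<in> pts (GN i N)"
    note h = g(1)[THEN spec, THEN bspec, OF N, THEN bspec, OF a]
    show "\<iota> i N a = ((i, N), a)" if "GN_src i N a \<in> N" "GN_tgt i N a \<in> N"
      by (rule h[THEN conjunct1, THEN mp, OF conjI[OF that]])
    show "\<exists>a'. \<iota> i N a = ((j, N'), a') \<and> kappa i N j N' S a a'"
      if N': "N' \<in> pieces j" "S \<in> connected_components_of (subtopology (mtop M) (N' \<inter> U i N))"
        "GN_src i N a \<in> S" "GN_tgt i N a \<in> S" for j N' S
      by (rule h[THEN conjunct2, THEN spec, THEN bspec, OF N'(1), THEN bspec, OF N'(2), THEN mp, OF conjI[OF N'(3,4)]])
  next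
    show "local_diffeo (GN i N) (arrs \<G>) (\<iota> i N)" if "N \<in> pieces i" for i N by (rule g(2)[THEN spec, THEN bspec, OF that])
  qed
qed

text \<open>The gluing map is specified only for arrows whose ends lie in one component
  \<open>S\<close>. Both ends of an arrow lie in one piece of the sheet; its image in
  \<open>M\<close> is connected, inside one stratum and inside the tube, hence inside one such
  \<open>S\<close>. The gluing map then preserves the ends by definition.\<close>

lemma gluing_ends:
  assumes N: "N \<in> pieces i" and E: "E \<in> sheets i N" and y: "y \<in> GE_arrows i N E"
    and glue: "\<And>j N' S. N' \<in> pieces j \<Longrightarrow> S \<in> connected_components_of (subtopology (mtop M) (N' \<inter> U i N)) \<Longrightarrow>
      GN_src i N (orbit i N (E, y)) \<in> S \<Longrightarrow> GN_tgt i N (orbit i N (E, y)) \<in> S \<Longrightarrow>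
      \<exists>a'. g = ((j, N'), a') \<and> kappa i N j N' S (orbit i N (E, y)) a'"
  shows "src \<G> g = fst (GE_src i N E y)" "tgt \<G> g = fst (GE_tgt i N E y)"
proof -
  let ?t = "fst (GE_tgt i N E y)" and ?s = "fst (GE_src i N E y)"
  obtain N0 where N0: "N0 \<in> sheet_pieces i N E" "GE_tgt i N E y \<in> N0" "GE_src i N E y \<in> N0" by (rule GE_same_piece[OF N E y])
  obtain k where k: "N0 \<subseteq> E" "\<And>x. x \<in> N0 \<Longrightarrow> fst x \<in> stratum k" "connectedin (PN_top i N) N0"
    by (rule sheet_piece_D[OF N E N0(1)]) (rule that)
  define C where "C = fst ` N0"
  have C: "connectedin (mtop M) C" unfolding C_def by (rule connectedin_continuous_map_image[OF PN_fst_continuous k(3)])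
  have CU: "C \<subseteq> stratum k" "C \<subseteq> U i N" "?t \<in> C" "?s \<in> C"
    unfolding C_def using k(1,2) N0(2,3) PN_fst E_sub[OF N E] by blast+
  define X1 where "X1 = subtopology (mtop M) (stratum k)"
  define N' where "N' = connected_component_of_set X1 ?t"
  have C1: "connectedin X1 C" unfolding X1_def connectedin_subtopology using C CU(1) by blast
  have "?t \<in> topspace X1" using connectedin_subset_topspace[OF C1] CU(3) by blast
  then have N': "N' \<in> pieces k" unfolding pieces_def N'_def X1_def[symmetric] by (simp add: connected_component_in_connected_components_of)
  have CN: "C \<subseteq> N'" unfolding N'_def by (rule connected_component_of_maximal[OF C1 CU(3)])
  define X2 where "X2 = subtopology (mtop M) (N' \<inter> U i N)"
  define S where "S = connected_component_of_set X2 ?t"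
  have C2: "connectedin X2 C" unfolding X2_def connectedin_subtopology using C CU(2) CN by blast
  have "?t \<in> topspace X2" using connectedin_subset_topspace[OF C2] CU(3) by blast
  then have S: "S \<in> connected_components_of (subtopology (mtop M) (N' \<inter> U i N))"
    unfolding S_def X2_def[symmetric] by (simp add: connected_component_in_connected_components_of)
  have CS: "C \<subseteq> S" unfolding S_def by (rule connected_component_of_maximal[OF C2 CU(3)])
  note ends = GN_ends[OF N E y]
  obtain a' where a': "g = ((k, N'), a')" "kappa i N k N' S (orbit i N (E, y)) a'"
    using glue[OF N' S, unfolded ends, OF subsetD[OF CS CU(4)] subsetD[OF CS CU(3)]] by (elim exE conjE)
  have ka: "a' \<in> pts (GN k N')" "GN_src k N' a' = ?s" "GN_tgt k N' a' = ?t"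
    using a'(2)[unfolded kappa_def ends, THEN conjunct2, THEN conjunct1]
      a'(2)[unfolded kappa_def ends, THEN conjunct2, THEN conjunct2, THEN conjunct2, THEN conjunct2, THEN conjunct1]
      a'(2)[unfolded kappa_def ends, THEN conjunct2, THEN conjunct2, THEN conjunct2, THEN conjunct2, THEN conjunct2, THEN conjunct1] .
  have "((k, N'), a') \<in> ell_arrows" unfolding ell_arrows_def
    by (intro CollectI exI[of _ k] exI[of _ N'] exI[of _ a'] conjI refl N' ka(1)) (use ka(2,3) CN CU(3,4) in auto)
  then show "src \<G> g = ?s" "tgt \<G> g = ?t" unfolding a'(1) using src tgt ka(2,3) by auto
qed

text \<open>Carries \<open>local_model\<close> from the blow-up to \<G>: near an arrow over
  \<open>N\<close> both the orbit map and the gluing map are local diffeomorphisms onto open sets,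
  and they preserve the ends even at neighbouring arrows over strata of lower multiplicity.\<close>

lemma arrow_local_model:
  assumes g: "((i, N), a) \<in> ell_arrows"
  obtains W \<phi> e where "chart (arrs \<G>) W \<phi>" "((i, N), a) \<in> W" "frame_enum e" "2 * i \<le> DIM('e \<times> 'e)"
    "\<And>j. j < i \<Longrightarrow> zc e j (\<phi> ((i, N), a)) = 0"
    "pulls_generator (arrs \<G>) M D I W (tgt \<G>) (\<lambda>p. \<Prod>j<i. (cmod (zc e j (\<phi> p)))\<^sup>2)"
    "pulls_generator (arrs \<G>) M D I W (src \<G>) (\<lambda>p. \<Prod>j<i. (cmod (zc e j (\<phi> p)))\<^sup>2)"
proof -
  let ?G = "arrs \<G>"
  have N: "N \<in> pieces i" and a: "a \<in> pts (GN i N)" "GN_src i N a \<in> N" "GN_tgt i N a \<in> N"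
    using g unfolding ell_arrows_def by auto
  obtain E y where Ey: "a = orbit i N (E, y)" "(E, y) \<in> pts (Gsum i N)" using a(1) unfolding topspace_GN[OF N] by auto
  have E: "E \<in> sheets i N" and y: "y \<in> GE_arrows i N E" using Ey(2) unfolding Gsum_point[OF N] by auto
  let ?Y = "Y i N E"
  note YS = Y_smooth(1)[OF N E]
  have yN: "fst (GE_tgt i N E y) \<in> N" "fst (GE_src i N E y) \<in> N" using a(2,3) GN_ends[OF N E y] unfolding Ey(1) by auto
  obtain \<iota> where \<iota>: "\<And>i N a. N \<in> pieces i \<Longrightarrow> a \<in> pts (GN i N) \<Longrightarrow> GN_src i N a \<in> N \<Longrightarrow> GN_tgt i N a \<in> N \<Longrightarrow>
      \<iota> i N a = ((i, N), a)"
    "\<And>i N a j N' S. N \<in> pieces i \<Longrightarrow> a \<in> pts (GN i N) \<Longrightarrow> N' \<in> pieces j \<Longrightarrow>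
      S \<in> connected_components_of (subtopology (mtop M) (N' \<inter> U i N)) \<Longrightarrow> GN_src i N a \<in> S \<Longrightarrow> GN_tgt i N a \<in> S \<Longrightarrow>
      \<exists>a'. \<iota> i N a = ((j, N'), a') \<and> kappa i N j N' S a a'"
    "\<And>i N. N \<in> pieces i \<Longrightarrow> local_diffeo (GN i N) ?G (\<iota> i N)" by (rule gluing_map) (rule that)
  obtain W \<phi> e V1 \<phi>1 e1 \<upsilon>1 V2 \<phi>2 e2 \<upsilon>2 where
    L: "chart ?Y W \<phi>" "y \<in> W" "W \<subseteq> GE_arrows i N E" "frame_enum e" "2 * i \<le> DIM('e \<times> 'e)"
    "\<And>j. j < i \<Longrightarrow> zc e j (\<phi> y) = 0"
    "(V1, \<phi>1, e1) \<in> T i N" "\<And>q. q \<in> W \<Longrightarrow> fst (GE_tgt i N E q) \<in> V1" "\<upsilon>1 \<in> smooth_funs ?Y W"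
    "\<And>q. q \<in> W \<Longrightarrow> (\<upsilon>1 q :: real) \<noteq> 0 \<and>
      (zprod e1 i (\<phi>1 (fst (GE_tgt i N E q)))) = \<upsilon>1 q * zprod e i (\<phi> q)"
    "(V2, \<phi>2, e2) \<in> T i N" "\<And>q. q \<in> W \<Longrightarrow> fst (GE_src i N E q) \<in> V2" "\<upsilon>2 \<in> smooth_funs ?Y W"
    "\<And>q. q \<in> W \<Longrightarrow> (\<upsilon>2 q :: real) \<noteq> 0 \<and>
      (zprod e2 i (\<phi>2 (fst (GE_src i N E q)))) = \<upsilon>2 q * zprod e i (\<phi> q)"
    by (rule local_model[OF N E y yN]) (rule that)
  obtain O1 where O1: "opn ?Y O1" "y \<in> O1" "O1 \<subseteq> GE_arrows i N E" "inj_on (orbit i N) ({E} \<times> O1)"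
    by (rule orbit_locally_injective[OF N E y yN]) (rule that)
  have B0: "opn (Gsum i N) ({E} \<times> (O1 \<inter> W))" "(E, y) \<in> {E} \<times> (O1 \<inter> W)"
    using Gsum_slice[OF N E, of "O1 \<inter> W"] O1(1,2,3) chartD(1)[OF L(1)] L(2) by auto
  have inj: "inj_on (orbit i N) ({E} \<times> (O1 \<inter> W))" by (rule inj_on_subset[OF O1(4)]) blast
  obtain B V' \<phi>' where B: "opn (Gsum i N) B" "(E, y) \<in> B" "B \<subseteq> {E} \<times> (O1 \<inter> W)" "(V', \<phi>') \<in> atlas (Gsum i N)" "B \<subseteq> V'"
    "inj_on (\<lambda>x. \<iota> i N (orbit i N x)) B"
    "chart ?G ((\<lambda>x. \<iota> i N (orbit i N x)) ` B) (\<phi>' \<circ> inv_into B (\<lambda>x. \<iota> i N (orbit i N x)))"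
    by (rule chart_via_quotient[OF Gsum_smooth[OF N] smooth orbit_image_open[OF N, unfolded GN_def] \<iota>(3)[OF N, unfolded GN_def] B0 inj])
      (assumption | rule that)+
  define \<kappa> where "\<kappa> = (\<lambda>q. \<iota> i N (orbit i N (E, q)))"
  define P where "P = {q. (E, q) \<in> B}"
  have BP: "B = {E} \<times> P" unfolding P_def using B(3) by auto
  have oP: "opn ?Y P" using B(1) unfolding BP Gsum_slice[OF N E] by blast
  have P: "y \<in> P" "P \<subseteq> W" "P \<subseteq> GE_arrows i N E" using B(2,3) L(3) unfolding BP by auto
  obtain V3 \<phi>'' where V3: "\<phi>' = \<phi>'' \<circ> snd" "(V3, \<phi>'') \<in> atlas ?Y" "P \<subseteq> V3"
  proof -
    obtain E' V4 \<phi>4 where v: "V' = {E'} \<times> V4" "\<phi>' = \<phi>4 \<circ> snd" "(V4, \<phi>4) \<in> atlas (GE i N E')"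
      using B(4) unfolding Gsum_def atlas_sum_mfd by blast
    have "E' = E" "P \<subseteq> V4" using B(2,5) unfolding v(1) BP by auto
    then show thesis using v(2,3) that unfolding GE_def atlas_open_sub by blast
  qed
  note c3 = chart_atlas[OF YS V3(2)]
  define R where "R = \<kappa> ` P"
  define h where "h = (\<lambda>p. snd (inv_into B (\<lambda>x. \<iota> i N (orbit i N x)) p))"
  have RB: "(\<lambda>x. \<iota> i N (orbit i N x)) ` B = R" unfolding R_def BP \<kappa>_def by auto
  have h: "h (\<kappa> q) = q" if "q \<in> P" for q using inv_into_f_f[OF B(6), of "(E, q)"] that unfolding h_def \<kappa>_def BP by simp
  have cR: "chart ?G R (\<lambda>p. \<phi>'' (h p))" using B(7) unfolding RB V3(1) h_def by (simp add: comp_def)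
  note oR = chartD(1)[OF cR]
  have imR: "(\<lambda>p. \<phi>'' (h p)) ` R = \<phi>'' ` P" unfolding R_def by (auto simp: h image_image)
  have iv: "inv_into R (\<lambda>p. \<phi>'' (h p)) (\<phi>'' q) = \<kappa> q" if "q \<in> P" for q
    using chartD(4)[OF cR, of "\<kappa> q"] that h[OF that] unfolding R_def by simp
  have iv3: "inv_into V3 \<phi>'' (\<phi>'' q) = q" if "q \<in> P" for q using chartD(4)[OF c3] V3(3) that by blast
  \<comment> \<open>\<open>h\<close> is the local inverse of \<kappa>. Since the chart on
    \<open>R\<close> is an atlas chart of the blow-up read through \<open>h\<close>, a smooth
    function on \<open>P\<close> has the same coordinate expression on \<open>R\<close>.\<close>
  have push: "(\<lambda>p. f (h p)) \<in> smooth_funs ?G R" if f: "f \<in> smooth_funs ?Y P" for f :: "'y \<Rightarrow> 'k::real_normed_vector"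
  proof (rule smooth_funs_in_chart[OF smooth cR oR order_refl], unfold imR)
    have "\<phi>'' ` (P \<inter> V3) = \<phi>'' ` P" using V3(3) by (simp add: Int_absorb2)
    then have "Cinf_on (\<phi>'' ` P) (f \<circ> inv_into V3 \<phi>'')" using smooth_funs_chart[OF YS f oP c3] by simp
    then show "Cinf_on (\<phi>'' ` P) ((\<lambda>p. f (h p)) \<circ> inv_into R (\<lambda>p. \<phi>'' (h p)))"
      by (rule Cinf_on_cong[OF chartD(6)[OF c3 oP V3(3)], rotated]) (auto simp: iv iv3 h)
  qed
  \<comment> \<open>The chart obtained from the quotient comes from the atlas of the blow-up. The
    coordinates adapted to the divisor are reached by the transition to \<phi>.\<close>
  have cg: "chart ?G R ((\<phi> \<circ> inv_into V3 \<phi>'') \<circ> (\<lambda>p. \<phi>'' (h p)))"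
  proof (rule chart_transform[OF smooth cR, unfolded imR])
    show "Cinf_on (\<phi>'' ` P) (\<phi> \<circ> inv_into V3 \<phi>'')"
      by (rule Cinf_on_subset[OF chart_compatible[OF YS c3 L(1)]]) (use V3(3) P(2) in blast)
    have im: "(\<phi> \<circ> inv_into V3 \<phi>'') ` \<phi>'' ` P = \<phi> ` P" by (force simp: iv3)
    show "open ((\<phi> \<circ> inv_into V3 \<phi>'') ` \<phi>'' ` P)" unfolding im by (rule chartD(6)[OF L(1) oP P(2)])
    show "Cinf_on ((\<phi> \<circ> inv_into V3 \<phi>'') ` \<phi>'' ` P) (\<phi>'' \<circ> inv_into W \<phi>)" unfolding im
      by (rule Cinf_on_subset[OF chart_compatible[OF YS L(1) c3]]) (use V3(3) P(2) in blast)
    show "(\<phi>'' \<circ> inv_into W \<phi>) ((\<phi> \<circ> inv_into V3 \<phi>'') x) = x" if "x \<in> \<phi>'' ` P" for x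
      using that iv3 chartD(4)[OF L(1)] P(2) by auto
  qed
  have ends: "src \<G> (\<kappa> q) = fst (GE_src i N E q)" "tgt \<G> (\<kappa> q) = fst (GE_tgt i N E q)" if q: "q \<in> P" for q
  proof -
    have qG: "q \<in> GE_arrows i N E" using q P(3) by blast
    have o: "orbit i N (E, q) \<in> pts (GN i N)" unfolding topspace_GN[OF N] using Gsum_point[OF N] E qG by blast
    show "src \<G> (\<kappa> q) = fst (GE_src i N E q)" unfolding \<kappa>_def
      by (rule gluing_ends(1)[OF N E qG]) (rule \<iota>(2)[OF N o])
    show "tgt \<G> (\<kappa> q) = fst (GE_tgt i N E q)" unfolding \<kappa>_def
      by (rule gluing_ends(2)[OF N E qG]) (rule \<iota>(2)[OF N o])
  qed
  have \<phi>R: "((\<phi> \<circ> inv_into V3 \<phi>'') \<circ> (\<lambda>p. \<phi>'' (h p))) (\<kappa> q) = \<phi> q" if "q \<in> P" for q using h[OF that] iv3[OF that] by simp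
  have pg: "pulls_generator ?G M D I R F (\<lambda>p. \<Prod>j<i. (cmod (zc e j (((\<phi> \<circ> inv_into V3 \<phi>'') \<circ> (\<lambda>p. \<phi>'' (h p))) p)))\<^sup>2)"
    if T: "(V1, \<phi>1, e1) \<in> T i N" and VW: "\<And>q. q \<in> W \<Longrightarrow> f q \<in> V1" and up: "\<upsilon> \<in> smooth_funs ?Y W"
      and gen: "\<And>q. q \<in> W \<Longrightarrow> (\<upsilon> q :: real) \<noteq> 0 \<and>
        (zprod e1 i (\<phi>1 (f q))) = \<upsilon> q * zprod e i (\<phi> q)"
      and fs: "smooth_map ?Y M f" and F: "\<And>q. q \<in> P \<Longrightarrow> F (\<kappa> q) = f q" for V1 \<phi>1 e1 f \<upsilon> F
    unfolding pulls_generator_def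
  proof (intro exI conjI ballI)
    note nc = tube_chartD(1)[OF N T]
    show "nc_coords M D I i V1 \<phi>1 e1" by (rule nc)
    show "(\<lambda>p. \<upsilon> (h p)) \<in> smooth_funs ?G R" by (rule push[OF smooth_funs_subset[OF up P(2)]])
    have "P \<subseteq> {q \<in> pts ?Y. f q \<in> V1}" using VW P(2) openin_subset[OF oP] by blast
    from smooth_funs_subset[OF smooth_funs_pullback[OF YS M fs smooth_funs_chart_map[OF nc_coordsD(1)[OF nc]] chartD(1)[OF nc_coordsD(1)[OF nc]]] this]
    have "(\<lambda>p. (\<phi>1 \<circ> f) (h p)) \<in> smooth_funs ?G R" by (rule push)
    then show "(\<lambda>p. \<phi>1 (F p)) \<in> smooth_funs ?G R" by (rule smooth_funs_cong[OF smooth oR]) (auto simp: R_def F h)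
    fix p assume "p \<in> R"
    then obtain q where q: "q \<in> P" "p = \<kappa> q" unfolding R_def by blast
    have qW: "q \<in> W" using q(1) P(2) by blast
    show "F p \<in> V1" using F[OF q(1)] VW[OF qW] unfolding q(2) by simp
    show "\<upsilon> (h p) \<noteq> 0" using gen[OF qW] h[OF q(1)] unfolding q(2) by simp
    show "zprod e1 i (\<phi>1 (F p)) = \<upsilon> (h p) * zprod e i (((\<phi> \<circ> inv_into V3 \<phi>'') \<circ> (\<lambda>p. \<phi>'' (h p))) p)"
      using gen[OF qW] unfolding q(2) h[OF q(1)] \<phi>R[OF q(1)] F[OF q(1)] by simp
  qed
  have ga: "((i, N), a) = \<kappa> y" unfolding \<kappa>_def Ey(1)[symmetric] by (rule \<iota>(1)[OF N a, symmetric])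
  show thesis
  proof (rule that[OF cg _ L(4,5)])
    show "((i, N), a) \<in> R" unfolding ga R_def using P(1) by blast
    show "zc e j (((\<phi> \<circ> inv_into V3 \<phi>'') \<circ> (\<lambda>p. \<phi>'' (h p))) ((i, N), a)) = 0" if "j < i" for j
      unfolding ga \<phi>R[OF P(1)] by (rule L(6)[OF that])
    show "pulls_generator ?G M D I R (tgt \<G>) (\<lambda>p. \<Prod>j<i. (cmod (zc e j (((\<phi> \<circ> inv_into V3 \<phi>'') \<circ> (\<lambda>p. \<phi>'' (h p))) p)))\<^sup>2)"
      by (rule pg[OF L(7-10) Y_proj_smooth(1)[OF N E] ends(2)])
    show "pulls_generator ?G M D I R (src \<G>) (\<lambda>p. \<Prod>j<i. (cmod (zc e j (((\<phi> \<circ> inv_into V3 \<phi>'') \<circ> (\<lambda>p. \<phi>'' (h p))) p)))\<^sup>2)"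
      by (rule pg[OF L(11-14) Y_proj_smooth(2)[OF N E] ends(1)])
  qed
qed

end

section \<open>Pullbacks of ideal sheaves\<close>

text \<open>Membership in a generated sheaf at a single point, free of the open set on which the
  section is considered; closure under the ideal operations can then be checked pointwise and sheaf
  properties become immediate.\<close>

definition gen_at :: "('p, 'e::euclidean_space) mfd \<Rightarrow> ('p set \<times> ('p \<Rightarrow> 'k::real_normed_field)) set \<Rightarrow> 'p \<Rightarrow> ('p \<Rightarrow> 'k) \<Rightarrow> bool" where
  "gen_at X S x g \<longleftrightarrow> (\<exists>W (c::nat) h f. opn X W \<and> x \<in> W \<and>
     (\<forall>l<c. h l \<in> smooth_funs X W \<and> (\<exists>V. W \<subseteq> V \<and> (V, f l) \<in> S)) \<and> (\<forall>y\<in>W. g y = (\<Sum>l<c. h l y * f l y)))"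

lemma gen_atI:
  assumes "opn X W" "x \<in> W" "\<And>l. l < (c::nat) \<Longrightarrow> h l \<in> smooth_funs X W"
    "\<And>l. l < c \<Longrightarrow> \<exists>V. W \<subseteq> V \<and> (V, f l) \<in> S" "\<And>y. y \<in> W \<Longrightarrow> g y = (\<Sum>l<c. h l y * f l y)"
  shows "gen_at X S x g" unfolding gen_at_def by (intro exI[of _ W] exI[of _ c] exI[of _ h] exI[of _ f] conjI allI impI ballI assms)

lemma gen_atE:
  assumes "gen_at X S x g" "opn X U" "x \<in> U"
  obtains W c h f where "opn X W" "x \<in> W" "W \<subseteq> U" "\<And>l. l < (c::nat) \<Longrightarrow> h l \<in> smooth_funs X W"
    "\<And>l. l < c \<Longrightarrow> \<exists>V. W \<subseteq> V \<and> (V, f l) \<in> S" "\<And>y. y \<in> W \<Longrightarrow> g y = (\<Sum>l<c. h l y * f l y)"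
proof -
  obtain W c h f where W: "opn X W" "x \<in> W"
     "\<forall>l<(c::nat). h l \<in> smooth_funs X W \<and> (\<exists>V. W \<subseteq> V \<and> (V, f l) \<in> S)" "\<forall>y\<in>W. g y = (\<Sum>l<c. h l y * f l y)"
    using assms(1) unfolding gen_at_def by (elim exE conjE)
  have WU: "opn X (W \<inter> U)" "x \<in> W \<inter> U" "W \<inter> U \<subseteq> U" using W(1,2) assms(2,3) by auto
  show thesis
  proof (rule that[OF WU])
    show "h l \<in> smooth_funs X (W \<inter> U)" if "l < c" for l using smooth_funs_subset[of "h l" X W] W(3) that by blast
    show "\<exists>V. W \<inter> U \<subseteq> V \<and> (V, f l) \<in> S" if "l < c" for l using W(3) that by blast
    show "g y = (\<Sum>l<c. h l y * f l y)" if "y \<in> W \<inter> U" for y using W(4) that by blast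
  qed
qed

lemma gen_sheaf_iff:
  assumes U: "opn X U"
  shows "g \<in> gen_sheaf X S U \<longleftrightarrow> g \<in> smooth_funs X U \<and> (\<forall>x\<in>U. gen_at X S x g)"
proof
  assume g: "g \<in> gen_sheaf X S U"
  have "gen_at X S x g" if x: "x \<in> U" for x
  proof -
    obtain V c h f where V: "opn X V" "x \<in> V" "V \<subseteq> U" "\<And>l. l < (c::nat) \<Longrightarrow> h l \<in> smooth_funs X V"
      "\<And>l. l < c \<Longrightarrow> \<exists>V'. V \<subseteq> V' \<and> (V', f l) \<in> S" "\<And>y. y \<in> V \<Longrightarrow> g y = (\<Sum>l<c. h l y * f l y)"
      by (rule gen_sheafE[OF g x]) (rule that)
    show ?thesis by (rule gen_atI[OF V(1,2,4,5,6)])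
  qed
  moreover have "g \<in> smooth_funs X U" using g unfolding gen_sheaf_def by blast
  ultimately show "g \<in> smooth_funs X U \<and> (\<forall>x\<in>U. gen_at X S x g)" by blast
next
  assume g: "g \<in> smooth_funs X U \<and> (\<forall>x\<in>U. gen_at X S x g)"
  show "g \<in> gen_sheaf X S U" unfolding gen_sheaf_def
  proof (intro CollectI conjI ballI)
    show "g \<in> smooth_funs X U" using g by blast
    fix x assume x: "x \<in> U"
    obtain W c h f where W: "opn X W" "x \<in> W" "W \<subseteq> U" "\<And>l. l < (c::nat) \<Longrightarrow> h l \<in> smooth_funs X W"
      "\<And>l. l < c \<Longrightarrow> \<exists>V. W \<subseteq> V \<and> (V, f l) \<in> S" "\<And>y. y \<in> W \<Longrightarrow> g y = (\<Sum>l<c. h l y * f l y)"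
      by (rule gen_atE[OF g[THEN conjunct2, THEN bspec, OF x] U x]) (rule that)
    show "\<exists>W (c::nat) h f. opn X W \<and> x \<in> W \<and> W \<subseteq> U \<and>
     (\<forall>l<c. h l \<in> smooth_funs X W \<and> (\<exists>V. W \<subseteq> V \<and> (V, f l) \<in> S)) \<and> (\<forall>y\<in>W. g y = (\<Sum>l<c. h l y * f l y))"
      by (intro exI[of _ W] exI[of _ c] exI[of _ h] exI[of _ f] conjI allI impI ballI W)
  qed
qed

lemma gen_at_cong:
  assumes g: "gen_at X S x g" and U: "opn X U" "x \<in> U" "\<And>y. y \<in> U \<Longrightarrow> g' y = g y"
  shows "gen_at X S x g'"
proof -
  obtain W c h f where W: "opn X W" "x \<in> W" "W \<subseteq> U" "\<And>l. l < (c::nat) \<Longrightarrow> h l \<in> smooth_funs X W"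
    "\<And>l. l < c \<Longrightarrow> \<exists>V. W \<subseteq> V \<and> (V, f l) \<in> S" "\<And>y. y \<in> W \<Longrightarrow> g y = (\<Sum>l<c. h l y * f l y)"
    by (rule gen_atE[OF g U(1,2)]) (rule that)
  show ?thesis by (rule gen_atI[of X W x c h f, OF W(1,2,4,5)]) (use W(3,6) U(3) in auto)
qed

lemma gen_at_mult:
  assumes X: "smooth_mfd X" and g: "gen_at X S x g" and U: "opn X U" "x \<in> U" and k: "k \<in> smooth_funs X U"
  shows "gen_at X S x (\<lambda>y. k y * g y)"
proof -
  obtain W c h f where W: "opn X W" "x \<in> W" "W \<subseteq> U" "\<And>l. l < (c::nat) \<Longrightarrow> h l \<in> smooth_funs X W"
    "\<And>l. l < c \<Longrightarrow> \<exists>V. W \<subseteq> V \<and> (V, f l) \<in> S" "\<And>y. y \<in> W \<Longrightarrow> g y = (\<Sum>l<c. h l y * f l y)"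
    by (rule gen_atE[OF g U]) (rule that)
  show ?thesis
  proof (rule gen_atI[of X W x c "\<lambda>l y. k y * h l y" f, OF W(1,2) _ W(5)])
    show "(\<lambda>y. k y * h l y) \<in> smooth_funs X W" if "l < c" for l
      by (rule smooth_funs_bilinear[OF bounded_bilinear_mult X W(1) smooth_funs_subset[OF k W(3)] W(4)[OF that]])
    show "k y * g y = (\<Sum>l<c. k y * h l y * f l y)" if "y \<in> W" for y
      unfolding W(6)[OF that] by (simp add: sum_distrib_left mult.assoc)
  qed
qed

text \<open>The two lists of generators and coefficients are concatenated over a common
  neighbourhood, the second one shifted by the length \<open>c\<close> of the first.\<close>

lemma gen_at_add:
  fixes X :: "('p, 'e::euclidean_space) mfd" and g :: "'p \<Rightarrow> 'b::real_normed_field"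
  assumes g: "gen_at X S x g" and g': "gen_at X S x g'" and x: "x \<in> pts X"
  shows "gen_at X S x (\<lambda>y. g y + g' y)"
proof -
  obtain W c h f where W: "opn X W" "x \<in> W" "W \<subseteq> pts X" "\<And>l. l < (c::nat) \<Longrightarrow> h l \<in> smooth_funs X W"
    "\<And>l. l < c \<Longrightarrow> \<exists>V. W \<subseteq> V \<and> (V, f l) \<in> S" "\<And>y. y \<in> W \<Longrightarrow> g y = (\<Sum>l<c. h l y * f l y)"
    by (rule gen_atE[OF g openin_topspace x]) (rule that)
  obtain W' c' h' f' where W': "opn X W'" "x \<in> W'" "W' \<subseteq> W" "\<And>l. l < (c'::nat) \<Longrightarrow> h' l \<in> smooth_funs X W'"
    "\<And>l. l < c' \<Longrightarrow> \<exists>V. W' \<subseteq> V \<and> (V, f' l) \<in> S" "\<And>y. y \<in> W' \<Longrightarrow> g' y = (\<Sum>l<c'. h' l y * f' l y)"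
    by (rule gen_atE[OF g' W(1,2)]) (rule that)
  let ?h = "\<lambda>l. if l < c then h l else h' (l - c)" and ?f = "\<lambda>l. if l < c then f l else f' (l - c)"
  show ?thesis
  proof (rule gen_atI[of X W' x "c + c'" ?h ?f, OF W'(1,2)])
    fix l assume l: "l < c + c'"
    show "?h l \<in> smooth_funs X W'"
    proof (cases "l < c")
      case True
      then show ?thesis using smooth_funs_subset[OF W(4)[OF True] W'(3)] by simp
    next
      case False
      then show ?thesis using W'(4)[of "l - c"] l by simp
    qed
    show "\<exists>V. W' \<subseteq> V \<and> (V, ?f l) \<in> S"
    proof (cases "l < c")
      case True
      then show ?thesis using W(5)[OF True] W'(3) by auto
    next
      case False
      then show ?thesis using W'(5)[of "l - c"] l by simp
    qed
  next
    fix y assume y: "y \<in> W'"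
    have split: "(\<Sum>l<c + d. F l) = (\<Sum>l<c. F l) + (\<Sum>l<d. F (c + l))" for F :: "nat \<Rightarrow> 'b" and d
      by (induction d) (simp_all add: add.assoc)
    show "g y + g' y = (\<Sum>l<c + c'. ?h l y * ?f l y)" unfolding split using W(6)[of y] W'(6)[OF y] W'(3) y by (simp add: subset_iff)
  qed
qed

lemma gen_at_zero: "x \<in> pts X \<Longrightarrow> gen_at X S x (\<lambda>_. 0)" by (rule gen_atI[of X "pts X" x 0]) auto

lemma ideal_sheaf_gen_sheaf:
  assumes X: "smooth_mfd X"
  shows "ideal_sheaf X (gen_sheaf X S)" unfolding ideal_sheaf_def
proof (intro allI impI)
  fix U assume U: "opn X U"
  note iff = gen_sheaf_iff[OF U, of _ S]
  have Ut: "U \<subseteq> pts X" by (rule openin_subset[OF U])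
  show "gen_sheaf X S U \<subseteq> smooth_funs X U \<and> (\<lambda>_. 0) \<in> gen_sheaf X S U \<and>
     (\<forall>f\<in>gen_sheaf X S U. \<forall>g\<in>gen_sheaf X S U. (\<lambda>x. f x + g x) \<in> gen_sheaf X S U) \<and>
     (\<forall>h\<in>smooth_funs X U. \<forall>f\<in>gen_sheaf X S U. (\<lambda>x. h x * f x) \<in> gen_sheaf X S U) \<and>
     (\<forall>f\<in>gen_sheaf X S U. \<forall>g. (\<forall>x\<in>U. g x = f x) \<longrightarrow> g \<in> gen_sheaf X S U) \<and>
     (\<forall>W. opn X W \<and> W \<subseteq> U \<longrightarrow> gen_sheaf X S U \<subseteq> gen_sheaf X S W) \<and>
     (\<forall>f. (\<forall>x\<in>U. \<exists>W. opn X W \<and> x \<in> W \<and> W \<subseteq> U \<and> f \<in> gen_sheaf X S W) \<longrightarrow> f \<in> gen_sheaf X S U)"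
  proof (intro conjI ballI allI impI subsetI)
    show "f \<in> smooth_funs X U" if "f \<in> gen_sheaf X S U" for f using that iff by blast
    show "(\<lambda>_. 0) \<in> gen_sheaf X S U" unfolding iff by (intro conjI ballI smooth_funs_const gen_at_zero) (use Ut in blast)
    show "(\<lambda>x. f x + g x) \<in> gen_sheaf X S U" if "f \<in> gen_sheaf X S U" "g \<in> gen_sheaf X S U" for f g
      using that unfolding iff by (intro conjI ballI smooth_funs_add[OF X U] gen_at_add) (use Ut in auto)
    show "(\<lambda>x. h x * f x) \<in> gen_sheaf X S U" if h: "h \<in> smooth_funs X U" and f: "f \<in> gen_sheaf X S U" for h f
      using f unfolding iff by (intro conjI ballI smooth_funs_bilinear[OF bounded_bilinear_mult X U h] gen_at_mult[OF X _ U _ h]) auto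
    show "g \<in> gen_sheaf X S U" if f: "f \<in> gen_sheaf X S U" and e: "\<forall>x\<in>U. g x = f x" for f g
      using f e unfolding iff by (intro conjI ballI smooth_funs_cong[OF X U, of f g] gen_at_cong[of X S _ f U g] U) auto
    show "f \<in> gen_sheaf X S W" if "opn X W \<and> W \<subseteq> U" "f \<in> gen_sheaf X S U" for W f
      using gen_sheaf_restrict[OF X that(2)] that(1) by blast
    show "f \<in> gen_sheaf X S U"
      if f: "\<forall>x\<in>U. \<exists>W. opn X W \<and> x \<in> W \<and> W \<subseteq> U \<and> f \<in> gen_sheaf X S W" for f
      unfolding iff
    proof (intro conjI ballI)
      show "f \<in> smooth_funs X U"
      proof (rule smooth_funs_local[OF X])
        fix p assume "p \<in> U"
        then obtain W where "opn X W" "p \<in> W" "f \<in> gen_sheaf X S W" using f by blast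
        then show "\<exists>W. opn X W \<and> p \<in> W \<and> f \<in> smooth_funs X W" using gen_sheaf_iff by blast
      qed
      fix x assume "x \<in> U"
      then obtain W where "opn X W" "x \<in> W" "f \<in> gen_sheaf X S W" using f by blast
      then show "gen_at X S x f" using gen_sheaf_iff by blast
    qed
  qed
qed

text \<open>The local quotients are glued: they agree where the product does not vanish, which is dense.\<close>

lemma locally_multiple:
  fixes X :: "('p, 'e::euclidean_space) mfd" and g :: "'p \<Rightarrow> real"
  assumes X: "smooth_mfd X" and c: "chart X V \<phi>" and e: "frame_enum e" "2 * k \<le> DIM('e)" and W: "W \<subseteq> V"
    and loc: "\<And>x. x \<in> W \<Longrightarrow> \<exists>A h. opn X A \<and> x \<in> A \<and> A \<subseteq> W \<and> h \<in> smooth_funs X A \<and>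
      (\<forall>y\<in>A. g y = h y * zprod e k (\<phi> y))"
  obtains h where "h \<in> smooth_funs X W" "\<And>y. y \<in> W \<Longrightarrow> g y = h y * zprod e k (\<phi> y)"
proof -
  let ?\<rho> = "\<lambda>y. \<Prod>j<k. (cmod (zc e j (\<phi> y)))\<^sup>2"
  define good where "good = (\<lambda>x A h. opn X A \<and> x \<in> A \<and> A \<subseteq> W \<and> h \<in> smooth_funs X A \<and> (\<forall>y\<in>A. g y = h y * ?\<rho> y))"
  have "\<forall>x. \<exists>A h. x \<in> W \<longrightarrow> good x A h" unfolding good_def using loc by blast
  then obtain A h where "\<forall>x. x \<in> W \<longrightarrow> good x (A x) (h x)" by metis
  then have A: "opn X (A x)" "x \<in> A x" "A x \<subseteq> W" "h x \<in> smooth_funs X (A x)" "\<And>y. y \<in> A x \<Longrightarrow> g y = h x y * ?\<rho> y"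
    if "x \<in> W" for x using that unfolding good_def by auto
  have agree: "h x z = h x' z" if x: "x \<in> W" "x' \<in> W" and z: "z \<in> A x" "z \<in> A x'" for x x' z
  proof (rule ccontr)
    assume ne: "h x z \<noteq> h x' z"
    let ?B = "A x \<inter> A x'"
    have oB: "opn X ?B" using A(1) x by blast
    have s: "h x \<in> smooth_funs X ?B" "(\<lambda>y. - h x' y) \<in> smooth_funs X ?B"
      using smooth_funs_subset[OF A(4)[OF x(1)], of ?B] smooth_funs_linear[OF bounded_linear_minus[OF bounded_linear_ident] X oB smooth_funs_subset[OF A(4)[OF x(2)], of ?B]]
      by auto
    have "opn X {y \<in> ?B. h x y + - h x' y \<in> - {0}}"
      by (rule smooth_funs_continuous_map[OF X smooth_funs_add[OF X oB s] oB]) (rule open_Compl, simp)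
    moreover have "z \<in> {y \<in> ?B. h x y + - h x' y \<in> - {0}}" "z \<in> V" using z ne A(3)[OF x(1)] W by auto
    ultimately obtain q where q: "q \<in> {y \<in> ?B. h x y + - h x' y \<in> - {0}}" "\<And>j. j < k \<Longrightarrow> zc e j (\<phi> q) \<noteq> 0"
      using dense_complement[OF c _ e, of z] by blast
    have "h x q * ?\<rho> q = h x' q * ?\<rho> q" using A(5)[OF x(1), of q] A(5)[OF x(2), of q] q(1) by simp
    moreover have "?\<rho> q \<noteq> 0" using q(2) by simp
    ultimately show False using q(1) by simp
  qed
  \<comment> \<open>At \<open>y\<close> the quotient belonging to the neighbourhood chosen for
    \<open>y\<close> is used; by \<open>agree\<close> it coincides near each point with a single
    smooth quotient.\<close>
  define H where "H = (\<lambda>y. h y y)"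
  show thesis
  proof (rule that)
    show "H \<in> smooth_funs X W"
    proof (rule smooth_funs_local[OF X])
      fix p assume p: "p \<in> W"
      have "H \<in> smooth_funs X (A p)"
      proof (rule smooth_funs_cong[OF X A(1,4)[OF p]])
        fix x assume x: "x \<in> A p"
        have xW: "x \<in> W" using x A(3)[OF p] by blast
        show "H x = h p x" unfolding H_def by (rule agree[OF xW p A(2)[OF xW] x])
      qed
      then show "\<exists>W. opn X W \<and> p \<in> W \<and> H \<in> smooth_funs X W" using A(1,2)[OF p] by blast
    qed
    show "g y = H y * ?\<rho> y" if "y \<in> W" for y unfolding H_def by (rule A(5)[OF that A(2)[OF that]])
  qed
qed

lemma smooth_funs_generator:
  assumes X: "smooth_mfd X" and c: "chart X V \<phi>"
  shows "(\<lambda>y. \<Prod>j<k. (cmod (zc e j (\<phi> y)))\<^sup>2) \<in> smooth_funs X V"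
  by (intro smooth_funs_prod smooth_funs_norm2 smooth_funs_linear[OF bounded_linear_zc] X chartD(1)[OF c] smooth_funs_chart_map[OF c])

text \<open>A pulled back section is, locally, a smooth factor times the generator of the ideal
  below, whose pullback is the unit \<upsilon> times the product on \<open>W\<close>; the local
  factors are glued by \<open>locally_multiple\<close>. Conversely the generator below is itself a
  section, and division by \<upsilon> recovers the product.\<close>

lemma pullback_generated:
  fixes G :: "('g, 'f::euclidean_space) mfd" and M :: "('a, 'e::euclidean_space) mfd"
  assumes G: "smooth_mfd G" and M: "smooth_mfd M" and I: "ideal_sheaf M I" and F: "smooth_map G M F"
    and c: "chart G W \<phi>" and e: "frame_enum e" "2 * k \<le> DIM('f)"
    and pg: "pulls_generator G M D I W F (\<lambda>p. \<Prod>j<k. (cmod (zc e j (\<phi> p)))\<^sup>2)"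
  shows "generated_on G W (pullback G M F I) 1 (\<lambda>_ p. \<Prod>j<k. (cmod (zc e j (\<phi> p)))\<^sup>2)"
proof -
  let ?\<rho> = "\<lambda>p. \<Prod>j<k. (cmod (zc e j (\<phi> p)))\<^sup>2"
  let ?S = "{({x \<in> pts G. F x \<in> V}, \<psi> \<circ> F) | V \<psi>. opn M V \<and> \<psi> \<in> I V}"
  obtain i V1 \<phi>1 e1 \<upsilon> where p: "nc_coords M D I i V1 \<phi>1 e1" "\<forall>p\<in>W. F p \<in> V1"
    "(\<lambda>p. \<phi>1 (F p)) \<in> smooth_funs G W" "\<upsilon> \<in> smooth_funs G W"
    "\<forall>p\<in>W. \<upsilon> p \<noteq> 0 \<and> zprod e1 i (\<phi>1 (F p)) = \<upsilon> p * ?\<rho> p"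
    using pg unfolding pulls_generator_def by (elim exE conjE)
  let ?\<rho>1 = "\<lambda>q. \<Prod>l<i. (cmod (zc e1 l (\<phi>1 q)))\<^sup>2"
  note n = nc_coordsD[OF p(1)] and oW = chartD(1)[OF c] and Wt = chartD(2)[OF c]
  note oV1 = chartD(1)[OF n(1)]
  note gen = n(5)[unfolded generated_on_one]
  have IV1: "?\<rho>1 \<in> I V1"
  proof -
    have I: "I V1 = {g. \<exists>h\<in>smooth_funs M V1. \<forall>x\<in>V1. g x = h x * ?\<rho>1 x}"
      by (rule gen[THEN spec, THEN mp, OF conjI[OF oV1 order_refl]])
    show ?thesis unfolding I by (intro CollectI bexI[OF _ smooth_funs_const[of 1]] ballI) simp
  qed
  have "g \<in> pullback G M F I W' \<longleftrightarrow> (\<exists>h\<in>smooth_funs G W'. \<forall>x\<in>W'. g x = h x * ?\<rho> x)"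
    if W': "opn G W'" "W' \<subseteq> W" for W' g
  proof
    assume "g \<in> pullback G M F I W'"
    then have g: "g \<in> gen_sheaf G ?S W'" unfolding pullback_def .
    have loc: "\<exists>A h. opn G A \<and> x \<in> A \<and> A \<subseteq> W' \<and> h \<in> smooth_funs G A \<and> (\<forall>y\<in>A. g y = h y * ?\<rho> y)" if x: "x \<in> W'" for x
    proof -
      obtain A c h f where A: "opn G A" "x \<in> A" "A \<subseteq> W'" "\<And>l. l < (c::nat) \<Longrightarrow> h l \<in> smooth_funs G A"
        "\<And>l. l < c \<Longrightarrow> \<exists>V'. A \<subseteq> V' \<and> (V', f l) \<in> ?S" "\<And>y. y \<in> A \<Longrightarrow> g y = (\<Sum>l<c. h l y * f l y)"
        by (rule gen_sheafE[OF g x]) (rule that)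
      have AW: "A \<subseteq> W" using A(3) W'(2) by blast
      have ex: "\<exists>k. k \<in> smooth_funs G A \<and> (\<forall>y\<in>A. f l y = k y * ?\<rho> y)" if l: "l < c" for l
      proof -
        obtain V0 \<psi> where V0: "A \<subseteq> {x \<in> pts G. F x \<in> V0}" "f l = \<psi> \<circ> F" "opn M V0" "\<psi> \<in> I V0"
          using A(5)[OF l] by blast
        have oV: "opn M (V0 \<inter> V1)" using V0(3) oV1 by blast
        have sub: "I V0 \<subseteq> I (V0 \<inter> V1)" using I V0(3) oV unfolding ideal_sheaf_def by (meson Int_lower1)
        have eq: "I (V0 \<inter> V1) = {g. \<exists>h\<in>smooth_funs M (V0 \<inter> V1). \<forall>x\<in>V0 \<inter> V1. g x = h x * ?\<rho>1 x}"
          by (rule gen[THEN spec, THEN mp, OF conjI[OF oV Int_lower2]])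
        obtain h0 where h0: "h0 \<in> smooth_funs M (V0 \<inter> V1)" "\<forall>x\<in>V0 \<inter> V1. \<psi> x = h0 x * ?\<rho>1 x"
          using subsetD[OF sub V0(4), unfolded eq] by (elim CollectE bexE)
        have AV: "A \<subseteq> {x \<in> pts G. F x \<in> V0 \<inter> V1}" using V0(1) p(2) AW by blast
        have "(\<lambda>y. (h0 \<circ> F) y * \<upsilon> y) \<in> smooth_funs G A"
          by (rule smooth_funs_bilinear[OF bounded_bilinear_mult G A(1) smooth_funs_subset[OF smooth_funs_pullback[OF G M F h0(1) oV] AV]
             smooth_funs_subset[OF p(4) AW]])
        moreover have "f l y = (h0 \<circ> F) y * \<upsilon> y * ?\<rho> y" if y: "y \<in> A" for y
        proof -
          have "F y \<in> V0 \<inter> V1" "y \<in> W" using AV AW y by auto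
          then show ?thesis unfolding V0(2) using h0(2) p(5) by simp
        qed
        ultimately show ?thesis by blast
      qed
      then have "\<forall>l. \<exists>k. l < c \<longrightarrow> k \<in> smooth_funs G A \<and> (\<forall>y\<in>A. f l y = k y * ?\<rho> y)" by blast
      then obtain k where k: "\<forall>l. l < c \<longrightarrow> k l \<in> smooth_funs G A \<and> (\<forall>y\<in>A. f l y = k l y * ?\<rho> y)" by metis
      have "(\<lambda>y. \<Sum>l<c. h l y * k l y) \<in> smooth_funs G A"
        by (intro smooth_funs_sum[OF G A(1)] smooth_funs_bilinear[OF bounded_bilinear_mult G A(1)]) (use A(4) k in auto)
      moreover have "\<forall>y\<in>A. g y = (\<Sum>l<c. h l y * k l y) * ?\<rho> y"
        using A(6) k by (simp add: sum_distrib_right mult.assoc)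
      ultimately show ?thesis using A(1-3) by blast
    qed
    obtain h where "h \<in> smooth_funs G W'" "\<And>y. y \<in> W' \<Longrightarrow> g y = h y * ?\<rho> y"
      by (rule locally_multiple[OF G c e W'(2) loc]; (assumption | rule that))
    then show "\<exists>h\<in>smooth_funs G W'. \<forall>x\<in>W'. g x = h x * ?\<rho> x" by blast
  next
    assume "\<exists>h\<in>smooth_funs G W'. \<forall>x\<in>W'. g x = h x * ?\<rho> x"
    then obtain h where h: "h \<in> smooth_funs G W'" "\<forall>x\<in>W'. g x = h x * ?\<rho> x" by blast
    have "(\<lambda>x. h x * ?\<rho> x) \<in> smooth_funs G W'"
      by (rule smooth_funs_bilinear[OF bounded_bilinear_mult G W'(1) h(1) smooth_funs_subset[OF smooth_funs_generator[OF G c] W'(2)]])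
    then have gs: "g \<in> smooth_funs G W'" by (rule smooth_funs_cong[OF G W'(1)]) (use h(2) in simp)
    have us: "(\<lambda>x. h x * inverse (\<upsilon> x)) \<in> smooth_funs G W'"
      by (rule smooth_funs_bilinear[OF bounded_bilinear_mult G W'(1) h(1) smooth_funs_inverse[OF G W'(1) smooth_funs_subset[OF p(4) W'(2)]]])
        (use p(5) W'(2) in blast)
    have ge: "g x = h x * inverse (\<upsilon> x) * (?\<rho>1 \<circ> F) x" if "x \<in> W'" for x
      using h(2) p(5) that W'(2) by (auto simp: field_simps)
    have "gen_at G ?S x g" if x: "x \<in> W'" for x
    proof (rule gen_atI[of G W' x 1 "\<lambda>_ x. h x * inverse (\<upsilon> x)" "\<lambda>_. ?\<rho>1 \<circ> F", OF W'(1) x us])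
      show "\<exists>V. W' \<subseteq> V \<and> (V, ?\<rho>1 \<circ> F) \<in> ?S" for l
      proof (intro exI conjI)
        show "W' \<subseteq> {x \<in> pts G. F x \<in> V1}" using p(2) W'(2) Wt by blast
        show "({x \<in> pts G. F x \<in> V1}, ?\<rho>1 \<circ> F) \<in> ?S" using oV1 IV1 by blast
      qed
      show "g y = (\<Sum>l<(1::nat). h y * inverse (\<upsilon> y) * (?\<rho>1 \<circ> F) y)" if "y \<in> W'" for y using ge[OF that] by simp
    qed
    then show "g \<in> pullback G M F I W'" unfolding pullback_def gen_sheaf_iff[OF W'(1)] using gs by blast
  qed
  then show ?thesis unfolding generated_on_one by blast
qed

text \<open>Near each point both sheaves have the same generator and so the same sections, and
  membership is local. The hypothesis is symmetric in the two sheaves, so a second application gives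
  the reverse inclusion.\<close>

lemma gen_sheaf_eqI:
  fixes X :: "('p, 'e::euclidean_space) mfd" and \<rho> :: "'p \<Rightarrow> 'p \<Rightarrow> 'k::real_normed_field"
  assumes X: "smooth_mfd X" and W: "\<And>p. p \<in> pts X \<Longrightarrow> opn X (W p) \<and> p \<in> W p \<and>
      generated_on X (W p) (gen_sheaf X S) 1 (\<lambda>_. \<rho> p) \<and> generated_on X (W p) (gen_sheaf X S') 1 (\<lambda>_. \<rho> p)"
    and U: "opn X U"
  shows "gen_sheaf X S U \<subseteq> gen_sheaf X S' U"
proof
  fix g assume g: "g \<in> gen_sheaf X S U"
  have "gen_at X S' x g" if x: "x \<in> U" for x
  proof -
    have w: "opn X (W x)" "x \<in> W x" "generated_on X (W x) (gen_sheaf X S) 1 (\<lambda>_. \<rho> x)"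
      "generated_on X (W x) (gen_sheaf X S') 1 (\<lambda>_. \<rho> x)" using W openin_subset[OF U] x by auto
    have o: "opn X (U \<inter> W x)" using U w(1) by blast
    have "gen_sheaf X S (U \<inter> W x) = gen_sheaf X S' (U \<inter> W x)" using w(3,4) o unfolding generated_on_one by simp
    then have "g \<in> gen_sheaf X S' (U \<inter> W x)" using gen_sheaf_restrict[OF X g o] by blast
    then show ?thesis unfolding gen_sheaf_iff[OF o] using x w(2) by blast
  qed
  then show "g \<in> gen_sheaf X S' U" using g unfolding gen_sheaf_iff[OF U] by blast
qed

section \<open>Smoothness of source and target, and the divisor of arrows\<close>

context elliptic_groupoid
begin

lemma arrow_chart_at:
  assumes g: "g \<in> pts (arrs \<G>)"
  obtains i W \<phi> e where "chart (arrs \<G>) W \<phi>" "g \<in> W" "frame_enum e" "2 * i \<le> DIM('e \<times> 'e)"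
    "\<And>j. j < i \<Longrightarrow> zc e j (\<phi> g) = 0"
    "pulls_generator (arrs \<G>) M D I W (tgt \<G>) (\<lambda>p. \<Prod>j<i. (cmod (zc e j (\<phi> p)))\<^sup>2)"
    "pulls_generator (arrs \<G>) M D I W (src \<G>) (\<lambda>p. \<Prod>j<i. (cmod (zc e j (\<phi> p)))\<^sup>2)"
proof -
  obtain i N a where ga: "g = ((i, N), a)" "((i, N), a) \<in> ell_arrows" using g unfolding arrows ell_arrows_def by blast
  show thesis unfolding ga(1) by (rule arrow_local_model[OF ga(2)]) (rule that[unfolded ga(1)])
qed

lemma end_smooth:
  assumes "F = src \<G> \<or> F = tgt \<G>"
  shows "smooth_map (arrs \<G>) M F"
proof (rule smooth_map_local[OF smooth M])
  fix g assume "g \<in> pts (arrs \<G>)"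
  then obtain i W \<phi> e where W: "chart (arrs \<G>) W \<phi>" "g \<in> W"
    "pulls_generator (arrs \<G>) M D I W (tgt \<G>) (\<lambda>p. \<Prod>j<i. (cmod (zc e j (\<phi> p)))\<^sup>2)"
    "pulls_generator (arrs \<G>) M D I W (src \<G>) (\<lambda>p. \<Prod>j<i. (cmod (zc e j (\<phi> p)))\<^sup>2)"
    by (rule arrow_chart_at) (rule that)
  then have "pulls_generator (arrs \<G>) M D I W F (\<lambda>p. \<Prod>j<i. (cmod (zc e j (\<phi> p)))\<^sup>2)" using assms by blast
  then obtain k V1 \<phi>1 e1 where "nc_coords M D I k V1 \<phi>1 e1" "\<forall>p\<in>W. F p \<in> V1" "(\<lambda>p. \<phi>1 (F p)) \<in> smooth_funs (arrs \<G>) W"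
    unfolding pulls_generator_def by (elim exE conjE)
  then show "\<exists>W V \<phi>. opn (arrs \<G>) W \<and> g \<in> W \<and> chart M V \<phi> \<and> F ` W \<subseteq> V \<and> \<phi> \<circ> F \<in> smooth_funs (arrs \<G>) W"
    using nc_coordsD(1)[of M D I k V1 \<phi>1 e1] chartD(1)[OF W(1)] W(2)
    by (intro exI[of _ W] exI[of _ V1] exI[of _ \<phi>1]) (auto simp: comp_def)
qed

text \<open>As a set \<G> consists of arrows with both ends in one piece, and a piece lies in a
  single stratum, which is inside or outside the divisor as a whole.\<close>

lemma same_end_D:
  assumes "g \<in> pts (arrs \<G>)"
  shows "src \<G> g \<in> D \<longleftrightarrow> tgt \<G> g \<in> D"
proof -
  obtain i N a where ga: "g = ((i, N), a)" "((i, N), a) \<in> ell_arrows" using assms unfolding arrows ell_arrows_def by blast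
  have "src \<G> g \<in> N" "tgt \<G> g \<in> N" "N \<in> pieces i" using src[OF ga(2)] tgt[OF ga(2)] ga unfolding ell_arrows_def by auto
  then show ?thesis using pieces_subset stratum_D by blast
qed

lemma pulls_generator_D:
  assumes "pulls_generator G M D I W F \<rho>" "p \<in> W"
  shows "F p \<in> D \<longleftrightarrow> \<rho> p = 0"
proof -
  obtain i V \<phi> e \<upsilon> where h: "nc_coords M D I i V \<phi> e" "\<forall>p\<in>W. F p \<in> V"
     "\<forall>p\<in>W. \<upsilon> p \<noteq> 0 \<and> zprod e i (\<phi> (F p)) = \<upsilon> p * \<rho> p"
    using assms(1) unfolding pulls_generator_def by (elim exE conjE)
  have "F p \<in> D \<longleftrightarrow> zprod e i (\<phi> (F p)) = 0" using nc_coordsD(4)[OF h(1)] h(2) assms(2) by auto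
  also have "\<dots> \<longleftrightarrow> \<rho> p = 0" using h(3) assms(2) by simp
  finally show ?thesis .
qed

end

theorem proposition7p1:
  fixes M :: "('a, 'e::euclidean_space) mfd" and D :: "'a set" and I :: "('a, real) sheaf"
    and \<G> :: "('a, 'e, (nat \<times> 'a set) \<times> ('a cov set \<times> 'y) set, 'e \<times> 'e) gpd"
  assumes "nc_elliptic_divisor M D I"
    and "elliptic_groupoid M D I U pr T Y \<beta> \<G>"
  shows "let G = arrs \<G>; s = src \<G>; t = tgt \<G>;
             \<D> = {g \<in> topspace (mtop G). s g \<in> D};
             J = pullback G M s I
         in \<D> = {g \<in> topspace (mtop G). t g \<in> D} \<and>
            sheaf_eq G (pullback G M s I) (pullback G M t I) \<and>
            nc_elliptic_divisor G \<D> J \<and>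
            elliptic_map G \<D> J M D I s \<and>
            elliptic_map G \<D> J M D I t"
proof -
  interpret elliptic_groupoid M D I U pr T Y \<beta> \<G> by (rule assms(2))
  let ?G = "arrs \<G>" and ?D = "{g \<in> pts (arrs \<G>). src \<G> g \<in> D}"
  let ?s = "pullback ?G M (src \<G>) I" and ?t = "pullback ?G M (tgt \<G>) I"
  have I: "ideal_sheaf M I" using assms(1) unfolding nc_elliptic_divisor_def by blast
  have sms: "smooth_map ?G M (src \<G>)" "smooth_map ?G M (tgt \<G>)" by (rule end_smooth, simp)+
  have D: "?D = {g \<in> pts ?G. tgt \<G> g \<in> D}" using same_end_D by blast
  \<comment> \<open>One function \<rho> must generate both pullbacks on the same neighbourhood; this
    is the form in which the two sheaves can be compared.\<close>
  define Q where "Q = (\<lambda>g W \<rho>. opn ?G W \<and> g \<in> W \<and>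
    generated_on ?G W ?s 1 (\<lambda>_. \<rho>) \<and> generated_on ?G W ?t 1 (\<lambda>_. \<rho>))"
  have Q: "\<exists>W \<rho>. Q g W \<rho>" and nc: "\<exists>k V \<phi> e. nc_chart ?G ?D ?s k g V \<phi> e" if g: "g \<in> pts ?G" for g
  proof -
    obtain i W \<phi> e where W: "chart ?G W \<phi>" "g \<in> W" "frame_enum e" "2 * i \<le> DIM('e \<times> 'e)"
      "\<And>j. j < i \<Longrightarrow> zc e j (\<phi> g) = 0"
      "pulls_generator ?G M D I W (tgt \<G>) (\<lambda>p. \<Prod>j<i. (cmod (zc e j (\<phi> p)))\<^sup>2)"
      "pulls_generator ?G M D I W (src \<G>) (\<lambda>p. \<Prod>j<i. (cmod (zc e j (\<phi> p)))\<^sup>2)"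
      by (rule arrow_chart_at[OF g]) (rule that)
    note gs = pullback_generated[OF smooth M I sms(1) W(1,3,4,7)] and gt = pullback_generated[OF smooth M I sms(2) W(1,3,4,6)]
    show "\<exists>W \<rho>. Q g W \<rho>" unfolding Q_def
      by (intro exI[of _ W] exI[of _ "\<lambda>p. \<Prod>j<i. (cmod (zc e j (\<phi> p)))\<^sup>2"] conjI chartD(1)[OF W(1)] W(2) gs gt)
    \<comment> \<open>The chart at \<open>g\<close> need not be centred. Translation centres it and
      does not affect the first \<open>i\<close> complex coordinates, which already vanish at
      \<open>g\<close>, so the equation and the generator stay the same.\<close>
    define \<psi> where "\<psi> = (\<lambda>q. \<phi> q - \<phi> g)"
    have \<psi>: "zc e j (\<psi> q) = zc e j (\<phi> q)" if "j < i" for j q unfolding \<psi>_def zc_diff W(5)[OF that] by simp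
    have "?D \<inter> W = {q \<in> W. (\<Prod>j<i. zc e j (\<psi> q)) = 0}"
      using pulls_generator_D[OF W(7)] chartD(2)[OF W(1)] by (auto simp: \<psi>)
    moreover have "(\<lambda>_ q. \<Prod>j<i. (cmod (zc e j (\<psi> q)))\<^sup>2) = (\<lambda>(_::nat) q. \<Prod>j<i. (cmod (zc e j (\<phi> q)))\<^sup>2)" by (simp add: \<psi>)
    ultimately have "nc_coords ?G ?D ?s i W \<psi> e" unfolding nc_coords_def
      using chart_translate[OF smooth W(1), of "\<phi> g"] W(3,4) gs by (simp add: \<psi>_def)
    then have "nc_chart ?G ?D ?s i g W \<psi> e" unfolding nc_chart_def using W(2) by (simp add: \<psi>_def)
    then show "\<exists>k V \<phi> e. nc_chart ?G ?D ?s k g V \<phi> e" by (intro exI)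
  qed
  have "\<forall>g. \<exists>W \<rho>. g \<in> pts ?G \<longrightarrow> Q g W \<rho>" using Q by blast
  then obtain W \<rho> where W: "\<forall>g. g \<in> pts ?G \<longrightarrow> Q g (W g) (\<rho> g)" by metis
  have Wst: "opn ?G (W p) \<and> p \<in> W p \<and> generated_on ?G (W p) ?s 1 (\<lambda>_. \<rho> p) \<and> generated_on ?G (W p) ?t 1 (\<lambda>_. \<rho> p)"
    and Wts: "opn ?G (W p) \<and> p \<in> W p \<and> generated_on ?G (W p) ?t 1 (\<lambda>_. \<rho> p) \<and> generated_on ?G (W p) ?s 1 (\<lambda>_. \<rho> p)"
    if p: "p \<in> pts ?G" for p using W[THEN spec, THEN mp, OF p] unfolding Q_def by blast+
  have "?s V \<subseteq> ?t V" "?t V \<subseteq> ?s V" if V: "opn ?G V" for V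
    using gen_sheaf_eqI[OF smooth Wst[unfolded pullback_def] V] gen_sheaf_eqI[OF smooth Wts[unfolded pullback_def] V]
    unfolding pullback_def by blast+
  then have eq: "sheaf_eq ?G ?s ?t" unfolding sheaf_eq_def by blast
  have "nc_elliptic_divisor ?G ?D ?s" unfolding nc_elliptic_divisor_def
    using smooth ideal_sheaf_gen_sheaf[OF smooth] nc unfolding pullback_def by blast
  moreover have "elliptic_map ?G ?D ?s M D I (src \<G>)" unfolding elliptic_map_def strong_map_def sheaf_eq_def using sms(1) by simp
  moreover have "elliptic_map ?G ?D ?s M D I (tgt \<G>)"
    unfolding elliptic_map_def strong_map_def using sms(2) D eq by (simp add: sheaf_eq_def)
  ultimately show ?thesis unfolding Let_def using D eq by blast
qed

end
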